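(* Let $X\subseteq \mathbb P^r$ be an integral projective variety of dimension $3$. Let $D_1,\dots,D_l$ be pairwise distinct effective Cartier divisors of $X$, each an integral surface linearly equivalent to a multiple of the general hyperplane section $H$ of $X$, with degrees $s_1\leq s_2\leq\dots\leq s_l$; let $r_1,\dots,r_l$ be positive integers, and let $$S=r_1D_1+r_2D_2+\dots+r_lD_l.$$ Put $s=s_1$, let $\pi_1$ be the sectional genus of $D_1$, and put $\deg S=r_1s_1+\dots+r_ls_l$. Let $C\subset S$ be a curve of degree $d>0$ and arithmetic genus $p_a(C)$. Then $$p_a(C)\leq \frac{d^2}{2s}+\frac{d}{2s}(2\pi_1-2-s)+4(\deg S)^6.$$
   Context: The base field is $\mathbb C$. A curve is a projective scheme of dimension $1$ (not necessarily reduced, irreducible, or Cohen-Macaulay); its arithmetic genus is $p_a(C)=1-\chi(\mathcal O_C)$. Degrees are taken with respect to the given embedding in $\mathbb P^r$. Effective Cartier divisors of $X$ are identified with the associated closed subschemes of $X$. If $f_i$ is a local generator of the ideal sheaf of $D_i$ in $X$, then $S=r_1D_1+\dots+r_lD_l$ denotes the effective Cartier divisor with local generator $f_1^{r_1}f_2^{r_2}\cdots f_l^{r_l}$, regarded as a closed subscheme (a projective surface) of $X$; $C\subset S$ means that $C$ is a closed subscheme of $S$. The sectional genus of an integral surface in $\mathbb P^r$ is the arithmetic genus of its general hyperplane section. *)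

theory Defs
  imports
    Complex_Main
    "HOL-Library.Poly_Mapping"
    "HOL-Library.Function_Algebras"
    "HOL-Computational_Algebra.Polynomial"
    "HOL-Computational_Algebra.Fraction_Field"
begin

section \<open>The homogeneous coordinate ring of projective space\<close>

text \<open>
  Polynomials over the complex numbers in countably many variables; the coordinate ring
  of \<open>P\<^sup>r\<close> is the subring \<open>polys r\<close> on the variables with index \<open>0,\<dots>,r\<close>.
\<close>

type_synonym mpoly = "(nat \<Rightarrow>\<^sub>0 nat) \<Rightarrow>\<^sub>0 complex"

definition var :: "nat \<Rightarrow> mpoly" where
  "var i = Poly_Mapping.single (Poly_Mapping.single i 1) 1"

definition const :: "complex \<Rightarrow> mpoly" where
  "const c = Poly_Mapping.single 0 c"

definition polys :: "nat \<Rightarrow> mpoly set" where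
  "polys r = {p. \<forall>t\<in>Poly_Mapping.keys p. Poly_Mapping.keys t \<subseteq> {..r}}"

definition mdeg :: "(nat \<Rightarrow>\<^sub>0 nat) \<Rightarrow> nat" where
  "mdeg t = (\<Sum>i\<in>Poly_Mapping.keys t. Poly_Mapping.lookup t i)"

definition forms :: "nat \<Rightarrow> nat \<Rightarrow> mpoly set" where
  "forms r d = {p \<in> polys r. \<forall>t\<in>Poly_Mapping.keys p. mdeg t = d}"

definition hom_component :: "nat \<Rightarrow> mpoly \<Rightarrow> mpoly" where
  "hom_component d p =
     (\<Sum>t\<in>{t \<in> Poly_Mapping.keys p. mdeg t = d}. Poly_Mapping.single t (Poly_Mapping.lookup p t))"

definition eval_mpoly :: "(nat \<Rightarrow> complex) \<Rightarrow> mpoly \<Rightarrow> complex" where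
  "eval_mpoly a p =
     (\<Sum>t\<in>Poly_Mapping.keys p. Poly_Mapping.lookup p t *
        (\<Prod>i\<in>Poly_Mapping.keys t. a i ^ Poly_Mapping.lookup t i))"


section \<open>Closed subschemes of projective space\<close>

definition homogeneous_ideal :: "nat \<Rightarrow> mpoly set \<Rightarrow> bool" where
  "homogeneous_ideal r I \<longleftrightarrow>
     I \<subseteq> polys r \<and> 0 \<in> I \<and> (\<forall>p\<in>I. \<forall>q\<in>I. p + q \<in> I) \<and>
     (\<forall>p\<in>I. \<forall>q\<in>polys r. q * p \<in> I) \<and> (\<forall>p\<in>I. \<forall>d. hom_component d p \<in> I)"

definition saturation :: "nat \<Rightarrow> mpoly set \<Rightarrow> mpoly set" where
  "saturation r I = {p \<in> polys r. \<exists>k. \<forall>g\<in>forms r k. g * p \<in> I}"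

text \<open>
  A closed subscheme of \<open>P\<^sup>r\<close> is represented by its saturated homogeneous ideal; this is
  the usual bijective, inclusion-reversing correspondence, so \<open>Y\<close> is a closed subscheme
  of \<open>Z\<close> iff the ideals satisfy \<open>Z \<subseteq> Y\<close>. The empty scheme is the ideal \<open>polys r\<close>.
\<close>

definition closed_subscheme :: "nat \<Rightarrow> mpoly set \<Rightarrow> bool" where
  "closed_subscheme r I \<longleftrightarrow> homogeneous_ideal r I \<and> saturation r I = I"

definition subscheme_of :: "mpoly set \<Rightarrow> mpoly set \<Rightarrow> bool" where
  "subscheme_of Y Z \<longleftrightarrow> Z \<subseteq> Y"

definition homogeneous_prime :: "nat \<Rightarrow> mpoly set \<Rightarrow> bool" where
  "homogeneous_prime r P \<longleftrightarrow>
     homogeneous_ideal r P \<and> P \<noteq> polys r \<and>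
     (\<forall>p\<in>polys r. \<forall>q\<in>polys r. p * q \<in> P \<longrightarrow> p \<in> P \<or> q \<in> P)"

text \<open>
  The (not necessarily closed) points of the scheme: the points of \<open>Proj (polys r / I)\<close>.
\<close>

definition points :: "nat \<Rightarrow> mpoly set \<Rightarrow> mpoly set set" where
  "points r I = {P. homogeneous_prime r P \<and> I \<subseteq> P \<and> \<not> forms r 1 \<subseteq> P}"

text \<open>
  Integral closed subschemes correspond to the homogeneous primes other than the irrelevant
  ideal; the latter is excluded because it is not saturated.
\<close>

definition integral_subscheme :: "nat \<Rightarrow> mpoly set \<Rightarrow> bool" where
  "integral_subscheme r I \<longleftrightarrow> closed_subscheme r I \<and> homogeneous_prime r I"

text \<open>Krull dimension of the underlying topological space (\<open>0\<close> for the empty scheme).\<close>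

definition scheme_dim :: "nat \<Rightarrow> mpoly set \<Rightarrow> nat" where
  "scheme_dim r I =
     Sup {n. \<exists>P. (\<forall>i\<le>n. P i \<in> points r I) \<and> (\<forall>i<n. P i \<subset> P (Suc i))}"


section \<open>Hilbert polynomial and degree\<close>

text \<open>
  Dimension of \<open>V / W\<close> for complex vector spaces \<open>W \<subseteq> V\<close> with scalar multiplication
  \<open>scale\<close>: the cardinality of a finite set whose classes form a basis of \<open>V / W\<close>.
  Only meaningful for finite-dimensional quotients.
\<close>

definition quotient_dim ::
  "(complex \<Rightarrow> 'v \<Rightarrow> 'v) \<Rightarrow> 'v::ab_group_add set \<Rightarrow> 'v set \<Rightarrow> nat" where
  "quotient_dim scale V W =
     (THE n. \<exists>B. finite B \<and> B \<subseteq> V \<and> card B = n \<and>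
        (\<forall>v\<in>V. \<exists>!c. (\<forall>b. b \<notin> B \<longrightarrow> c b = 0) \<and> v - (\<Sum>b\<in>B. scale (c b) b) \<in> W))"

definition hilbert_function :: "nat \<Rightarrow> mpoly set \<Rightarrow> nat \<Rightarrow> nat" where
  "hilbert_function r I n =
     quotient_dim (\<lambda>c p. const c * p) (forms r n) (I \<inter> forms r n)"

definition hilbert_polynomial :: "nat \<Rightarrow> mpoly set \<Rightarrow> real poly" where
  "hilbert_polynomial r I =
     (THE P. \<forall>\<^sub>F n in sequentially. poly P (real n) = real (hilbert_function r I n))"

definition scheme_degree :: "nat \<Rightarrow> mpoly set \<Rightarrow> real" where
  "scheme_degree r I =
     fact (scheme_dim r I) * poly.coeff (hilbert_polynomial r I) (scheme_dim r I)"


section \<open>Sections over basic affine open sets\<close>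

type_synonym ratfun = "mpoly fract"

abbreviation frac :: "mpoly \<Rightarrow> mpoly \<Rightarrow> ratfun" where
  "frac \<equiv> Fraction_Field.Fract"

text \<open>
  Let \<open>h \<noteq> 0\<close> be a form of positive degree. Then \<open>sections r (polys r) h\<close> is the coordinate
  ring of the affine open set \<open>D\<^sub>+(h)\<close> of \<open>P\<^sup>r\<close> (fractions of degree \<open>0\<close> with denominator
  a power of \<open>h\<close>), and \<open>sections r I h\<close> is the ideal in this ring of the subscheme given
  by \<open>I\<close>.
\<close>

definition sections :: "nat \<Rightarrow> mpoly set \<Rightarrow> mpoly \<Rightarrow> ratfun set" where
  "sections r I h =
     {frac a (h ^ k) | a k d. h \<in> forms r d \<and> a \<in> I \<and> a \<in> forms r (k * d)}"

text \<open>
  \<open>basic_nbhd r P h\<close>: the affine open set \<open>D\<^sub>+(h)\<close> is a neighbourhood of the point \<open>P\<close>.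
\<close>

definition basic_nbhd :: "nat \<Rightarrow> mpoly set \<Rightarrow> mpoly \<Rightarrow> bool" where
  "basic_nbhd r P h \<longleftrightarrow> (\<exists>d>0. h \<in> forms r d) \<and> h \<notin> P"


section \<open>Euler characteristic and arithmetic genus\<close>

text \<open>
  Cohomology of the structure sheaf \<open>O\<^sub>Y\<close> of the subscheme \<open>Y\<close> with ideal \<open>I\<close> is computed by
  the alternating Cech complex of the standard affine cover \<open>D\<^sub>+(x\<^sub>0), \<dots>, D\<^sub>+(x\<^sub>r)\<close>. A set
  \<open>J\<close> of \<open>p + 1\<close> indices stands for the increasing sequence of its elements. The complex
  of \<open>O\<^sub>Y\<close> is the quotient of that of \<open>P\<^sup>r\<close> by the cochains with values in the ideal sheaf,
  and cocycles and coboundaries of \<open>O\<^sub>Y\<close> are represented by their preimages.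
\<close>

definition coord_prod :: "nat set \<Rightarrow> mpoly" where
  "coord_prod J = (\<Prod>j\<in>J. var j)"

definition cech_cochains :: "nat \<Rightarrow> nat \<Rightarrow> (nat set \<Rightarrow> ratfun) set" where
  "cech_cochains r p =
     {c. \<forall>J. if J \<subseteq> {..r} \<and> card J = p + 1
             then c J \<in> sections r (polys r) (coord_prod J) else c J = 0}"

definition cech_differential :: "(nat set \<Rightarrow> ratfun) \<Rightarrow> nat set \<Rightarrow> ratfun" where
  "cech_differential c J = (\<Sum>j\<in>J. (- 1) ^ card {i \<in> J. i < j} * c (J - {j}))"

definition cech_cocycles :: "nat \<Rightarrow> mpoly set \<Rightarrow> nat \<Rightarrow> (nat set \<Rightarrow> ratfun) set" where
  "cech_cocycles r I p =
     {c \<in> cech_cochains r p. \<forall>J. J \<subseteq> {..r} \<and> card J = p + 2 \<longrightarrow>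
        cech_differential c J \<in> sections r I (coord_prod J)}"

definition cech_coboundaries :: "nat \<Rightarrow> mpoly set \<Rightarrow> nat \<Rightarrow> (nat set \<Rightarrow> ratfun) set" where
  "cech_coboundaries r I p =
     {c \<in> cech_cochains r p. \<exists>b \<in> (if p = 0 then {0} else cech_cochains r (p - 1)).
        \<forall>J. J \<subseteq> {..r} \<and> card J = p + 1 \<longrightarrow>
          c J - cech_differential b J \<in> sections r I (coord_prod J)}"

definition cohomology_dim :: "nat \<Rightarrow> mpoly set \<Rightarrow> nat \<Rightarrow> nat" where
  "cohomology_dim r I p =
     quotient_dim (\<lambda>z c J. frac (const z) 1 * c J) (cech_cocycles r I p) (cech_coboundaries r I p)"

text \<open>The cover has \<open>r + 1\<close> members, so there is no cohomology in degrees above \<open>r\<close>.\<close>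

definition euler_char :: "nat \<Rightarrow> mpoly set \<Rightarrow> int" where
  "euler_char r I = (\<Sum>p\<le>r. (- 1) ^ p * int (cohomology_dim r I p))"

definition arith_genus :: "nat \<Rightarrow> mpoly set \<Rightarrow> int" where
  "arith_genus r I = 1 - euler_char r I"


section \<open>General hyperplane sections\<close>

definition linear_form :: "nat \<Rightarrow> (nat \<Rightarrow> complex) \<Rightarrow> mpoly" where
  "linear_form r a = (\<Sum>i\<le>r. const (a i) * var i)"

text \<open>
  A property holds for the general hyperplane if it holds on a nonempty Zariski open set of
  coefficient vectors; it suffices to consider complements of hypersurfaces.
\<close>

definition for_general_hyperplane :: "nat \<Rightarrow> (mpoly \<Rightarrow> bool) \<Rightarrow> bool" where
  "for_general_hyperplane r Q \<longleftrightarrow>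
     (\<exists>F\<in>polys r. F \<noteq> 0 \<and> (\<forall>a. eval_mpoly a F \<noteq> 0 \<longrightarrow> Q (linear_form r a)))"

text \<open>The scheme-theoretic intersection of a subscheme with the hyperplane \<open>L = 0\<close>.\<close>

definition hyperplane_section :: "nat \<Rightarrow> mpoly set \<Rightarrow> mpoly \<Rightarrow> mpoly set" where
  "hyperplane_section r I L = saturation r {p + q * L | p q. p \<in> I \<and> q \<in> polys r}"

definition sectional_genus :: "nat \<Rightarrow> mpoly set \<Rightarrow> int" where
  "sectional_genus r I =
     (THE g. for_general_hyperplane r (\<lambda>L. arith_genus r (hyperplane_section r I L) = g))"


section \<open>Effective Cartier divisors\<close>

text \<open>
  \<open>f\<close> generates the ideal sheaf of \<open>D\<close> in \<open>X\<close> over \<open>X \<inter> D\<^sub>+(h)\<close> and is not a zero divisor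
  there. Functions on \<open>X \<inter> D\<^sub>+(h)\<close> are represented by functions on \<open>D\<^sub>+(h)\<close>.
\<close>

definition local_generator ::
  "nat \<Rightarrow> mpoly set \<Rightarrow> mpoly set \<Rightarrow> mpoly \<Rightarrow> ratfun \<Rightarrow> bool" where
  "local_generator r X D h f \<longleftrightarrow>
     f \<in> sections r (polys r) h \<and>
     (\<forall>g\<in>sections r (polys r) h. f * g \<in> sections r X h \<longrightarrow> g \<in> sections r X h) \<and>
     sections r D h = {f * g + u | g u. g \<in> sections r (polys r) h \<and> u \<in> sections r X h}"

definition effective_cartier :: "nat \<Rightarrow> mpoly set \<Rightarrow> mpoly set \<Rightarrow> bool" where
  "effective_cartier r X D \<longleftrightarrow>
     closed_subscheme r D \<and> subscheme_of D X \<and>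
     (\<forall>P\<in>points r X. \<exists>h f. basic_nbhd r P h \<and> local_generator r X D h f)"

text \<open>\<open>S\<close> is the effective Cartier divisor \<open>\<Sum>i\<in>A. m i D i\<close> of \<open>X\<close>.\<close>

definition is_divisor_sum ::
  "nat \<Rightarrow> mpoly set \<Rightarrow> nat set \<Rightarrow> (nat \<Rightarrow> mpoly set) \<Rightarrow> (nat \<Rightarrow> nat) \<Rightarrow> mpoly set \<Rightarrow> bool" where
  "is_divisor_sum r X A D m S \<longleftrightarrow>
     closed_subscheme r S \<and> subscheme_of S X \<and>
     (\<forall>P\<in>points r X. \<exists>h f. basic_nbhd r P h \<and>
        (\<forall>i\<in>A. local_generator r X (D i) h (f i)) \<and>
        local_generator r X S h (\<Prod>i\<in>A. f i ^ m i))"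

text \<open>
  Linear equivalence of effective Cartier divisors on an integral \<open>X\<close>: the difference \<open>D - E\<close>
  is the divisor of a nonzero rational function \<open>a / b\<close> on \<open>X\<close>. Locally, generators \<open>f\<close> of
  \<open>D\<close> and \<open>g\<close> of \<open>E\<close> can be chosen with \<open>f = (a / b) g\<close> in the function field of \<open>X\<close>, that
  is, \<open>b f - a g\<close> vanishes on \<open>X\<close>.
\<close>

definition linearly_equivalent :: "nat \<Rightarrow> mpoly set \<Rightarrow> mpoly set \<Rightarrow> mpoly set \<Rightarrow> bool" where
  "linearly_equivalent r X D E \<longleftrightarrow>
     (\<exists>e. \<exists>a\<in>forms r e. \<exists>b\<in>forms r e. a \<notin> X \<and> b \<notin> X \<and>
        (\<forall>P\<in>points r X. \<exists>h f g. basic_nbhd r P h \<and>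
           local_generator r X D h f \<and> local_generator r X E h g \<and>
           frac b 1 * f - frac a 1 * g \<in> {frac c (h ^ k) | c k. c \<in> X}))"

text \<open>
  \<open>D\<close> is linearly equivalent to \<open>m H\<close> for some \<open>m > 0\<close> and the general hyperplane section
  \<open>H\<close> of \<open>X\<close>. Only positive \<open>m\<close> can occur for a nonzero effective \<open>D\<close>.
\<close>

definition equivalent_to_multiple_of_hyperplane_section ::
  "nat \<Rightarrow> mpoly set \<Rightarrow> mpoly set \<Rightarrow> bool" where
  "equivalent_to_multiple_of_hyperplane_section r X D \<longleftrightarrow>
     (\<exists>m>0. for_general_hyperplane r (\<lambda>L. \<exists>E.
        is_divisor_sum r X {0} (\<lambda>_. hyperplane_section r X L) (\<lambda>_. m) E \<and>
        linearly_equivalent r X D E))"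

end

theory Submission
 imports Defs
begin

text \<open>
 Linear equivalence of \<open>D\<^sub>i\<close> with \<open>\<mu>\<^sub>i\<close> hyperplane sections makes the ideal of \<open>D\<^sub>i\<close> in \<open>X\<close>, in large degrees, a
 shift by \<open>\<mu>\<^sub>i\<close> of the coordinate ring of \<open>X\<close>. Hence for the residual \<open>C'\<close> of \<open>C \<inter> D\<^sub>i\<close> in \<open>C\<close> one has
 \<open>\<chi>(C) = \<chi>(C \<inter> D\<^sub>i) + \<chi>(C') - \<mu>\<^sub>i deg C'\<close>. A product of the ideals of the \<open>D\<^sub>i\<close> vanishes on \<open>C\<close>, so peeling off the
 factor whose divisor meets \<open>C\<close> in largest degree reduces the bound to curves on a single integral surface \<open>D\<close>.

 There Castelnuovo's argument applies. Over \<open>\<complex>(\<tau>)\<close>, the generic member of a pencil of hyperplanes cuts \<open>D\<close> in an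
 integral curve \<open>\<Gamma>\<close> of degree \<open>s\<close> and \<open>C\<close>, of degree \<open>e\<close>, in a finite scheme \<open>Z\<close> on \<open>\<Gamma>\<close>. The ideals of \<open>Z\<close> and \<open>\<Gamma>\<close> agree in degrees
 below \<open>e / s\<close>, and from there on the Hilbert function of \<open>Z\<close> grows strictly until it reaches \<open>e\<close>; summing it up
 bounds \<open>\<chi>(C)\<close> from below.

 The Cech Euler characteristic of a curve is the constant term of its Hilbert polynomial: the standard cover can be
 exchanged, one open set at a time, for the complements of two hyperplanes that have no common point on the curve, and
 there both cohomology groups are visible in a single large degree of the coordinate ring.
\<close>

section \<open>Dimensions of quotient spaces\<close>

text \<open>The divisor with the largest intersection is peeled off to control the loss
  \<open>m d'\<close>. At most M intersections cover C, so the residual degree d' is at most M e.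
  Then m d' is either absorbed by the cross term e d' / s of (e + d')^2 / (2 s) or bounded by the
  constant M m^2 s. If the divisor has degree t > s, the smaller leading coefficient 1 / (2 t) beats
  the linear terms up to a constant. If t = s, the linear terms must agree. They do, because the
  Hilbert polynomial of a divisor depends only on its number of hyperplane sections, so equal
  degrees force equal sectional genera.

  Passing to \<complex>(\<tau>) replaces Bertini's theorem: substituting the root \<tau> = - M0 / M1
  of the pencil maps the generic section into fractions on the cone over D, where integrality is
  inherited.

  C may be nonreduced or have embedded and isolated points, so only saturated ideals and Hilbert
  functions are used. The Hilbert function of \<Gamma> need not equal its polynomial in low degrees;
  this defect is bounded through a further hyperplane section of \<Gamma>.\<close>

definition qbasis :: "('k::field \<Rightarrow> 'v::ab_group_add \<Rightarrow> 'v) \<Rightarrow> 'v set \<Rightarrow> 'v set \<Rightarrow> 'v set \<Rightarrow> bool" where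
 "qbasis s V W B \<longleftrightarrow> finite B \<and> B \<subseteq> V \<and> (\<forall>v\<in>V. \<exists>c. v - (\<Sum>b\<in>B. s (c b) b) \<in> W) \<and>
   (\<forall>c. (\<Sum>b\<in>B. s (c b) b) \<in> W \<longrightarrow> (\<forall>b\<in>B. c b = 0))"

text \<open>A relation instead of a value makes finiteness part of the statement. The scalars form
  an arbitrary field because dimensions over the rational function field are counted as
  well.\<close>

definition qdim :: "('k::field \<Rightarrow> 'v::ab_group_add \<Rightarrow> 'v) \<Rightarrow> 'v set \<Rightarrow> 'v set \<Rightarrow> nat \<Rightarrow> bool" where
 "qdim s V W n \<longleftrightarrow> (\<exists>B. qbasis s V W B \<and> card B = n)"

context vector_space begin

text \<open>Each element of V is congruent modulo W to a vector in the span of B. Independence of F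
  modulo W makes the chosen representatives distinct and linearly independent, so the usual exchange
  bound applies to them.\<close>

lemma qbasis_bound:
 assumes W: "subspace W" and B: "qbasis scale V W B" and FV: "F \<subseteq> V" "finite F"
  and F: "\<forall>c. (\<Sum>b\<in>F. c b *s b) \<in> W \<longrightarrow> (\<forall>b\<in>F. c b = 0)"
 shows "card F \<le> card B"
proof -
 have "\<forall>v\<in>V. \<exists>u. u \<in> span B \<and> v - u \<in> W"
  using B unfolding qbasis_def by (metis (no_types, lifting) span_base span_scale span_sum)
 then obtain u where u: "\<And>v. v \<in> V \<Longrightarrow> u v \<in> span B \<and> v - u v \<in> W" by metis
 have key: "\<forall>b\<in>F. c b = 0" if "(\<Sum>b\<in>F. c b *s u b) = 0" for c
 proof -
  have "(\<Sum>b\<in>F. c b *s (b - u b)) \<in> W"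
   using u FV by (intro subspace_sum[OF W] subspace_scale[OF W]) auto
  hence "(\<Sum>b\<in>F. c b *s b) \<in> W" using that by (simp add: scale_right_diff_distrib sum_subtractf)
  thus ?thesis using F by blast
 qed
 have inj: "inj_on u F"
 proof (rule inj_onI, rule ccontr)
  fix x y assume xy: "x \<in> F" "y \<in> F" "u x = u y" "x \<noteq> y"
  let ?c = "\<lambda>b. if b = x then 1 else if b = y then -1 else 0"
  have "(\<Sum>b\<in>F. ?c b *s u b) = (\<Sum>b\<in>{x,y}. ?c b *s u b)"
   by (rule sum.mono_neutral_right) (use FV xy in auto)
  also have "\<dots> = 0" using xy by simp
  finally show False using key[of ?c] xy by auto
 qed
 have ind: "independent (u ` F)"
 proof (rule independent_if_scalars_zero)
  fix f x assume "(\<Sum>x\<in>u ` F. f x *s x) = 0" "x \<in> u ` F"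
  thus "f x = 0" using key[of "f \<circ> u"] by (auto simp: sum.reindex[OF inj])
 qed (use FV in auto)
 have "card (u ` F) \<le> card B"
  using independent_span_bound[OF _ ind, of B] B u FV unfolding qbasis_def by blast
 thus ?thesis using card_image[OF inj] by simp
qed

lemma qdim_unique: "subspace W \<Longrightarrow> qdim scale V W n \<Longrightarrow> qdim scale V W m \<Longrightarrow> n = m"
proof -
 have le: "card B' \<le> card B" if "subspace W" "qbasis scale V W B" "qbasis scale V W B'" for B B'
  using qbasis_bound[OF that(1,2), of B'] that(3) unfolding qbasis_def by blast
 show "subspace W \<Longrightarrow> qdim scale V W n \<Longrightarrow> qdim scale V W m \<Longrightarrow> n = m"
  unfolding qdim_def using le order_antisym by blast
qed

text \<open>Bridge to \<open>quotient_dim\<close>: forcing the coefficients to vanish off B makes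
  them unique as functions, and uniqueness at the vector 0 is independence modulo W.\<close>

lemma qbasis_Ex1:
 assumes W: "subspace W" and V: "subspace V"
 shows "qbasis scale V W B \<longleftrightarrow> finite B \<and> B \<subseteq> V \<and>
  (\<forall>v\<in>V. \<exists>!c. (\<forall>b. b \<notin> B \<longrightarrow> c b = 0) \<and> v - (\<Sum>b\<in>B. c b *s b) \<in> W)" (is "_ \<longleftrightarrow> ?R")
proof
 assume q: "qbasis scale V W B"
 have "\<exists>!c. (\<forall>b. b \<notin> B \<longrightarrow> c b = 0) \<and> v - (\<Sum>b\<in>B. c b *s b) \<in> W" if v: "v \<in> V" for v
 proof -
  obtain c where c: "v - (\<Sum>b\<in>B. c b *s b) \<in> W" using q v unfolding qbasis_def by blast
  let ?c = "\<lambda>b. if b \<in> B then c b else 0"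
  have 1: "v - (\<Sum>b\<in>B. ?c b *s b) \<in> W" using c by (simp cong: sum.cong)
  show ?thesis
  proof (rule ex1I[of _ ?c])
   fix c' assume c': "(\<forall>b. b \<notin> B \<longrightarrow> c' b = 0) \<and> v - (\<Sum>b\<in>B. c' b *s b) \<in> W"
   have "(\<Sum>b\<in>B. (c' b - ?c b) *s b) = (v - (\<Sum>b\<in>B. ?c b *s b)) - (v - (\<Sum>b\<in>B. c' b *s b))"
    by (simp add: scale_left_diff_distrib sum_subtractf)
   also have "\<dots> \<in> W" using 1 c' subspace_diff[OF W] by blast
   finally have 2: "(\<Sum>b\<in>B. (c' b - ?c b) *s b) \<in> W" .
   have "\<And>d. (\<Sum>b\<in>B. d b *s b) \<in> W \<Longrightarrow> \<forall>b\<in>B. d b = 0" using q unfolding qbasis_def by blast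
   from this[OF 2] have "\<forall>b\<in>B. c' b - ?c b = 0" .
   thus "c' = ?c" using c' by (intro ext) auto
  qed (use 1 in auto)
 qed
 thus ?R using q unfolding qbasis_def by blast
next
 assume R: ?R
 have "\<forall>b\<in>B. c b = 0" if c: "(\<Sum>b\<in>B. c b *s b) \<in> W" for c
 proof -
  let ?c = "\<lambda>b. if b \<in> B then c b else 0"
  define Q where "Q d \<longleftrightarrow> (\<forall>b. b \<notin> B \<longrightarrow> d b = 0) \<and> 0 - (\<Sum>b\<in>B. d b *s b) \<in> W" for d
  have "\<exists>!d. Q d" using R subspace_0[OF V] unfolding Q_def by blast
  moreover have "Q ?c" unfolding Q_def using subspace_neg[OF W c] by (simp cong: sum.cong)
  moreover have "Q (\<lambda>_. 0)" unfolding Q_def using subspace_0[OF W] by simp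
  ultimately have "?c = (\<lambda>_. 0)" by blast
  hence "?c b = 0" for b by (rule fun_cong)
  thus ?thesis by (metis (full_types))
 qed
 thus "qbasis scale V W B" using R unfolding qbasis_def by blast
qed

lemma quotient_dim_conv:
 assumes "subspace W" "subspace V" "qdim scale V W n"
 shows "(THE n. \<exists>B. finite B \<and> B \<subseteq> V \<and> card B = n \<and>
  (\<forall>v\<in>V. \<exists>!c. (\<forall>b. b \<notin> B \<longrightarrow> c b = 0) \<and> v - (\<Sum>b\<in>B. c b *s b) \<in> W)) = n"
proof -
 have "(\<exists>B. finite B \<and> B \<subseteq> V \<and> card B = n \<and>
  (\<forall>v\<in>V. \<exists>!c. (\<forall>b. b \<notin> B \<longrightarrow> c b = 0) \<and> v - (\<Sum>b\<in>B. c b *s b) \<in> W)) = qdim scale V W n" for n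
  unfolding qdim_def qbasis_Ex1[OF assms(1,2)] by blast
 hence "?thesis \<longleftrightarrow> (THE n. qdim scale V W n) = n" by presburger
 also have "\<dots>" by (rule the_equality) (use assms(3) qdim_unique[OF assms(1) _ assms(3)] in blast)+
 finally show ?thesis by blast
qed

lemma qdim_0_iff:
 assumes "W \<subseteq> V" "subspace W"
 shows "qdim scale V W 0 \<longleftrightarrow> V = W"
proof
 assume "qdim scale V W 0"
 then obtain B where "qbasis scale V W B" "card B = 0" unfolding qdim_def by blast
 thus "V = W" using assms unfolding qbasis_def by auto
next
 assume "V = W"
 hence "qbasis scale V W {}" unfolding qbasis_def by auto
 thus "qdim scale V W 0" unfolding qdim_def by force
qed

lemma sum_insert_coeff:
 assumes "finite A" "finite B" "A \<inter> B = {}"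
 shows "(\<Sum>b\<in>A\<union>B. (if b \<in> A then f b else g b) *s b) = (\<Sum>b\<in>A. f b *s b) + (\<Sum>b\<in>B. g b *s b)"
 unfolding sum.union_disjoint[OF assms] using assms(3)
 by (intro arg_cong2[of _ _ _ _ "(+)"] sum.cong) auto

lemma qdim_add:
 assumes W: "subspace W" and U: "subspace U" and V: "subspace V" and WU: "W \<subseteq> U" and UV: "U \<subseteq> V"
  and a: "qdim scale U W a" and b: "qdim scale V U b"
 shows "qdim scale V W (a + b)"
proof -
 obtain A where A: "qbasis scale U W A" "card A = a" using a unfolding qdim_def by blast
 obtain B where B: "qbasis scale V U B" "card B = b" using b unfolding qdim_def by blast
 have disj: "A \<inter> B = {}"
 proof (rule ccontr)
  assume "A \<inter> B \<noteq> {}"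
  then obtain x where x: "x \<in> A" "x \<in> B" by blast
  have "(\<Sum>b\<in>B. (if b = x then 1 else 0) *s b) = x"
   using x B by (simp add: if_distrib[of "\<lambda>c. c *s _"] qbasis_def cong: if_cong)
  hence "(\<Sum>b\<in>B. (if b = x then 1 else 0) *s b) \<in> U" using x A unfolding qbasis_def by auto
  hence "\<forall>b\<in>B. (if b = x then 1 else 0::'a) = 0"
   using B(1)[unfolded qbasis_def] by (elim conjE) (erule allE[of _ "\<lambda>b. if b = x then 1 else 0"], blast)
  thus False using x by auto
 qed
 have fin: "finite A" "finite B" using A B unfolding qbasis_def by auto
 have sA: "(\<Sum>b\<in>A. f b *s b) \<in> U" for f
  using A U unfolding qbasis_def by (intro subspace_sum subspace_scale) auto
 have "qbasis scale V W (A \<union> B)" unfolding qbasis_def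
 proof (intro conjI ballI allI impI)
  fix v assume "v \<in> V"
  then obtain g where g: "v - (\<Sum>b\<in>B. g b *s b) \<in> U" using B unfolding qbasis_def by blast
  then obtain f where f: "v - (\<Sum>b\<in>B. g b *s b) - (\<Sum>b\<in>A. f b *s b) \<in> W"
   using A unfolding qbasis_def by blast
  show "\<exists>c. v - (\<Sum>b\<in>A \<union> B. c b *s b) \<in> W"
   using f by (intro exI[of _ "\<lambda>b. if b \<in> A then f b else g b"])
    (simp add: sum_insert_coeff[OF fin disj] diff_diff_eq add.commute)
 next
  fix c b assume c: "(\<Sum>b\<in>A \<union> B. c b *s b) \<in> W" and b: "b \<in> A \<union> B"
  have e: "(\<Sum>b\<in>A \<union> B. c b *s b) = (\<Sum>b\<in>A. c b *s b) + (\<Sum>b\<in>B. c b *s b)"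
   by (rule sum.union_disjoint[OF fin disj])
  have "(\<Sum>b\<in>B. c b *s b) = (\<Sum>b\<in>A \<union> B. c b *s b) - (\<Sum>b\<in>A. c b *s b)" using e by simp
  also have "\<dots> \<in> U" using c WU sA subspace_diff[OF U] by blast
  finally have 1: "\<forall>b\<in>B. c b = 0" using B unfolding qbasis_def by blast
  hence "(\<Sum>b\<in>A. c b *s b) \<in> W" using c e by simp
  hence "\<forall>b\<in>A. c b = 0" using A unfolding qbasis_def by blast
  thus "c b = 0" using 1 b by blast
 qed (use fin A B UV in \<open>auto simp: qbasis_def\<close>)
 thus ?thesis unfolding qdim_def using card_Un_disjoint[OF fin disj] A B by blast
qed

lemma qbasis_extend:
 assumes W: "subspace W" and V: "subspace V" and WV: "W \<subseteq> V" and F: "finite F" "F \<subseteq> V"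
  and ind: "\<forall>c. (\<Sum>b\<in>F. c b *s b) \<in> W \<longrightarrow> (\<forall>b\<in>F. c b = 0)"
  and max: "\<And>x. x \<in> V \<Longrightarrow> x \<notin> F \<Longrightarrow> \<exists>c. (\<Sum>b\<in>insert x F. c b *s b) \<in> W \<and> (\<exists>b\<in>insert x F. c b \<noteq> 0)"
 shows "qbasis scale V W F"
 unfolding qbasis_def
proof (intro conjI ballI)
 fix v assume v: "v \<in> V"
 show "\<exists>c. v - (\<Sum>b\<in>F. c b *s b) \<in> W"
 proof (cases "v \<in> F")
  case True
  have "(\<Sum>b\<in>F. (if b = v then 1 else 0) *s b) = v"
   using True F by (simp add: if_distrib[of "\<lambda>c. c *s _"] cong: if_cong)
  thus ?thesis using subspace_0[OF W] by (intro exI[of _ "\<lambda>b. if b = v then 1 else 0"]) simp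
 next
  case False
  then obtain c where c: "(\<Sum>b\<in>insert v F. c b *s b) \<in> W" "\<exists>b\<in>insert v F. c b \<noteq> 0"
   using max[OF v] by blast
  have e: "(\<Sum>b\<in>insert v F. c b *s b) = c v *s v + (\<Sum>b\<in>F. c b *s b)" using False F by simp
  have cv: "c v \<noteq> 0"
  proof
   assume "c v = 0"
   thus False using c ind e by auto
  qed
  have "v - (\<Sum>b\<in>F. (- (c b / c v)) *s b) = (1 / c v) *s (c v *s v + (\<Sum>b\<in>F. c b *s b))"
   using cv by (simp add: scale_right_distrib scale_sum_right sum_negf)
  also have "\<dots> \<in> W" using c e subspace_scale[OF W] by metis
  finally show ?thesis by (intro exI)
 qed
qed (use F ind in auto)

text \<open>A bound on the size of independent families yields a largest one, and by maximality it
  also generates V modulo W.\<close>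

lemma qdim_exists:
 assumes W: "subspace W" and V: "subspace V" and WV: "W \<subseteq> V"
  and bd: "\<And>F. F \<subseteq> V \<Longrightarrow> finite F \<Longrightarrow> (\<forall>c. (\<Sum>b\<in>F. c b *s b) \<in> W \<longrightarrow> (\<forall>b\<in>F. c b = 0)) \<Longrightarrow> card F \<le> N"
 shows "\<exists>n\<le>N. qdim scale V W n"
proof -
 let ?P = "\<lambda>n. \<exists>F. F \<subseteq> V \<and> finite F \<and> card F = n \<and> (\<forall>c. (\<Sum>b\<in>F. c b *s b) \<in> W \<longrightarrow> (\<forall>b\<in>F. c b = 0))"
 have P0: "?P 0" by (rule exI[of _ "{}"]) auto
 have Pb: "?P n \<Longrightarrow> n \<le> N" for n using bd by blast
 define n where "n = (GREATEST n. ?P n)"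
 have Pn: "?P n" unfolding n_def using P0 Pb by (rule GreatestI_nat[where P="?P"])
 have nmax: "?P m \<Longrightarrow> m \<le> n" for m unfolding n_def using _ Pb by (rule Greatest_le_nat[where P="?P"])
 obtain F where F: "F \<subseteq> V" "finite F" "card F = n" "\<forall>c. (\<Sum>b\<in>F. c b *s b) \<in> W \<longrightarrow> (\<forall>b\<in>F. c b = 0)"
  using Pn by blast
 have "qbasis scale V W F"
 proof (rule qbasis_extend[OF W V WV F(2,1,4)])
  fix x assume x: "x \<in> V" "x \<notin> F"
  show "\<exists>c. (\<Sum>b\<in>insert x F. c b *s b) \<in> W \<and> (\<exists>b\<in>insert x F. c b \<noteq> 0)"
  proof (rule ccontr)
   assume "\<not> ?thesis"
   hence "?P (Suc n)" using x F by (intro exI[of _ "insert x F"]) auto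
   hence "Suc n \<le> n" by (rule nmax)
   thus False by simp
  qed
 qed
 thus ?thesis using F Pb[OF Pn] unfolding qdim_def by blast
qed

lemma qdim_between:
 assumes W: "subspace W" and U: "subspace U" and V: "subspace V" and WU: "W \<subseteq> U" and UV: "U \<subseteq> V"
  and n: "qdim scale V W n"
 shows "\<exists>a b. qdim scale U W a \<and> qdim scale V U b \<and> n = a + b"
proof -
 obtain B where B: "qbasis scale V W B" "card B = n" using n unfolding qdim_def by blast
 have bd: "card F \<le> n" if "F \<subseteq> V" "finite F" "\<forall>c. (\<Sum>b\<in>F. c b *s b) \<in> W \<longrightarrow> (\<forall>b\<in>F. c b = 0)" for F
  using qbasis_bound[OF W B(1) that] B(2) by simp
 have "\<exists>a\<le>n. qdim scale U W a"
 proof (rule qdim_exists[OF W U WU])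
  fix F assume "F \<subseteq> U" "finite F" "\<forall>c. (\<Sum>b\<in>F. c b *s b) \<in> W \<longrightarrow> (\<forall>b\<in>F. c b = 0)"
  thus "card F \<le> n" using UV by (intro bd) auto
 qed
 then obtain a where a: "qdim scale U W a" by blast
 have "\<exists>b\<le>n. qdim scale V U b"
 proof (rule qdim_exists[OF U V UV])
  fix F assume F: "F \<subseteq> V" "finite F" "\<forall>c. (\<Sum>b\<in>F. c b *s b) \<in> U \<longrightarrow> (\<forall>b\<in>F. c b = 0)"
  thus "card F \<le> n" using WU by (intro bd) blast+
 qed
 then obtain b where b: "qdim scale V U b" by blast
 show ?thesis using a b qdim_unique[OF W n qdim_add[OF W U V WU UV a b]] by blast
qed

lemma qdim_spanned:
 assumes W: "subspace W" and V: "subspace V" and WV: "W \<subseteq> V" and A: "finite A" "V \<subseteq> span A"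
 shows "\<exists>n\<le>card A. qdim scale V W n"
proof (rule qdim_exists[OF W V WV])
 fix F assume F: "F \<subseteq> V" "finite F" "\<forall>c. (\<Sum>b\<in>F. c b *s b) \<in> W \<longrightarrow> (\<forall>b\<in>F. c b = 0)"
 have "independent F"
  by (rule independent_if_scalars_zero) (use F subspace_0[OF W] in auto)
 thus "card F \<le> card A" using independent_span_bound[OF A(1), of F] F A by blast
qed

end

text \<open>A linear relation inducing an isomorphism of \<open>V / W\<close> with \<open>V' / W'\<close>.\<close>

lemma qdim_transfer:
 fixes s1 :: "'k::field \<Rightarrow> 'v::ab_group_add \<Rightarrow> 'v" and s2 :: "'k \<Rightarrow> 'w::ab_group_add \<Rightarrow> 'w"
 assumes vs: "vector_space s1" "vector_space s2"
  and R: "R 0 0" "\<And>x y x' y'. R x y \<Longrightarrow> R x' y' \<Longrightarrow> R (x + x') (y + y')" "\<And>c x y. R x y \<Longrightarrow> R (s1 c x) (s2 c y)"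
  and ker: "\<And>x y. R x y \<Longrightarrow> x \<in> W \<longleftrightarrow> y \<in> W'" and W: "0 \<in> W"
  and tot: "\<And>x. x \<in> V \<Longrightarrow> \<exists>y\<in>V'. R x y" "\<And>y. y \<in> V' \<Longrightarrow> \<exists>x\<in>V. R x y"
  and q: "qdim s1 V W n"
 shows "qdim s2 V' W' n"
proof -
 interpret v1: vector_space s1 by (rule vs)
 interpret v2: vector_space s2 by (rule vs)
 obtain B where B: "qbasis s1 V W B" "card B = n" using q unfolding qdim_def by blast
 have BV: "finite B" "B \<subseteq> V" using B unfolding qbasis_def by auto
 obtain g where g: "\<And>b. b \<in> B \<Longrightarrow> g b \<in> V' \<and> R b (g b)" using tot(1) BV(2) by (metis subsetD)
 have "finite A \<Longrightarrow> A \<subseteq> B \<Longrightarrow> R (\<Sum>b\<in>A. s1 (c b) b) (\<Sum>b\<in>A. s2 (c b) (g b))" for A c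
  by (induction A rule: finite_induct) (use R g in auto)
 hence sum: "R (\<Sum>b\<in>B. s1 (c b) b) (\<Sum>b\<in>B. s2 (c b) (g b))" for c using BV(1) by blast
 have ind: "\<forall>b\<in>B. c b = 0" if "(\<Sum>b\<in>B. s2 (c b) (g b)) \<in> W'" for c
  using that ker[OF sum[of c]] B unfolding qbasis_def by blast
 have inj: "inj_on g B"
 proof (rule inj_onI, rule ccontr)
  fix x y assume xy: "x \<in> B" "y \<in> B" "g x = g y" "x \<noteq> y"
  let ?c = "\<lambda>b. if b = x then 1 else if b = y then -1 else 0"
  have "(\<Sum>b\<in>B. s2 (?c b) (g b)) = (\<Sum>b\<in>{x,y}. s2 (?c b) (g b))"
   by (rule sum.mono_neutral_right) (use BV xy in auto)
  also have "\<dots> = 0" using xy by simp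
  finally show False using ind[of ?c] xy ker[OF R(1)] W by auto
 qed
 have "qbasis s2 V' W' (g ` B)" unfolding qbasis_def
 proof (intro conjI ballI allI impI)
  fix z assume "z \<in> V'"
  then obtain x where x: "x \<in> V" "R x z" using tot(2) by blast
  obtain c where c: "x - (\<Sum>b\<in>B. s1 (c b) b) \<in> W" using B x unfolding qbasis_def by blast
  have "R (x - (\<Sum>b\<in>B. s1 (c b) b)) (z - (\<Sum>b\<in>B. s2 (c b) (g b)))"
   using R(2)[OF x(2) R(3)[OF sum[of c], of "-1"]] by simp
  hence "z - (\<Sum>b\<in>g ` B. s2 (c (the_inv_into B g b)) b) \<in> W'"
   using ker c by (simp add: sum.reindex[OF inj] the_inv_into_f_f[OF inj] cong: sum.cong)
  thus "\<exists>c. z - (\<Sum>b\<in>g ` B. s2 (c b) b) \<in> W'" by (intro exI)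
 next
  fix c b assume "(\<Sum>b\<in>g ` B. s2 (c b) b) \<in> W'" "b \<in> g ` B"
  thus "c b = 0" using ind[of "c \<circ> g"] by (auto simp: sum.reindex[OF inj])
 qed (use BV g in auto)
 thus ?thesis using card_image[OF inj] B unfolding qdim_def by blast
qed

text \<open>The map need be additive only on V and surjective only modulo W'. Its graph modulo W' is
  a relation to which \<open>qdim_transfer\<close> applies in both directions, so no inverse map has
  to be constructed.\<close>

locale quotient_iso = v1: vector_space s1 + v2: vector_space s2
 for s1 :: "'k::field \<Rightarrow> 'v::ab_group_add \<Rightarrow> 'v" and s2 :: "'k \<Rightarrow> 'w::ab_group_add \<Rightarrow> 'w" +
 fixes V W :: "'v set" and V' W' :: "'w set" and f :: "'v \<Rightarrow> 'w"
 assumes V: "v1.subspace V" and W': "v2.subspace W'"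
  and f_add: "x \<in> V \<Longrightarrow> y \<in> V \<Longrightarrow> f (x + y) = f x + f y"
  and f_scale: "x \<in> V \<Longrightarrow> f (s1 c x) = s2 c (f x)"
  and f_into: "x \<in> V \<Longrightarrow> f x \<in> V'"
  and f_ker: "x \<in> V \<Longrightarrow> f x \<in> W' \<longleftrightarrow> x \<in> W"
  and f_onto: "z \<in> V' \<Longrightarrow> \<exists>x\<in>V. z - f x \<in> W'"
begin

definition rel where "rel x z \<longleftrightarrow> x \<in> V \<and> z - f x \<in> W'"

lemma rel:
 "rel 0 0" "rel x y \<Longrightarrow> rel x' y' \<Longrightarrow> rel (x + x') (y + y')" "rel x y \<Longrightarrow> rel (s1 c x) (s2 c y)"
 "rel x y \<Longrightarrow> x \<in> W \<longleftrightarrow> y \<in> W'" "x \<in> V \<Longrightarrow> \<exists>y\<in>V'. rel x y" "y \<in> V' \<Longrightarrow> \<exists>x\<in>V. rel x y" "0 \<in> W" "0 \<in> W'"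
proof -
 show W'0: "0 \<in> W'" by (rule v2.subspace_0[OF W'])
 have f0: "f 0 = 0" using f_scale[OF v1.subspace_0[OF V], of 0] by simp
 show "rel 0 0" unfolding rel_def using v1.subspace_0[OF V] f0 W'0 by simp
 show "0 \<in> W" using f_ker[OF v1.subspace_0[OF V]] f0 W'0 by simp
 show "rel (x + x') (y + y')" if "rel x y" "rel x' y'"
  using that f_add[of x x'] v1.subspace_add[OF V, of x x'] v2.subspace_add[OF W', of "y - f x" "y' - f x'"]
  unfolding rel_def by (simp add: algebra_simps)
 show "rel (s1 c x) (s2 c y)" if "rel x y"
  using that f_scale[of x c] v1.subspace_scale[OF V, of x c] v2.subspace_scale[OF W', of "y - f x" c]
  unfolding rel_def by (simp add: v2.scale_right_diff_distrib)
 show "x \<in> W \<longleftrightarrow> y \<in> W'" if xy: "rel x y"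
 proof -
  have "f x \<in> W' \<longleftrightarrow> y \<in> W'"
   using v2.subspace_add[OF W', of "y - f x" "f x"] v2.subspace_diff[OF W', of y "y - f x"] xy unfolding rel_def by auto
  thus ?thesis using f_ker xy unfolding rel_def by blast
 qed
 show "x \<in> V \<Longrightarrow> \<exists>y\<in>V'. rel x y" using f_into W'0 unfolding rel_def by (intro bexI[of _ "f x"]) auto
 show "y \<in> V' \<Longrightarrow> \<exists>x\<in>V. rel x y" using f_onto unfolding rel_def by blast
qed

lemma qdim_forward: "qdim s1 V W n \<Longrightarrow> qdim s2 V' W' n"
 by (rule qdim_transfer[where R = rel])
  (assumption | rule v1.vector_space_axioms v2.vector_space_axioms rel(1,7) | erule (1) rel(2) | erule rel(3-6))+

lemma qdim_backward: "qdim s2 V' W' n \<Longrightarrow> qdim s1 V W n"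
 by (rule qdim_transfer[where R = "\<lambda>y x. rel x y"])
  (assumption | rule v1.vector_space_axioms v2.vector_space_axioms rel(1,8) | erule (1) rel(2) | erule rel(3,5,6) rel(4)[symmetric])+

end

abbreviation (input) "lookup \<equiv> Poly_Mapping.lookup"
abbreviation (input) "keys \<equiv> Poly_Mapping.keys"

section \<open>Graded ideals in graded algebras generated in degree one\<close>

text \<open>A decreasing sequence of naturals is constant from the point where it attains its
  minimum, so its tail is nondecreasing too.\<close>

lemma nat_seq_mono_subseq:
 fixes s :: "nat \<Rightarrow> nat"
 shows "\<exists>\<phi>::nat \<Rightarrow> nat. strict_mono \<phi> \<and> mono (\<lambda>n. s (\<phi> n))"
proof -
 obtain \<psi> where \<psi>: "strict_mono \<psi>" "monoseq (\<lambda>n. s (\<psi> n))" using seq_monosub by blast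
 show ?thesis
 proof (cases "\<forall>m. \<forall>n\<ge>m. s (\<psi> m) \<le> s (\<psi> n)")
  case True thus ?thesis using \<psi>(1) by (intro exI[of _ \<psi>]) (auto simp: mono_def)
 next
  case False
  hence dec: "s (\<psi> n) \<le> s (\<psi> m)" if "m \<le> n" for m n using \<psi>(2) that unfolding monoseq_def by blast
  obtain N where N: "\<And>n. s (\<psi> N) \<le> s (\<psi> n)"
   using ex_has_least_nat[of "\<lambda>_. True" 0 "\<lambda>n. s (\<psi> n)"] by blast
  have "s (\<psi> (N + n)) = s (\<psi> N)" for n using N[of "N + n"] dec[of N "N + n"] by simp
  moreover have "strict_mono (\<lambda>n. \<psi> (N + n))" using \<psi>(1) by (auto simp: strict_mono_def)
  ultimately show ?thesis by (intro exI[of _ "\<lambda>n. \<psi> (N + n)"]) (auto simp: mono_def)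
 qed
qed

text \<open>Passing to a subsequence for one coordinate after another makes every coordinate
  nondecreasing; then the first two remaining terms are already comparable.\<close>

lemma Dickson:
 fixes a :: "nat \<Rightarrow> nat \<Rightarrow>\<^sub>0 nat"
 assumes keys: "\<And>k. keys (a k) \<subseteq> {..r}"
 shows "\<exists>j k c. j < k \<and> a k = a j + c"
proof -
 have "\<exists>\<phi>::nat \<Rightarrow> nat. strict_mono \<phi> \<and> (\<forall>i<m. mono (\<lambda>n. lookup (a (\<phi> n)) i))" for m
 proof (induction m)
  case 0 show ?case by (intro exI[of _ "\<lambda>n. n"]) (auto simp: strict_mono_def)
 next
  case (Suc m)
  then obtain \<phi> :: "nat \<Rightarrow> nat" where \<phi>: "strict_mono \<phi>" "\<forall>i<m. mono (\<lambda>n. lookup (a (\<phi> n)) i)" by blast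
  obtain \<psi> :: "nat \<Rightarrow> nat" where \<psi>: "strict_mono \<psi>" "mono (\<lambda>n. lookup (a (\<phi> (\<psi> n))) m)"
   using nat_seq_mono_subseq[of "\<lambda>n. lookup (a (\<phi> n)) m"] by blast
  have "mono (\<lambda>n. lookup (a (\<phi> (\<psi> n))) i)" if "i < Suc m" for i
  proof (cases "i = m")
   case False
   hence "mono (\<lambda>n. lookup (a (\<phi> n)) i)" using \<phi> that by simp
   thus ?thesis using strict_mono_mono[OF \<psi>(1)] by (auto simp: mono_def)
  qed (use \<psi> in simp)
  moreover have "strict_mono (\<lambda>n. \<phi> (\<psi> n))" using \<phi>(1) \<psi>(1) by (auto simp: strict_mono_def)
  ultimately show ?case by (intro exI[of _ "\<lambda>n. \<phi> (\<psi> n)"]) auto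
 qed
 then obtain \<phi> :: "nat \<Rightarrow> nat" where \<phi>: "strict_mono \<phi>" "\<forall>i<Suc r. mono (\<lambda>n. lookup (a (\<phi> n)) i)" by blast
 have le: "lookup (a (\<phi> 0)) i \<le> lookup (a (\<phi> 1)) i" for i
 proof (cases "i \<le> r")
  case True thus ?thesis using \<phi>(2) by (auto simp: mono_def)
 next
  case False
  hence "i \<notin> keys (a (\<phi> 0))" using keys by force
  thus ?thesis by (simp add: in_keys_iff)
 qed
 have "a (\<phi> 1) = a (\<phi> 0) + (a (\<phi> 1) - a (\<phi> 0))"
  by (rule poly_mapping_eqI) (use le in \<open>simp add: lookup_add lookup_minus\<close>)
 moreover have "\<phi> 0 < \<phi> 1" using \<phi>(1) by (simp add: strict_mono_def)
 ultimately show ?thesis by blast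
qed

text \<open>The axioms keep what the Hilbert function arguments use, so that they can be
  instantiated with the polynomial ring both over the complex numbers and over the rational function
  field. The field is infinite in order that a linear form can avoid finitely many primes.\<close>

locale graded_alg = vector_space scale
 for scale :: "'k::field \<Rightarrow> 'a::comm_ring_1 \<Rightarrow> 'a" (infixr "*s" 75) +
 fixes G :: "nat \<Rightarrow> 'a set" and X :: "nat \<Rightarrow> 'a" and r :: nat
 assumes inf: "infinite (UNIV :: 'k set)"
  and scale_mult: "(c *s x) * y = c *s (x * y)"
  and G_sub: "subspace (G n)"
  and G_one: "1 \<in> G 0"
  and G_zero: "p \<in> G 0 \<Longrightarrow> \<exists>c. p = c *s 1"
  and G_mult: "p \<in> G m \<Longrightarrow> q \<in> G n \<Longrightarrow> p * q \<in> G (m + n)"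
  and X_in: "i \<le> r \<Longrightarrow> X i \<in> G 1"
  and G_gen: "p \<in> G (Suc n) \<Longrightarrow> \<exists>q. (\<forall>i\<le>r. q i \<in> G n) \<and> p = (\<Sum>i\<le>r. X i * q i)"
begin

lemma mult_scale: "x * (c *s y) = c *s (x * y)"
 by (metis mult.commute scale_mult)

subsection \<open>Monomials\<close>

definition mon :: "(nat \<Rightarrow>\<^sub>0 nat) \<Rightarrow> 'a" where
 "mon a = (\<Prod>i\<le>r. X i ^ lookup a i)"

definition expos :: "nat \<Rightarrow> (nat \<Rightarrow>\<^sub>0 nat) set" where
 "expos n = {a. keys a \<subseteq> {..r} \<and> (\<Sum>i\<le>r. lookup a i) = n}"

lemma mon_add: "mon (a + b) = mon a * mon b"
 by (simp add: mon_def lookup_add power_add prod.distrib)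

lemma mon_single: "i \<le> r \<Longrightarrow> mon (Poly_Mapping.single i 1) = X i"
 unfolding mon_def
 by (subst prod.remove[of _ i]) (auto simp: lookup_single)

lemma expos_0: "expos 0 = {0}"
proof -
 have "a = 0" if "a \<in> expos 0" for a
 proof (rule poly_mapping_eqI)
  fix k show "lookup a k = lookup 0 k"
   using that by (cases "k \<le> r") (auto simp: expos_def in_keys_iff subset_iff)
 qed
 thus ?thesis by (auto simp: expos_def)
qed

lemma single_expos: "i \<le> r \<Longrightarrow> Poly_Mapping.single i 1 \<in> expos 1"
 by (auto simp: expos_def lookup_single when_def)

lemma expos_add: "a \<in> expos m \<Longrightarrow> b \<in> expos n \<Longrightarrow> a + b \<in> expos (m + n)"
 using keys_add[of a b] by (auto simp: expos_def lookup_add sum.distrib)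

lemma expos_diff: "a \<in> expos m \<Longrightarrow> a + b \<in> expos n \<Longrightarrow> m \<le> n \<and> b \<in> expos (n - m)"
 by (auto simp: expos_def lookup_add sum.distrib in_keys_iff subset_iff)

lemma expos_Suc: "expos (Suc n) \<subseteq> (\<Union>i\<le>r. (+) (Poly_Mapping.single i 1) ` expos n)"
proof
 fix a assume a: "a \<in> expos (Suc n)"
 hence "(\<Sum>i\<le>r. lookup a i) \<noteq> 0" unfolding expos_def by simp
 then obtain i where i: "i \<le> r" "lookup a i \<noteq> 0" by (meson atMost_iff sum.neutral)
 have "a = Poly_Mapping.single i 1 + (a - Poly_Mapping.single i 1)"
  by (rule poly_mapping_eqI) (use i in \<open>auto simp: lookup_add lookup_minus lookup_single when_def\<close>)
 moreover from this have "a - Poly_Mapping.single i 1 \<in> expos n"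
  using expos_diff[OF single_expos[OF i(1)], of "a - Poly_Mapping.single i 1" "Suc n"] a
  by (simp del: One_nat_def)
 ultimately show "a \<in> (\<Union>i\<le>r. (+) (Poly_Mapping.single i 1) ` expos n)" using i by blast
qed

lemma finite_expos: "finite (expos n)"
proof (induction n)
 case (Suc n) thus ?case by (intro finite_subset[OF expos_Suc]) auto
qed (simp add: expos_0)

lemma mon_span_mult: "x \<in> span (mon ` A) \<Longrightarrow> mon c * x \<in> span (mon ` (+) c ` A)"
proof (induction rule: span_induct_alt)
 case base thus ?case by (simp add: span_zero)
next
 case (step k x y)
 then obtain a where a: "x = mon a" "a \<in> A" by blast
 have "mon c * (k *s x + y) = k *s mon (c + a) + mon c * y"
  using a by (simp add: mon_add distrib_left mult_scale)
 thus ?case using step a by (simp add: span_add span_scale span_base)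
qed

lemma G_span: "G n \<subseteq> span (mon ` expos n)"
proof (induction n)
 case 0
 show ?case using G_zero by (auto simp: expos_0 span_singleton mon_def)
next
 case (Suc n)
 show ?case
 proof
  fix p assume "p \<in> G (Suc n)"
  then obtain q where q: "\<forall>i\<le>r. q i \<in> G n" "p = (\<Sum>i\<le>r. X i * q i)" using G_gen by blast
  have "X i * q i \<in> span (mon ` expos (Suc n))" if "i \<le> r" for i
  proof -
   have "mon (Poly_Mapping.single i 1) * q i \<in> span (mon ` (+) (Poly_Mapping.single i 1) ` expos n)"
    using Suc q that by (intro mon_span_mult) blast
   also have "\<dots> \<subseteq> span (mon ` expos (Suc n))"
    using expos_add[OF single_expos[OF that]] by (intro span_mono image_mono) auto
   finally show ?thesis using that by (simp add: mon_single del: One_nat_def)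
  qed
  thus "p \<in> span (mon ` expos (Suc n))" using q(2) by (auto intro: span_sum)
 qed
qed

subsection \<open>Graded ideals\<close>

text \<open>A graded ideal is stored as the family of its graded pieces. Closure under the variables
  is enough: generation in degree one extends it to all forms in \<open>gideal_mult\<close>.\<close>

definition gideal :: "(nat \<Rightarrow> 'a set) \<Rightarrow> bool" where
 "gideal I \<longleftrightarrow> (\<forall>n. subspace (I n) \<and> I n \<subseteq> G n) \<and> (\<forall>n. \<forall>p\<in>I n. \<forall>i\<le>r. X i * p \<in> I (Suc n))"

lemma gidealI:
 assumes "\<And>n. subspace (I n)" "\<And>n p. p \<in> I n \<Longrightarrow> p \<in> G n"
  "\<And>n p i. p \<in> I n \<Longrightarrow> i \<le> r \<Longrightarrow> X i * p \<in> I (Suc n)"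
 shows "gideal I"
 using assms unfolding gideal_def by blast

lemma gideal_sub: "gideal I \<Longrightarrow> subspace (I n)" unfolding gideal_def by blast
lemma gideal_G: "gideal I \<Longrightarrow> p \<in> I n \<Longrightarrow> p \<in> G n" unfolding gideal_def by blast
lemma gideal_subset: "gideal I \<Longrightarrow> I n \<subseteq> G n" unfolding gideal_def by blast

lemmas gideal_add = subspace_add[OF gideal_sub] and gideal_diff = subspace_diff[OF gideal_sub]
 and gideal_0 = subspace_0[OF gideal_sub] and gideal_scale = subspace_scale[OF gideal_sub]

lemma gideal_mult:
 assumes I: "gideal I"
 shows "g \<in> G m \<Longrightarrow> p \<in> I n \<Longrightarrow> g * p \<in> I (m + n)"
proof (induction m arbitrary: g)
 case 0
 then obtain c where "g = c *s 1" using G_zero by blast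
 thus ?case using 0 gideal_scale[OF I] by (simp add: scale_mult)
next
 case (Suc m)
 then obtain q where q: "\<forall>i\<le>r. q i \<in> G m" "g = (\<Sum>i\<le>r. X i * q i)" using G_gen by blast
 have "g * p = (\<Sum>i\<le>r. X i * (q i * p))" by (simp add: q(2) sum_distrib_right mult.assoc)
 also have "\<dots> \<in> I (Suc (m + n))"
 proof (rule subspace_sum[OF gideal_sub[OF I]])
  fix i assume "i \<in> {..r}"
  thus "X i * (q i * p) \<in> I (Suc (m + n))" using I Suc q unfolding gideal_def by simp
 qed
 finally show ?case by simp
qed

lemma gideal_mult': "gideal I \<Longrightarrow> p \<in> I n \<Longrightarrow> g \<in> G m \<Longrightarrow> p * g \<in> I (n + m)"
 using gideal_mult[of I g m p n] by (simp add: mult.commute add.commute)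

lemma G_gideal: "gideal G"
proof (rule gidealI)
 show "X i * p \<in> G (Suc n)" if "p \<in> G n" "i \<le> r" for n p i
  using G_mult[OF X_in[OF that(2)] that(1)] by simp
qed (use G_sub in auto)

lemma mon_G: "a \<in> expos n \<Longrightarrow> mon a \<in> G n"
proof (induction n arbitrary: a)
 case 0 thus ?case using G_one by (simp add: expos_0 mon_def)
next
 case (Suc n)
 then obtain i b where i: "i \<le> r" "a = Poly_Mapping.single i 1 + b" "b \<in> expos n" using expos_Suc by blast
 thus ?case using Suc.IH[of b] G_mult[OF X_in[of i], of "mon b" n]
  by (simp add: mon_add mon_single del: One_nat_def) simp
qed

subsection \<open>The ascending chain condition\<close>

text \<open>A Groebner argument with lowest terms. At each step choose an element of the new ideal,
  not in the old one, whose lowest exponent is as large as possible. By Dickson's lemma some lowest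
  monomial is a multiple of an earlier one; cancelling it produces an element that contradicts
  maximality.\<close>

lemma gideal_acc: "\<not> (\<forall>k. gideal (I k) \<and> I k < I (Suc k))"
proof
 assume I: "\<forall>k. gideal (I k) \<and> I k < I (Suc k)"
 have mono: "I j \<le> I k" if "j \<le> k" for j k
  using that by (induction rule: dec_induct) (use I in \<open>auto intro: order_trans less_imp_le\<close>)
 define S where "S n a = span (mon ` {b \<in> expos n. a \<le> b})" for n a
 define T where "T n a = span (mon ` {b \<in> expos n. a < b})" for n a
 have "\<exists>n a p. a \<in> expos n \<and> p \<in> I (Suc k) n - I k n \<and> p \<in> S n a \<and> T n a \<inter> (I (Suc k) n - I k n) = {}" for k
 proof -
  obtain n where n: "I k n \<subset> I (Suc k) n"
   using I by (metis le_fun_def less_le_not_le psubsetI subset_antisym)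
  then obtain p where p: "p \<in> I (Suc k) n - I k n" by blast
  \<comment> \<open>The exponents a such that a new element is still found in the span of the
    monomials with exponent at least a; \<open>Max ?A\<close> is the best lowest exponent.\<close>
  let ?A = "{a \<in> expos n. S n a \<inter> (I (Suc k) n - I k n) \<noteq> {}}"
  have pG: "p \<in> span (mon ` expos n)" using p I gideal_G G_span by blast
  have p0: "p \<noteq> 0" using p I gideal_0 by blast
  have ne: "expos n \<noteq> {}" using pG p0 by auto
  have "S n (Min (expos n)) = span (mon ` expos n)" unfolding S_def
   using Min_le[OF finite_expos] by (intro arg_cong[of _ _ span] arg_cong[of _ _ "image mon"]) auto
  hence "Min (expos n) \<in> ?A" using p pG Min_in[OF finite_expos ne] by blast
  moreover have fA: "finite ?A" using finite_expos by simp
  ultimately have M: "Max ?A \<in> ?A" using Max_in by blast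
  have "T n (Max ?A) \<inter> (I (Suc k) n - I k n) = {}"
  proof (rule ccontr)
   assume T: "T n (Max ?A) \<inter> (I (Suc k) n - I k n) \<noteq> {}"
   let ?B = "{b \<in> expos n. Max ?A < b}"
   have "?B \<noteq> {}"
   proof
    assume "?B = {}"
    hence "T n (Max ?A) = {0}" unfolding T_def by (simp only: image_empty span_empty)
    thus False using T I gideal_0 by auto
   qed
   moreover have fB: "finite ?B" using finite_expos by simp
   ultimately have B: "Min ?B \<in> ?B" using Min_in by blast
   have "{b \<in> expos n. Min ?B \<le> b} = ?B"
    using B Min_le[OF fB] by (auto intro: less_le_trans)
   hence "S n (Min ?B) = T n (Max ?A)" unfolding S_def T_def by simp
   hence "Min ?B \<in> ?A" using T B by auto
   hence "Min ?B \<le> Max ?A" using Max_ge[OF fA] by blast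
   moreover have "Max ?A < Min ?B" using B by blast
   ultimately show False using leD by blast
  qed
  thus ?thesis using M by blast
 qed
 then obtain n a p where nap: "\<And>k. a k \<in> expos (n k)" "\<And>k. p k \<in> I (Suc k) (n k) - I k (n k)"
  "\<And>k. p k \<in> S (n k) (a k)" "\<And>k. T (n k) (a k) \<inter> (I (Suc k) (n k) - I k (n k)) = {}"
  by metis
 have "\<exists>c. p k - c *s mon (a k) \<in> T (n k) (a k)" for k
 proof -
  have "{b \<in> expos (n k). a k \<le> b} = insert (a k) {b \<in> expos (n k). a k < b}"
   using nap(1) by (auto simp: order.order_iff_strict)
  thus ?thesis using nap(3)[of k] unfolding S_def T_def by (simp add: span_breakdown_eq)
 qed
 then obtain c where c: "\<And>k. p k - c k *s mon (a k) \<in> T (n k) (a k)" by metis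
 have c0: "c k \<noteq> 0" for k
 proof
  assume "c k = 0"
  thus False using c[of k] nap(2,4)[of k] by auto
 qed
 obtain j k b where jk: "j < k" "a k = a j + b"
  using Dickson[of a r] nap(1) unfolding expos_def by blast
 have b: "n j \<le> n k" "b \<in> expos (n k - n j)" using expos_diff nap(1)[of j] nap(1)[of k] jk by auto
 \<comment> \<open>The multiple of \<open>p j\<close> with the same lowest term as
   \<open>p k\<close>. It lies in \<open>I k\<close> because j < k, so subtracting it leaves an
   element outside \<open>I k\<close>.\<close>
 define w where "w = (c k / c j) *s (mon b * p j)"
 have "mon b * p j \<in> I (Suc j) (n k)"
  using gideal_mult[of "I (Suc j)" "mon b" "n k - n j" "p j" "n j"] mon_G b I nap(2)[of j] by simp
 hence "w \<in> I (Suc j) (n k)" unfolding w_def using I gideal_scale by blast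
 hence w: "w \<in> I k (n k)" using mono[of "Suc j" k] jk(1) by (auto simp: le_fun_def)
 have "mon b * (p j - c j *s mon (a j)) \<in> span (mon ` (+) b ` {b \<in> expos (n j). a j < b})"
  using c[of j] unfolding T_def by (rule mon_span_mult)
 also have "\<dots> \<subseteq> T (n k) (a k)" unfolding T_def
 proof (intro span_mono image_mono subsetI)
  fix x assume "x \<in> (+) b ` {b \<in> expos (n j). a j < b}"
  then obtain y where y: "x = b + y" "y \<in> expos (n j)" "a j < y" by blast
  have "b + y \<in> expos (n k)" using expos_add[OF b(2) y(2)] b(1) by simp
  moreover have "a k < b + y" unfolding jk(2) add.commute[of "a j" b] using y(3) by (rule add_strict_left_mono)
  ultimately show "x \<in> {b \<in> expos (n k). a k < b}" using y by blast
 qed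
 finally have "(c k / c j) *s (mon b * (p j - c j *s mon (a j))) \<in> T (n k) (a k)"
  unfolding T_def by (rule span_scale)
 moreover have "(c k / c j) *s (mon b * (p j - c j *s mon (a j))) = w - c k *s mon (a k)"
  unfolding w_def using c0[of j] jk(2)
  by (simp add: right_diff_distrib scale_right_diff_distrib mult_scale mon_add mult.commute)
 ultimately have "w - c k *s mon (a k) \<in> T (n k) (a k)" by simp
 with c[of k] have "(p k - c k *s mon (a k)) - (w - c k *s mon (a k)) \<in> T (n k) (a k)"
  unfolding T_def by (rule span_diff)
 hence "p k - w \<in> T (n k) (a k)" by simp
 moreover have "p k - w \<in> I (Suc k) (n k)"
 proof (rule gideal_diff)
  show "gideal (I (Suc k))" using I by blast
  show "w \<in> I (Suc k) (n k)" using w mono[of k "Suc k"] by (auto simp: le_fun_def)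
 qed (use nap(2)[of k] in blast)
 moreover have "p k - w \<notin> I k (n k)"
  using nap(2)[of k] w I gideal_add[of "I k" "p k - w" "n k" w] by fastforce
 ultimately show False using nap(4)[of k] by blast
qed

lemma noeth_induct [consumes 1, case_names step]:
 assumes I: "gideal I"
  and step: "\<And>I. gideal I \<Longrightarrow> (\<And>J. gideal J \<Longrightarrow> I < J \<Longrightarrow> P J) \<Longrightarrow> P I"
 shows "P I"
proof -
 let ?R = "{(J, I). gideal I \<and> gideal J \<and> I < J}"
 have "wf ?R"
 proof (subst wf_iff_no_infinite_down_chain, rule notI)
  assume "\<exists>f. \<forall>i. (f (Suc i), f i) \<in> ?R"
  then obtain f where "\<forall>i. (f (Suc i), f i) \<in> ?R" by blast
  thus False using gideal_acc[of f] by auto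
 qed
 hence "gideal I \<longrightarrow> P I"
  by (induction I rule: wf_induct_rule) (use step in blast)
 thus ?thesis using I by blast
qed

subsection \<open>The Hilbert function\<close>

definition hf :: "(nat \<Rightarrow> 'a set) \<Rightarrow> nat \<Rightarrow> nat" where
 "hf I n = (THE m. qdim scale (G n) (I n) m)"

lemma hf_eqI: "gideal I \<Longrightarrow> qdim scale (G n) (I n) m \<Longrightarrow> hf I n = m"
 unfolding hf_def using qdim_unique[OF gideal_sub] by (intro the_equality) blast+

lemma hf_qdim:
 assumes I: "gideal I" shows "qdim scale (G n) (I n) (hf I n)"
proof -
 obtain m where "qdim scale (G n) (I n) m"
  using qdim_spanned[OF gideal_sub[OF I] G_sub gideal_subset[OF I] _ G_span] finite_expos by blast
 thus ?thesis using hf_eqI[OF I] by simp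
qed

lemma hf_between:
 assumes I: "gideal I" and J: "gideal J" and le: "I n \<subseteq> J n"
 shows "hf J n \<le> hf I n" "qdim scale (J n) (I n) (hf I n - hf J n)"
proof -
 obtain a b where ab: "qdim scale (J n) (I n) a" "qdim scale (G n) (J n) b" "hf I n = a + b"
  using qdim_between[OF gideal_sub[OF I] gideal_sub[OF J] G_sub le gideal_subset[OF J] hf_qdim[OF I]] by blast
 thus "hf J n \<le> hf I n" "qdim scale (J n) (I n) (hf I n - hf J n)" using hf_eqI[OF J ab(2)] by auto
qed

lemma hf_eq:
 assumes I: "gideal I" and J: "gideal J" and le: "I n \<subseteq> J n" and eq: "hf I n = hf J n"
 shows "I n = J n"
 using hf_between(2)[OF I J le] eq qdim_0_iff[OF le gideal_sub[OF I]] by simp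

lemma hf_add:
 assumes I: "gideal I" and J: "gideal J" and le: "I n \<subseteq> J n" and m: "qdim scale (J n) (I n) m"
 shows "hf I n = hf J n + m"
 using hf_between[OF I J le] qdim_unique[OF gideal_sub[OF I] m] by fastforce

lemma hf_G: "hf G n = 0"
 by (rule hf_eqI[OF G_gideal]) (simp add: qdim_0_iff G_sub)

lemma hf_0_iff: assumes I: "gideal I" shows "hf I n = 0 \<longleftrightarrow> I n = G n"
proof
 assume "hf I n = 0"
 thus "I n = G n" using hf_G[of n] by (intro hf_eq[OF I G_gideal gideal_subset[OF I]]) simp
next
 assume "I n = G n"
 hence "qdim scale (G n) (I n) 0" unfolding qdim_0_iff[OF gideal_subset[OF I] gideal_sub[OF I]] by simp
 thus "hf I n = 0" by (rule hf_eqI[OF I])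
qed

subsection \<open>Sums and quotients of ideals\<close>

definition colon :: "(nat \<Rightarrow> 'a set) \<Rightarrow> 'a \<Rightarrow> nat \<Rightarrow> nat \<Rightarrow> 'a set" where
 "colon I f d n = {p \<in> G n. f * p \<in> I (n + d)}"

definition adjoin :: "(nat \<Rightarrow> 'a set) \<Rightarrow> 'a \<Rightarrow> nat \<Rightarrow> nat \<Rightarrow> 'a set" where
 "adjoin I f d n = {p + f * q | p q. p \<in> I n \<and> (d \<le> n \<and> q \<in> G (n - d) \<or> q = 0)}"

lemma colon_gideal:
 assumes I: "gideal I" and f: "f \<in> G d"
 shows "gideal (colon I f d)"
proof (rule gidealI)
 show "subspace (colon I f d n)" for n
  unfolding subspace_def colon_def using G_sub[of n] gideal_sub[OF I, of "n + d"]
  by (auto simp: distrib_left mult_scale subspace_def)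
 show "p \<in> G n" if "p \<in> colon I f d n" for n p using that unfolding colon_def by blast
 show "X i * p \<in> colon I f d (Suc n)" if "p \<in> colon I f d n" "i \<le> r" for n p i
  using that gideal_mult[OF I X_in[OF that(2)], of "f * p" "n + d"] gideal_mult[OF G_gideal X_in[OF that(2)], of p n]
  by (auto simp: colon_def mult.left_commute)
qed

lemma colon_ge: "gideal I \<Longrightarrow> f \<in> G d \<Longrightarrow> I \<le> colon I f d"
 using gideal_mult[of I f d] gideal_G by (auto simp: le_fun_def colon_def add.commute)

text \<open>The ideal I + f D, with \<open>adjoin\<close> the case D = G. The alternative q = 0
  covers the degrees below d, where the truncated difference n - d would select a wrong
  piece.\<close>

definition extend :: "(nat \<Rightarrow> 'a set) \<Rightarrow> 'a \<Rightarrow> nat \<Rightarrow> (nat \<Rightarrow> 'a set) \<Rightarrow> nat \<Rightarrow> 'a set" where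
 "extend I f d D n = {p + f * q | p q. p \<in> I n \<and> (d \<le> n \<and> q \<in> D (n - d) \<or> q = 0)}"

lemma extend_gideal:
 assumes I: "gideal I" and f: "f \<in> G d" and D: "gideal D"
 shows "gideal (extend I f d D)"
proof (rule gidealI)
 fix n
 show "subspace (extend I f d D n)"
 proof (rule subspaceI)
  show "0 \<in> extend I f d D n" using gideal_0[OF I] unfolding extend_def by force
 next
  fix x y assume "x \<in> extend I f d D n" "y \<in> extend I f d D n"
  then obtain p q p' q' where *: "x = p + f * q" "y = p' + f * q'" "p \<in> I n" "p' \<in> I n"
   "d \<le> n \<and> q \<in> D (n - d) \<or> q = 0" "d \<le> n \<and> q' \<in> D (n - d) \<or> q' = 0" unfolding extend_def by blast
  have "x + y = (p + p') + f * (q + q')" using * by (simp add: algebra_simps)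
  moreover have "p + p' \<in> I n" using * gideal_add[OF I] by blast
  moreover have "d \<le> n \<and> q + q' \<in> D (n - d) \<or> q + q' = 0" using * gideal_add[OF D] by auto
  ultimately show "x + y \<in> extend I f d D n" unfolding extend_def by blast
 next
  fix c x assume "x \<in> extend I f d D n"
  then obtain p q where *: "x = p + f * q" "p \<in> I n" "d \<le> n \<and> q \<in> D (n - d) \<or> q = 0"
   unfolding extend_def by blast
  have "c *s x = c *s p + f * (c *s q)" using * by (simp add: scale_right_distrib mult_scale)
  moreover have "c *s p \<in> I n" using * gideal_scale[OF I] by blast
  moreover have "d \<le> n \<and> c *s q \<in> D (n - d) \<or> c *s q = 0" using * gideal_scale[OF D] by auto
  ultimately show "c *s x \<in> extend I f d D n" unfolding extend_def by blast
 qed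
next
 fix n x assume "x \<in> extend I f d D n"
 then obtain p q where *: "x = p + f * q" "p \<in> I n" "d \<le> n \<and> q \<in> D (n - d) \<or> q = 0"
  unfolding extend_def by blast
 have "f * q \<in> G n" using *(3) G_mult[OF f, of q "n - d"] gideal_G[OF D] subspace_0[OF G_sub] by auto
 thus "x \<in> G n" using * gideal_G[OF I] subspace_add[OF G_sub] by blast
 fix i assume i: "i \<le> r"
 have "X i * x = X i * p + f * (X i * q)" using * by (simp add: algebra_simps)
 moreover have "X i * p \<in> I (Suc n)" using gideal_mult[OF I X_in[OF i]] * by fastforce
 moreover have "d \<le> Suc n \<and> X i * q \<in> D (Suc n - d) \<or> X i * q = 0"
  using * gideal_mult[OF D X_in[OF i], of q "n - d"] by (auto simp: Suc_diff_le)
 ultimately show "X i * x \<in> extend I f d D (Suc n)" unfolding extend_def by blast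
qed

lemma extend_ge: "I \<le> extend I f d D"
 unfolding le_fun_def extend_def by force

lemma extend_iff: "gideal D \<Longrightarrow> x \<in> extend I f d D (n + d) \<longleftrightarrow> (\<exists>q\<in>D n. x - f * q \<in> I (n + d))"
 unfolding extend_def using gideal_0[of D n] by (auto simp: algebra_simps) force+

lemma adjoin_gideal: "gideal I \<Longrightarrow> f \<in> G d \<Longrightarrow> gideal (adjoin I f d)"
 using extend_gideal[OF _ _ G_gideal] unfolding adjoin_def extend_def .

lemma adjoin_ge: "I \<le> adjoin I f d"
 unfolding le_fun_def adjoin_def by force

lemma adjoin_mult: "gideal I \<Longrightarrow> q \<in> G n \<Longrightarrow> f * q \<in> adjoin I f d (n + d)"
 unfolding adjoin_def using gideal_0[of I "n + d"] by force

lemma adjoin_mem: "gideal I \<Longrightarrow> f \<in> adjoin I f d d"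
 using adjoin_mult[OF _ G_one, of I f d] by simp

lemma adjoin_least: "gideal J \<Longrightarrow> I \<le> J \<Longrightarrow> f \<in> J d \<Longrightarrow> adjoin I f d \<le> J"
 unfolding le_fun_def adjoin_def
 using gideal_add[of J] gideal_mult'[of J f d] by fastforce

lemma adjoin_D: "x \<in> adjoin I f d (n + d) \<Longrightarrow> \<exists>p q. x = p + f * q \<and> p \<in> I (n + d) \<and> q \<in> G n"
 unfolding adjoin_def using subspace_0[OF G_sub] by auto

lemma adjoin_low: "n < d \<Longrightarrow> adjoin I f d n = I n"
 unfolding adjoin_def by auto

text \<open>The exact sequence 0 -> (G / (I : f))(-d) -> G / I -> G / (I + f G) -> 0 in degree n +
  d.\<close>

lemma hf_split:
 assumes I: "gideal I" and f: "f \<in> G d"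
 shows "hf I (n + d) = hf (adjoin I f d) (n + d) + hf (colon I f d) n"
proof -
 note C = colon_gideal[OF I f] and A = adjoin_gideal[OF I f]
 interpret quotient_iso scale scale "G n" "colon I f d n" "adjoin I f d (n + d)" "I (n + d)" "(*) f"
 proof
  show "subspace (G n)" by (rule G_sub)
  show "subspace (I (n + d))" by (rule gideal_sub[OF I])
  fix x y z c
  show "f * (x + y) = f * x + f * y" by (rule distrib_left)
  show "f * (c *s x) = c *s (f * x)" by (rule mult_scale)
  show "x \<in> G n \<Longrightarrow> f * x \<in> adjoin I f d (n + d)" by (rule adjoin_mult[OF I])
  show "x \<in> G n \<Longrightarrow> f * x \<in> I (n + d) \<longleftrightarrow> x \<in> colon I f d n" by (simp add: colon_def)
  assume "z \<in> adjoin I f d (n + d)"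
  then obtain p q where "z = p + f * q" "p \<in> I (n + d)" "q \<in> G n" using adjoin_D by blast
  thus "\<exists>x\<in>G n. z - f * x \<in> I (n + d)" by (intro bexI[of _ q]) auto
 qed
 show ?thesis
  using hf_add[OF I A _ qdim_forward[OF hf_qdim[OF C]]] adjoin_ge[of I f d] by (simp add: le_fun_def)
qed

subsection \<open>Saturation\<close>

definition sat :: "(nat \<Rightarrow> 'a set) \<Rightarrow> nat \<Rightarrow> 'a set" where
 "sat I n = {p \<in> G n. \<exists>k. \<forall>g\<in>G k. g * p \<in> I (k + n)}"

lemma sat_mono_exponent:
 assumes I: "gideal I" and k: "\<forall>g\<in>G k. g * p \<in> I (k + n)" and le: "k \<le> l"
 shows "\<forall>g\<in>G l. g * p \<in> I (l + n)"
 using le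
proof (induction rule: dec_induct)
 case (step l)
 show ?case
 proof
  fix g assume "g \<in> G (Suc l)"
  then obtain q where q: "\<forall>i\<le>r. q i \<in> G l" "g = (\<Sum>i\<le>r. X i * q i)" using G_gen by blast
  have "g * p = (\<Sum>i\<le>r. X i * (q i * p))" by (simp add: q(2) sum_distrib_right mult.assoc)
  also have "\<dots> \<in> I (Suc l + n)"
  proof (rule subspace_sum[OF gideal_sub[OF I]])
   fix i assume "i \<in> {..r}"
   thus "X i * (q i * p) \<in> I (Suc l + n)" using I step q unfolding gideal_def by simp
  qed
  finally show "g * p \<in> I (Suc l + n)" .
 qed
qed (use k in blast)

lemma sat_gideal:
 assumes I: "gideal I" shows "gideal (sat I)"
proof (rule gidealI)
 fix n
 show "subspace (sat I n)"
 proof (rule subspaceI)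
  show "0 \<in> sat I n" using gideal_0[OF I] subspace_0[OF G_sub] unfolding sat_def by auto
 next
  fix x y assume xy: "x \<in> sat I n" "y \<in> sat I n"
  then obtain k l where k: "\<forall>g\<in>G k. g * x \<in> I (k + n)" and l: "\<forall>g\<in>G l. g * y \<in> I (l + n)"
   unfolding sat_def by blast
  have "\<forall>g\<in>G (max k l). g * (x + y) \<in> I (max k l + n)"
   using sat_mono_exponent[OF I k, of "max k l"] sat_mono_exponent[OF I l, of "max k l"] gideal_add[OF I]
   by (simp add: distrib_left)
  thus "x + y \<in> sat I n" using xy subspace_add[OF G_sub] unfolding sat_def by blast
 next
  fix c x assume "x \<in> sat I n"
  then obtain k where "x \<in> G n" "\<forall>g\<in>G k. g * x \<in> I (k + n)" unfolding sat_def by blast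
  hence "c *s x \<in> G n" "\<forall>g\<in>G k. g * (c *s x) \<in> I (k + n)"
   using subspace_scale[OF G_sub] gideal_scale[OF I] by (auto simp: mult_scale)
  thus "c *s x \<in> sat I n" unfolding sat_def by blast
 qed
next
 fix n p assume p: "p \<in> sat I n"
 thus "p \<in> G n" unfolding sat_def by blast
 fix i assume i: "i \<le> r"
 obtain k where k: "\<forall>g\<in>G k. g * p \<in> I (k + n)" using p unfolding sat_def by blast
 have "g * (X i * p) \<in> I (k + Suc n)" if "g \<in> G k" for g
  using gideal_mult[OF I X_in[OF i], of "g * p" "k + n"] k that by (simp add: mult.left_commute)
 moreover have "X i * p \<in> G (Suc n)" using p G_mult[OF X_in[OF i], of p n] unfolding sat_def by simp
 ultimately show "X i * p \<in> sat I (Suc n)" unfolding sat_def by blast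
qed

lemma sat_ge: "gideal I \<Longrightarrow> I \<le> sat I"
 unfolding le_fun_def sat_def using gideal_mult[of I] gideal_G by blast

lemma sat_mono: "I \<le> J \<Longrightarrow> sat I \<le> sat J"
 unfolding le_fun_def sat_def by blast

definition saturated :: "(nat \<Rightarrow> 'a set) \<Rightarrow> bool" where
 "saturated I \<longleftrightarrow> gideal I \<and> sat I = I"

lemma saturatedD:
 assumes "saturated I" "p \<in> G n" "\<And>g. g \<in> G k \<Longrightarrow> g * p \<in> I (k + n)"
 shows "p \<in> I n"
proof -
 have "p \<in> sat I n" using assms(2,3) unfolding sat_def by blast
 moreover have "sat I n = I n" using assms(1) unfolding saturated_def by simp
 ultimately show ?thesis by blast
qed

subsection \<open>Prime ideals and elements that are almost nonzerodivisors\<close>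

definition gprime :: "(nat \<Rightarrow> 'a set) \<Rightarrow> bool" where
 "gprime P \<longleftrightarrow> gideal P \<and> P \<noteq> G \<and>
   (\<forall>m n. \<forall>p\<in>G m. \<forall>q\<in>G n. p * q \<in> P (m + n) \<longrightarrow> p \<in> P m \<or> q \<in> P n)"

lemma gprime_gideal: "gprime P \<Longrightarrow> gideal P" unfolding gprime_def by blast

lemma gprimeD: "gprime P \<Longrightarrow> p \<in> G m \<Longrightarrow> q \<in> G n \<Longrightarrow> p * q \<in> P (m + n) \<Longrightarrow> p \<in> P m \<or> q \<in> P n"
 unfolding gprime_def by blast

lemma gideal_top: "gideal I \<Longrightarrow> 1 \<in> I 0 \<Longrightarrow> I = G"
 using gideal_mult'[of I 1 0] gideal_subset[of I] by (auto simp: fun_eq_iff)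

text \<open>The case split behind the Noetherian inductions: a proper ideal that is not prime has
  two strictly larger companions I : f and I + f G, and \<open>hf_split\<close> recovers its Hilbert
  function from theirs.\<close>

lemma gideal_cases:
 assumes I: "gideal I" "I \<noteq> G" "\<not> gprime I"
 obtains f d where "f \<in> G d" "gideal (colon I f d)" "gideal (adjoin I f d)"
  "I < colon I f d" "I < adjoin I f d"
proof -
 obtain m n p q where *: "p \<in> G m" "q \<in> G n" "p * q \<in> I (m + n)" "p \<notin> I m" "q \<notin> I n"
  using I unfolding gprime_def by blast
 have "q \<in> colon I p m n" using * unfolding colon_def by (simp add: add.commute)
 hence "I < colon I p m"
  using colon_ge[OF I(1) *(1)] *(5) by (metis order_less_le)
 moreover have "I < adjoin I p m"
  using adjoin_ge[of I p m] adjoin_mem[OF I(1), of p m] *(4) by (metis order_less_le)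
 ultimately show thesis using that * colon_gideal[OF I(1)] adjoin_gideal[OF I(1)] by blast
qed

lemma irrelevant_eq_G:
 assumes I: "gideal I" and G1: "\<And>i. i \<le> r \<Longrightarrow> X i \<in> I 1" and n: "n > 0"
 shows "I n = G n"
proof -
 obtain k where k: "n = Suc k" using n gr0_implies_Suc by blast
 have "p \<in> I n" if p: "p \<in> G n" for p
 proof -
  obtain q where q: "\<forall>i\<le>r. q i \<in> G k" "p = (\<Sum>i\<le>r. X i * q i)" using G_gen[of p k] p k by blast
  have "X i * q i \<in> I n" if "i \<le> r" for i using gideal_mult'[OF I G1[OF that], of "q i" k] q that k by simp
  thus ?thesis using q(2) by (auto intro!: subspace_sum[OF gideal_sub[OF I]])
 qed
 thus ?thesis using gideal_subset[OF I] by blast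
qed

definition relevant :: "(nat \<Rightarrow> 'a set) \<Rightarrow> bool" where
 "relevant P \<longleftrightarrow> gprime P \<and> \<not> G 1 \<subseteq> P 1"

lemma relevant_X: "relevant P \<Longrightarrow> \<exists>i\<le>r. X i \<notin> P 1"
 using irrelevant_eq_G[of P 1] unfolding relevant_def gprime_def by auto

text \<open>Multiplication by f is injective on G / I in large degrees. The irrelevant ideal as an
  associated prime is thereby ignored, as it leaves no trace on the scheme.\<close>

definition almost_nzd :: "(nat \<Rightarrow> 'a set) \<Rightarrow> 'a \<Rightarrow> nat \<Rightarrow> bool" where
 "almost_nzd I f d \<longleftrightarrow> (\<exists>N. \<forall>n\<ge>N. \<forall>p\<in>G n. f * p \<in> I (n + d) \<longrightarrow> p \<in> I n)"

text \<open>A finite set of primes in the role of the associated ones. It is gathered along a prime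
  filtration, for a nonprime ideal as the union of the sets for I : g and I + g G, and may contain
  further primes.\<close>

lemma almost_nzd_primes:
 assumes "gideal I"
 shows "\<exists>PS. finite PS \<and> (\<forall>P\<in>PS. relevant P) \<and> (\<forall>f d. f \<in> G d \<longrightarrow> (\<forall>P\<in>PS. f \<notin> P d) \<longrightarrow> almost_nzd I f d)"
 using assms
proof (induction I rule: noeth_induct)
 case (step I)
 consider "I = G" | "gprime I" "relevant I" | "gprime I" "\<not> relevant I" | "I \<noteq> G" "\<not> gprime I" by blast
 thus ?case
 proof cases
  case 1 thus ?thesis by (intro exI[of _ "{}"]) (auto simp: almost_nzd_def)
 next
  case 2
  have "almost_nzd I f d" if "f \<in> G d" "f \<notin> I d" for f d
   unfolding almost_nzd_def using gprimeD[OF 2(1) that(1)] that(2) by (metis add.commute)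
  thus ?thesis using 2 by (intro exI[of _ "{I}"]) auto
 next
  case 3
  hence "I n = G n" if "n > 0" for n
   using irrelevant_eq_G[OF step(1) _ that] X_in unfolding relevant_def by blast
  hence "almost_nzd I f d" for f d unfolding almost_nzd_def by (intro exI[of _ 1]) auto
  thus ?thesis by (intro exI[of _ "{}"]) auto
 next
  case 4
  obtain g e where g: "g \<in> G e" "gideal (colon I g e)" "gideal (adjoin I g e)"
   "I < colon I g e" "I < adjoin I g e" using gideal_cases[OF step(1) 4] by blast
  obtain PS1 where PS1: "finite PS1" "\<forall>P\<in>PS1. relevant P"
   "\<And>f d. f \<in> G d \<Longrightarrow> (\<forall>P\<in>PS1. f \<notin> P d) \<Longrightarrow> almost_nzd (adjoin I g e) f d"
   using step(2)[OF g(3,5)] by blast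
  obtain PS2 where PS2: "finite PS2" "\<forall>P\<in>PS2. relevant P"
   "\<And>f d. f \<in> G d \<Longrightarrow> (\<forall>P\<in>PS2. f \<notin> P d) \<Longrightarrow> almost_nzd (colon I g e) f d"
   using step(2)[OF g(2,4)] by blast
  have "almost_nzd I f d" if f: "f \<in> G d" "\<forall>P\<in>PS1 \<union> PS2. f \<notin> P d" for f d
  proof -
   obtain N1 where N1: "\<And>n p. n \<ge> N1 \<Longrightarrow> p \<in> G n \<Longrightarrow> f * p \<in> adjoin I g e (n + d) \<Longrightarrow> p \<in> adjoin I g e n"
    using PS1(3)[OF f(1)] f(2) unfolding almost_nzd_def by blast
   obtain N2 where N2: "\<And>n p. n \<ge> N2 \<Longrightarrow> p \<in> G n \<Longrightarrow> f * p \<in> colon I g e (n + d) \<Longrightarrow> p \<in> colon I g e n"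
    using PS2(3)[OF f(1)] f(2) unfolding almost_nzd_def by blast
   have "p \<in> I n" if n: "n \<ge> N1 + N2 + e" and p: "p \<in> G n" "f * p \<in> I (n + d)" for n p
   proof -
    define k where "k = n - e"
    have k: "n = k + e" "k \<ge> N2" using n unfolding k_def by auto
    \<comment> \<open>The form f is cancelled first modulo I + g G, and then, for the quotient q in
      p = i + g q, modulo I : g.\<close>
    have "p \<in> adjoin I g e n" using N1[of n p] n p adjoin_ge[of I g e] by (auto simp: le_fun_def)
    then obtain i q where iq: "p = i + g * q" "i \<in> I n" "q \<in> G k" using adjoin_D k by blast
    have "f * i \<in> I (n + d)" using gideal_mult[OF step(1) f(1) iq(2)] by (simp add: add.commute)
    hence "g * (f * q) \<in> I (n + d)"
     using gideal_diff[OF step(1) p(2), of "f * i"] iq by (simp add: algebra_simps)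
    moreover have "f * q \<in> G (k + d)" using G_mult[OF f(1) iq(3)] by (simp add: add.commute)
    ultimately have "f * q \<in> colon I g e (k + d)" unfolding colon_def k by (simp add: algebra_simps)
    hence "q \<in> colon I g e k" using N2 k iq by blast
    thus ?thesis using iq gideal_add[OF step(1)] unfolding colon_def k by blast
   qed
   thus ?thesis unfolding almost_nzd_def by blast
  qed
  thus ?thesis using PS1 PS2 by (intro exI[of _ "PS1 \<union> PS2"]) auto
 qed
qed

text \<open>If the form L found so far lies in P, move along the line L + c M with M outside P. Each
  earlier prime forbids at most one c, since two values would put M and then L into it.\<close>

lemma linear_avoid:
 assumes "finite PS" "\<forall>P\<in>PS. relevant P"
 shows "\<exists>L\<in>G 1. \<forall>P\<in>PS. L \<notin> P 1"
 using assms
proof (induction PS rule: finite_induct)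
 case empty thus ?case using subspace_0[OF G_sub] by auto
next
 case (insert P PS)
 then obtain L where L: "L \<in> G 1" "\<forall>P\<in>PS. L \<notin> P 1" by auto
 show ?case
 proof (cases "L \<in> P 1")
  case True
  obtain M where M: "M \<in> G 1" "M \<notin> P 1" using insert(4) unfolding relevant_def by blast
  have gi: "gideal Q" if "Q \<in> insert P PS" for Q using insert(4) that unfolding relevant_def gprime_def by blast
  have uniq: "c = c'" if "Q \<in> PS" "L + c *s M \<in> Q 1" "L + c' *s M \<in> Q 1" for Q c c'
  proof (rule ccontr)
   assume "c \<noteq> c'"
   have "(L + c *s M) - (L + c' *s M) \<in> Q 1" using gideal_diff[OF gi] that by blast
   hence "(1 / (c - c')) *s ((c - c') *s M) \<in> Q 1"
    using gideal_scale[OF gi, of Q] that(1) by (simp add: scale_left_diff_distrib)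
   hence "M \<in> Q 1" using \<open>c \<noteq> c'\<close> by simp
   hence "(L + c *s M) - c *s M \<in> Q 1" using gideal_diff[OF gi] gideal_scale[OF gi] that by blast
   thus False using L that by simp
  qed
  have "finite {c. L + c *s M \<in> Q 1}" if "Q \<in> PS" for Q
  proof (cases "\<exists>c. L + c *s M \<in> Q 1")
   case True
   then obtain c where "L + c *s M \<in> Q 1" by blast
   hence "{c. L + c *s M \<in> Q 1} \<subseteq> {c}" using uniq[OF that] by blast
   thus ?thesis using finite_subset by blast
  qed auto
  hence "finite (insert 0 (\<Union>Q\<in>PS. {c. L + c *s M \<in> Q 1}))" using insert(1) by auto
  then obtain c where c: "c \<notin> insert 0 (\<Union>Q\<in>PS. {c. L + c *s M \<in> Q 1})"
   using ex_new_if_finite[OF inf] by blast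
  have "L + c *s M \<notin> P 1"
  proof
   assume "L + c *s M \<in> P 1"
   hence "(L + c *s M) - L \<in> P 1" using gideal_diff[OF gi] True by blast
   hence "(1 / c) *s (c *s M) \<in> P 1" using gideal_scale[OF gi, of P] by (simp del: One_nat_def scale_scale)
   thus False using c M by (simp del: One_nat_def)
  qed
  moreover have "L + c *s M \<in> G 1" using L M subspace_add[OF G_sub] subspace_scale[OF G_sub] by blast
  ultimately show ?thesis using c by blast
 qed (use L in blast)
qed

lemma linear_nzd_exists:
 assumes "finite II" "\<forall>I\<in>II. gideal I"
 shows "\<exists>L\<in>G 1. \<forall>I\<in>II. almost_nzd I L 1"
proof -
 have "\<forall>I\<in>II. \<exists>PS. finite PS \<and> (\<forall>P\<in>PS. relevant P) \<and>
  (\<forall>f d. f \<in> G d \<longrightarrow> (\<forall>P\<in>PS. f \<notin> P d) \<longrightarrow> almost_nzd I f d)" using almost_nzd_primes assms(2) by blast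
 then obtain PS where PS: "\<And>I. I \<in> II \<Longrightarrow> finite (PS I) \<and> (\<forall>P\<in>PS I. relevant P) \<and>
  (\<forall>f d. f \<in> G d \<longrightarrow> (\<forall>P\<in>PS I. f \<notin> P d) \<longrightarrow> almost_nzd I f d)" by metis
 have "\<exists>L\<in>G 1. \<forall>P\<in>(\<Union>I\<in>II. PS I). L \<notin> P 1" using PS assms(1) by (intro linear_avoid) auto
 then obtain L where L: "L \<in> G 1" "\<And>I P. I \<in> II \<Longrightarrow> P \<in> PS I \<Longrightarrow> L \<notin> P 1" by blast
 have "almost_nzd I L 1" if I: "I \<in> II" for I
 proof -
  have "\<forall>P\<in>PS I. L \<notin> P 1" using L(2)[OF I] by blast
  moreover have "L \<in> G 1 \<longrightarrow> (\<forall>P\<in>PS I. L \<notin> P 1) \<longrightarrow> almost_nzd I L 1" using PS[OF I] by presburger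
  ultimately show ?thesis using L(1) by presburger
 qed
 thus ?thesis using L(1) by blast
qed

text \<open>Saturation lifts cancellation from large degrees to all degrees: multiply by the forms
  of degree N, cancel f there, and remove the forms again by saturation.\<close>

lemma saturated_nzd:
 assumes I: "saturated I" and f: "f \<in> G d" "almost_nzd I f d" and p: "p \<in> G n" "f * p \<in> I (n + d)"
 shows "p \<in> I n"
proof -
 obtain N where N: "\<And>n p. n \<ge> N \<Longrightarrow> p \<in> G n \<Longrightarrow> f * p \<in> I (n + d) \<Longrightarrow> p \<in> I n"
  using f(2) unfolding almost_nzd_def by blast
 have gI: "gideal I" using I unfolding saturated_def by blast
 show ?thesis
 proof (rule saturatedD[OF I p(1), of N])
  fix g assume g: "g \<in> G N"
  have "g * (f * p) \<in> I (N + (n + d))" using gideal_mult[OF gI g p(2)] .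
  hence "f * (g * p) \<in> I ((N + n) + d)" by (simp add: algebra_simps)
  thus "g * p \<in> I (N + n)" using N[of "N + n" "g * p"] G_mult[OF g p(1)] by simp
 qed
qed

lemma G_power: "f \<in> G d \<Longrightarrow> f ^ k \<in> G (k * d)"
 by (induction k) (use G_one G_mult in auto)

lemma G_power1: "f \<in> G 1 \<Longrightarrow> f ^ k \<in> G k"
 using G_power[of f 1 k] by simp

text \<open>Powers of a linear form that is almost a nonzerodivisor already detect membership in the
  saturation, and in large degrees they can be cancelled one factor at a time.\<close>

lemma sat_eventually:
 assumes I: "gideal I" shows "\<exists>N. \<forall>n\<ge>N. sat I n = I n"
proof -
 obtain L where L: "L \<in> G 1" "almost_nzd I L 1" using linear_nzd_exists[of "{I}"] I by auto
 then obtain N where N: "\<And>n p. n \<ge> N \<Longrightarrow> p \<in> G n \<Longrightarrow> L * p \<in> I (n + 1) \<Longrightarrow> p \<in> I n"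
  unfolding almost_nzd_def by blast
 have *: "p \<in> I n" if "n \<ge> N" "p \<in> G n" "L ^ k * p \<in> I (k + n)" for n p k
  using that
 proof (induction k arbitrary: n p)
  case (Suc k)
  have "L * p \<in> I (Suc n)"
   using Suc.IH[of "Suc n" "L * p"] Suc.prems G_mult[OF L(1) Suc.prems(2)] by (simp add: algebra_simps)
  thus ?case using N Suc.prems by simp
 qed simp
 have "sat I n \<subseteq> I n" if n: "n \<ge> N" for n
 proof
  fix p assume "p \<in> sat I n"
  then obtain k where k: "p \<in> G n" "\<forall>g\<in>G k. g * p \<in> I (k + n)" unfolding sat_def by blast
  have "L ^ k \<in> G k" using G_power[OF L(1), of k] by simp
  thus "p \<in> I n" using *[OF n k(1), of k] k(2) by blast
 qed
 thus ?thesis using sat_ge[OF I] unfolding le_fun_def by blast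
qed

lemma sat_sat: assumes I: "gideal I" shows "saturated (sat I)"
proof -
 have "sat (sat I) n \<subseteq> sat I n" for n
 proof
  fix p assume "p \<in> sat (sat I) n"
  then obtain k where k: "p \<in> G n" "\<forall>g\<in>G k. g * p \<in> sat I (k + n)" unfolding sat_def by blast
  obtain N where N: "\<forall>n\<ge>N. sat I n = I n" using sat_eventually[OF I] by blast
  have "\<forall>g\<in>G (k + N). g * p \<in> sat I (k + N + n)"
   by (rule sat_mono_exponent[OF sat_gideal[OF I] k(2)]) simp
  thus "p \<in> sat I n" using N k(1) unfolding sat_def[of I n] by auto
 qed
 thus ?thesis using sat_ge[OF sat_gideal[OF I]] sat_gideal[OF I]
  unfolding saturated_def by (auto simp: le_fun_def fun_eq_iff)
qed

lemma relevant_saturated: assumes P: "relevant P" shows "saturated P"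
proof -
 have g: "gprime P" "gideal P" using P unfolding relevant_def gprime_def by auto
 obtain i where i: "i \<le> r" "X i \<notin> P 1" using relevant_X[OF P] by blast
 have pw: "X i ^ k \<notin> P k" for k
 proof (induction k)
  case 0 thus ?case using gideal_top[OF g(2)] g(1) unfolding gprime_def by auto
 next
  case (Suc k)
  have "X i ^ k \<in> G k" using G_power[OF X_in[OF i(1)], of k] by simp
  thus ?case using gprimeD[OF g(1) X_in[OF i(1)], of "X i ^ k" k] Suc i(2) by auto
 qed
 have "sat P n \<subseteq> P n" for n
 proof
  fix p assume "p \<in> sat P n"
  then obtain k where k: "p \<in> G n" "\<forall>g\<in>G k. g * p \<in> P (k + n)" unfolding sat_def by blast
  have "X i ^ k \<in> G k" using G_power[OF X_in[OF i(1)], of k] by simp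
  thus "p \<in> P n" using gprimeD[OF g(1), of "X i ^ k" k p n] k pw by blast
 qed
 thus ?thesis using sat_ge[OF g(2)] g(2) unfolding saturated_def by (auto simp: le_fun_def fun_eq_iff)
qed

end

section \<open>Hilbert polynomials\<close>

definition pdiff :: "real poly \<Rightarrow> real \<Rightarrow> real poly" where
 "pdiff P c = P - pcompose P [:- c, 1:]"

lemma poly_pdiff: "poly (pdiff P c) x = poly P x - poly P (x - c)"
 by (simp add: pdiff_def poly_pcompose)

lemma pdiff_const: "degree P = 0 \<Longrightarrow> pdiff P c = 0"
 by (auto simp: pdiff_def pcompose_const elim: degree_eq_zeroE)

lemma pdiff_degree:
 "degree P \<le> Suc k \<Longrightarrow> degree (pdiff P c) \<le> k \<and> coeff (pdiff P c) k = real (Suc k) * c * coeff P (Suc k)"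
proof (induction k arbitrary: P)
 case 0
 obtain a b where "P = [:a, b:]"
 proof -
  have "P = [:coeff P 0, coeff P 1:]"
   using 0 by (intro poly_eqI) (auto simp: coeff_pCons coeff_eq_0 split: nat.splits)
  thus thesis using that by blast
 qed
 thus ?case by (simp add: pdiff_def pcompose_pCons)
next
 case (Suc k)
 obtain a Q where P: "P = pCons a Q" by (cases P)
 have Q: "degree Q \<le> Suc k" using Suc.prems unfolding P by (cases "Q = 0") auto
 note IH = Suc.IH[OF Q]
 have e: "pdiff P c = pCons 0 (pdiff Q c) + smult c (Q - pdiff Q c)"
  by (simp add: pdiff_def P pcompose_pCons algebra_simps)
 have d1: "degree (pCons 0 (pdiff Q c)) \<le> Suc k" using IH degree_pCons_le[of 0 "pdiff Q c"] by linarith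
 have d2: "degree (smult c (Q - pdiff Q c)) \<le> Suc k"
  using IH Q by (intro order.trans[OF degree_smult_le] degree_diff_le) auto
 have "coeff (pdiff Q c) (Suc k) = 0" using IH by (intro coeff_eq_0) simp
 hence "coeff (pdiff P c) (Suc k) = coeff (pdiff Q c) k + c * coeff Q (Suc k)"
  unfolding e by simp
 also have "\<dots> = real (Suc (Suc k)) * c * coeff P (Suc (Suc k))" using IH by (simp add: P algebra_simps)
 finally show ?case using d1 d2 unfolding e by (auto intro: degree_add_le)
qed

lemma pdiff_add: "pdiff (P + Q) c = pdiff P c + pdiff Q c"
 by (simp add: pdiff_def pcompose_add)

lemma antidifference: "\<exists>P. pdiff P 1 = Q"
proof -
 have "degree Q \<le> k \<Longrightarrow> \<exists>P. pdiff P 1 = Q" for k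
 proof (induction k arbitrary: Q)
  case 0
  then obtain a where "Q = [:a:]" using degree_eq_zeroE by blast
  thus ?case by (intro exI[of _ "[:0, a:]"]) (simp add: pdiff_def pcompose_pCons)
 next
  case (Suc k)
  let ?P = "monom (coeff Q (Suc k) / real (Suc (Suc k))) (Suc (Suc k))"
  have d: "degree (pdiff ?P 1) \<le> Suc k" "coeff (pdiff ?P 1) (Suc k) = coeff Q (Suc k)"
   using pdiff_degree[of ?P "Suc k" 1] degree_monom_le[of _ "Suc (Suc k)"] by auto
  have "degree (Q - pdiff ?P 1) \<le> k"
  proof (rule degree_le, intro allI impI)
   fix i assume i: "k < i"
   show "coeff (Q - pdiff ?P 1) i = 0"
   proof (cases "i = Suc k")
    case False
    hence "Suc k < i" using i by simp
    thus ?thesis using d(1) Suc.prems by (simp add: coeff_eq_0)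
   qed (use d in simp)
  qed
  then obtain P' where "pdiff P' 1 = Q - pdiff ?P 1" using Suc.IH by blast
  hence "pdiff (P' + ?P) 1 = Q" unfolding pdiff_add by simp
  thus ?case by blast
 qed
 thus ?thesis by blast
qed

lemma poly_eq_eventually:
 fixes P Q :: "real poly"
 assumes "\<forall>\<^sub>F n in sequentially. poly P (real n) = poly Q (real n)"
 shows "P = Q"
proof (rule ccontr)
 assume "P \<noteq> Q"
 hence fin: "finite {x. poly (P - Q) x = 0}" by (intro poly_roots_finite) simp
 obtain N where "\<forall>n\<ge>N. poly P (real n) = poly Q (real n)" using assms eventually_sequentially by auto
 hence "real ` {N..} \<subseteq> {x. poly (P - Q) x = 0}" by auto
 hence "finite (real ` {N..})" using fin finite_subset by blast
 thus False using finite_imageD[of real "{N..}"] infinite_Ici by (auto simp: inj_on_def)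
qed

lemma eventually_shift: "eventually P sequentially \<Longrightarrow> \<forall>\<^sub>F n in sequentially. P (n + k)"
 by (simp add: eventually_sequentially_seg)

lemma eventually_unshift: "(\<forall>\<^sub>F n in sequentially. P (n + k)) \<Longrightarrow> eventually P sequentially"
 by (simp add: eventually_sequentially_seg)

context graded_alg begin

definition hpoly :: "(nat \<Rightarrow> 'a set) \<Rightarrow> real poly \<Rightarrow> bool" where
 "hpoly I P \<longleftrightarrow> (\<forall>\<^sub>F n in sequentially. real (hf I n) = poly P (real n))"

lemma hpoly_unique: "hpoly I P \<Longrightarrow> hpoly I Q \<Longrightarrow> P = Q"
 unfolding hpoly_def by (rule poly_eq_eventually) (erule (1) eventually_elim2, simp)

lemma hpoly_cong: "\<forall>\<^sub>F n in sequentially. hf I n = hf J n \<Longrightarrow> hpoly I P \<Longrightarrow> hpoly J P"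
 unfolding hpoly_def by (erule (1) eventually_elim2) simp

lemma hpoly_split:
 assumes I: "gideal I" and f: "f \<in> G d" and A: "hpoly (adjoin I f d) A" and B: "hpoly (colon I f d) B"
 shows "hpoly I (A + pcompose B [:- real d, 1:])"
proof -
 have "\<forall>\<^sub>F n in sequentially. real (hf I (n + d)) = poly (A + pcompose B [:- real d, 1:]) (real (n + d))"
  using eventually_shift[OF A[unfolded hpoly_def], of d] B[unfolded hpoly_def]
  by eventually_elim (simp add: hf_split[OF I f] poly_pcompose)
 thus ?thesis unfolding hpoly_def
  using eventually_unshift[of "\<lambda>n. real (hf I n) = poly (A + pcompose B [:- real d, 1:]) (real n)" d] by blast
qed

lemma almost_nzd_colon:
 assumes "gideal I" "f \<in> G d" "almost_nzd I f d"
 shows "\<forall>\<^sub>F n in sequentially. colon I f d n = I n"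
proof -
 obtain N where N: "\<And>n p. n \<ge> N \<Longrightarrow> p \<in> G n \<Longrightarrow> f * p \<in> I (n + d) \<Longrightarrow> p \<in> I n"
  using assms(3) unfolding almost_nzd_def by blast
 have "colon I f d n = I n" if "n \<ge> N" for n
  using N[OF that] colon_ge[OF assms(1,2)] by (auto simp: colon_def le_fun_def)
 thus ?thesis using eventually_sequentially by auto
qed

lemma hf_cong: "I n = J n \<Longrightarrow> hf I n = hf J n"
 by (simp add: hf_def)

lemma hf_nzd:
 assumes "gideal I" "f \<in> G d" "almost_nzd I f d"
 shows "\<forall>\<^sub>F n in sequentially. hf I (n + d) = hf (adjoin I f d) (n + d) + hf I n"
 using almost_nzd_colon[OF assms]
 by eventually_elim (use hf_split[OF assms(1,2)] hf_cong[of "colon I f d" _ I] in simp)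

lemma hpoly_nzd:
 assumes I: "gideal I" "f \<in> G d" "almost_nzd I f d" and P: "hpoly I P"
 shows "hpoly (adjoin I f d) (pdiff P (real d))"
proof -
 have "\<forall>\<^sub>F n in sequentially. real (hf (adjoin I f d) (n + d)) = poly (pdiff P (real d)) (real (n + d))"
  using eventually_shift[OF P[unfolded hpoly_def], of d] P[unfolded hpoly_def] hf_nzd[OF I]
  by eventually_elim (simp add: poly_pdiff)
 thus ?thesis unfolding hpoly_def
  using eventually_unshift[of "\<lambda>n. real (hf (adjoin I f d) n) = poly (pdiff P (real d)) (real n)" d] by blast
qed

lemma hf_sat: assumes "gideal I" shows "\<forall>\<^sub>F n in sequentially. hf (sat I) n = hf I n"
 using sat_eventually[OF assms] hf_cong unfolding eventually_sequentially by metis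

lemma hpoly_sat: assumes "gideal I" "hpoly I P" shows "hpoly (sat I) P"
 by (rule hpoly_cong[OF _ assms(2)]) (use hf_sat[OF assms(1)] in eventually_elim, simp)

lemma gprime_nzd: "gprime I \<Longrightarrow> f \<in> G d \<Longrightarrow> f \<notin> I d \<Longrightarrow> almost_nzd I f d"
 unfolding almost_nzd_def using gprimeD[of I f d] by (metis add.commute)

text \<open>For a relevant prime I some variable X i is a nonzerodivisor, and the Hilbert polynomial
  of the larger ideal I + X i G is the difference of the one sought; \<open>antidifference\<close>
  sums it. Irrelevant primes contribute zero, and the other proper ideals split by
  \<open>hpoly_split\<close>.\<close>

lemma hpoly_exists: assumes "gideal I" shows "\<exists>P. hpoly I P"
 using assms
proof (induction I rule: noeth_induct)
 case (step I)
 consider "I = G" | "gprime I" "relevant I" | "gprime I" "\<not> relevant I" | "I \<noteq> G" "\<not> gprime I" by blast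
 thus ?case
 proof cases
  case 1 thus ?thesis by (intro exI[of _ 0]) (simp add: hpoly_def hf_G)
 next
  case 2
  then obtain i where i: "i \<le> r" "X i \<notin> I 1" using relevant_X by blast
  note Xi = X_in[OF i(1)]
  have "I < adjoin I (X i) 1"
   using adjoin_ge[of I "X i" 1] adjoin_mem[OF step(1), of "X i" 1] i by (metis order_less_le)
  then obtain Q where Q: "hpoly (adjoin I (X i) 1) Q" using step(2) adjoin_gideal[OF step(1) Xi] by blast
  obtain P where P: "pdiff P 1 = Q" using antidifference by blast
  have "\<forall>\<^sub>F n in sequentially. real (hf I (n + 1)) - real (hf I n) = poly P (real (n + 1)) - poly P (real n)"
   using eventually_shift[OF Q[unfolded hpoly_def], of 1] hf_nzd[OF step(1) Xi gprime_nzd[OF 2(1) Xi i(2)]]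
   by eventually_elim (simp add: P[symmetric] poly_pdiff)
  then obtain N where N: "\<And>n. n \<ge> N \<Longrightarrow> real (hf I (n + 1)) - real (hf I n) = poly P (real (n + 1)) - poly P (real n)"
   unfolding eventually_sequentially by blast
  have "real (hf I n) = poly (P + [:real (hf I N) - poly P (real N):]) (real n)" if "n \<ge> N" for n
   using that
  proof (induction rule: dec_induct)
   case (step n) thus ?case using N[of n] by (simp add: algebra_simps)
  qed simp
  thus ?thesis unfolding hpoly_def eventually_sequentially by blast
 next
  case 3
  hence "I n = G n" if "n > 0" for n
   using irrelevant_eq_G[OF step(1) _ that] X_in unfolding relevant_def by blast
  hence "hf I n = 0" if "n \<ge> 1" for n using hf_0_iff[OF step(1)] that by simp
  hence "hpoly I 0" unfolding hpoly_def eventually_sequentially by auto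
  thus ?thesis by blast
 next
  case 4
  obtain f d where f: "f \<in> G d" "gideal (colon I f d)" "gideal (adjoin I f d)"
   "I < colon I f d" "I < adjoin I f d" using gideal_cases[OF step(1) 4] by blast
  thus ?thesis using step(2)[OF f(2,4)] step(2)[OF f(3,5)] hpoly_split[OF step(1) f(1)] by blast
 qed
qed

section \<open>Hilbert functions of curves and their hyperplane sections\<close>

lemma gideal_top_above:
 assumes J: "gideal J" and n: "J n = G n" and m: "n \<le> m"
 shows "J m = G m"
 using m
proof (induction rule: dec_induct)
 case (step m)
 have "p \<in> J (Suc m)" if p: "p \<in> G (Suc m)" for p
 proof -
  obtain q where q: "\<forall>i\<le>r. q i \<in> G m" "p = (\<Sum>i\<le>r. X i * q i)" using G_gen[OF p] by blast
  have "X i * q i \<in> J (Suc m)" if "i \<le> r" for i using gideal_mult[OF J X_in[OF that], of "q i" m] q that step by simp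
  thus ?thesis using q(2) by (auto intro!: subspace_sum[OF gideal_sub[OF J]])
 qed
 thus ?case using gideal_subset[OF J] by blast
qed (rule n)

lemma hf_mono: "gideal I \<Longrightarrow> gideal J \<Longrightarrow> I \<le> J \<Longrightarrow> hf J n \<le> hf I n"
 using hf_between(1)[of I J n] by (simp add: le_fun_def)

lemma saturated_gideal: "saturated I \<Longrightarrow> gideal I"
 unfolding saturated_def by blast

lemma saturated_colon:
 assumes "saturated I" "f \<in> G d" "almost_nzd I f d"
 shows "colon I f d = I"
 using saturated_nzd[OF assms] colon_ge[OF saturated_gideal[OF assms(1)] assms(2)]
 by (auto simp: colon_def fun_eq_iff le_fun_def)

text \<open>With a linear nonzerodivisor L, the increments of the Hilbert function are the values
  for the section Z + L G. Once such a value vanishes, the section ideal fills all later degrees and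
  the function has reached its final value e; before that, each step gains at least one.\<close>

lemma finite_scheme_hf:
 assumes Z: "saturated Z" and e: "\<forall>\<^sub>F n in sequentially. hf Z n = e"
 shows "hf Z n \<le> e" and "m \<le> n \<Longrightarrow> min e (hf Z m + (n - m)) \<le> hf Z n"
proof -
 note gZ = saturated_gideal[OF Z]
 obtain L where L: "L \<in> G 1" "almost_nzd Z L 1" using linear_nzd_exists[of "{Z}"] gZ by auto
 let ?A = "adjoin Z L 1"
 have inc: "hf Z (Suc n) = hf ?A (Suc n) + hf Z n" for n
  using hf_split[OF gZ L(1), of n] saturated_colon[OF Z L] by simp
 have mono: "hf Z m \<le> hf Z n" if "m \<le> n" for m n using that by (induction rule: dec_induct) (use inc in auto)
 obtain N where N: "\<And>n. n \<ge> N \<Longrightarrow> hf Z n = e" using e eventually_sequentially by auto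
 show le: "hf Z n \<le> e" for n using mono[of n "max n N"] N[of "max n N"] by simp
 have stop: "hf Z n = e" if z: "hf ?A (Suc n) = 0" for n
 proof -
  have "hf ?A m = 0" if m: "Suc n \<le> m" for m
   using gideal_top_above[OF adjoin_gideal[OF gZ L(1)] _ m] z hf_0_iff[OF adjoin_gideal[OF gZ L(1)]] by blast
  hence step: "hf Z (Suc m) = hf Z m" if "m \<ge> n" for m using inc[of m] that by simp
  have const: "hf Z m = hf Z n" if "m \<ge> n" for m using that by (induction rule: dec_induct) (use step in auto)
  show ?thesis using const[of "max n N"] N[of "max n N"] by simp
 qed
 show "min e (hf Z m + (n - m)) \<le> hf Z n" if "m \<le> n" for m n
  using that
 proof (induction rule: dec_induct)
  case (step n)
  show ?case
  proof (cases "hf ?A (Suc n) = 0")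
   case True thus ?thesis using stop inc[of n] by simp
  next
   case False
   have "Suc n - m = Suc (n - m)" using step(1) by (simp add: Suc_diff_le)
   hence "min e (hf Z m + (Suc n - m)) \<le> Suc (min e (hf Z m + (n - m)))" by (simp add: min_def)
   also have "\<dots> \<le> hf Z (Suc n)" using step inc[of n] False by linarith
   finally show ?thesis .
  qed
 qed simp
qed

lemma gprime_colon:
 assumes P: "gprime P" and f: "f \<in> G d" "f \<notin> P d"
 shows "colon P f d = P"
proof
 fix n
 have "p \<in> P n" if "p \<in> colon P f d n" for p
 proof -
  have p: "p \<in> G n" "f * p \<in> P (d + n)" using that unfolding colon_def by (simp_all add: add.commute)
  show ?thesis using gprimeD[OF P f(1) p] f(2) by blast
 qed
 thus "colon P f d n = P n" using colon_ge[OF gprime_gideal[OF P] f(1)] by (auto simp: le_fun_def)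
qed

text \<open>A form that vanishes on \<open>Z\<close> but not on the integral curve \<open>\<Gamma>\<close> cuts \<open>\<Gamma>\<close> in a finite scheme
 of degree \<open>s n\<close> containing \<open>Z\<close>.\<close>

lemma finite_on_integral_curve:
 assumes \<Gamma>: "gprime \<Gamma>" "\<forall>\<^sub>F n in sequentially. int (hf \<Gamma> n) = int s * int n + c"
  and Z: "gideal Z" "\<Gamma> \<le> Z" and e: "\<forall>\<^sub>F n in sequentially. hf Z n = e" and n: "s * n < e"
 shows "Z n = \<Gamma> n"
proof (rule ccontr)
 assume "Z n \<noteq> \<Gamma> n"
 then obtain f where f: "f \<in> Z n" "f \<notin> \<Gamma> n" using Z(2) by (auto simp: le_fun_def)
 have fG: "f \<in> G n" using gideal_G[OF Z(1) f(1)] .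
 note g\<Gamma> = gprime_gideal[OF \<Gamma>(1)]
 have le: "adjoin \<Gamma> f n \<le> Z" by (rule adjoin_least[OF Z f(1)])
 have "hf \<Gamma> (k + n) = hf (adjoin \<Gamma> f n) (k + n) + hf \<Gamma> k" for k
  using hf_split[OF g\<Gamma> fG, of k] gprime_colon[OF \<Gamma>(1) fG f(2)] by simp
 hence "hf \<Gamma> (k + n) \<ge> hf Z (k + n) + hf \<Gamma> k" for k
  using hf_mono[OF adjoin_gideal[OF g\<Gamma> fG] Z(1) le, of "k + n"] by simp
 hence *: "int (hf \<Gamma> (k + n)) \<ge> int (hf Z (k + n)) + int (hf \<Gamma> k)" for k
  by (metis of_nat_add of_nat_mono)
 have "\<forall>\<^sub>F k in sequentially. e \<le> s * n"
  using \<Gamma>(2) eventually_shift[OF \<Gamma>(2), of n] eventually_shift[OF e, of n]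
 proof eventually_elim
  case (elim k)
  hence "int e \<le> int s * int n" using *[of k] by (simp add: algebra_simps)
  thus ?case by (metis of_nat_le_iff of_nat_mult)
 qed
 thus False using n by (auto simp: eventually_sequentially)
qed

lemma gprime_power: "gprime P \<Longrightarrow> f \<in> G 1 \<Longrightarrow> f \<notin> P 1 \<Longrightarrow> f ^ k \<notin> P k"
proof (induction k)
 case 0
 thus ?case using gideal_top[of P] unfolding gprime_def by auto
next
 case (Suc k)
 have "f ^ k \<in> G k" using G_power[OF Suc(3), of k] by simp
 thus ?case using gprimeD[of P f 1 "f ^ k" k] Suc by auto
qed

end

section \<open>Castelnuovo's count for an integral curve and a finite subscheme\<close>

lemma sum_le_of_vanishing:
 fixes f :: "nat \<Rightarrow> int" and g K :: nat
 assumes "\<And>n. f n \<le> int g" "\<And>n. n \<ge> K \<Longrightarrow> f n \<le> 0"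
 shows "(\<Sum>n=1..m. f n) \<le> int K * int g"
proof -
 have "(\<Sum>n=1..m. f n) \<le> int (min m K) * int g"
 proof (induction m)
  case (Suc m)
  thus ?case using assms(1)[of "Suc m"] assms(2)[of "Suc m"]
   by (cases "Suc m \<le> K"; cases "Suc m = K") (auto simp: algebra_simps)
 qed simp
 also have "\<dots> \<le> int K * int g" by (intro mult_right_mono) auto
 finally show ?thesis .
qed

text \<open>With n < s and t = s - n - 1 the slack is t (t - 1); for n >= s - 1 both sides are
  equal.\<close>

lemma sum_min_lower: "2 * int s * int n + 3 * int s \<le> 2 * (\<Sum>k\<le>n. int (min s (k + 1))) + int s * int s"
proof -
 have low: "2 * (\<Sum>k\<le>n. int (min s (k + 1))) = (int n + 1) * (int n + 2)" if "n < s" for n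
  using that by (induction n) (auto simp: algebra_simps)
 show ?thesis
 proof (induction n)
  case 0
  show ?case
  proof (cases s)
   case (Suc t)
   hence "0 \<le> int t * (int t - 1)" by (cases t) auto
   thus ?thesis using Suc by (simp add: algebra_simps)
  qed simp
 next
  case (Suc n)
  show ?case
  proof (cases "Suc n < s")
   case True
   then obtain t where "s = Suc (Suc n + t)" using less_imp_Suc_add by blast
   hence t: "s = Suc n + Suc t" by simp
   have "0 \<le> int t * (int t - 1)" by (cases t) auto
   thus ?thesis unfolding low[OF True] unfolding t by (simp add: algebra_simps)
  next
   case False
   thus ?thesis using Suc by (simp add: algebra_simps)
  qed
 qed
qed

context graded_alg begin

context
 fixes \<Gamma> :: "nat \<Rightarrow> 'a set" and s :: nat and c :: int
 assumes \<Gamma>: "gprime \<Gamma>" "saturated \<Gamma>" "\<forall>\<^sub>F n in sequentially. int (hf \<Gamma> n) = int s * int n + c"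
  and s: "s \<ge> 1"
begin

lemma curve_relevant: "\<exists>L\<in>G 1. L \<notin> \<Gamma> 1"
proof (rule ccontr)
 assume "\<not> ?thesis"
 hence "\<Gamma> n = G n" if "n > 0" for n
  using irrelevant_eq_G[OF gprime_gideal[OF \<Gamma>(1)] _ that] X_in by blast
 hence "hf \<Gamma> n = 0" if "n > 0" for n using hf_0_iff[OF gprime_gideal[OF \<Gamma>(1)]] that by blast
 moreover obtain N where "\<And>n. n \<ge> N \<Longrightarrow> int (hf \<Gamma> n) = int s * int n + c"
  using \<Gamma>(3) unfolding eventually_sequentially by blast
 ultimately have "int s * int (Suc N) + c = 0" "int s * int (Suc (Suc N)) + c = 0" by (metis le_Suc_eq of_nat_0 zero_less_Suc le_refl)+
 thus False using s by (simp add: algebra_simps)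
qed

lemma curve_section:
 assumes L: "L \<in> G d" "L \<notin> \<Gamma> d"
 shows "hf \<Gamma> (n + d) = hf (adjoin \<Gamma> L d) (n + d) + hf \<Gamma> n"
  and "\<forall>\<^sub>F n in sequentially. hf (sat (adjoin \<Gamma> L d)) n = s * d"
proof -
 note g\<Gamma> = gprime_gideal[OF \<Gamma>(1)]
 show *: "hf \<Gamma> (n + d) = hf (adjoin \<Gamma> L d) (n + d) + hf \<Gamma> n" for n
  using hf_split[OF g\<Gamma> L(1), of n] gprime_colon[OF \<Gamma>(1) L] by simp
 have "\<forall>\<^sub>F n in sequentially. hf (adjoin \<Gamma> L d) (n + d) = s * d"
  using \<Gamma>(3) eventually_shift[OF \<Gamma>(3), of d]
 proof eventually_elim
  case (elim n)
  have "int (hf (adjoin \<Gamma> L d) (n + d)) = int (s * d)"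
   using elim arg_cong[OF *[of n], of int] by (simp add: algebra_simps)
  thus ?case by presburger
 qed
 hence "\<forall>\<^sub>F n in sequentially. hf (adjoin \<Gamma> L d) n = s * d"
  using eventually_unshift[of "\<lambda>n. hf (adjoin \<Gamma> L d) n = s * d" d] by blast
 with hf_sat[OF adjoin_gideal[OF g\<Gamma> L(1)]]
 show "\<forall>\<^sub>F n in sequentially. hf (sat (adjoin \<Gamma> L d)) n = s * d"
  by eventually_elim simp
qed

text \<open>In terms of the genus, p_a >= 1 - s. A hypersurface of degree N + 1 cuts the curve in a
  finite scheme of degree s (N + 1). As s N < s (N + 1), the ideals of this scheme and of the curve
  agree in degree N, so s N + c is at most s (N + 1).\<close>

lemma curve_const_le: "c \<le> int s"
proof -
 note g\<Gamma> = gprime_gideal[OF \<Gamma>(1)]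
 obtain N where N: "int (hf \<Gamma> N) = int s * int N + c"
  using \<Gamma>(3) unfolding eventually_sequentially by blast
 obtain L where L: "L \<in> G 1" "L \<notin> \<Gamma> 1" using curve_relevant by blast
 have L': "L ^ (Suc N) \<in> G (Suc N)" "L ^ (Suc N) \<notin> \<Gamma> (Suc N)"
  using G_power[OF L(1), of "Suc N"] gprime_power[OF \<Gamma>(1) L, of "Suc N"] by (auto simp del: power_Suc)
 let ?A = "adjoin \<Gamma> (L ^ Suc N) (Suc N)"
 have gA: "gideal ?A" by (rule adjoin_gideal[OF g\<Gamma> L'(1)])
 have le: "\<Gamma> \<le> sat ?A" using adjoin_ge sat_ge[OF gA] by (rule order_trans)
 note ev = curve_section(2)[OF L']
 have "sat ?A N = \<Gamma> N"
  by (rule finite_on_integral_curve[OF \<Gamma>(1,3) sat_gideal[OF gA] le ev]) (use s in simp)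
 hence "hf \<Gamma> N = hf (sat ?A) N" by (rule hf_cong[symmetric])
 also have "\<dots> \<le> s * Suc N" by (rule finite_scheme_hf(1)[OF sat_sat[OF gA] ev])
 finally have "int (hf \<Gamma> N) \<le> int (s * Suc N)" by (rule of_nat_mono)
 thus ?thesis using N by (simp add: algebra_simps)
qed

text \<open>Hilbert polynomial minus Hilbert function. Nonnegativity is obtained only from degree s
  - 1 on.\<close>

definition defect :: "nat \<Rightarrow> int" where "defect n = int s * int n + c - int (hf \<Gamma> n)"

text \<open>The saturated hyperplane section W of the curve has Hilbert function at least min s (n +
  1); summing over the degrees bounds the defect from above. From degree s - 1 on, W has reached its
  final value s, so the defect cannot increase. If it stayed constant once while positive, the
  section and its saturation would agree from there on, and the defect would never reach
  zero.\<close>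

lemma curve_defect:
 shows "2 * defect n \<le> int s * (int s - 3) + 2 * c"
  and "s \<le> Suc n \<Longrightarrow> defect n \<ge> 0"
  and "s \<le> Suc n \<Longrightarrow> defect (Suc n) \<le> defect n"
  and "s \<le> Suc n \<Longrightarrow> defect n > 0 \<Longrightarrow> defect (Suc n) \<le> defect n - 1"
  and "hf \<Gamma> 0 \<ge> 1"
proof -
 note g\<Gamma> = gprime_gideal[OF \<Gamma>(1)]
 obtain L where L: "L \<in> G 1" "L \<notin> \<Gamma> 1" using curve_relevant by blast
 let ?A = "adjoin \<Gamma> L 1"
 let ?W = "sat ?A"
 have gA: "gideal ?A" by (rule adjoin_gideal[OF g\<Gamma> L(1)])
 note gW = sat_gideal[OF gA] and sW = sat_sat[OF gA]
 have ev: "\<forall>\<^sub>F n in sequentially. hf ?W n = s" using curve_section(2)[OF L] by simp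
 have inc: "hf \<Gamma> (Suc n) = hf ?A (Suc n) + hf \<Gamma> n" for n using curve_section(1)[OF L, of n] by simp
 have WA: "hf ?W n \<le> hf ?A n" for n by (rule hf_mono[OF gA gW sat_ge[OF gA]])
 have W0: "hf ?W 0 \<ge> 1"
 proof (rule ccontr)
  assume "\<not> ?thesis"
  hence "hf ?W 0 = 0" by linarith
  hence "?W 0 = G 0" using hf_0_iff[OF gW] by blast
  hence "?W = G" using gideal_top[OF gW] G_one by simp
  hence "hf ?W n = 0" for n by (simp add: hf_G)
  thus False using ev s by (auto simp: eventually_sequentially)
 qed
 show G0: "hf \<Gamma> 0 \<ge> 1" using W0 WA[of 0] adjoin_low[of 0 1 \<Gamma> L] hf_cong[of ?A 0 \<Gamma>] by simp
 have W: "min s (n + 1) \<le> hf ?W n" for n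
  using finite_scheme_hf(2)[OF sW ev, of 0 n] W0 by (auto simp: min_def split: if_splits)
 have "(\<Sum>k\<le>n. int (min s (k + 1))) \<le> int (hf \<Gamma> n)" for n
 proof (induction n)
  case 0 thus ?case using G0 s by simp
 next
  case (Suc n)
  have "min s (Suc n + 1) \<le> hf ?A (Suc n)" using W[of "Suc n"] WA[of "Suc n"] by (rule order_trans)
  hence "int (min s (Suc n + 1)) \<le> int (hf ?A (Suc n))" by (rule of_nat_mono)
  thus ?case using Suc inc[of n] by simp
 qed
 from this[of n] sum_min_lower[of s n]
 show "2 * defect n \<le> int s * (int s - 3) + 2 * c" unfolding defect_def by (simp add: algebra_simps)
 have As: "hf ?A n \<ge> s" if "s \<le> Suc n" for n using W[of n] WA[of n] that by simp
 have dinc: "defect (Suc n) = defect n + int s - int (hf ?A (Suc n))" for n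
  unfolding defect_def using inc[of n] by (simp add: algebra_simps)
 obtain N where "\<forall>n\<ge>N. int (hf \<Gamma> n) = int s * int n + c"
  using \<Gamma>(3) unfolding eventually_sequentially by blast
 hence N: "\<And>n. n \<ge> N \<Longrightarrow> defect n = 0" unfolding defect_def by simp
 have dec: "defect m \<le> defect n" if "n \<le> m" "s \<le> Suc n" for m n
  using that
 proof (induction rule: dec_induct)
  case (step k) thus ?case using As[of "Suc k"] dinc[of k] by simp
 qed simp
 show nn: "defect n \<ge> 0" if "s \<le> Suc n" for n using dec[of n "max n N"] N[of "max n N"] that by simp
 show "defect (Suc n) \<le> defect n" if "s \<le> Suc n" for n using dec[of n "Suc n"] that by simp
 obtain L2 where L2: "L2 \<in> G 1" "almost_nzd ?W L2 1" using linear_nzd_exists[of "{?W}"] gW by auto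
 have Wtop: "hf ?W n = s" if "s \<le> Suc n" for n
  using finite_scheme_hf(1)[OF sW ev, of n] W[of n] that by simp
 \<comment> \<open>From degree s on, W and a second linear form together generate everything. This
   regularity makes equality of \<open>?A\<close> and \<open>?W\<close> propagate upwards in
   \<open>gen\<close>.\<close>
 have A2: "adjoin ?W L2 1 (Suc n) = G (Suc n)" if "s \<le> Suc n" for n
 proof -
  have "hf ?W (Suc n) = hf (adjoin ?W L2 1) (Suc n) + hf ?W n"
   using hf_split[OF gW L2(1), of n] saturated_colon[OF sW L2] by simp
  hence "hf (adjoin ?W L2 1) (Suc n) = 0" using Wtop[of n] Wtop[of "Suc n"] that by simp
  thus ?thesis using hf_0_iff[OF adjoin_gideal[OF gW L2(1)]] by blast
 qed
 \<comment> \<open>Each coefficient of p splits into an element of W and a multiple of L2. The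
   multiples collect to L2 k, which lies in W; cancelling L2 puts k into W, hence into
   \<open>?A\<close> one degree lower, where the two ideals agree.\<close>
 have gen: "?A (Suc (Suc n)) = ?W (Suc (Suc n))" if n: "s \<le> Suc n" and eq: "?A (Suc n) = ?W (Suc n)" for n
 proof -
  have "p \<in> ?A (Suc (Suc n))" if p: "p \<in> ?W (Suc (Suc n))" for p
  proof -
   obtain g where g: "\<forall>i\<le>r. g i \<in> G (Suc n)" "p = (\<Sum>i\<le>r. X i * g i)"
    using G_gen[OF gideal_G[OF gW p]] by blast
   have "\<forall>i\<in>{..r}. \<exists>w h. g i = w + L2 * h \<and> w \<in> ?W (Suc n) \<and> h \<in> G n"
    using g(1) A2[OF n] adjoin_D[of _ ?W L2 1 n] by (metis Suc_eq_plus1 atMost_iff)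
   then obtain w h where wh: "\<And>i. i \<le> r \<Longrightarrow> g i = w i + L2 * h i \<and> w i \<in> ?W (Suc n) \<and> h i \<in> G n"
    by (metis atMost_iff)
   define k where "k = (\<Sum>i\<le>r. X i * h i)"
   have kG: "k \<in> G (Suc n)" unfolding k_def
    using wh G_mult[OF X_in] by (intro subspace_sum[OF G_sub]) fastforce
   have pe: "p = (\<Sum>i\<le>r. X i * w i) + L2 * k"
    unfolding g(2) k_def using wh by (simp add: sum_distrib_left sum.distrib[symmetric] algebra_simps)
   have w1: "(\<Sum>i\<le>r. X i * w i) \<in> ?A (Suc (Suc n))"
    using wh gideal_mult[OF gA X_in] eq by (intro subspace_sum[OF gideal_sub[OF gA]]) fastforce
   hence "(\<Sum>i\<le>r. X i * w i) \<in> ?W (Suc (Suc n))" using sat_ge[OF gA] by (auto simp: le_fun_def)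
   hence "p - (\<Sum>i\<le>r. X i * w i) \<in> ?W (Suc (Suc n))" by (rule gideal_diff[OF gW p])
   hence "L2 * k \<in> ?W (Suc n + 1)" using pe by simp
   hence "k \<in> ?W (Suc n)" by (rule saturated_nzd[OF sW L2 kG])
   hence "L2 * k \<in> ?A (1 + Suc n)" using eq gideal_mult[OF gA L2(1)] by blast
   thus ?thesis using pe w1 gideal_add[OF gA] by simp
  qed
  thus ?thesis using sat_ge[OF gA] by (auto simp: le_fun_def)
 qed
 show "defect (Suc n) \<le> defect n - 1" if n: "s \<le> Suc n" and pos: "defect n > 0" for n
 proof (rule ccontr)
  assume "\<not> ?thesis"
  hence eq: "hf ?A (Suc n) = s" using dinc[of n] As[of "Suc n"] n by simp
  have base: "?A (Suc n) = ?W (Suc n)"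
   by (rule hf_eq[OF gA gW]) (use sat_ge[OF gA] eq Wtop[of "Suc n"] n in \<open>auto simp: le_fun_def\<close>)
  have same: "?A (Suc m) = ?W (Suc m)" if "n \<le> m" for m
   using that
  proof (induction rule: dec_induct)
   case (step m)
   thus ?case using gen[of m] n by simp
  qed (rule base)
  have const: "defect (Suc m) = defect m" if "n \<le> m" for m
   using hf_cong[of ?A "Suc m" ?W] same[OF that] Wtop[of "Suc m"] that n dinc[of m] by simp
  have "defect m = defect n" if "n \<le> m" for m using that by (induction rule: dec_induct) (use const in auto)
  from this[of "max n N"] show False using N[of "max n N"] pos by simp
 qed
qed

text \<open>With p_a = 1 - c this reads p_a <= (s - 1) (s - 2) / 2, the genus of a plane curve of
  degree s.\<close>

lemma curve_const_ge: "0 \<le> int s * (int s - 3) + 2 * c"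
 using curve_defect(1)[of s] curve_defect(2)[of s] by simp

text \<open>The binomial coefficient of s over 2. It arises from the bound s (s - 3) / 2 + c on the
  defect by inserting c <= s.\<close>

definition gap :: nat where "gap = s * (s - 1) div 2"

lemma gap_eq: "2 * gap = s * (s - 1)"
proof -
 have "even (s * (s - 1))" by (cases s) auto
 thus ?thesis unfolding gap_def by (rule dvd_mult_div_cancel)
qed

lemma gap_int: "2 * int gap = int s * (int s - 1)"
proof -
 have "int (2 * gap) = int (s * (s - 1))" by (simp only: gap_eq)
 thus ?thesis using s by (simp add: of_nat_diff)
qed

lemma defect_le_gap: "defect n \<le> int gap"
 using curve_defect(1)[of n] curve_const_le gap_int by (simp add: algebra_simps)

text \<open>The defect is at most \<open>gap\<close> everywhere and from degree s on loses at least
  one per degree while positive. Hence only degrees below s + gap contribute.\<close>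

lemma sum_defect: "(\<Sum>n=1..m. defect n) \<le> (int s + int gap) * int gap"
proof -
 have tail: "defect (s + j) \<le> int (gap - j)" for j
 proof (induction j)
  case 0 show ?case using defect_le_gap by simp
 next
  case (Suc j)
  show ?case
  proof (cases "defect (s + j) > 0")
   case True
   hence "defect (s + Suc j) \<le> defect (s + j) - 1" using curve_defect(4)[of "s + j"] by simp
   also have "\<dots> \<le> int (gap - Suc j)" using Suc True by simp
   finally show ?thesis .
  next
   case False
   thus ?thesis using curve_defect(3)[of "s + j"] by simp
  qed
 qed
 show ?thesis unfolding of_nat_add[symmetric]
 proof (rule sum_le_of_vanishing[OF defect_le_gap])
  fix n assume "n \<ge> s + gap"
  thus "defect n \<le> 0" using tail[of "n - s"] by simp
 qed
qed

end

text \<open>The bound on the genus of a curve is the sum of the codimensions of its hyperplane section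
 \<open>Z\<close>. In degrees \<open>n < e / s\<close> the ideals of \<open>Z\<close> and \<open>\<Gamma>\<close> agree; from there on the Hilbert function of
 \<open>Z\<close> increases strictly until it reaches \<open>e\<close>.\<close>

lemma sum_hf_section:
 assumes \<Gamma>: "gprime \<Gamma>" "saturated \<Gamma>" "\<forall>\<^sub>F n in sequentially. int (hf \<Gamma> n) = int s * int n + c"
  and s: "s \<ge> 1"
  and Z: "saturated Z" "\<Gamma> \<le> Z" and e: "\<forall>\<^sub>F n in sequentially. hf Z n = e" "e \<ge> 1"
 shows "\<forall>\<^sub>F N in sequentially. real (\<Sum>n\<le>N. hf Z n) \<ge>
  real e * real N + 1 - ((real e)\<^sup>2 / (2 * s) - real e / 2 - real_of_int c * e / s + 3 / 2 * real s ^ 4)"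
proof -
 note gap = gap_int[OF \<Gamma> s]
 define q where "q = gap s"
 \<comment> \<open>The largest n with s n < e, so that the ideals of Z and of the curve agree in all
   degrees up to m.\<close>
 define m where "m = (e - 1) div s"
 have ms: "s * m < e" "e \<le> s * m + s"
 proof -
  have "s * m \<le> e - 1" unfolding m_def by simp
  thus "s * m < e" using e(2) by linarith
  have "e - 1 < s * m + s" unfolding m_def using s dividend_less_times_div[of s "e - 1"] by simp
  thus "e \<le> s * m + s" by linarith
 qed
 have eqm: "hf Z n = hf \<Gamma> n" if "n \<le> m" for n
 proof -
  have "s * n \<le> s * m" using that by simp
  hence "s * n < e" using ms by linarith
  thus ?thesis
   using finite_on_integral_curve[OF \<Gamma>(1,3) saturated_gideal[OF Z(1)] Z(2) e(1)] hf_cong by blast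
 qed
 have z: "int e - int (hf Z n) = int e - int s * int n - c + defect \<Gamma> s c n" if "n \<le> m" for n
  using eqm[OF that] by (simp add: defect_def[OF \<Gamma> s])
 \<comment> \<open>Since e <= s m + s, the constant c cancels against the one in the bound on the
   defect, and at most s + s (s - 3) / 2 = q remains.\<close>
 have T: "int e - int (hf Z m) \<le> int q"
 proof -
  have "int e \<le> int (s * m + s)" using ms(2) by (rule of_nat_mono)
  hence "2 * (int e - int (hf Z m)) \<le> 2 * int q"
   using z[of m] curve_defect(1)[OF \<Gamma> s, of m] gap unfolding q_def by (simp add: algebra_simps)
  thus ?thesis by simp
 qed
 have tail: "int e - int (hf Z (m + j)) \<le> int (q - j)" for j
 proof -
  have "min e (hf Z m + j) \<le> hf Z (m + j)" using finite_scheme_hf(2)[OF Z(1) e(1), of m "m + j"] by simp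
  thus ?thesis using T by linarith
 qed
 \<comment> \<open>Twice the bound for the whole sum: the arithmetic progression up to m, then 2 (s
   + q) q for the defects and 2 q^2 for the tail beyond m, where the codimension starts from at most
   q and drops by at least one per degree until it vanishes.\<close>
 define B where "B = int m * (int e - c) * 2 - int s * int m * (int m + 1) + 2 * int s * int q + 4 * int q * int q"
 have body: "2 * (\<Sum>n=1..m. int e - int (hf Z n)) \<le> B - 2 * int q * int q"
 proof -
  have "(\<Sum>n=1..m. int e - int (hf Z n)) = (\<Sum>n=1..m. int e - c) - int s * (\<Sum>n=1..m. int n) + (\<Sum>n=1..m. defect \<Gamma> s c n)"
   by (subst sum.cong[OF refl z]) (auto simp: sum_subtractf sum.distrib sum_distrib_left right_diff_distrib)
  moreover have "2 * (\<Sum>n=1..m. int n) = int m * (int m + 1)" by (induction m) (auto simp: algebra_simps)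
  hence "2 * (int s * (\<Sum>n=1..m. int n)) = int s * (int m * (int m + 1))"
   by (metis mult.left_commute)
  moreover note sum_defect[OF \<Gamma> s, of m, folded q_def]
  ultimately show ?thesis unfolding B_def by (simp add: algebra_simps)
 qed
 have all: "2 * (\<Sum>n=1..m + M. int e - int (hf Z n)) \<le> B" for M
 proof -
  have "(\<Sum>n=1..m + M. int e - int (hf Z n)) = (\<Sum>n=1..m. int e - int (hf Z n)) + (\<Sum>j=1..M. int e - int (hf Z (m + j)))"
   by (induction M) auto
  moreover have "(\<Sum>j=1..M. int e - int (hf Z (m + j))) \<le> int q * int q"
  proof (rule sum_le_of_vanishing)
   show "int e - int (hf Z (m + j)) \<le> int q" for j by (rule order_trans[OF tail]) simp
   show "int e - int (hf Z (m + j)) \<le> 0" if "j \<ge> q" for j using tail[of j] that by simp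
  qed
  ultimately show ?thesis using body by linarith
 qed
 have z0: "hf Z 0 \<ge> 1" using eqm[of 0] curve_defect(5)[OF \<Gamma> s] by simp
 have sumZ: "2 * int (\<Sum>n\<le>N. hf Z n) \<ge> 2 + 2 * int e * int N - B" if N: "N \<ge> m" for N
 proof -
  have "(\<Sum>n\<le>N. hf Z n) = hf Z 0 + (\<Sum>n=1..N. hf Z n)"
   by (simp add: atMost_atLeast0 sum.atLeast_Suc_atMost)
  moreover have "(\<Sum>n=1..N. int e - int (hf Z n)) = int N * int e - int (\<Sum>n=1..N. hf Z n)"
   by (simp add: sum_subtractf)
  ultimately show ?thesis using all[of "N - m"] N z0 by (simp add: algebra_simps)
 qed
 have c: "real_of_int c \<le> real s" using curve_const_le[OF \<Gamma> s] by linarith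
 have s1: "real s \<ge> 1" using s by simp
 have q: "real q = real s * (real s - 1) / 2"
 proof -
  have "real_of_int (2 * int q) = real_of_int (int s * (int s - 1))" unfolding q_def by (simp only: gap)
  thus ?thesis by simp
 qed
 \<comment> \<open>Replacing m by e / s - \<theta> with \<theta> between 0 and 1 turns the quadratic
   in m into the main term in e and a remainder bounded in s alone.\<close>
 define t where "t = real e / real s"
 define \<theta> where "\<theta> = t - real m"
 have th: "0 \<le> \<theta>" "\<theta> \<le> 1"
 proof -
  have "real (s * m) < real e" "real e \<le> real (s * m + s)" using ms by linarith+
  thus "0 \<le> \<theta>" "\<theta> \<le> 1" unfolding \<theta>_def t_def using s1 by (simp_all add: field_simps)
 qed
 have et: "real e = real s * t" unfolding t_def using s1 by simp
 have "real_of_int B / 2 = real m * (real e - c) - real s * real m * (real m + 1) / 2 + real s * real q + 2 * real q * real q"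
  unfolding B_def by (simp add: field_simps)
 also have "\<dots> = ((real e)\<^sup>2 / (2 * s) - real e / 2 - real_of_int c * e / s) + \<theta> * (real s / 2 + c) - real s * \<theta>\<^sup>2 / 2
   + real s * real q + 2 * real q * real q"
 proof -
  have m: "real m = t - \<theta>" unfolding \<theta>_def by simp
  show ?thesis unfolding m et using s1 by (simp add: field_simps power2_eq_square)
 qed
 also have "\<dots> \<le> ((real e)\<^sup>2 / (2 * s) - real e / 2 - real_of_int c * e / s) + 3 / 2 * real s
   + real s * real q + 2 * real q * real q"
 proof -
  have "\<theta> * (real s / 2 + c) \<le> \<theta> * (3 / 2 * real s)" using c th by (intro mult_left_mono) auto
  also have "\<dots> \<le> 3 / 2 * real s" using th s1 by (simp add: mult_left_le_one_le)
  finally have "\<theta> * (real s / 2 + c) \<le> 3 / 2 * real s" .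
  moreover have "real s * \<theta>\<^sup>2 / 2 \<ge> 0" using s1 by simp
  ultimately show ?thesis by linarith
 qed
 finally have B1: "real_of_int B / 2 \<le> ((real e)\<^sup>2 / (2 * s) - real e / 2 - real_of_int c * e / s) + 3 / 2 * real s
   + real s * real q + 2 * real q * real q" .
 \<comment> \<open>Origin of the constant 3/2 s^4: inserting q = s (s - 1) / 2 gives 3/2 s + (s^4 -
   s^3) / 2.\<close>
 have "3 / 2 * real s + real s * real q + 2 * real q * real q = 3 / 2 * real s + real s ^ 4 / 2 - real s ^ 3 / 2"
  unfolding q by (simp add: field_simps power3_eq_cube power4_eq_xxxx)
 also have "\<dots> \<le> 3 / 2 * real s ^ 4"
 proof -
  have "real s ^ 1 \<le> real s ^ 3" "real s ^ 3 \<le> real s ^ 4" using s1 by (intro power_increasing; simp)+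
  thus ?thesis unfolding power_one_right by linarith
 qed
 finally have "3 / 2 * real s + real s * real q + 2 * real q * real q \<le> 3 / 2 * real s ^ 4" .
 with B1 have Bb: "real_of_int B / 2 \<le> (real e)\<^sup>2 / (2 * s) - real e / 2 - real_of_int c * e / s + 3 / 2 * real s ^ 4"
  by linarith
 have "real (\<Sum>n\<le>N. hf Z n) \<ge> real e * real N + 1 -
   ((real e)\<^sup>2 / (2 * s) - real e / 2 - real_of_int c * e / s + 3 / 2 * real s ^ 4)" if N: "N \<ge> m" for N
 proof -
  have "real_of_int (2 * int (\<Sum>n\<le>N. hf Z n)) \<ge> real_of_int (2 + 2 * int e * int N - B)"
   using sumZ[OF N] by (rule of_int_le_iff[THEN iffD2])
  hence "real (\<Sum>n\<le>N. hf Z n) \<ge> 1 + real e * real N - real_of_int B / 2" by simp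
  thus ?thesis using Bb by linarith
 qed
 thus ?thesis unfolding eventually_sequentially by blast
qed

end

section \<open>The homogeneous coordinate ring as a graded algebra\<close>

abbreviation cscale :: "complex \<Rightarrow> mpoly \<Rightarrow> mpoly" where "cscale \<equiv> \<lambda>c p. const c * p"

lemma const_add: "const (a + b) = const a + const b" by (simp add: const_def single_add)
lemma const_mult: "const (a * b) = const a * const b" by (simp add: const_def mult_single)
lemma const_1: "const 1 = 1" by (simp add: const_def)
lemma const_0: "const 0 = 0" by (simp add: const_def)
lemma const_eq_0_iff: "const c = 0 \<longleftrightarrow> c = 0"
proof
 assume "const c = 0"
 hence "lookup (const c) 0 = 0" by simp
 thus "c = 0" by (simp add: const_def)
qed (simp add: const_0)

lemma cscale_vector_space: "vector_space cscale"
 by unfold_locales (simp_all add: distrib_left const_add const_mult const_1 distrib_right mult.assoc)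

lemma mdeg_superset: "finite A \<Longrightarrow> keys t \<subseteq> A \<Longrightarrow> mdeg t = (\<Sum>i\<in>A. lookup t i)"
 unfolding mdeg_def by (rule sum.mono_neutral_left) (auto simp: in_keys_iff)

lemma mdeg_add: "mdeg (s + t) = mdeg s + mdeg t"
proof -
 let ?A = "keys s \<union> keys t"
 have "mdeg (s + t) = (\<Sum>i\<in>?A. lookup (s + t) i)"
  by (rule mdeg_superset) (use keys_add[of s t] in auto)
 also have "\<dots> = (\<Sum>i\<in>?A. lookup s i) + (\<Sum>i\<in>?A. lookup t i)"
  by (simp add: lookup_add sum.distrib)
 also have "\<dots> = mdeg s + mdeg t"
  using mdeg_superset[of ?A s] mdeg_superset[of ?A t] by simp
 finally show ?thesis .
qed

lemma mdeg_0 [simp]: "mdeg 0 = 0" by (simp add: mdeg_def)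
lemma mdeg_single [simp]: "mdeg (Poly_Mapping.single i n) = n" by (simp add: mdeg_def)

lemma mdeg_0_iff: "mdeg t = 0 \<longleftrightarrow> t = 0"
proof
 assume "mdeg t = 0"
 hence "\<forall>i\<in>keys t. lookup t i = 0" unfolding mdeg_def by simp
 thus "t = 0" by (intro poly_mapping_eqI) (auto simp: in_keys_iff)
qed simp

lemma polys_iff: "p \<in> polys r \<longleftrightarrow> (\<forall>t. lookup p t \<noteq> 0 \<longrightarrow> keys t \<subseteq> {..r})"
 unfolding polys_def by (auto simp: in_keys_iff)

lemma forms_iff: "p \<in> forms r d \<longleftrightarrow>
  (\<forall>t. lookup p t \<noteq> 0 \<longrightarrow> keys t \<subseteq> {..r} \<and> mdeg t = d)"
 unfolding forms_def polys_def by (auto simp: in_keys_iff)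

lemma forms_polys: "forms r d \<subseteq> polys r" unfolding forms_def by blast

lemma forms_0 [simp]: "0 \<in> forms r d" and polys_0 [simp]: "0 \<in> polys r"
 by (simp_all add: forms_iff polys_iff)

lemma forms_add: "p \<in> forms r d \<Longrightarrow> q \<in> forms r d \<Longrightarrow> p + q \<in> forms r d"
 unfolding forms_iff by (auto simp: lookup_add) (metis add_cancel_left_left subsetD atMost_iff)+

lemma polys_add: "p \<in> polys r \<Longrightarrow> q \<in> polys r \<Longrightarrow> p + q \<in> polys r"
 unfolding polys_iff by (auto simp: lookup_add) (metis add_cancel_left_left subsetD atMost_iff)+

lemma keys_add_subset: "keys s \<subseteq> A \<Longrightarrow> keys t \<subseteq> A \<Longrightarrow> keys (s + t) \<subseteq> A"
 using keys_add[of s t] by blast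

lemma forms_mult: assumes "p \<in> forms r d" "q \<in> forms r e" shows "p * q \<in> forms r (d + e)"
proof -
 have "keys t \<subseteq> {..r} \<and> mdeg t = d + e" if t: "t \<in> keys (p * q)" for t
 proof -
  obtain a b where ab: "t = a + b" "a \<in> keys p" "b \<in> keys q"
   using keys_mult[of p q] t by blast
  hence "keys a \<subseteq> {..r}" "keys b \<subseteq> {..r}" "mdeg a = d" "mdeg b = e"
   using assms unfolding forms_iff in_keys_iff by blast+
  thus ?thesis unfolding ab using keys_add_subset[of a "{..r}" b] mdeg_add by simp
 qed
 thus ?thesis unfolding forms_iff in_keys_iff by blast
qed

lemma polys_mult: assumes "p \<in> polys r" "q \<in> polys r" shows "p * q \<in> polys r"
proof -
 have "keys t \<subseteq> {..r}" if t: "t \<in> keys (p * q)" for t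
 proof -
  obtain a b where ab: "t = a + b" "a \<in> keys p" "b \<in> keys q"
   using keys_mult[of p q] t by blast
  thus ?thesis using assms keys_add_subset[of a "{..r}" b] unfolding polys_iff in_keys_iff by blast
 qed
 thus ?thesis unfolding polys_iff in_keys_iff by blast
qed

lemma const_forms: "const c \<in> forms r 0"
 by (auto simp: forms_iff const_def lookup_single when_def)

lemma const_polys: "const c \<in> polys r" using const_forms forms_polys by blast

lemma var_forms: "i \<le> r \<Longrightarrow> var i \<in> forms r 1"
 by (auto simp: forms_iff var_def lookup_single when_def)

lemma forms_scale: "p \<in> forms r d \<Longrightarrow> const c * p \<in> forms r d"
 using forms_mult[OF const_forms, of p r d] by simp

lemma poly_mapping_sum_singles: "p = (\<Sum>t\<in>keys p. Poly_Mapping.single t (lookup p t))"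
 by (rule poly_mapping_eqI)
  (auto simp: lookup_sum lookup_single when_def in_keys_iff sum.delta)

lemma forms_0_const: "p \<in> forms r 0 \<Longrightarrow> p = const (lookup p 0)"
 by (rule poly_mapping_eqI) (auto simp: forms_iff mdeg_0_iff const_def lookup_single when_def)

lemma forms_subspace: "module.subspace cscale (forms r n)"
proof -
 interpret vector_space cscale by (rule cscale_vector_space)
 show ?thesis by (rule subspaceI) (auto intro: forms_add forms_scale)
qed

text \<open>Each monomial of p is divided by one chosen variable occurring in it; grouping the
  monomials by that variable gives the quotients.\<close>

lemma forms_gen:
 assumes p: "p \<in> forms r (Suc n)"
 shows "\<exists>q. (\<forall>i\<le>r. q i \<in> forms r n) \<and> p = (\<Sum>i\<le>r. var i * q i)"
proof -
 interpret vector_space cscale by (rule cscale_vector_space)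
 let ?K = "keys p"
 have key: "\<exists>i. i \<le> r \<and> lookup t i \<noteq> 0" if "t \<in> ?K" for t
 proof -
  have "mdeg t \<noteq> 0" "keys t \<subseteq> {..r}" using p that unfolding forms_iff in_keys_iff by auto
  thus ?thesis unfolding mdeg_def by (metis in_keys_iff atMost_iff subsetD sum.neutral)
 qed
 then obtain v where v: "\<And>t. t \<in> ?K \<Longrightarrow> v t \<le> r \<and> lookup t (v t) \<noteq> 0" by metis
 define u where "u t = t - Poly_Mapping.single (v t) 1" for t
 have ut: "t = Poly_Mapping.single (v t) 1 + u t" if "t \<in> ?K" for t
  by (rule poly_mapping_eqI) (use v[OF that] in \<open>auto simp: u_def lookup_add lookup_minus lookup_single when_def\<close>)
 define q where "q i = (\<Sum>t\<in>{t \<in> ?K. v t = i}. Poly_Mapping.single (u t) (lookup p t))" for i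
 have uf: "Poly_Mapping.single (u t) c \<in> forms r n" if t: "t \<in> ?K" for t c
 proof -
  have "mdeg t = Suc n" "keys t \<subseteq> {..r}" using p t unfolding forms_iff in_keys_iff by auto
  moreover from this have "mdeg (u t) = n" using arg_cong[OF ut[OF t], of mdeg] by (simp add: mdeg_add)
  moreover have "keys (u t) \<subseteq> keys t"
   unfolding u_def by (auto simp: in_keys_iff lookup_minus)
  ultimately show ?thesis by (auto simp: forms_iff lookup_single when_def)
 qed
 have "q i \<in> forms r n" for i
  unfolding q_def by (rule subspace_sum[OF forms_subspace]) (use uf in auto)
 moreover have "p = (\<Sum>i\<le>r. var i * q i)"
 proof -
  have "(\<Sum>i\<le>r. var i * q i) = (\<Sum>i\<le>r. \<Sum>t\<in>{t \<in> ?K. v t = i}. Poly_Mapping.single t (lookup p t))"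
   unfolding q_def sum_distrib_left
  proof (intro sum.cong refl)
   fix i t assume "t \<in> {t \<in> ?K. v t = i}"
   hence "t = Poly_Mapping.single i 1 + u t" using ut by blast
   thus "var i * Poly_Mapping.single (u t) (lookup p t) = Poly_Mapping.single t (lookup p t)"
    unfolding var_def mult_single by simp
  qed
  also have "\<dots> = (\<Sum>t\<in>?K. Poly_Mapping.single t (lookup p t))"
   by (rule sum.group) (use v in auto)
  finally show ?thesis using poly_mapping_sum_singles[of p] by simp
 qed
 ultimately show ?thesis by (intro exI[of _ q] conjI allI impI)
qed

interpretation S: graded_alg cscale "forms r" var r for r
proof -
 interpret V: vector_space cscale by (rule cscale_vector_space)
 show "graded_alg cscale (forms r) var r"
 proof
  show "infinite (UNIV :: complex set)" by (rule infinite_UNIV_char_0)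
  show "1 \<in> forms r 0" using const_forms[of 1 r] by (simp add: const_1)
  show "p \<in> forms r 0 \<Longrightarrow> \<exists>c. p = const c * 1" for p using forms_0_const[of p r] by auto
 qed (use forms_subspace forms_mult var_forms forms_gen in \<open>auto simp: mult.assoc\<close>)
qed

lemma hom_component_lookup: "lookup (hom_component d p) t = (if mdeg t = d then lookup p t else 0)"
proof -
 have "lookup (hom_component d p) t =
   (\<Sum>s\<in>{s \<in> keys p. mdeg s = d}. if s = t then lookup p t else 0)"
  unfolding hom_component_def lookup_sum by (intro sum.cong) (auto simp: lookup_single when_def)
 also have "\<dots> = (if mdeg t = d then lookup p t else 0)"
  by (subst sum.delta) (auto simp: in_keys_iff)
 finally show ?thesis .
qed

lemma hom_component_add: "hom_component d (p + q) = hom_component d p + hom_component d q"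
 by (rule poly_mapping_eqI) (simp add: hom_component_lookup lookup_add)

lemma hom_component_sum: "hom_component d (sum f A) = (\<Sum>x\<in>A. hom_component d (f x))"
 by (rule poly_mapping_eqI) (simp add: hom_component_lookup lookup_sum)

lemma hom_component_forms: "p \<in> polys r \<Longrightarrow> hom_component d p \<in> forms r d"
 by (auto simp: forms_iff polys_iff hom_component_lookup)

lemma hom_component_of_form: "p \<in> forms r e \<Longrightarrow> hom_component d p = (if d = e then p else 0)"
 by (rule poly_mapping_eqI) (auto simp: forms_iff hom_component_lookup)

lemma hom_component_decomp: "p = (\<Sum>d\<in>mdeg ` keys p. hom_component d p)"
 by (rule poly_mapping_eqI) (auto simp: lookup_sum hom_component_lookup in_keys_iff sum.delta)

lemma hom_component_mult:
 assumes p: "p \<in> polys r" and q: "q \<in> polys r"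
 shows "hom_component m (p * q) =
  (\<Sum>i\<in>mdeg ` keys p. if i \<le> m then hom_component i p * hom_component (m - i) q else 0)"
proof -
 have *: "hom_component m (g * q) = (if e \<le> m then g * hom_component (m - e) q else 0)" if g: "g \<in> forms r e" for g e
 proof -
  have "hom_component m (g * q) = (\<Sum>d\<in>mdeg ` keys q. hom_component m (g * hom_component d q))"
   by (subst (1) hom_component_decomp[of q]) (simp add: sum_distrib_left hom_component_sum)
  also have "\<dots> = (\<Sum>d\<in>mdeg ` keys q. if d = m - e \<and> e \<le> m then g * hom_component d q else 0)"
   using hom_component_of_form[OF forms_mult[OF g hom_component_forms[OF q]]] by (intro sum.cong) auto
  also have "\<dots> = (if e \<le> m then g * hom_component (m - e) q else 0)"
  proof (cases "m - e \<in> mdeg ` keys q")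
   case False
   hence "hom_component (m - e) q = 0"
    by (intro poly_mapping_eqI) (auto simp: hom_component_lookup image_iff, metis in_keys_iff)
   moreover have "(\<Sum>d\<in>mdeg ` keys q. if d = m - e \<and> e \<le> m then g * hom_component d q else 0) = 0"
    by (rule sum.neutral) (use False in \<open>metis (mono_tags, lifting)\<close>)
   ultimately show ?thesis by simp
  qed (simp add: sum.delta)
  finally show ?thesis .
 qed
 have "hom_component m (p * q) = (\<Sum>i\<in>mdeg ` keys p. hom_component m (hom_component i p * q))"
  by (subst (1) hom_component_decomp[of p]) (simp add: sum_distrib_right hom_component_sum)
 thus ?thesis using *[OF hom_component_forms[OF p]] by simp
qed

section \<open>Homogeneous ideals as graded families\<close>

definition gr :: "nat \<Rightarrow> mpoly set \<Rightarrow> nat \<Rightarrow> mpoly set" where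
 "gr r I n = I \<inter> forms r n"

definition ungr :: "nat \<Rightarrow> (nat \<Rightarrow> mpoly set) \<Rightarrow> mpoly set" where
 "ungr r J = {p \<in> polys r. \<forall>n. hom_component n p \<in> J n}"

lemma gr_gideal: assumes I: "homogeneous_ideal r I" shows "S.gideal r (gr r I)"
proof (rule S.gidealI)
 have c: "const c * p \<in> I" if "p \<in> I" for c p
  using I that const_polys unfolding homogeneous_ideal_def by blast
 show "module.subspace cscale (gr r I n)" for n
 proof -
  show ?thesis
   by (rule S.subspaceI) (use I c in \<open>auto simp: gr_def homogeneous_ideal_def intro: forms_add forms_scale\<close>)
 qed
 show "p \<in> forms r n" if "p \<in> gr r I n" for n p using that unfolding gr_def by blast
 show "var i * p \<in> gr r I (Suc n)" if "p \<in> gr r I n" "i \<le> r" for n p i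
 proof -
  have "var i * p \<in> I" using I that var_forms[OF that(2)] forms_polys unfolding homogeneous_ideal_def gr_def by blast
  thus ?thesis using that forms_mult[OF var_forms[OF that(2)], of p n] unfolding gr_def by auto
 qed
qed

lemma ungr_homogeneous: assumes J: "S.gideal r J" shows "homogeneous_ideal r (ungr r J)"
 unfolding homogeneous_ideal_def
proof (intro conjI ballI allI)
 show "ungr r J \<subseteq> polys r" unfolding ungr_def by blast
 have z: "hom_component n 0 = 0" for n by (rule poly_mapping_eqI) (simp add: hom_component_lookup)
 show "0 \<in> ungr r J" unfolding ungr_def using S.gideal_0[OF J] by (simp add: z)
 show "p + q \<in> ungr r J" if "p \<in> ungr r J" "q \<in> ungr r J" for p q
  using that S.gideal_add[OF J] unfolding ungr_def by (auto simp: hom_component_add polys_add)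
 show "q * p \<in> ungr r J" if p: "p \<in> ungr r J" and q: "q \<in> polys r" for p q
 proof -
  have pp: "p \<in> polys r" "\<And>n. hom_component n p \<in> J n" using p unfolding ungr_def by auto
  have "hom_component m (q * p) \<in> J m" for m
   unfolding hom_component_mult[OF q pp(1)]
  proof (rule S.subspace_sum[OF S.gideal_sub[OF J]])
   fix i
   show "(if i \<le> m then hom_component i q * hom_component (m - i) p else 0) \<in> J m"
    using S.gideal_mult[OF J hom_component_forms[OF q, of i] pp(2)[of "m - i"]] S.gideal_0[OF J] by auto
  qed
  thus ?thesis unfolding ungr_def using polys_mult[OF q pp(1)] by blast
 qed
 show "hom_component d p \<in> ungr r J" if "p \<in> ungr r J" for p d
 proof -
  have p: "p \<in> polys r" "\<And>n. hom_component n p \<in> J n" using that unfolding ungr_def by auto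
  have f: "hom_component d p \<in> forms r d" by (rule hom_component_forms[OF p(1)])
  show ?thesis unfolding ungr_def
   using f forms_polys p(2) S.gideal_0[OF J] hom_component_of_form[OF f] by auto
 qed
qed

lemma gr_ungr: assumes J: "S.gideal r J" shows "gr r (ungr r J) = J"
proof
 fix n
 have "p \<in> J n" if "p \<in> gr r (ungr r J) n" for p
  using that hom_component_of_form[of p r n n] unfolding gr_def ungr_def by (auto dest: spec[of _ n])
 moreover have "p \<in> gr r (ungr r J) n" if p: "p \<in> J n" for p
  using S.gideal_G[OF J p] hom_component_of_form[OF S.gideal_G[OF J p]] p S.gideal_0[OF J] forms_polys[of r n]
  unfolding gr_def ungr_def by auto
 ultimately show "gr r (ungr r J) n = J n" by blast
qed

lemma ungr_gr: assumes I: "homogeneous_ideal r I" shows "ungr r (gr r I) = I"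
proof
 show "I \<subseteq> ungr r (gr r I)"
  using I hom_component_forms unfolding ungr_def gr_def homogeneous_ideal_def by blast
 show "ungr r (gr r I) \<subseteq> I"
 proof
  fix p assume p: "p \<in> ungr r (gr r I)"
  have "finite A \<Longrightarrow> (\<Sum>d\<in>A. hom_component d p) \<in> I" for A
   by (induction A rule: finite_induct) (use I p in \<open>auto simp: homogeneous_ideal_def ungr_def gr_def\<close>)
  hence "(\<Sum>d\<in>mdeg ` keys p. hom_component d p) \<in> I" by simp
  thus "p \<in> I" using hom_component_decomp[of p] by simp
 qed
qed

lemma gr_mono_iff: "homogeneous_ideal r I \<Longrightarrow> homogeneous_ideal r J \<Longrightarrow> gr r I \<le> gr r J \<longleftrightarrow> I \<subseteq> J"
proof
 assume I: "homogeneous_ideal r I" "homogeneous_ideal r J" and le: "gr r I \<le> gr r J"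
 have "ungr r (gr r I) \<subseteq> ungr r (gr r J)" using le unfolding ungr_def le_fun_def by blast
 thus "I \<subseteq> J" using ungr_gr I by simp
qed (auto simp: gr_def le_fun_def)

lemma gr_inj: "homogeneous_ideal r I \<Longrightarrow> homogeneous_ideal r J \<Longrightarrow> gr r I = gr r J \<Longrightarrow> I = J"
 using ungr_gr by metis

lemma gr_saturation: "gr r (saturation r I) n = S.sat r (gr r I) n"
proof -
 have "(\<forall>g\<in>forms r k. g * p \<in> I) \<longleftrightarrow> (\<forall>g\<in>forms r k. g * p \<in> gr r I (k + n))" if "p \<in> forms r n" for k p
  using forms_mult[OF _ that] unfolding gr_def by blast
 hence "{p \<in> forms r n. \<exists>k. \<forall>g\<in>forms r k. g * p \<in> I} = S.sat r (gr r I) n"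
  unfolding S.sat_def by blast
 moreover have "gr r (saturation r I) n = {p \<in> forms r n. \<exists>k. \<forall>g\<in>forms r k. g * p \<in> I}"
  unfolding gr_def saturation_def using forms_polys[of r n] by blast
 ultimately show ?thesis by simp
qed

lemma closed_homogeneous: "closed_subscheme r I \<Longrightarrow> homogeneous_ideal r I"
 unfolding closed_subscheme_def by blast

lemma gr_saturated: assumes "closed_subscheme r I" shows "S.saturated r (gr r I)"
 using assms gr_saturation[of r I] gr_gideal[of r I]
 unfolding closed_subscheme_def S.saturated_def by (simp add: fun_eq_iff)

lemma one_forms: "1 \<in> forms r 0" by (rule S.G_one)

lemma homogeneous_ideal_top:
 assumes "homogeneous_ideal r I" "1 \<in> I" shows "I = polys r"
 using assms unfolding homogeneous_ideal_def by (metis mult.right_neutral subsetI subset_antisym)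

lemma gr_gprime: assumes P: "homogeneous_prime r P" shows "S.gprime r (gr r P)"
proof -
 have h: "homogeneous_ideal r P" "P \<noteq> polys r" using P unfolding homogeneous_prime_def by auto
 have "gr r P \<noteq> forms r"
 proof
  assume "gr r P = forms r"
  hence "1 \<in> gr r P 0" using one_forms by simp
  thus False using homogeneous_ideal_top[OF h(1)] h(2) unfolding gr_def by blast
 qed
 moreover have "p \<in> gr r P m \<or> q \<in> gr r P n"
  if "p \<in> forms r m" "q \<in> forms r n" "p * q \<in> gr r P (m + n)" for p q m n
  using that P forms_polys unfolding homogeneous_prime_def gr_def by blast
 ultimately show ?thesis unfolding S.gprime_def using gr_gideal[OF h(1)] by blast
qed

text \<open>Primality for forms suffices. If neither factor lies in the ideal, let a and b be the
  largest degrees in which their components lie outside J. Modulo J the component of the product in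
  degree a + b is the product of these two components alone.\<close>

lemma ungr_prime: assumes J: "S.gprime r J" shows "homogeneous_prime r (ungr r J)"
proof -
 have gJ: "S.gideal r J" using S.gprime_gideal[OF J] .
 have "ungr r J \<noteq> polys r"
 proof
  assume *: "ungr r J = polys r"
  have "1 \<in> polys r" using one_forms forms_polys by blast
  hence "1 \<in> ungr r J" unfolding * .
  hence "hom_component 0 1 \<in> J 0" unfolding ungr_def by blast
  hence "1 \<in> J 0" using hom_component_of_form[OF one_forms, of 0] by simp
  thus False using S.gideal_top[OF gJ] J unfolding S.gprime_def by blast
 qed
 moreover have "p \<in> ungr r J \<or> q \<in> ungr r J"
  if p: "p \<in> polys r" and q: "q \<in> polys r" and pq: "p * q \<in> ungr r J" for p q
 proof (rule ccontr)
  assume n: "\<not> ?thesis"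
  let ?A = "\<lambda>p. {d. hom_component d p \<notin> J d}"
  have fin: "finite (?A p)" for p
  proof (rule finite_subset)
   show "?A p \<subseteq> mdeg ` keys p"
   proof
    fix d assume d: "d \<in> ?A p"
    show "d \<in> mdeg ` keys p"
    proof (rule ccontr)
     assume "d \<notin> mdeg ` keys p"
     hence "hom_component d p = 0"
      by (intro poly_mapping_eqI) (auto simp: hom_component_lookup image_iff, metis in_keys_iff)
     thus False using d S.gideal_0[OF gJ] by simp
    qed
   qed
  qed simp
  have ne: "?A p \<noteq> {}" "?A q \<noteq> {}" using n p q unfolding ungr_def by auto
  define a b where "a = Max (?A p)" and "b = Max (?A q)"
  have a: "hom_component a p \<notin> J a" "\<And>i. i > a \<Longrightarrow> hom_component i p \<in> J i"
   using Max_in[OF fin ne(1)] Max_ge[OF fin[of p]] unfolding a_def by (auto, meson not_less)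
  have b: "hom_component b q \<notin> J b" "\<And>i. i > b \<Longrightarrow> hom_component i q \<in> J i"
   using Max_in[OF fin ne(2)] Max_ge[OF fin[of q]] unfolding b_def by (auto, meson not_less)
  have am: "a \<in> mdeg ` keys p"
  proof (rule ccontr)
   assume "a \<notin> mdeg ` keys p"
   hence "hom_component a p = 0"
    by (intro poly_mapping_eqI) (auto simp: hom_component_lookup image_iff, metis in_keys_iff)
   thus False using a S.gideal_0[OF gJ] by simp
  qed
  let ?t = "\<lambda>i. if i \<le> a + b then hom_component i p * hom_component (a + b - i) q else 0"
  have e: "hom_component (a + b) (p * q) = ?t a + (\<Sum>i\<in>mdeg ` keys p - {a}. ?t i)"
   unfolding hom_component_mult[OF p q] using am by (subst sum.remove[of _ a]) auto
  have m: "hom_component (a + b) (p * q) \<in> J (a + b)" using pq unfolding ungr_def by blast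
  have rest: "(\<Sum>i\<in>mdeg ` keys p - {a}. ?t i) \<in> J (a + b)"
  proof (rule S.subspace_sum[OF S.gideal_sub[OF gJ]])
   fix i assume i: "i \<in> mdeg ` keys p - {a}"
   consider "i > a + b" | "i > a" "i \<le> a + b" | "i < a" using i by fastforce
   thus "?t i \<in> J (a + b)"
   proof cases
    case 1 thus ?thesis using S.gideal_0[OF gJ] by simp
   next
    case 2
    thus ?thesis using S.gideal_mult'[OF gJ a(2)[OF 2(1)] hom_component_forms[OF q, of "a + b - i"]] by simp
   next
    case 3
    hence "a + b - i > b" by simp
    thus ?thesis using 3 S.gideal_mult[OF gJ hom_component_forms[OF p, of i] b(2)] by fastforce
   qed
  qed
  have "?t a \<in> J (a + b)" using S.gideal_diff[OF gJ m rest] unfolding e by simp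
  hence "hom_component a p * hom_component b q \<in> J (a + b)" by simp
  thus False
   using S.gprimeD[OF J hom_component_forms[OF p] hom_component_forms[OF q]] a(1) b(1) by blast
 qed
 ultimately show ?thesis unfolding homogeneous_prime_def using ungr_homogeneous[OF gJ] by blast
qed

section \<open>Dimension and degree\<close>

lemma lead_coeff_pos:
 fixes A :: "real poly"
 assumes "\<forall>\<^sub>F n in sequentially. 0 \<le> poly A (real n)" "A \<noteq> 0"
 shows "lead_coeff A > 0"
proof (rule ccontr)
 assume "\<not> ?thesis"
 hence "lead_coeff (- A) > 0" using assms(2) by (simp add: order_less_le)
 then obtain x where x: "\<And>y. y \<ge> x \<Longrightarrow> poly (- A) y \<ge> lead_coeff (- A)"
  using poly_pinfty_gt_lc[of "- A"] by blast
 obtain N where N: "\<And>n. n \<ge> N \<Longrightarrow> 0 \<le> poly A (real n)" using assms(1) unfolding eventually_sequentially by blast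
 obtain m where m: "real m \<ge> x" using real_arch_simple by blast
 have "poly (- A) (real (max N m)) \<ge> lead_coeff (- A)" using m by (intro x) auto
 thus False using N[of "max N m"] \<open>lead_coeff (- A) > 0\<close> by simp
qed

lemma degree_mono_eventually:
 fixes A B :: "real poly"
 assumes 0: "\<forall>\<^sub>F n in sequentially. 0 \<le> poly A (real n)" and le: "\<forall>\<^sub>F n in sequentially. poly A (real n) \<le> poly B (real n)"
 shows "degree A \<le> degree B" and "A \<noteq> 0 \<Longrightarrow> B \<noteq> 0"
proof -
 show d: "degree A \<le> degree B"
 proof (rule ccontr)
  assume lt: "\<not> ?thesis"
  hence "A \<noteq> 0" by auto
  have "degree (- A + B) = degree A" using lt degree_add_eq_left[of B "- A"] by simp
  moreover from this have "lead_coeff (- A + B) = lead_coeff (- A)" using lt by (simp add: coeff_eq_0)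
  moreover have "\<forall>\<^sub>F n in sequentially. 0 \<le> poly (- A + B) (real n)" using le by eventually_elim simp
  moreover have "- A + B \<noteq> 0" using calculation(1) lt by force
  ultimately show False using lead_coeff_pos[of "- A + B"] lead_coeff_pos[OF 0 \<open>A \<noteq> 0\<close>] by simp
 qed
 show "B \<noteq> 0" if "A \<noteq> 0"
 proof
  assume "B = 0"
  hence "\<forall>\<^sub>F n in sequentially. poly A (real n) = poly 0 (real n)"
   using 0 le by (auto elim: eventually_elim2)
  thus False using poly_eq_eventually that by blast
 qed
qed

definition int_valued :: "real poly \<Rightarrow> bool" where
 "int_valued P \<longleftrightarrow> (\<forall>\<^sub>F n in sequentially. poly P (real n) \<in> \<int>)"

lemma int_valued_pdiff: assumes "int_valued P" shows "int_valued (pdiff P (real m))"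
proof -
 have "\<forall>\<^sub>F n in sequentially. poly (pdiff P (real m)) (real (n + m)) \<in> \<int>"
  using eventually_shift[OF assms[unfolded int_valued_def], of m] assms[unfolded int_valued_def]
  by eventually_elim (simp add: poly_pdiff)
 thus ?thesis unfolding int_valued_def
  using eventually_unshift[of "\<lambda>n. poly (pdiff P (real m)) (real n) \<in> \<int>" m] by blast
qed

lemma int_valued_linear:
 assumes "int_valued P" "degree P \<le> 1"
 shows "\<exists>e c::int. P = [:of_int c, of_int e:]"
proof -
 have P: "P = [:coeff P 0, coeff P 1:]"
  using assms(2) by (intro poly_eqI) (auto simp: coeff_pCons coeff_eq_0 split: nat.splits)
 obtain N where N: "\<And>n. n \<ge> N \<Longrightarrow> poly P (real n) \<in> \<int>"
  using assms(1) unfolding int_valued_def eventually_sequentially by blast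
 have v: "poly P x = coeff P 0 + x * coeff P 1" for x by (subst P) simp
 have "poly P (real (Suc N)) - poly P (real N) \<in> \<int>" by (intro Ints_diff N) auto
 hence 1: "coeff P 1 \<in> \<int>" by (simp add: v algebra_simps)
 have "poly P (real N) - real N * coeff P 1 \<in> \<int>" using N[of N] 1 by auto
 hence "coeff P 0 \<in> \<int>" by (simp add: v)
 thus ?thesis using 1 P by (metis Ints_cases)
qed

context graded_alg begin

lemma hpoly_nonneg: "hpoly I Q \<Longrightarrow> \<forall>\<^sub>F n in sequentially. 0 \<le> poly Q (real n)"
 unfolding hpoly_def by (erule eventually_mono) (metis of_nat_0_le_iff)

lemma hpoly_int_valued: "hpoly I Q \<Longrightarrow> int_valued Q"
 unfolding hpoly_def int_valued_def by (erule eventually_mono) (metis Ints_of_nat)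

lemma hpoly_mono:
 assumes "gideal I" "gideal J" "I \<le> J" "hpoly I Q" "hpoly J R"
 shows "degree R \<le> degree Q" "R \<noteq> 0 \<Longrightarrow> Q \<noteq> 0"
  "\<forall>\<^sub>F n in sequentially. poly R (real n) \<le> poly Q (real n)"
proof -
 show le: "\<forall>\<^sub>F n in sequentially. poly R (real n) \<le> poly Q (real n)"
  using assms(4,5)[unfolded hpoly_def]
 proof eventually_elim
  case (elim n)
  have "real (hf J n) \<le> real (hf I n)" using hf_mono[OF assms(1-3)] by simp
  thus ?case using elim by simp
 qed
 show "degree R \<le> degree Q" "R \<noteq> 0 \<Longrightarrow> Q \<noteq> 0"
  using degree_mono_eventually[OF hpoly_nonneg[OF assms(5)] le] by auto
qed

text \<open>Some form f lies in J but not in P. Then J contains P + f G, whose Hilbert polynomial is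
  a difference of the one of P because f is a nonzerodivisor modulo P.\<close>

lemma prime_hpoly_drop:
 assumes P: "gprime P" and J: "gideal J" "P < J" and Q: "hpoly P Q" and R: "hpoly J R" "R \<noteq> 0"
 shows "degree R < degree Q"
proof -
 obtain d f where f: "f \<in> J d" "f \<notin> P d" using J(2) by (metis le_fun_def less_le_not_le subsetI)
 have fG: "f \<in> G d" using gideal_G[OF J(1) f(1)] .
 note gP = gprime_gideal[OF P]
 have A: "hpoly (adjoin P f d) (pdiff Q (real d))" by (rule hpoly_nzd[OF gP fG gprime_nzd[OF P fG f(2)] Q])
 have le: "adjoin P f d \<le> J" by (rule adjoin_least[OF J(1) less_imp_le[OF J(2)] f(1)])
 note m = hpoly_mono[OF adjoin_gideal[OF gP fG] J(1) le A R(1)]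
 have "degree Q \<noteq> 0" using m(2) R(2) pdiff_const by auto
 then obtain k where k: "degree Q = Suc k" using not0_implies_Suc by blast
 hence "degree (pdiff Q (real d)) \<le> k" using pdiff_degree[of Q k "real d"] by simp
 thus ?thesis using m(1) k by simp
qed

lemma relevant_hpoly: assumes P: "relevant P" and Q: "hpoly P Q" shows "Q \<noteq> 0"
proof
 assume "Q = 0"
 then obtain N where N: "\<And>n. n \<ge> N \<Longrightarrow> hf P n = 0" using Q unfolding hpoly_def eventually_sequentially by auto
 have g: "gprime P" "gideal P" using P unfolding relevant_def gprime_def by auto
 obtain i where i: "i \<le> r" "X i \<notin> P 1" using relevant_X[OF P] by blast
 have "X i ^ N \<in> G N" using G_power[OF X_in[OF i(1)], of N] by simp
 moreover have "P N = G N" using N hf_0_iff[OF g(2)] by blast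
 ultimately show False using gprime_power[OF g(1) X_in[OF i(1)] i(2), of N] by blast
qed

lemma relevant_gideal: "relevant P \<Longrightarrow> gideal P"
 unfolding relevant_def gprime_def by blast

lemma prime_chain_length:
 assumes I: "gideal I" "hpoly I Q" and P: "\<And>i. i \<le> n \<Longrightarrow> relevant (P i)" "I \<le> P 0" "\<And>i. i < n \<Longrightarrow> P i < P (Suc i)"
 shows "n \<le> degree Q"
proof -
 obtain R where R: "\<And>i. i \<le> n \<Longrightarrow> hpoly (P i) (R i)"
  using hpoly_exists[OF relevant_gideal[OF P(1)]] by metis
 have "degree (R i) + i \<le> degree Q" if "i \<le> n" for i
  using that
 proof (induction i)
  case 0
  thus ?case using hpoly_mono(1)[OF I(1) relevant_gideal[OF P(1)] P(2) I(2) R[of 0]] by simp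
 next
  case (Suc i)
  have "degree (R (Suc i)) < degree (R i)"
   using Suc.prems P(1)[of i] P(1)[of "Suc i"] P(3)[of i] R[of i] R[of "Suc i"] relevant_hpoly[of "P (Suc i)"]
   by (intro prime_hpoly_drop[of "P i" "P (Suc i)"]) (auto simp: relevant_def gprime_def)
  thus ?case using Suc by simp
 qed
 from this[of n] show ?thesis by simp
qed

text \<open>A prime I starts the chain itself and continues above I + X i G, where the degree has
  dropped by exactly one. Otherwise Q is the sum of the polynomials of I + f G and, shifted, of I :
  f, so one of these has the degree of Q and its chain serves for I.\<close>

lemma prime_chain_exists:
 assumes "gideal I" "hpoly I Q" "Q \<noteq> 0"
 shows "\<exists>P. (\<forall>i\<le>degree Q. relevant (P i) \<and> I \<le> P i) \<and> (\<forall>i<degree Q. P i < P (Suc i))"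
 using assms
proof (induction I arbitrary: Q rule: noeth_induct)
 case (step I)
 note Q = step.prems(1) and Q0 = step.prems(2)
 have "I \<noteq> G"
 proof
  assume "I = G"
  hence "hpoly I 0" by (simp add: hpoly_def hf_G)
  thus False using hpoly_unique[OF Q] Q0 by blast
 qed
 show ?case
 proof (cases "gprime I")
  case True
  have rel: "relevant I"
  proof (rule ccontr)
   assume "\<not> relevant I"
   hence "I n = G n" if "n > 0" for n
    using True irrelevant_eq_G[OF step(1) _ that] X_in unfolding relevant_def by blast
   hence "hf I n = 0" if "n \<ge> 1" for n using hf_0_iff[OF step(1)] that by simp
   hence "hpoly I 0" unfolding hpoly_def eventually_sequentially by auto
   thus False using hpoly_unique[OF Q] Q0 by blast
  qed
  show ?thesis
  proof (cases "degree Q")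
   case 0 thus ?thesis using rel by (intro exI[of _ "\<lambda>_. I"]) auto
  next
   case (Suc k)
   obtain i where i: "i \<le> r" "X i \<notin> I 1" using relevant_X[OF rel] by blast
   note Xi = X_in[OF i(1)]
   let ?A = "adjoin I (X i) 1"
   have lt: "I < ?A"
    using adjoin_ge[of I "X i" 1] adjoin_mem[OF step(1), of "X i" 1] i by (metis order_less_le)
   have hA: "hpoly ?A (pdiff Q 1)"
    using hpoly_nzd[OF step(1) Xi gprime_nzd[OF True Xi i(2)] Q] by simp
   have "coeff (pdiff Q 1) k \<noteq> 0" "degree (pdiff Q 1) \<le> k"
    using pdiff_degree[of Q k 1] Suc Q0 leading_coeff_0_iff[of Q] by auto
   hence dk: "degree (pdiff Q 1) = k" "pdiff Q 1 \<noteq> 0" using le_degree[of "pdiff Q 1" k] by auto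
   obtain P where P: "\<And>i. i \<le> k \<Longrightarrow> relevant (P i) \<and> ?A \<le> P i" "\<And>i. i < k \<Longrightarrow> P i < P (Suc i)"
    using step.IH[OF adjoin_gideal[OF step(1) Xi] lt hA dk(2)] unfolding dk by blast
   show ?thesis
   proof (intro exI[of _ "\<lambda>j. case j of 0 \<Rightarrow> I | Suc j \<Rightarrow> P j"] conjI allI impI)
    fix j assume j: "j \<le> degree Q"
    show "relevant (case j of 0 \<Rightarrow> I | Suc j \<Rightarrow> P j)"
     using P(1) rel j Suc by (cases j) auto
    show "I \<le> (case j of 0 \<Rightarrow> I | Suc j \<Rightarrow> P j)"
    proof (cases j)
     case (Suc j')
     hence "?A \<le> P j'" using P(1) j \<open>degree Q = Suc k\<close> by simp
     thus ?thesis using Suc adjoin_ge[of I "X i" 1] by (simp add: order_trans[of I ?A])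
    qed simp
   next
    fix j assume j: "j < degree Q"
    show "(case j of 0 \<Rightarrow> I | Suc j \<Rightarrow> P j) < (case Suc j of 0 \<Rightarrow> I | Suc j \<Rightarrow> P j)"
    proof (cases j)
     case 0 thus ?thesis using lt P(1)[of 0] by (simp add: less_le_trans[of I ?A])
    next
     case (Suc j') thus ?thesis using P(2)[of j'] j \<open>degree Q = Suc k\<close> by simp
    qed
   qed
  qed
 next
  case False
  obtain f d where f: "f \<in> G d" "gideal (colon I f d)" "gideal (adjoin I f d)"
   "I < colon I f d" "I < adjoin I f d" using gideal_cases[OF step(1) \<open>I \<noteq> G\<close> False] by blast
  obtain A where A: "hpoly (adjoin I f d) A" using hpoly_exists[OF f(3)] by blast
  obtain B where B: "hpoly (colon I f d) B" using hpoly_exists[OF f(2)] by blast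
  have QAB: "Q = A + pcompose B [:- real d, 1:]" by (rule hpoly_unique[OF Q hpoly_split[OF step(1) f(1) A B]])
  note leA = hpoly_mono(1)[OF step(1) f(3) less_imp_le[OF f(5)] Q A]
  note leB = hpoly_mono(1)[OF step(1) f(2) less_imp_le[OF f(4)] Q B]
  have dB: "degree (pcompose B [:- real d, 1:]) = degree B" by (simp add: degree_pcompose)
  have "coeff A (degree Q) + coeff (pcompose B [:- real d, 1:]) (degree Q) \<noteq> 0"
   using Q0 leading_coeff_0_iff[of Q] unfolding QAB[symmetric] coeff_add[symmetric] by simp
  then consider "coeff A (degree Q) \<noteq> 0" | "coeff (pcompose B [:- real d, 1:]) (degree Q) \<noteq> 0" by fastforce
  thus ?thesis
  proof cases
   case 1
   hence e: "degree A = degree Q" "A \<noteq> 0" using le_degree[OF 1] leA by auto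
   obtain P where P: "\<And>i. i \<le> degree Q \<Longrightarrow> relevant (P i) \<and> adjoin I f d \<le> P i" "\<And>i. i < degree Q \<Longrightarrow> P i < P (Suc i)"
    using step.IH[OF f(3,5) A e(2)] unfolding e by blast
   thus ?thesis using less_imp_le[OF f(5)] order_trans by blast
  next
   case 2
   hence e: "degree B = degree Q" "B \<noteq> 0" using le_degree[OF 2] leB dB by auto
   obtain P where P: "\<And>i. i \<le> degree Q \<Longrightarrow> relevant (P i) \<and> colon I f d \<le> P i" "\<And>i. i < degree Q \<Longrightarrow> P i < P (Suc i)"
    using step.IH[OF f(2,4) B e(2)] unfolding e by blast
   thus ?thesis using less_imp_le[OF f(4)] order_trans by blast
  qed
 qed
qed

text \<open>A projective Nullstellensatz: a nonzero Hilbert polynomial would yield a chain of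
  relevant primes above I.\<close>

lemma no_relevant_prime:
 assumes I: "gideal I" and no: "\<And>P. relevant P \<Longrightarrow> I \<le> P \<Longrightarrow> False"
 shows "\<forall>\<^sub>F n in sequentially. I n = G n"
proof -
 obtain Q where Q: "hpoly I Q" using hpoly_exists[OF I] by blast
 have "Q = 0" using prime_chain_exists[OF I Q] no by (metis zero_le)
 thus ?thesis using Q hf_0_iff[OF I] unfolding hpoly_def by (auto elim: eventually_mono)
qed

end

lemma hilbert_function_hf:
 assumes "homogeneous_ideal r I" shows "hilbert_function r I n = S.hf r (gr r I) n"
 unfolding hilbert_function_def quotient_dim_def
 using S.quotient_dim_conv[OF S.gideal_sub[OF gr_gideal[OF assms]] forms_subspace
   S.hf_qdim[OF gr_gideal[OF assms]], of n]
 unfolding gr_def .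

lemma hilbert_polynomial_hpoly:
 assumes I: "homogeneous_ideal r I" and Q: "S.hpoly r (gr r I) Q"
 shows "hilbert_polynomial r I = Q"
proof -
 have "(\<forall>\<^sub>F n in sequentially. poly P (real n) = real (hilbert_function r I n)) \<longleftrightarrow> S.hpoly r (gr r I) P" for P
  unfolding S.hpoly_def hilbert_function_hf[OF I] by (simp add: eq_commute)
 thus ?thesis unfolding hilbert_polynomial_def
  using Q S.hpoly_unique[OF _ Q] by (intro the_equality) blast+
qed

lemma relevant_points:
 assumes I: "homogeneous_ideal r I"
 shows "P \<in> points r I \<Longrightarrow> S.relevant r (gr r P) \<and> gr r I \<le> gr r P"
  and "S.relevant r J \<Longrightarrow> gr r I \<le> J \<Longrightarrow> ungr r J \<in> points r I"
proof -
 assume P: "P \<in> points r I"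
 hence "homogeneous_prime r P" "I \<subseteq> P" "\<not> forms r 1 \<subseteq> P" unfolding points_def by auto
 thus "S.relevant r (gr r P) \<and> gr r I \<le> gr r P"
  unfolding S.relevant_def using gr_gprime by (auto simp: gr_def le_fun_def)
next
 assume J: "S.relevant r J" "gr r I \<le> J"
 hence g: "S.gprime r J" "S.gideal r J" unfolding S.relevant_def S.gprime_def by auto
 have "gr r (ungr r J) = J" by (rule gr_ungr[OF g(2)])
 hence "I \<subseteq> ungr r J" using J(2) gr_mono_iff[OF I ungr_homogeneous[OF g(2)]] by simp
 moreover have "\<not> forms r 1 \<subseteq> ungr r J"
  using J(1) \<open>gr r (ungr r J) = J\<close> unfolding S.relevant_def gr_def by (metis Int_iff subset_iff)
 ultimately show "ungr r J \<in> points r I" unfolding points_def using ungr_prime[OF g(1)] by blast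
qed

lemma scheme_dim_eq:
 assumes I: "homogeneous_ideal r I" and Q: "S.hpoly r (gr r I) Q"
 shows "scheme_dim r I = degree Q"
proof -
 let ?N = "{n. \<exists>P. (\<forall>i\<le>n. P i \<in> points r I) \<and> (\<forall>i<n. P i \<subset> P (Suc i))}"
 have bound: "n \<le> degree Q" if n: "n \<in> ?N" for n
 proof -
  obtain P where P: "\<And>i. i \<le> n \<Longrightarrow> P i \<in> points r I" "\<And>i. i < n \<Longrightarrow> P i \<subset> P (Suc i)" using n by blast
  have h: "homogeneous_ideal r (P i)" if "i \<le> n" for i
   using P(1)[OF that] unfolding points_def homogeneous_prime_def by blast
  have "gr r (P i) < gr r (P (Suc i))" if "i < n" for i
   using P(2)[OF that] gr_mono_iff[OF h h, of i "Suc i"] gr_inj[OF h h, of i "Suc i"] that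
   by (auto simp: order_less_le)
  thus ?thesis
   using S.prime_chain_length[OF gr_gideal[OF I] Q, of n "\<lambda>i. gr r (P i)"] relevant_points(1)[OF I P(1)] by blast
 qed
 show ?thesis
 proof (cases "Q = 0")
  \<comment> \<open>For the empty scheme both sides take their default 0: the supremum of the empty
    set of naturals and the degree of the zero polynomial.\<close>
  case True
  have "points r I = {}"
  proof (rule ccontr)
   assume "points r I \<noteq> {}"
   then obtain P where P: "S.relevant r (gr r P)" "gr r I \<le> gr r P" using relevant_points(1)[OF I] by blast
   obtain R where R: "S.hpoly r (gr r P) R" using S.hpoly_exists S.relevant_gideal[OF P(1)] by blast
   show False using S.hpoly_mono(2)[OF gr_gideal[OF I] S.relevant_gideal[OF P(1)] P(2) Q R]
     S.relevant_hpoly[OF P(1) R] True by blast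
  qed
  hence "?N = {}" by blast
  thus ?thesis unfolding scheme_dim_def by (simp only: True degree_0) (simp add: Sup_nat_def)
 next
  case False
  obtain P where P: "\<And>i. i \<le> degree Q \<Longrightarrow> S.relevant r (P i) \<and> gr r I \<le> P i" "\<And>i. i < degree Q \<Longrightarrow> P i < P (Suc i)"
   using S.prime_chain_exists[OF gr_gideal[OF I] Q False] by blast
  have "ungr r (P i) \<subset> ungr r (P (Suc i))" if "i < degree Q" for i
  proof -
   have g: "S.gideal r (P i)" "S.gideal r (P (Suc i))" using P(1)[of i] P(1)[of "Suc i"] that S.relevant_gideal by auto
   have "ungr r (P i) \<subseteq> ungr r (P (Suc i))"
    using less_imp_le[OF P(2)[OF that]] unfolding ungr_def le_fun_def by blast
   moreover have "ungr r (P i) \<noteq> ungr r (P (Suc i))"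
    using gr_ungr[OF g(1)] gr_ungr[OF g(2)] P(2)[OF that] by (metis order_less_irrefl)
   ultimately show ?thesis by blast
  qed
  hence "degree Q \<in> ?N" using P(1) relevant_points(2)[OF I] by (intro CollectI exI[of _ "\<lambda>i. ungr r (P i)"]) auto
  thus ?thesis unfolding scheme_dim_def using bound by (intro cSup_eq_maximum)
 qed
qed

lemma scheme_degree_eq:
 assumes "homogeneous_ideal r I" "S.hpoly r (gr r I) Q"
 shows "scheme_degree r I = fact (degree Q) * lead_coeff Q"
 unfolding scheme_degree_def scheme_dim_eq[OF assms] hilbert_polynomial_hpoly[OF assms] ..

section \<open>Base change to the rational function field\<close>

text \<open>The scalars are extended to \<open>\<complex>(\<tau>)\<close>. Elements of the extended coordinate ring are
 represented by fractions \<open>F / c\<close> with \<open>F\<close> a polynomial in \<open>\<tau>\<close> over the coordinate ring and \<open>c \<in> \<complex>[\<tau>]\<close>.\<close>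

type_synonym kfield = "complex poly fract"
type_synonym kpoly = "mpoly poly fract"

definition cm :: "complex poly \<Rightarrow> mpoly poly" where "cm p = map_poly const p"

lemma coeff_cm: "coeff (cm p) i = const (coeff p i)"
 by (simp add: cm_def coeff_map_poly const_0)

lemma const_sum: "const (sum f A) = (\<Sum>x\<in>A. const (f x))"
 by (induction A rule: infinite_finite_induct) (auto simp: const_0 const_add)

lemma cm_add: "cm (p + q) = cm p + cm q" by (rule poly_eqI) (simp add: coeff_cm const_add)
lemma cm_mult: "cm (p * q) = cm p * cm q" by (rule poly_eqI) (simp add: coeff_cm coeff_mult const_sum const_mult)
lemma cm_1: "cm 1 = 1" by (rule poly_eqI) (simp add: coeff_cm const_1 const_0)
lemma cm_eq_0_iff: "cm p = 0 \<longleftrightarrow> p = 0" by (simp add: poly_eq_iff coeff_cm const_eq_0_iff)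

definition emb :: "kfield \<Rightarrow> kpoly" where
 "emb \<kappa> = (THE a. \<exists>p q. q \<noteq> 0 \<and> \<kappa> = Fract p q \<and> a = Fract (cm p) (cm q))"

lemma emb_Fract: assumes "q \<noteq> 0" shows "emb (Fract p q) = Fract (cm p) (cm q)"
 unfolding emb_def
proof (rule the_equality)
 fix a assume "\<exists>p' q'. q' \<noteq> 0 \<and> Fract p q = Fract p' q' \<and> a = Fract (cm p') (cm q')"
 then obtain p' q' where *: "q' \<noteq> 0" "Fract p q = Fract p' q'" "a = Fract (cm p') (cm q')" by blast
 hence "cm (p * q') = cm (p' * q)" using assms by (simp add: eq_fract)
 thus "a = Fract (cm p) (cm q)" using * assms by (simp add: eq_fract cm_eq_0_iff cm_mult)
qed (use assms in blast)

lemma emb_add: "emb (x + y) = emb x + emb y"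
 by (cases x, cases y) (simp add: emb_Fract cm_eq_0_iff cm_add cm_mult)
lemma emb_mult: "emb (x * y) = emb x * emb y"
 by (cases x, cases y) (simp add: emb_Fract cm_eq_0_iff cm_mult)
lemma emb_1: "emb 1 = 1" by (simp add: One_fract_def emb_Fract cm_1)

abbreviation kscale :: "kfield \<Rightarrow> kpoly \<Rightarrow> kpoly" where "kscale \<equiv> \<lambda>\<kappa> a. emb \<kappa> * a"

lemma kscale_vector_space: "vector_space kscale"
 by unfold_locales (simp_all add: distrib_left emb_add emb_mult emb_1 distrib_right mult.assoc)

definition ext :: "(nat \<Rightarrow> mpoly set) \<Rightarrow> nat \<Rightarrow> kpoly set" where
 "ext I n = {Fract F (cm c) | F c. c \<noteq> 0 \<and> (\<forall>i. coeff F i \<in> I n)}"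

lemma mult_const_mem: "S.subspace V \<Longrightarrow> x \<in> V \<Longrightarrow> x * const c \<in> V"
 using S.subspace_scale[of V x c] by (simp add: mult.commute)

lemma coeffs_mult_cm: "S.subspace V \<Longrightarrow> \<forall>i. coeff F i \<in> V \<Longrightarrow> coeff (F * cm c) i \<in> V"
 unfolding coeff_mult coeff_cm by (intro S.subspace_sum mult_const_mem) auto

text \<open>If j is the order of c at \<tau> = 0, the coefficient of F c at i + j is a nonzero
  multiple of coefficient i of F, up to contributions of lower coefficients of F, which are settled
  by induction. This makes membership in \<open>ext\<close> independent of the representing
  fraction.\<close>

lemma coeffs_mult_cm_cancel:
 assumes V: "S.subspace V" and c: "c \<noteq> 0" and F: "\<forall>i. coeff (F * cm c) i \<in> V"
 shows "coeff F i \<in> V"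
proof (induction i rule: less_induct)
 case (less i)
 define j where "j = (LEAST j. coeff c j \<noteq> 0)"
 have "\<exists>j. coeff c j \<noteq> 0" using c by (auto simp: poly_eq_iff)
 hence j: "coeff c j \<noteq> 0" "\<And>k. k < j \<Longrightarrow> coeff c k = 0"
  unfolding j_def by (rule LeastI_ex, blast dest: not_less_Least)
 have "coeff (F * cm c) (i + j) = (\<Sum>k\<le>i + j. coeff F k * const (coeff c (i + j - k)))"
  by (simp add: coeff_mult coeff_cm)
 also have "\<dots> = coeff F i * const (coeff c j) + (\<Sum>k\<in>{..i + j} - {i}. coeff F k * const (coeff c (i + j - k)))"
  by (subst sum.remove[of _ i]) auto
 finally have e: "coeff F i * const (coeff c j) =
   coeff (F * cm c) (i + j) - (\<Sum>k\<in>{..i + j} - {i}. coeff F k * const (coeff c (i + j - k)))" by simp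
 have "(\<Sum>k\<in>{..i + j} - {i}. coeff F k * const (coeff c (i + j - k))) \<in> V"
 proof (rule S.subspace_sum[OF V])
  fix k assume k: "k \<in> {..i + j} - {i}"
  show "coeff F k * const (coeff c (i + j - k)) \<in> V"
  proof (cases "k < i")
   case True thus ?thesis using less mult_const_mem[OF V] by blast
  next
   case False
   hence "i + j - k < j" using k by auto
   thus ?thesis using j(2) S.subspace_0[OF V] by (simp add: const_0)
  qed
 qed
 hence "coeff F i * const (coeff c j) \<in> V" unfolding e using F S.subspace_diff[OF V] by blast
 hence "coeff F i * const (coeff c j) * const (1 / coeff c j) \<in> V" by (rule mult_const_mem[OF V])
 thus ?case using j(1) by (simp add: mult.assoc const_mult[symmetric] const_1)
qed

lemma ext_iff:
 assumes V: "S.subspace (I n)" and c: "c \<noteq> 0"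
 shows "Fract F (cm c) \<in> ext I n \<longleftrightarrow> (\<forall>i. coeff F i \<in> I n)"
proof
 assume "Fract F (cm c) \<in> ext I n"
 then obtain F' c' where *: "Fract F (cm c) = Fract F' (cm c')" "c' \<noteq> 0" "\<forall>i. coeff F' i \<in> I n"
  unfolding ext_def by blast
 hence "F * cm c' = F' * cm c" using c by (simp add: eq_fract cm_eq_0_iff)
 hence "\<forall>i. coeff (F * cm c') i \<in> I n" using coeffs_mult_cm[OF V *(3)] by simp
 thus "\<forall>i. coeff F i \<in> I n" using coeffs_mult_cm_cancel[OF V *(2)] by blast
qed (use c in \<open>auto simp: ext_def\<close>)

interpretation KV: vector_space kscale by (rule kscale_vector_space)

lemma ext_subspace: assumes V: "S.subspace (I n)" shows "KV.subspace (ext I n)"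
proof (rule KV.subspaceI)
 show "0 \<in> ext I n"
  using ext_iff[of I n 1 0, OF V] S.subspace_0[OF V] by (simp add: Zero_fract_def cm_1)
next
 fix x y assume "x \<in> ext I n" "y \<in> ext I n"
 then obtain F c F' c' where *: "x = Fract F (cm c)" "c \<noteq> 0" "\<And>i. coeff F i \<in> I n"
  "y = Fract F' (cm c')" "c' \<noteq> 0" "\<And>i. coeff F' i \<in> I n" unfolding ext_def by blast
 have "x + y = Fract (F * cm c' + F' * cm c) (cm (c * c'))" using * by (simp add: cm_eq_0_iff cm_mult)
 moreover have "coeff (F * cm c' + F' * cm c) i \<in> I n" for i
  using coeffs_mult_cm[OF V] * S.subspace_add[OF V] by simp
 ultimately show "x + y \<in> ext I n" using * ext_iff[of I n "c * c'", OF V] by simp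
next
 fix \<kappa> :: kfield and x assume "x \<in> ext I n"
 then obtain F c where *: "x = Fract F (cm c)" "c \<noteq> 0" "\<And>i. coeff F i \<in> I n" unfolding ext_def by blast
 obtain p q where pq: "\<kappa> = Fract p q" "q \<noteq> 0" by (cases \<kappa>)
 have "kscale \<kappa> x = Fract (F * cm p) (cm (q * c))" using * pq by (simp add: emb_Fract cm_mult mult.commute)
 thus "kscale \<kappa> x \<in> ext I n" using ext_iff[of I n "q * c", OF V] coeffs_mult_cm[OF V] * pq by simp
qed

definition kvar :: "nat \<Rightarrow> kpoly" where "kvar i = Fract [:var i:] 1"

lemma coeffs_forms_mult:
 assumes "\<And>i. coeff F i \<in> I m" "\<And>i. coeff F' i \<in> I' n" "S.subspace (J (m + n))"
  "\<And>f g. f \<in> I m \<Longrightarrow> g \<in> I' n \<Longrightarrow> f * g \<in> J (m + n)"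
 shows "coeff (F * F') i \<in> J (m + n)"
 unfolding coeff_mult using assms by (intro S.subspace_sum) auto

lemma ext_mult:
 assumes "a \<in> ext I m" "b \<in> ext I' n" "S.subspace (J (m + n))"
  "\<And>f g. f \<in> I m \<Longrightarrow> g \<in> I' n \<Longrightarrow> f * g \<in> J (m + n)"
 shows "a * b \<in> ext J (m + n)"
proof -
 obtain F c F' c' where *: "a = Fract F (cm c)" "c \<noteq> 0" "\<And>i. coeff F i \<in> I m"
  "b = Fract F' (cm c')" "c' \<noteq> 0" "\<And>i. coeff F' i \<in> I' n" using assms(1,2) unfolding ext_def by blast
 have "a * b = Fract (F * F') (cm (c * c'))" using * by (simp add: cm_mult)
 thus ?thesis
  using ext_iff[of J "m + n" "c * c'", OF assms(3)] coeffs_forms_mult[of F I m F' I' n J] * assms(3,4) by simp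
qed

lemma iota_ext: "f \<in> I n \<Longrightarrow> 0 \<in> I n \<Longrightarrow> Fract [:f:] 1 \<in> ext I n"
proof -
 assume "f \<in> I n" "0 \<in> I n"
 hence "Fract [:f:] (cm 1) \<in> ext I n"
  unfolding ext_def by (intro CollectI exI[of _ "[:f:]"] exI[of _ 1]) (auto simp: coeff_pCons split: nat.splits)
 thus ?thesis by (simp add: cm_1)
qed

lemma poly_of_coeffs: "coeff (\<Sum>j\<le>d. monom (g j) j) i = (if i \<le> d then g i else 0)"
 by (simp add: coeff_sum sum.delta)

interpretation K: graded_alg kscale "ext (forms r)" kvar r for r
proof
 show "infinite (UNIV :: kfield set)"
 proof
  assume "finite (UNIV :: kfield set)"
  hence "finite (range (\<lambda>c::complex. Fract [:c:] (1::complex poly)))" by (rule finite_subset[rotated]) simp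
  moreover have "inj (\<lambda>c::complex. Fract [:c:] (1::complex poly))" by (auto simp: inj_def eq_fract)
  ultimately have "finite (UNIV :: complex set)" by (rule finite_imageD)
  thus False using infinite_UNIV_char_0 by blast
 qed
 show "kscale c x * y = kscale c (x * y)" for c x y by (rule mult.assoc)
 show "KV.subspace (ext (forms r) n)" for n by (rule ext_subspace[OF forms_subspace])
 show "1 \<in> ext (forms r) 0"
  using iota_ext[of 1 "forms r" 0] one_forms[of r] by (simp add: One_fract_def one_pCons)
 show "\<exists>c. p = kscale c 1" if p: "p \<in> ext (forms r) 0" for p
 proof -
  obtain F c where *: "p = Fract F (cm c)" "c \<noteq> 0" "\<And>i. coeff F i \<in> forms r 0" using p unfolding ext_def by blast
  define q where "q = map_poly (\<lambda>x. lookup x 0) F"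
  have "cm q = F"
   using forms_0_const[OF *(3)] by (intro poly_eqI) (simp add: coeff_cm q_def coeff_map_poly)
  hence "p = kscale (Fract q c) 1" using * by (simp add: emb_Fract)
  thus ?thesis by blast
 qed
 show "p * q \<in> ext (forms r) (m + n)" if "p \<in> ext (forms r) m" "q \<in> ext (forms r) n" for p q m n
  using that by (rule ext_mult) (use forms_subspace forms_mult in auto)
 show "kvar i \<in> ext (forms r) 1" if "i \<le> r" for i
  unfolding kvar_def using var_forms[OF that] by (intro iota_ext) auto
 show "\<exists>q. (\<forall>i\<le>r. q i \<in> ext (forms r) n) \<and> p = (\<Sum>i\<le>r. kvar i * q i)" if p: "p \<in> ext (forms r) (Suc n)" for p n
 proof -
  obtain F c where *: "p = Fract F (cm c)" "c \<noteq> 0" "\<And>i. coeff F i \<in> forms r (Suc n)" using p unfolding ext_def by blast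
  have "\<forall>i. \<exists>q. (\<forall>k\<le>r. q k \<in> forms r n) \<and> coeff F i = (\<Sum>k\<le>r. var k * q k)" using forms_gen[OF *(3)] by blast
  then obtain q where q: "\<And>i k. k \<le> r \<Longrightarrow> q i k \<in> forms r n" "\<And>i. coeff F i = (\<Sum>k\<le>r. var k * q i k)" by metis
  define Q where "Q k = (\<Sum>j\<le>degree F. monom (q j k) j)" for k
  have "coeff F i = coeff (\<Sum>k\<le>r. [:var k:] * Q k) i" for i
  proof -
   have "coeff (\<Sum>k\<le>r. [:var k:] * Q k) i = (\<Sum>k\<le>r. var k * (if i \<le> degree F then q i k else 0))"
    by (simp add: coeff_sum Q_def sum.delta)
   thus ?thesis using q(2)[of i] by (cases "i \<le> degree F") (auto simp: coeff_eq_0)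
  qed
  hence F: "F = (\<Sum>k\<le>r. [:var k:] * Q k)" by (rule poly_eqI)
  have sum: "finite A \<Longrightarrow> (\<Sum>k\<in>A. Fract (H k) (cm c)) = Fract (\<Sum>k\<in>A. H k) (cm c)" for A :: "nat set" and H
  proof (induction A rule: finite_induct)
   case empty thus ?case using *(2) by (simp add: Zero_fract_def eq_fract cm_eq_0_iff)
  next
   case (insert x A)
   thus ?case using *(2) by (simp add: cm_eq_0_iff eq_fract algebra_simps)
  qed
  have "p = (\<Sum>k\<le>r. kvar k * Fract (Q k) (cm c))"
   unfolding *(1) kvar_def by (simp add: sum F[symmetric] del: mult_pCons_left)
  moreover have "Fract (Q k) (cm c) \<in> ext (forms r) n" if "k \<le> r" for k
   unfolding ext_iff[of "forms r" n, OF forms_subspace *(2)] Q_def poly_of_coeffs using q(1)[OF that] by simp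
  ultimately show ?thesis by (intro exI[of _ "\<lambda>k. Fract (Q k) (cm c)"] conjI allI impI)
 qed
qed

lemma sum_Fract: "finite A \<Longrightarrow> b \<noteq> 0 \<Longrightarrow> (\<Sum>k\<in>A. Fract (H k) b) = Fract (\<Sum>k\<in>A. H k) (b :: 'a::idom)"
proof (induction A rule: finite_induct)
 case empty thus ?case by (simp add: Zero_fract_def eq_fract)
next
 case (insert x A) thus ?case by (simp add: eq_fract algebra_simps)
qed

lemma ext_gideal: assumes I: "S.gideal r I" shows "K.gideal r (ext I)"
proof (rule K.gidealI)
 show "KV.subspace (ext I n)" for n by (rule ext_subspace[OF S.gideal_sub[OF I]])
 show "p \<in> ext (forms r) n" if "p \<in> ext I n" for n p
  using that S.gideal_G[OF I] unfolding ext_def by blast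
 show "kvar i * p \<in> ext I (Suc n)" if "p \<in> ext I n" "i \<le> r" for n p i
 proof -
  have "kvar i \<in> ext (forms r) 1" by (rule K.X_in[OF that(2)])
  hence "kvar i * p \<in> ext I (1 + n)"
   using that(1) by (rule ext_mult) (use S.gideal_sub[OF I] S.gideal_mult[OF I] in blast)+
  thus ?thesis by simp
 qed
qed

lemma ext_mono: "I \<le> J \<Longrightarrow> ext I \<le> ext J"
 unfolding ext_def le_fun_def by blast

lemma common_denominator:
 "finite B \<Longrightarrow> \<exists>c p. c \<noteq> 0 \<and> (\<forall>b\<in>B. \<kappa> b = Fract (p b) (c :: complex poly))"
proof (induction B rule: finite_induct)
 case empty thus ?case by (intro exI[of _ 1]) auto
next
 case (insert x B)
 then obtain c p where c: "c \<noteq> 0" "\<forall>b\<in>B. \<kappa> b = Fract (p b) c" by blast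
 obtain p' q' where x: "\<kappa> x = Fract p' q'" "q' \<noteq> 0" by (cases "\<kappa> x")
 show ?case
  by (intro exI[of _ "c * q'"] exI[of _ "\<lambda>b. if b = x then p' * c else p b * q'"])
   (use c x in \<open>auto simp: eq_fract\<close>)
qed

text \<open>A basis modulo I remains one after extension of scalars: membership in
  \<open>ext\<close> is tested coefficient by coefficient in \<tau>, and finitely many scalars have
  a common denominator.\<close>

lemma hf_ext: assumes I: "S.gideal r I" shows "K.hf r (ext I) n = S.hf r I n"
proof -
 have V: "S.subspace (I n)" by (rule S.gideal_sub[OF I])
 obtain B where B: "qbasis cscale (forms r n) (I n) B" "card B = S.hf r I n"
  using S.hf_qdim[OF I] unfolding qdim_def by blast
 have Bf: "finite B" "B \<subseteq> forms r n" using B(1) unfolding qbasis_def by auto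
 define \<iota> where "\<iota> b = Fract [:b:] (1 :: mpoly poly)" for b
 have inj: "inj_on \<iota> B" unfolding \<iota>_def by (auto simp: inj_on_def eq_fract)
 have scale: "kscale (Fract p c) (\<iota> b) = Fract (cm p * [:b:]) (cm c)" if "c \<noteq> 0" for p c b
  using that by (simp add: \<iota>_def emb_Fract)
 have comb: "(\<Sum>b\<in>B. kscale (Fract (p b) c) (\<iota> b)) = Fract (\<Sum>b\<in>B. cm (p b) * [:b:]) (cm c)" if "c \<noteq> 0" for p c
  using that by (simp add: scale sum_Fract[OF Bf(1)] cm_eq_0_iff)
 have cf: "coeff (\<Sum>b\<in>B. cm (p b) * [:b:]) i = (\<Sum>b\<in>B. const (coeff (p b) i) * b)" for p i
  by (simp add: coeff_sum coeff_cm mult.commute)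
 have "qbasis kscale (ext (forms r) n) (ext I n) (\<iota> ` B)"
  unfolding qbasis_def
 proof (intro conjI ballI allI impI)
  show "finite (\<iota> ` B)" using Bf by simp
  show "\<iota> ` B \<subseteq> ext (forms r) n" unfolding \<iota>_def using Bf iota_ext[of _ "forms r" n] by auto
 next
  fix v assume "v \<in> ext (forms r) n"
  then obtain F c where *: "v = Fract F (cm c)" "c \<noteq> 0" "\<And>i. coeff F i \<in> forms r n" unfolding ext_def by blast
  have "\<forall>i. \<exists>g. coeff F i - (\<Sum>b\<in>B. const (g b) * b) \<in> I n" using B(1) *(3) unfolding qbasis_def by blast
  hence "\<exists>g. \<forall>i. coeff F i - (\<Sum>b\<in>B. const (g i b) * b) \<in> I n" by (rule choice)
  then obtain g where g: "\<And>i. coeff F i - (\<Sum>b\<in>B. const (g i b) * b) \<in> I n" by blast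
  define p where "p b = (\<Sum>j\<le>degree F. monom (g j b) j)" for b
  have "coeff (F - (\<Sum>b\<in>B. cm (p b) * [:b:])) i \<in> I n" for i
  proof (cases "i \<le> degree F")
   case True thus ?thesis unfolding coeff_diff cf using g[of i] by (simp add: p_def poly_of_coeffs)
  next
   case False
   thus ?thesis unfolding coeff_diff cf
    using S.subspace_0[OF V] by (simp add: p_def poly_of_coeffs coeff_eq_0 const_0)
  qed
  hence "Fract (F - (\<Sum>b\<in>B. cm (p b) * [:b:])) (cm c) \<in> ext I n" using ext_iff[of I n, OF V *(2)] by blast
  moreover have "Fract (F - (\<Sum>b\<in>B. cm (p b) * [:b:])) (cm c) = v - (\<Sum>b\<in>B. kscale (Fract (p b) c) (\<iota> b))"
   unfolding *(1) comb[OF *(2)] using *(2) by (simp add: cm_eq_0_iff eq_fract algebra_simps)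
  moreover have "(\<Sum>b\<in>B. kscale (Fract (p b) c) (\<iota> b)) = (\<Sum>b\<in>\<iota> ` B. kscale (Fract (p (the_inv_into B \<iota> b)) c) b)"
   by (simp add: sum.reindex[OF inj] the_inv_into_f_f[OF inj])
  ultimately show "\<exists>c. v - (\<Sum>b\<in>\<iota> ` B. kscale (c b) b) \<in> ext I n"
   by (intro exI[of _ "\<lambda>b. Fract (p (the_inv_into B \<iota> b)) c"]) simp
 next
  fix \<kappa> b' assume sum: "(\<Sum>b\<in>\<iota> ` B. kscale (\<kappa> b) b) \<in> ext I n" and b': "b' \<in> \<iota> ` B"
  obtain c p where c: "c \<noteq> 0" "\<forall>b\<in>B. \<kappa> (\<iota> b) = Fract (p b) (c :: complex poly)"
   using common_denominator[OF Bf(1), of "\<lambda>b. \<kappa> (\<iota> b)"] by blast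
  have "(\<Sum>b\<in>\<iota> ` B. kscale (\<kappa> b) b) = (\<Sum>b\<in>B. kscale (Fract (p b) c) (\<iota> b))"
   unfolding sum.reindex[OF inj] by (rule sum.cong) (use c in auto)
  hence "Fract (\<Sum>b\<in>B. cm (p b) * [:b:]) (cm c) \<in> ext I n" using sum comb[OF c(1)] by simp
  hence s: "(\<Sum>b\<in>B. const (coeff (p b) i) * b) \<in> I n" for i
   unfolding cf[symmetric] using ext_iff[of I n, OF V c(1)] by blast
  have qb: "\<And>c. (\<Sum>b\<in>B. const (c b) * b) \<in> I n \<Longrightarrow> \<forall>b\<in>B. c b = 0" using B(1) unfolding qbasis_def by blast
  have "coeff (p b) i = 0" if "b \<in> B" for b i using qb[OF s[of i]] that by blast
  hence "p b = 0" if "b \<in> B" for b using that by (intro poly_eqI) simp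
  thus "\<kappa> b' = 0" using b' c by (auto simp: Zero_fract_def eq_fract)
 qed
 hence "qdim kscale (ext (forms r) n) (ext I n) (S.hf r I n)"
  unfolding qdim_def using card_image[OF inj] B(2) by metis
 thus ?thesis by (rule K.hf_eqI[OF ext_gideal[OF I]])
qed

subsection \<open>The generic member of a pencil of hyperplanes\<close>

definition pencil :: "mpoly \<Rightarrow> mpoly \<Rightarrow> kpoly" where "pencil M0 M1 = Fract [:M0, M1:] 1"

lemma pencil_forms: "M0 \<in> forms r 1 \<Longrightarrow> M1 \<in> forms r 1 \<Longrightarrow> pencil M0 M1 \<in> ext (forms r) 1"
proof -
 assume "M0 \<in> forms r 1" "M1 \<in> forms r 1"
 hence "Fract [:M0, M1:] (cm 1) \<in> ext (forms r) 1"
  unfolding ext_def by (intro CollectI exI[of _ "[:M0, M1:]"] exI[of _ 1]) (auto simp: coeff_pCons split: nat.splits)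
 thus ?thesis by (simp add: cm_1 pencil_def)
qed

lemma coeff_pencil_mult: "coeff ([:M0, M1:] * F) i = M0 * coeff F i + (case i of 0 \<Rightarrow> 0 | Suc j \<Rightarrow> M1 * coeff F j)"
 by (simp add: mult_pCons_left coeff_pCons split: nat.splits)

text \<open>Descending induction on the power of \<tau>: coefficient j + 1 of the product is M0
  times coefficient j + 1 of F plus M1 times coefficient j. Once the former is known to lie in I,
  cancelling M1 gives the next lower coefficient.\<close>

lemma pencil_nzd:
 assumes I: "S.gideal r I" and M: "M0 \<in> forms r 1" "M1 \<in> forms r 1"
  and nzd: "\<And>n p. p \<in> forms r n \<Longrightarrow> M1 * p \<in> I (n + 1) \<Longrightarrow> p \<in> I n"
  and a: "a \<in> ext (forms r) n" "pencil M0 M1 * a \<in> ext I (n + 1)"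
 shows "a \<in> ext I n"
proof -
 obtain F c where *: "a = Fract F (cm c)" "c \<noteq> 0" "\<And>i. coeff F i \<in> forms r n" using a(1) unfolding ext_def by blast
 note V = S.gideal_sub[OF I]
 have "Fract ([:M0, M1:] * F) (cm c) \<in> ext I (n + 1)" using a(2) by (simp add: * pencil_def)
 hence co: "coeff ([:M0, M1:] * F) i \<in> I (n + 1)" for i using ext_iff[of I "n + 1", OF V *(2)] by blast
 have "coeff F (Suc (degree F) - k) \<in> I n" if "k \<le> Suc (degree F)" for k
  using that
 proof (induction k)
  case 0 thus ?case using S.subspace_0[OF V] by (simp add: coeff_eq_0)
 next
  case (Suc k)
  define j where "j = Suc (degree F) - Suc k"
  have j: "Suc (degree F) - k = Suc j" using Suc.prems unfolding j_def by simp
  have "M0 * coeff F (Suc j) \<in> I (1 + n)" using Suc j S.gideal_mult[OF I M(1)] by simp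
  hence m0: "M0 * coeff F (Suc j) \<in> I (n + 1)" by (simp add: add.commute)
  have "M1 * coeff F j = coeff ([:M0, M1:] * F) (Suc j) - M0 * coeff F (Suc j)"
   unfolding coeff_pencil_mult by simp
  hence "M1 * coeff F j \<in> I (n + 1)" using S.subspace_diff[OF V co m0] by metis
  thus ?case using nzd *(3) j_def by simp
 qed
 from this[of "Suc (degree F) - _"] have "coeff F i \<in> I n" for i
 proof (cases "i \<le> degree F")
  case True
  thus ?thesis using \<open>\<And>k. k \<le> Suc (degree F) \<Longrightarrow> coeff F (Suc (degree F) - k) \<in> I n\<close>[of "Suc (degree F) - i"] by simp
 next
  case False thus ?thesis using S.subspace_0[OF V] by (simp add: coeff_eq_0)
 qed
 thus ?thesis unfolding * using ext_iff[of I n, OF V *(2)] by blast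
qed

lemma pencil_section_hf:
 assumes I: "S.gideal r I" and M: "M0 \<in> forms r 1" "M1 \<in> forms r 1"
  and nzd: "\<And>n p. p \<in> forms r n \<Longrightarrow> M1 * p \<in> I (n + 1) \<Longrightarrow> p \<in> I n"
 shows "S.hf r I (Suc n) = K.hf r (K.adjoin r (ext I) (pencil M0 M1) 1) (Suc n) + S.hf r I n"
proof -
 let ?L = "pencil M0 M1"
 have L: "?L \<in> ext (forms r) 1" by (rule pencil_forms[OF M])
 have "K.colon r (ext I) ?L 1 = ext I"
 proof
  fix n
  show "K.colon r (ext I) ?L 1 n = ext I n"
   using pencil_nzd[OF I M nzd] K.colon_ge[OF ext_gideal[OF I] L] unfolding K.colon_def le_fun_def by blast
 qed
 thus ?thesis using K.hf_split[OF ext_gideal[OF I] L, of n] hf_ext[OF I] by simp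
qed

section \<open>Substituting the root of the pencil\<close>

lemma Fract_eq_1: "Fract a 1 = Fract b (1::'a::idom) \<longleftrightarrow> a = b"
 by (simp add: eq_fract)

text \<open>Evaluation at \<tau> = - M0 / M1, the value at which M0 + \<tau> M1 vanishes.\<close>

definition pev :: "mpoly \<Rightarrow> mpoly \<Rightarrow> mpoly poly \<Rightarrow> ratfun" where
 "pev M0 M1 F = poly (map_poly (\<lambda>x. Fract x 1) F) (Fract (- M0) M1)"

text \<open>The homogenisation of \<open>F(- M0 / M1)\<close>.\<close>

definition hev :: "mpoly \<Rightarrow> mpoly \<Rightarrow> nat \<Rightarrow> mpoly poly \<Rightarrow> mpoly" where
 "hev M0 M1 m F = (\<Sum>j\<le>m. (- M0) ^ j * M1 ^ (m - j) * coeff F j)"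

lemma Fract_power: "Fract a b ^ k = Fract (a ^ k) (b ^ k)"
 by (induction k) (auto simp: One_fract_def)

lemma pev_mult: "pev M0 M1 (F * G) = pev M0 M1 F * pev M0 M1 G"
proof -
 have z: "Fract 0 1 = (0 :: ratfun)" by (simp add: Zero_fract_def)
 have "map_poly (\<lambda>x. Fract x 1) (F * G) = map_poly (\<lambda>x. Fract x (1::mpoly)) F * map_poly (\<lambda>x. Fract x 1) G"
  by (rule poly_eqI) (simp add: coeff_map_poly coeff_mult z sum_Fract[symmetric])
 thus ?thesis by (simp add: pev_def)
qed

lemma pev_add: "pev M0 M1 (F + G) = pev M0 M1 F + pev M0 M1 G"
proof -
 have z: "Fract 0 1 = (0 :: ratfun)" by (simp add: Zero_fract_def)
 have "map_poly (\<lambda>x. Fract x 1) (F + G) = map_poly (\<lambda>x. Fract x (1::mpoly)) F + map_poly (\<lambda>x. Fract x 1) G"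
  by (rule poly_eqI) (simp add: coeff_map_poly z)
 thus ?thesis by (simp add: pev_def)
qed

lemma pev_pCons: "pev M0 M1 (pCons a F) = Fract a 1 + Fract (- M0) M1 * pev M0 M1 F"
proof -
 have "map_poly (\<lambda>x. Fract x (1::mpoly)) (pCons a F) = pCons (Fract a 1) (map_poly (\<lambda>x. Fract x 1) F)"
  by (rule poly_eqI) (simp add: coeff_map_poly coeff_pCons Zero_fract_def split: nat.splits)
 thus ?thesis by (simp add: pev_def)
qed

lemma pev_0: "pev M0 M1 0 = 0" by (simp add: pev_def)

lemma pev_pencil: "M1 \<noteq> 0 \<Longrightarrow> pev M0 M1 [:M0, M1:] = 0"
 by (simp add: pev_pCons pev_0 Zero_fract_def eq_fract)

lemma hev_pev:
 assumes M: "M1 \<noteq> 0" and d: "degree F \<le> m"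
 shows "Fract (hev M0 M1 m F) 1 = Fract (M1 ^ m) 1 * pev M0 M1 F"
proof -
 have z: "Fract 0 1 = (0 :: ratfun)" by (simp add: Zero_fract_def)
 let ?F = "map_poly (\<lambda>x. Fract x (1::mpoly)) F"
 have "degree ?F \<le> m" using d map_poly_degree_leq[of "\<lambda>x. Fract x 1" F] by linarith
 hence "pev M0 M1 F = (\<Sum>j\<le>m. coeff ?F j * Fract (- M0) M1 ^ j)"
  unfolding pev_def poly_altdef by (intro sum.mono_neutral_left) (auto simp: coeff_eq_0)
 hence "Fract (M1 ^ m) 1 * pev M0 M1 F = (\<Sum>j\<le>m. Fract (M1 ^ m) 1 * (Fract (coeff F j) 1 * Fract ((- M0) ^ j) (M1 ^ j)))"
  by (simp add: sum_distrib_left coeff_map_poly z Fract_power)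
 also have "\<dots> = (\<Sum>j\<le>m. Fract ((- M0) ^ j * M1 ^ (m - j) * coeff F j) 1)"
 proof (intro sum.cong refl)
  fix j assume "j \<in> {..m}"
  hence "M1 ^ m = M1 ^ (m - j) * M1 ^ j" by (simp add: power_add[symmetric])
  thus "Fract (M1 ^ m) 1 * (Fract (coeff F j) 1 * Fract ((- M0) ^ j) (M1 ^ j)) =
    Fract ((- M0) ^ j * M1 ^ (m - j) * coeff F j) 1"
   using M by (simp add: eq_fract)
 qed
 finally show ?thesis by (simp add: hev_def sum_Fract)
qed

lemma Fract_mult1: "Fract (a * b) 1 = Fract a 1 * Fract b (1::'a::idom)"
 by simp

lemma hev_mult:
 assumes "M1 \<noteq> 0" "degree F \<le> m" "degree F' \<le> m'"
 shows "hev M0 M1 (m + m') (F * F') = hev M0 M1 m F * hev M0 M1 m' F'"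
proof -
 have "degree (F * F') \<le> m + m'" using degree_mult_le[of F F'] assms by linarith
 hence "Fract (hev M0 M1 (m + m') (F * F')) 1 = Fract (hev M0 M1 m F * hev M0 M1 m' F') 1"
  unfolding Fract_mult1 hev_pev[OF assms(1,2)] hev_pev[OF assms(1,3)] using hev_pev[OF assms(1), of "F * F'" "m + m'" M0]
  by (simp only: pev_mult power_add Fract_mult1 mult_ac)
 thus ?thesis by (simp only: Fract_eq_1)
qed

lemma forms_uminus: "f \<in> forms r d \<Longrightarrow> - f \<in> forms r d"
 by (rule S.subspace_neg[OF forms_subspace])

lemma hev_forms:
 assumes "M0 \<in> forms r 1" "M1 \<in> forms r 1" "\<And>i. coeff F i \<in> forms r n"
 shows "hev M0 M1 m F \<in> forms r (n + m)"
 unfolding hev_def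
proof (rule S.subspace_sum[OF forms_subspace])
 fix j assume j: "j \<in> {..m}"
 have "(- M0) ^ j * M1 ^ (m - j) * coeff F j \<in> forms r (j + (m - j) + n)"
  using assms by (intro forms_mult S.G_power1 forms_uminus)
 thus "(- M0) ^ j * M1 ^ (m - j) * coeff F j \<in> forms r (n + m)" using j by (simp add: add.commute)
qed

text \<open>\<open>hD\<close> says that a hyperplane section of the surface D has Hilbert polynomial
  s n + c, so c is 1 minus the sectional genus. The conditions on M1 and M0 make M1, M0 a regular
  sequence on D in large degrees.\<close>

locale generic_pencil =
 fixes r :: nat and D :: "nat \<Rightarrow> mpoly set" and M0 M1 :: mpoly and s :: nat and c :: int
 assumes D: "S.relevant r D" and s: "s \<ge> 1"
  and hD: "\<forall>\<^sub>F n in sequentially. int (S.hf r D (Suc n)) - int (S.hf r D n) = int s * int (Suc n) + c"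
  and M: "M0 \<in> forms r 1" "M1 \<in> forms r 1" and M1: "M1 \<notin> D 1"
  and M0: "S.almost_nzd r (S.adjoin r D M1 1) M0 1"
begin

abbreviation L where "L \<equiv> pencil M0 M1"

definition J :: "nat \<Rightarrow> kpoly set" where "J = K.adjoin r (ext D) L 1"

definition \<Gamma> :: "nat \<Rightarrow> kpoly set" where "\<Gamma> = K.sat r J"

lemma gp: "S.gprime r D" using D unfolding S.relevant_def by blast
lemma gD: "S.gideal r D" using S.gprime_gideal[OF gp] .
lemma geD: "K.gideal r (ext D)" by (rule ext_gideal[OF gD])
lemma L: "L \<in> ext (forms r) 1" by (rule pencil_forms[OF M])
lemma gJ: "K.gideal r J" unfolding J_def by (rule K.adjoin_gideal[OF geD L])
lemma s\<Gamma>: "K.saturated r \<Gamma>" unfolding \<Gamma>_def by (rule K.sat_sat[OF gJ])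
lemma g\<Gamma>: "K.gideal r \<Gamma>" unfolding \<Gamma>_def by (rule K.sat_gideal[OF gJ])
lemma J_le: "J \<le> \<Gamma>" unfolding \<Gamma>_def by (rule K.sat_ge[OF gJ])

lemma nzdD: "p \<in> forms r n \<Longrightarrow> M1 * p \<in> D (n + 1) \<Longrightarrow> p \<in> D n"
 using S.gprimeD[OF gp M(2), of p n] M1 by (simp add: add.commute)

lemma M1_nonzero: "M1 \<noteq> 0" using M1 S.gideal_0[OF gD] by auto

lemma hf_\<Gamma>: "\<forall>\<^sub>F n in sequentially. int (K.hf r \<Gamma> n) = int s * int n + c"
proof -
 have "\<forall>\<^sub>F n in sequentially. int (K.hf r J (n + 1)) = int s * int (n + 1) + c"
  using hD
 proof eventually_elim
  case (elim n)
  have "int (S.hf r D (Suc n)) = int (K.hf r J (Suc n)) + int (S.hf r D n)"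
   using pencil_section_hf[OF gD M nzdD, of n] unfolding J_def by linarith
  thus ?case using elim by simp
 qed
 hence "\<forall>\<^sub>F n in sequentially. int (K.hf r J n) = int s * int n + c"
  by (rule eventually_unshift[of "\<lambda>n. int (K.hf r J n) = int s * int n + c"])
 with K.hf_sat[OF gJ] show ?thesis unfolding \<Gamma>_def by eventually_elim simp
qed

lemma M1_K: "Fract [:M1:] 1 \<in> ext (forms r) 1" using M(2) by (intro iota_ext) auto

text \<open>An exchange in a regular sequence. From M1 a = e + L b one finds that b is d + M1 b2
  with d in the ideal of D, because modulo M1 the pencil is M0. Then M1 (a - L b2) lies in the ideal
  of D, where M1 can be cancelled.\<close>

lemma M1_nzd_J: "K.almost_nzd r J (Fract [:M1:] 1) 1"
proof -
 let ?A = "S.adjoin r D M1 1"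
 have gA: "S.gideal r ?A" by (rule S.adjoin_gideal[OF gD M(2)])
 have sA: "S.saturated r (S.sat r ?A)" by (rule S.sat_sat[OF gA])
 have gsA: "S.gideal r (S.sat r ?A)" by (rule S.sat_gideal[OF gA])
 obtain N where N: "\<And>n. n \<ge> N \<Longrightarrow> S.sat r ?A n = ?A n" using S.sat_eventually[OF gA] by blast
 obtain N' where N': "\<And>n p. n \<ge> N' \<Longrightarrow> p \<in> forms r n \<Longrightarrow> M0 * p \<in> ?A (n + 1) \<Longrightarrow> p \<in> ?A n"
  using M0 unfolding S.almost_nzd_def by blast
 have "a \<in> J n" if n: "n \<ge> Suc N'" and a: "a \<in> ext (forms r) n" and Ma: "Fract [:M1:] 1 * a \<in> J (n + 1)" for n a
 proof -
  obtain e b where eb: "Fract [:M1:] 1 * a = e + L * b" "e \<in> ext D (n + 1)" "b \<in> ext (forms r) n"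
   using Ma K.adjoin_D unfolding J_def by blast
  obtain F c0 where F: "a = Fract F (cm c0)" "c0 \<noteq> 0" "\<And>i. coeff F i \<in> forms r n"
   using a unfolding ext_def by blast
  obtain B c2 where B: "b = Fract B (cm c2)" "c2 \<noteq> 0" "\<And>i. coeff B i \<in> forms r n"
   using eb(3) unfolding ext_def by blast
  have "coeff ([:M1:] * F) i \<in> ?A (n + 1)" for i
   using S.adjoin_mult[OF gD F(3)[of i], of M1 1] by simp
  hence "Fract ([:M1:] * F) (cm c0) \<in> ext ?A (n + 1)"
   using ext_iff[of ?A "n + 1", OF S.gideal_sub[OF gA] F(2)] by blast
  hence "Fract [:M1:] 1 * a \<in> ext ?A (n + 1)" unfolding F by simp
  moreover have "e \<in> ext ?A (n + 1)" using eb(2) ext_mono[OF S.adjoin_ge[of D r M1 1]] by (auto simp: le_fun_def)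
  ultimately have "Fract [:M1:] 1 * a - e \<in> ext ?A (n + 1)"
   by (rule KV.subspace_diff[OF ext_subspace[of ?A "n + 1", OF S.gideal_sub[OF gA]]])
  hence "L * b \<in> ext ?A (n + 1)" using eb(1) by simp
  hence "Fract ([:M0, M1:] * B) (cm c2) \<in> ext ?A (n + 1)" unfolding B pencil_def by simp
  hence co: "coeff ([:M0, M1:] * B) i \<in> ?A (n + 1)" for i
   using ext_iff[of ?A "n + 1", OF S.gideal_sub[OF gA] B(2)] by blast
  \<comment> \<open>The \<tau>-coefficients of L b are M0 times those of b up to multiples of M1,
    and M0 is cancelled modulo D + M1.\<close>
  have "coeff B i \<in> ?A n" for i
  proof -
   have "(case i of 0 \<Rightarrow> 0 | Suc j \<Rightarrow> M1 * coeff B j) \<in> ?A (n + 1)"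
    using S.adjoin_mult[OF gD B(3)[of "i - 1"], of M1 1] S.gideal_0[OF gA] by (auto split: nat.splits)
   hence "coeff ([:M0, M1:] * B) i - (case i of 0 \<Rightarrow> 0 | Suc j \<Rightarrow> M1 * coeff B j) \<in> ?A (n + 1)"
    by (rule S.subspace_diff[OF S.gideal_sub[OF gA] co])
   hence "M0 * coeff B i \<in> ?A (n + 1)" unfolding coeff_pencil_mult by simp
   thus ?thesis using N' n B(3) by simp
  qed
  obtain k where k: "n = k + 1" using n by (metis Suc_eq_plus1 Suc_le_D)
  have "\<forall>i. \<exists>d q. coeff B i = d + M1 * q \<and> d \<in> D n \<and> q \<in> forms r k"
   using \<open>\<And>i. coeff B i \<in> ?A n\<close> S.adjoin_D[of _ r D M1 1 k] unfolding k by blast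
  then obtain d q where dq: "\<And>i. coeff B i = d i + M1 * q i" "\<And>i. d i \<in> D n" "\<And>i. q i \<in> forms r k" by metis
  define B1 where "B1 = (\<Sum>j\<le>degree B. monom (d j) j)"
  define B2 where "B2 = (\<Sum>j\<le>degree B. monom (q j) j)"
  have "coeff B i = coeff (B1 + [:M1:] * B2) i" for i
   using dq(1)[of i] coeff_eq_0[of B i] by (cases "i \<le> degree B") (simp_all add: B1_def B2_def poly_of_coeffs)
  hence B12: "B = B1 + [:M1:] * B2" by (rule poly_eqI)
  define b1 where "b1 = Fract B1 (cm c2)"
  define b2 where "b2 = Fract B2 (cm c2)"
  have b1: "b1 \<in> ext D n"
   unfolding b1_def ext_iff[of D n, OF S.gideal_sub[OF gD] B(2)] B1_def poly_of_coeffs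
   using dq(2) S.gideal_0[OF gD] by simp
  have b2: "b2 \<in> ext (forms r) k"
   unfolding b2_def ext_iff[of "forms r" k, OF forms_subspace B(2)] B2_def poly_of_coeffs using dq(3) by simp
  have be: "b = b1 + Fract [:M1:] 1 * b2"
   unfolding B B12 b1_def b2_def using B(2) by (simp add: cm_eq_0_iff eq_fract algebra_simps)
  have Lb1: "L * b1 \<in> ext D (n + 1)" using K.gideal_mult[OF geD L b1] by simp
  have Lb2: "L * b2 \<in> ext (forms r) n" using K.G_mult[OF L b2] unfolding k by simp
  have "Fract [:M1:] 1 * (a - L * b2) = e + L * b1" using eb(1) unfolding be by (simp add: algebra_simps)
  hence mem: "Fract [:M1:] 1 * (a - L * b2) \<in> ext D (n + 1)" using K.gideal_add[OF geD eb(2) Lb1] by simp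
  have "a - L * b2 \<in> ext (forms r) n" by (rule KV.subspace_diff[OF K.G_sub a Lb2])
  then obtain H c3 where H: "a - L * b2 = Fract H (cm c3)" "c3 \<noteq> 0" "\<And>i. coeff H i \<in> forms r n"
   unfolding ext_def by blast
  have "Fract ([:M1:] * H) (cm c3) \<in> ext D (n + 1)" using mem unfolding H by simp
  hence "coeff ([:M1:] * H) i \<in> D (n + 1)" for i
   using ext_iff[of D "n + 1", OF S.gideal_sub[OF gD] H(2)] by blast
  hence "M1 * coeff H i \<in> D (n + 1)" for i by simp
  hence "coeff H i \<in> D n" for i using nzdD H(3) by blast
  hence "a - L * b2 \<in> ext D n" unfolding H using ext_iff[of D n, OF S.gideal_sub[OF gD] H(2)] by blast
  hence 1: "a - L * b2 \<in> J n" using K.adjoin_ge[of "ext D" r L 1] unfolding J_def by (auto simp: le_fun_def)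
  have 2: "L * b2 \<in> J n" using K.adjoin_mult[OF geD b2, of L 1] unfolding J_def k by simp
  show ?thesis using K.gideal_add[OF gJ 1 2] by simp
 qed
 thus ?thesis unfolding K.almost_nzd_def by blast
qed

lemma M1_nzd: assumes "a \<in> ext (forms r) n" "Fract [:M1:] 1 * a \<in> \<Gamma> (n + 1)" shows "a \<in> \<Gamma> n"
proof -
 obtain N where N: "\<And>n. n \<ge> N \<Longrightarrow> \<Gamma> n = J n" using K.sat_eventually[OF gJ] unfolding \<Gamma>_def by blast
 obtain N' where N': "\<And>n p. n \<ge> N' \<Longrightarrow> p \<in> ext (forms r) n \<Longrightarrow> Fract [:M1:] 1 * p \<in> J (n + 1) \<Longrightarrow> p \<in> J n"
  using M1_nzd_J unfolding K.almost_nzd_def by blast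
 have "K.almost_nzd r \<Gamma> (Fract [:M1:] 1) 1"
  unfolding K.almost_nzd_def using N N' by (intro exI[of _ "max N N'"]) auto
 thus ?thesis using K.saturated_nzd[OF s\<Gamma> M1_K] assms by blast
qed

lemma M1_power_nzd:
 "a \<in> ext (forms r) n \<Longrightarrow> Fract [:M1 ^ k:] 1 * a \<in> \<Gamma> (n + k) \<Longrightarrow> a \<in> \<Gamma> n"
proof (induction k)
 case 0 thus ?case by (simp add: one_pCons[symmetric] One_fract_def[symmetric])
next
 case (Suc k)
 have e: "Fract [:M1 ^ Suc k:] 1 = Fract [:M1:] 1 * Fract [:M1 ^ k:] 1" by (simp add: mult.commute)
 have "Fract [:M1 ^ k:] 1 \<in> ext (forms r) k" using S.G_power1[OF M(2)] by (intro iota_ext) auto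
 hence "Fract [:M1 ^ k:] 1 * a \<in> ext (forms r) (n + k)" using K.G_mult Suc.prems(1) by (metis add.commute)
 moreover have "Fract [:M1:] 1 * (Fract [:M1 ^ k:] 1 * a) \<in> \<Gamma> (n + k + 1)"
  using Suc.prems(2) unfolding e by (simp only: mult.assoc add_Suc_right Suc_eq_plus1 add.assoc)
 ultimately have "Fract [:M1 ^ k:] 1 * a \<in> \<Gamma> (n + k)" by (rule M1_nzd)
 thus ?case using Suc by blast
qed

text \<open>Modulo the pencil, M1 \<tau> = - M0, so each power of \<tau> is traded for one of the m
  available factors M1.\<close>

lemma substitute_monom:
 "j \<le> m \<Longrightarrow> f \<in> forms r n \<Longrightarrow>
  Fract (monom (M1 ^ m * f) j) 1 - Fract [:(- M0) ^ j * M1 ^ (m - j) * f:] 1 \<in> J (n + m)"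
proof (induction j arbitrary: m f n)
 case 0
 have "monom (M1 ^ m * f) 0 = [:(- M0) ^ 0 * M1 ^ (m - 0) * f:]" by (simp add: monom_0)
 thus ?case using K.gideal_0[OF gJ] by simp
next
 case (Suc j)
 then obtain m' where m': "m = Suc m'" by (cases m) auto
 define f' where "f' = - M0 * f"
 have f': "f' \<in> forms r (Suc n)" unfolding f'_def using forms_mult[OF forms_uminus[OF M(1)] Suc.prems(2)] by simp
 have IH: "Fract (monom (M1 ^ m' * f') j) 1 - Fract [:(- M0) ^ j * M1 ^ (m' - j) * f':] 1 \<in> J (Suc n + m')"
  using Suc.IH[of m' f' "Suc n"] Suc.prems m' f' by simp
 have g: "M1 ^ m' * f \<in> forms r (m' + n)" by (rule forms_mult[OF S.G_power1[OF M(2)] Suc.prems(2)])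
 have "\<And>i. coeff (monom (M1 ^ m' * f) j) i \<in> forms r (m' + n)" using g by (simp add: coeff_monom)
 hence "Fract (monom (M1 ^ m' * f) j) (cm 1) \<in> ext (forms r) (m' + n)"
  using ext_iff[of "forms r" "m' + n" 1, OF forms_subspace] by simp
 hence "L * Fract (monom (M1 ^ m' * f) j) 1 \<in> J (m' + n + 1)"
  unfolding J_def cm_1 by (rule K.adjoin_mult[OF geD])
 moreover have "m' + n + 1 = n + m" "Suc n + m' = n + m" using m' by auto
 ultimately have a: "L * Fract (monom (M1 ^ m' * f) j) 1 +
   (Fract (monom (M1 ^ m' * f') j) 1 - Fract [:(- M0) ^ j * M1 ^ (m' - j) * f':] 1) \<in> J (n + m)"
  using K.gideal_add[OF gJ] IH by metis
 have b: "L * Fract (monom (M1 ^ m' * f) j) 1 + Fract (monom (M1 ^ m' * f') j) 1 = Fract (monom (M1 ^ m * f) (Suc j)) 1"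
 proof -
  have "[:M0, M1:] * monom (M1 ^ m' * f) j + monom (M1 ^ m' * f') j = monom (M1 ^ m * f) (Suc j)"
   by (simp add: mult_pCons_left f'_def m' smult_monom monom_Suc add_monom algebra_simps)
  thus ?thesis unfolding pencil_def by simp
 qed
 have c: "(- M0) ^ j * M1 ^ (m' - j) * f' = (- M0) ^ Suc j * M1 ^ (m - Suc j) * f"
  unfolding f'_def m' by simp
 show ?case using a unfolding add_diff_eq b c .
qed

text \<open>Multiplication by M1^m makes F congruent to its homogenised value at the root of the
  pencil, and M1 is a nonzerodivisor modulo \<Gamma>. With the converse
  \<open>in_\<Gamma>_D\<close>, membership in \<Gamma> becomes membership in D.\<close>

lemma in_\<Gamma>_if:
 assumes F: "\<And>i. coeff F i \<in> forms r n" and m: "degree F \<le> m" and h: "hev M0 M1 m F \<in> D (n + m)"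
 shows "Fract F 1 \<in> \<Gamma> n"
proof (rule M1_power_nzd)
 have "Fract F (cm 1) \<in> ext (forms r) n" using F ext_iff[of "forms r" n 1, OF forms_subspace] by simp
 thus "Fract F 1 \<in> ext (forms r) n" by (simp add: cm_1)
 have mono: "[:M1 ^ m:] * F = (\<Sum>j\<le>m. monom (M1 ^ m * coeff F j) j)"
  by (rule poly_eqI) (use m in \<open>auto simp: poly_of_coeffs coeff_eq_0\<close>)
 have he: "[:hev M0 M1 m F:] = (\<Sum>j\<le>m. [:(- M0) ^ j * M1 ^ (m - j) * coeff F j:])"
  unfolding hev_def by (rule poly_eqI) (simp add: coeff_sum coeff_pCons split: nat.splits)
 have "(\<Sum>j\<le>m. Fract (monom (M1 ^ m * coeff F j) j) 1 - Fract [:(- M0) ^ j * M1 ^ (m - j) * coeff F j:] 1) \<in> J (n + m)"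
  using substitute_monom F by (intro KV.subspace_sum[OF K.gideal_sub[OF gJ]]) auto
 hence 1: "Fract ([:M1 ^ m:] * F) 1 - Fract [:hev M0 M1 m F:] 1 \<in> J (n + m)"
  unfolding mono he by (simp add: sum_subtractf sum_Fract)
 have "Fract [:hev M0 M1 m F:] 1 \<in> ext D (n + m)" using h S.gideal_0[OF gD] by (intro iota_ext)
 hence 2: "Fract [:hev M0 M1 m F:] 1 \<in> J (n + m)"
  using K.adjoin_ge[of "ext D" r L 1] unfolding J_def by (auto simp: le_fun_def)
 have "Fract ([:M1 ^ m:] * F) 1 \<in> J (n + m)"
  using K.gideal_add[OF gJ 1 2] unfolding diff_add_cancel .
 thus "Fract [:M1 ^ m:] 1 * Fract F 1 \<in> \<Gamma> (n + m)" using J_le by (auto simp: le_fun_def)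
qed

text \<open>Otherwise a nonzero scalar, hence 1, would lie in \<Gamma>, and the Hilbert polynomial s
  n + c of \<Gamma> would vanish although s >= 1.\<close>

lemma hev_scalar: assumes "c0 \<noteq> 0" "degree c0 \<le> m" shows "hev M0 M1 m (cm c0) \<notin> D m"
proof
 assume h: "hev M0 M1 m (cm c0) \<in> D m"
 have "Fract (cm c0) 1 \<in> \<Gamma> 0"
 proof (rule in_\<Gamma>_if)
  show "coeff (cm c0) i \<in> forms r 0" for i unfolding coeff_cm by (rule const_forms)
  show "degree (cm c0) \<le> m" unfolding cm_def using map_poly_degree_leq[of const c0] assms(2) by linarith
  show "hev M0 M1 m (cm c0) \<in> D (0 + m)" using h by simp
 qed
 hence "kscale (Fract 1 c0) (Fract (cm c0) 1) \<in> \<Gamma> 0" by (rule K.gideal_scale[OF g\<Gamma>])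
 moreover have "kscale (Fract 1 c0) (Fract (cm c0) 1) = 1"
  using assms(1) by (simp add: emb_Fract cm_1 One_fract_def eq_fract cm_eq_0_iff)
 ultimately have "\<Gamma> = ext (forms r)" using K.gideal_top[OF g\<Gamma>] by simp
 hence "K.hf r \<Gamma> n = 0" for n using K.hf_G by simp
 then obtain N where N: "\<And>n. n \<ge> N \<Longrightarrow> int s * int n + c = 0"
  using hf_\<Gamma> unfolding eventually_sequentially by auto
 have "int s * int (Suc N) + c - (int s * int N + c) = 0" using N[of N] N[of "Suc N"] by simp
 thus False using s by (simp add: algebra_simps)
qed

lemma ungr_D: "f \<in> forms r n \<Longrightarrow> f \<in> ungr r D \<longleftrightarrow> f \<in> D n"
 using fun_cong[OF gr_ungr[OF gD], of n] S.gideal_G[OF gD] unfolding gr_def by blast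

text \<open>Clearing denominators and substituting the root of the pencil removes the multiple of L
  and leaves an element of D. The factors accompanying the value of F are a power of a variable,
  values of nonzero scalars and powers of M1, all outside the prime D.\<close>

lemma in_\<Gamma>_D:
 assumes F: "\<And>i. coeff F i \<in> forms r n" and m: "degree F \<le> m" and c0: "c0 \<noteq> 0" and a: "Fract F (cm c0) \<in> \<Gamma> n"
 shows "hev M0 M1 m F \<in> D (n + m)"
proof -
 obtain i where i: "i \<le> r" "var i \<notin> D 1" using S.relevant_X[OF D] by blast
 obtain k0 where "\<forall>g\<in>ext (forms r) k0. g * Fract F (cm c0) \<in> J (k0 + n)"
  using a unfolding \<Gamma>_def K.sat_def by blast
 hence k: "\<forall>g\<in>ext (forms r) (Suc k0). g * Fract F (cm c0) \<in> J (Suc k0 + n)"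
  by (rule K.sat_mono_exponent[OF gJ]) simp
 \<comment> \<open>A power of a variable outside D undoes the saturation and can be cancelled modulo
   D at the end.\<close>
 define v where "v = var i ^ Suc k0"
 have v: "v \<in> forms r (Suc k0)" unfolding v_def by (rule S.G_power1[OF var_forms[OF i(1)]])
 have "Fract [:v:] 1 * Fract F (cm c0) \<in> J (k0 + n + 1)"
  using bspec[OF k, of "Fract [:v:] 1"] iota_ext[of v "forms r" "Suc k0"] v by (simp del: mult_fract)
 then obtain e b where eb: "Fract [:v:] 1 * Fract F (cm c0) = e + L * b" "e \<in> ext D (k0 + n + 1)" "b \<in> ext (forms r) (k0 + n)"
  using K.adjoin_D unfolding J_def by blast
 obtain E c1 where E: "e = Fract E (cm c1)" "c1 \<noteq> 0" "\<And>i. coeff E i \<in> D (k0 + n + 1)"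
  using eb(2) unfolding ext_def by blast
 obtain B c2 where B: "b = Fract B (cm c2)" "c2 \<noteq> 0" "\<And>i. coeff B i \<in> forms r (k0 + n)"
  using eb(3) unfolding ext_def by blast
 have "Fract ([:v:] * F) (cm c0) = Fract (E * cm c2 + [:M0, M1:] * B * cm c1) (cm c1 * cm c2)"
  using eb(1) E(2) B(2) unfolding E(1) B(1) pencil_def by (simp add: cm_eq_0_iff del: mult_pCons_left)
 hence eq: "[:v:] * F * (cm c1 * cm c2) = (E * cm c2 + [:M0, M1:] * B * cm c1) * cm c0"
  using E(2) B(2) c0 by (simp add: cm_eq_0_iff eq_fract del: mult_pCons_left)
 note M10 = M1_nonzero
 define u where "u = pev M0 M1"
 have u: "Fract v 1 * u F * (u (cm c1) * u (cm c2)) = u E * u (cm c2) * u (cm c0)"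
  using arg_cong[OF eq, of u] unfolding u_def pev_mult pev_add pev_pencil[OF M10] by (simp add: pev_pCons pev_0)
 define h where "h G = hev M0 M1 (degree G) G" for G
 have hu: "Fract (h G) 1 = Fract (M1 ^ degree G) 1 * u G" for G
  unfolding h_def u_def by (rule hev_pev[OF M10 order_refl])
 have hFu: "Fract (hev M0 M1 m F) 1 = Fract (M1 ^ m) 1 * u F"
  unfolding u_def by (rule hev_pev[OF M10 m])
 let ?w = "\<lambda>G. M1 ^ degree G"
 have "Fract (v * hev M0 M1 m F * (h (cm c1) * h (cm c2)) * (?w E * ?w (cm c2) * ?w (cm c0))) 1 =
   (Fract v 1 * u F * (u (cm c1) * u (cm c2))) *
   Fract (M1 ^ m * ?w (cm c1) * ?w (cm c2) * (?w E * ?w (cm c2) * ?w (cm c0))) 1"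
  unfolding Fract_mult1 hu hFu by (simp only: mult_ac)
 also have "\<dots> = Fract (h E * (h (cm c2) * h (cm c0)) * (M1 ^ m * ?w (cm c1) * ?w (cm c2))) 1"
  unfolding u Fract_mult1 hu by (simp only: mult_ac)
 finally have key: "v * hev M0 M1 m F * (h (cm c1) * h (cm c2)) * (?w E * ?w (cm c2) * ?w (cm c0)) =
   h E * (h (cm c2) * h (cm c0)) * (M1 ^ m * ?w (cm c1) * ?w (cm c2))"
  by (simp only: Fract_eq_1)
 let ?P = "ungr r D"
 have P: "homogeneous_prime r ?P" by (rule ungr_prime[OF gp])
 hence hP: "homogeneous_ideal r ?P" unfolding homogeneous_prime_def by blast
 have prime: "p \<in> polys r \<Longrightarrow> q \<in> polys r \<Longrightarrow> p * q \<in> ?P \<Longrightarrow> p \<in> ?P \<or> q \<in> ?P" for p q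
  using P unfolding homogeneous_prime_def by blast
 have pol: "x \<in> forms r n \<Longrightarrow> x \<in> polys r" for x n using forms_polys by blast
 have w: "M1 ^ k \<in> polys r" "M1 ^ k \<notin> ?P" for k
  using S.G_power1[OF M(2), of k] S.gprime_power[OF gp M(2) M1, of k] ungr_D pol by blast+
 have vp: "v \<in> polys r" "v \<notin> ?P"
  using v S.gprime_power[OF gp var_forms[OF i(1)] i(2), of "Suc k0"] ungr_D[OF v] pol unfolding v_def by blast+
 have cf: "h (cm d) \<in> forms r (degree (cm d))" for d
  unfolding h_def using hev_forms[OF M, of "cm d" 0 "degree (cm d)"] const_forms by (simp add: coeff_cm)
 have dc: "degree (cm d) = degree d" for d
  unfolding cm_def by (rule degree_map_poly) (simp add: const_eq_0_iff)
 have hc: "h (cm d) \<in> polys r" "d \<noteq> 0 \<Longrightarrow> h (cm d) \<notin> ?P" for d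
  using cf[of d] pol ungr_D[OF cf[of d]] hev_scalar[of d "degree d"] unfolding h_def dc by auto
 have hEf: "h E \<in> D (k0 + n + 1 + degree E)"
  unfolding h_def hev_def
 proof (rule S.subspace_sum[OF S.gideal_sub[OF gD]])
  fix j assume j: "j \<in> {..degree E}"
  have "(- M0) ^ j * M1 ^ (degree E - j) \<in> forms r (j + (degree E - j))"
   by (intro forms_mult S.G_power1 forms_uminus M)
  thus "(- M0) ^ j * M1 ^ (degree E - j) * coeff E j \<in> D (k0 + n + 1 + degree E)"
   using S.gideal_mult[OF gD _ E(3)[of j]] j by (simp add: add.commute)
 qed
 hence hEP: "h E \<in> ?P" using ungr_D[OF S.gideal_G[OF gD hEf]] by blast
 have Fp: "hev M0 M1 m F \<in> forms r (n + m)" by (rule hev_forms[OF M F])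
 have "(h (cm c2) * h (cm c0)) * (M1 ^ m * ?w (cm c1) * ?w (cm c2)) \<in> polys r"
  by (intro polys_mult hc(1) w(1))
 hence "(h (cm c2) * h (cm c0)) * (M1 ^ m * ?w (cm c1) * ?w (cm c2)) * h E \<in> ?P"
  using hP hEP unfolding homogeneous_ideal_def by blast
 hence "v * hev M0 M1 m F * (h (cm c1) * h (cm c2)) * (?w E * ?w (cm c2) * ?w (cm c0)) \<in> ?P"
  unfolding key by (simp only: mult_ac)
 hence "hev M0 M1 m F \<in> ?P"
  using prime[OF polys_mult[OF polys_mult[OF vp(1) pol[OF Fp]] polys_mult[OF hc(1) hc(1)]] polys_mult[OF polys_mult[OF w(1) w(1)] w(1)]]
   prime[OF polys_mult[OF w(1) w(1)] w(1)] prime[OF w(1) w(1)] prime[OF polys_mult[OF vp(1) pol[OF Fp]] polys_mult[OF hc(1) hc(1)]]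
   prime[OF vp(1) pol[OF Fp]] prime[OF hc(1) hc(1)] w(2) vp(2) hc(2)[OF E(2)] hc(2)[OF B(2)] by blast
 thus ?thesis using ungr_D[OF Fp] by blast
qed

text \<open>The homogenised evaluation \<open>hev\<close> is multiplicative and tests membership in
  \<Gamma> by membership in D, so primality is pulled back from D.\<close>

lemma \<Gamma>_prime: "K.gprime r \<Gamma>"
proof -
 have "\<Gamma> \<noteq> ext (forms r)"
 proof
  assume "\<Gamma> = ext (forms r)"
  hence "Fract 1 (cm 1) \<in> \<Gamma> 0" using K.G_one[of r] by (simp add: cm_1 One_fract_def)
  hence "hev M0 M1 0 (cm 1) \<in> D (0 + 0)"
   unfolding cm_1 by (intro in_\<Gamma>_D[of 1 0 0 1]) (auto simp: coeff_1 one_forms cm_1)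
  thus False using hev_scalar[of 1 0] by simp
 qed
 moreover have "a \<in> \<Gamma> n \<or> b \<in> \<Gamma> n'"
  if a: "a \<in> ext (forms r) n" and b: "b \<in> ext (forms r) n'" and ab: "a * b \<in> \<Gamma> (n + n')" for a b n n'
 proof -
  obtain F c1 where F: "a = Fract F (cm c1)" "c1 \<noteq> 0" "\<And>i. coeff F i \<in> forms r n" using a unfolding ext_def by blast
  obtain H c2 where H: "b = Fract H (cm c2)" "c2 \<noteq> 0" "\<And>i. coeff H i \<in> forms r n'" using b unfolding ext_def by blast
  have "a * b = Fract (F * H) (cm (c1 * c2))" using F H by (simp add: cm_mult)
  hence "hev M0 M1 (degree F + degree H) (F * H) \<in> D (n + n' + (degree F + degree H))"
   using ab F H coeffs_forms_mult[of F "forms r" n H "forms r" n' "forms r"] forms_subspace forms_mult degree_mult_le[of F H]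
   by (intro in_\<Gamma>_D[of _ _ _ "c1 * c2"]) auto
  hence "hev M0 M1 (degree F) F * hev M0 M1 (degree H) H \<in> D ((n + degree F) + (n' + degree H))"
   using hev_mult[OF M1_nonzero order_refl order_refl, of M0 F H] by (simp add: algebra_simps)
  hence "hev M0 M1 (degree F) F \<in> D (n + degree F) \<or> hev M0 M1 (degree H) H \<in> D (n' + degree H)"
   using S.gprimeD[OF gp hev_forms[OF M F(3)] hev_forms[OF M H(3)]] by blast
  moreover have "Fract F (cm c) = kscale (Fract 1 c) (Fract F 1)" if "c \<noteq> 0" for F c
   using that by (simp add: emb_Fract cm_1)
  ultimately show ?thesis
   using in_\<Gamma>_if[OF F(3) order_refl] in_\<Gamma>_if[OF H(3) order_refl] K.gideal_scale[OF g\<Gamma>] F(1,2) H(1,2) by metis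
 qed
 ultimately show ?thesis unfolding K.gprime_def using g\<Gamma> by blast
qed

lemma section_bounds: "c \<le> int s" "0 \<le> int s * (int s - 3) + 2 * c"
 using K.curve_const_le[OF \<Gamma>_prime s\<Gamma> hf_\<Gamma> s] K.curve_const_ge[OF \<Gamma>_prime s\<Gamma> hf_\<Gamma> s] by auto

text \<open>The values of the Hilbert function of the generic hyperplane section telescope to the
  one of E. Saturating the section to Z can only lower them, and for Z the sum is bounded from below
  by \<open>sum_hf_section\<close>; comparison with e N + \<chi> gives the claim.\<close>

lemma curve_bound:
 assumes E: "S.saturated r E" "D \<le> E"
  and e: "\<forall>\<^sub>F n in sequentially. int (S.hf r E n) = int e * int n + \<chi>" "e \<ge> 1"
  and nzd: "S.almost_nzd r E M1 1"
 shows "real_of_int \<chi> \<ge> 1 - ((real e)\<^sup>2 / (2 * s) - real e / 2 - real_of_int c * e / s + 3 / 2 * real s ^ 4)"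
proof -
 have gE: "S.gideal r E" using E(1) unfolding S.saturated_def by blast
 have nzdE: "p \<in> forms r n \<Longrightarrow> M1 * p \<in> E (n + 1) \<Longrightarrow> p \<in> E n" for n p
  by (rule S.saturated_nzd[OF E(1) M(2) nzd])
 define A where "A = K.adjoin r (ext E) L 1"
 have gA: "K.gideal r A" unfolding A_def by (rule K.adjoin_gideal[OF ext_gideal[OF gE] L])
 have inc: "S.hf r E (Suc n) = K.hf r A (Suc n) + S.hf r E n" for n
  unfolding A_def by (rule pencil_section_hf[OF gE M nzdE])
 have "A 0 = ext E 0" unfolding A_def by (rule K.adjoin_low) simp
 hence h0: "K.hf r A 0 = S.hf r E 0" using K.hf_cong[of A 0 "ext E" r] hf_ext[OF gE] by simp
 have sumA: "(\<Sum>n\<le>N. K.hf r A n) = S.hf r E N" for N by (induction N) (use h0 inc in auto)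
 define Z where "Z = K.sat r A"
 have sZ: "K.saturated r Z" unfolding Z_def by (rule K.sat_sat[OF gA])
 have gZ: "K.gideal r Z" unfolding Z_def by (rule K.sat_gideal[OF gA])
 have "J \<le> A" unfolding J_def
  by (rule K.adjoin_least[OF gA]) (use ext_mono[OF E(2)] K.adjoin_ge[of "ext E" r L 1] K.adjoin_mem[OF ext_gideal[OF gE], of L 1]
    in \<open>auto simp: A_def intro: order_trans\<close>)
 hence \<Gamma>Z: "\<Gamma> \<le> Z" unfolding \<Gamma>_def Z_def by (rule K.sat_mono)
 have "\<forall>\<^sub>F n in sequentially. K.hf r A (n + 1) = e"
  using e(1) eventually_shift[OF e(1), of 1]
 proof eventually_elim
  case (elim n)
  have "int (S.hf r E (n + 1)) = int (K.hf r A (n + 1)) + int (S.hf r E n)" using inc[of n] by simp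
  hence "int (K.hf r A (n + 1)) = int e" using elim by (simp add: algebra_simps)
  thus ?case by presburger
 qed
 hence "\<forall>\<^sub>F n in sequentially. K.hf r A n = e"
  by (rule eventually_unshift[of "\<lambda>n. K.hf r A n = e"])
 with K.hf_sat[OF gA] have hZ: "\<forall>\<^sub>F n in sequentially. K.hf r Z n = e" unfolding Z_def by eventually_elim simp
 have "\<forall>\<^sub>F N in sequentially. real_of_int \<chi> \<ge> 1 - ((real e)\<^sup>2 / (2 * s) - real e / 2 - real_of_int c * e / s + 3 / 2 * real s ^ 4)"
  using K.sum_hf_section[OF \<Gamma>_prime s\<Gamma> hf_\<Gamma> s sZ \<Gamma>Z hZ e(2)] e(1)
 proof eventually_elim
  case (elim N)
  have "(\<Sum>n\<le>N. K.hf r Z n) \<le> (\<Sum>n\<le>N. K.hf r A n)"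
   unfolding Z_def by (intro sum_mono K.hf_mono[OF gA K.sat_gideal[OF gA] K.sat_ge[OF gA]])
  hence "real (\<Sum>n\<le>N. K.hf r Z n) \<le> real (S.hf r E N)" unfolding sumA by (rule of_nat_mono)
  moreover have "real (S.hf r E N) = real e * real N + real_of_int \<chi>"
   using arg_cong[OF elim(2), of real_of_int] by simp
  ultimately show ?case using elim(1) by linarith
 qed
 thus ?thesis by (auto simp: eventually_sequentially)
qed

end

section \<open>Curves on an integral surface\<close>

lemma generic_pencil_exists:
 assumes D: "S.relevant r D" and s: "s \<ge> 1"
  and hD: "\<forall>\<^sub>F n in sequentially. int (S.hf r D (Suc n)) - int (S.hf r D n) = int s * int (Suc n) + c"
  and E: "S.gideal r E"
 shows "\<exists>M0 M1. generic_pencil r D M0 M1 s c \<and> S.almost_nzd r E M1 1"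
proof -
 have gp: "S.gprime r D" using D unfolding S.relevant_def by blast
 have gD: "S.gideal r D" using S.gprime_gideal[OF gp] .
 obtain M1 where M1: "M1 \<in> forms r 1" "S.almost_nzd r D M1 1" "S.almost_nzd r E M1 1"
  using S.linear_nzd_exists[of "{D, E}" r] gD E by auto
 have M1D: "M1 \<notin> D 1"
 proof
  assume m: "M1 \<in> D 1"
  obtain N where N: "\<And>n p. n \<ge> N \<Longrightarrow> p \<in> forms r n \<Longrightarrow> M1 * p \<in> D (n + 1) \<Longrightarrow> p \<in> D n"
   using M1(2) unfolding S.almost_nzd_def by blast
  obtain i where i: "i \<le> r" "var i \<notin> D 1" using S.relevant_X[OF D] by blast
  have f: "var i ^ N \<in> forms r N" by (rule S.G_power1[OF var_forms[OF i(1)]])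
  have "M1 * var i ^ N \<in> D (N + 1)" using S.gideal_mult'[OF gD m f] by (simp add: add.commute)
  thus False using N[OF order_refl f] S.gprime_power[OF gp var_forms[OF i(1)] i(2), of N] by blast
 qed
 obtain M0 where M0: "M0 \<in> forms r 1" "S.almost_nzd r (S.adjoin r D M1 1) M0 1"
  using S.linear_nzd_exists[of "{S.adjoin r D M1 1}" r] S.adjoin_gideal[OF gD M1(1)] by auto
 have "generic_pencil r D M0 M1 s c"
  by unfold_locales (use D s hD M0 M1 M1D in auto)
 thus ?thesis using M1(3) by blast
qed

lemma curve_on_surface:
 assumes D: "S.relevant r D" and s: "s \<ge> 1"
  and hD: "\<forall>\<^sub>F n in sequentially. int (S.hf r D (Suc n)) - int (S.hf r D n) = int s * int (Suc n) + c"
  and E: "S.saturated r E" "D \<le> E" and e: "\<forall>\<^sub>F n in sequentially. int (S.hf r E n) = int e * int n + \<chi>"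
 shows "real_of_int \<chi> \<ge> 1 - ((real e)\<^sup>2 / (2 * s) - real e / 2 - real_of_int c * e / s + 3 / 2 * real s ^ 4)"
proof (cases "e \<ge> 1")
 case True
 have "S.gideal r E" using E(1) unfolding S.saturated_def by blast
 then obtain M0 M1 where M: "generic_pencil r D M0 M1 s c" "S.almost_nzd r E M1 1"
  using generic_pencil_exists[OF D s hD] by blast
 show ?thesis by (rule generic_pencil.curve_bound[OF M(1) E e True M(2)])
next
 case False
 \<comment> \<open>In this degenerate case \<chi> is a value of a Hilbert function, hence
   nonnegative, while the claimed lower bound 1 - 3/2 s^4 is negative.\<close>
 hence "e = 0" by simp
 from e have "\<forall>\<^sub>F n in sequentially. \<chi> \<ge> 0"
 proof eventually_elim
  case (elim n) thus ?case using \<open>e = 0\<close> by (metis add_0 mult_zero_left of_nat_0 of_nat_0_le_iff)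
 qed
 hence "real_of_int \<chi> \<ge> 0" by (auto simp: eventually_sequentially)
 moreover have "real s ^ 4 \<ge> 1" using s by simp
 ultimately show ?thesis using \<open>e = 0\<close> by simp
qed

lemma surface_section_bounds:
 assumes D: "S.relevant r D" and s: "s \<ge> 1"
  and hD: "\<forall>\<^sub>F n in sequentially. int (S.hf r D (Suc n)) - int (S.hf r D n) = int s * int (Suc n) + c"
 shows "c \<le> int s" "0 \<le> int s * (int s - 3) + 2 * c"
proof -
 obtain M0 M1 where "generic_pencil r D M0 M1 s c"
  using generic_pencil_exists[OF assms S.G_gideal] by blast
 thus "c \<le> int s" "0 \<le> int s * (int s - 3) + 2 * c" by (rule generic_pencil.section_bounds)+
qed

section \<open>Cech cohomology\<close>

subsection \<open>Sections over basic open sets\<close>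

lemma gr_polys: "gr r (polys r) = forms r"
 using forms_polys by (auto simp: gr_def fun_eq_iff)

lemma forms_degree_unique: "h \<in> forms r d \<Longrightarrow> h \<in> forms r e \<Longrightarrow> h \<noteq> 0 \<Longrightarrow> d = e"
 using hom_component_of_form[of h r d d] hom_component_of_form[of h r e d] by (auto split: if_splits)

lemma sections_iff:
 assumes h: "h \<in> forms r d" "h \<noteq> 0"
 shows "x \<in> sections r I h \<longleftrightarrow> (\<exists>a k. a \<in> gr r I (k * d) \<and> x = frac a (h ^ k))"
proof
 assume "x \<in> sections r I h"
 then obtain a k e where *: "x = frac a (h ^ k)" "h \<in> forms r e" "a \<in> I" "a \<in> forms r (k * e)"
  unfolding sections_def by blast
 have "e = d" using forms_degree_unique[OF *(2) h(1) h(2)] .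
 thus "\<exists>a k. a \<in> gr r I (k * d) \<and> x = frac a (h ^ k)" using * unfolding gr_def by blast
qed (use h in \<open>auto simp: sections_def gr_def\<close>)

lemma sections_raise:
 assumes I: "S.gideal r (gr r I)" and h: "h \<in> forms r d" "h \<noteq> 0" and a: "a \<in> gr r I (k * d)" and le: "k \<le> m"
 shows "\<exists>b. b \<in> gr r I (m * d) \<and> frac a (h ^ k) = frac b (h ^ m)"
proof -
 obtain j where j: "m = k + j" using le le_Suc_ex by blast
 have "a * h ^ j \<in> gr r I (k * d + j * d)" by (rule S.gideal_mult'[OF I a S.G_power[OF h(1)]])
 hence "a * h ^ j \<in> gr r I (m * d)" by (simp add: j distrib_right)
 moreover have "frac a (h ^ k) = frac (a * h ^ j) (h ^ m)" using h(2) by (simp add: eq_fract j power_add)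
 ultimately show ?thesis by blast
qed

lemma sections_frac_iff:
 assumes I: "S.gideal r (gr r I)" and h: "h \<in> forms r d" "h \<noteq> 0" and a: "a \<in> forms r (k * d)"
 shows "frac a (h ^ k) \<in> sections r I h \<longleftrightarrow> (\<exists>m. h ^ m * a \<in> gr r I (m * d + k * d))"
proof
 assume "frac a (h ^ k) \<in> sections r I h"
 then obtain b j where b: "b \<in> gr r I (j * d)" "frac a (h ^ k) = frac b (h ^ j)" using sections_iff[OF h] by blast
 hence "a * h ^ j = b * h ^ k" using h(2) by (simp add: eq_fract)
 hence "h ^ j * a = b * h ^ k" by (simp add: mult.commute)
 moreover have "b * h ^ k \<in> gr r I (j * d + k * d)" by (rule S.gideal_mult'[OF I b(1) S.G_power[OF h(1)]])
 ultimately show "\<exists>m. h ^ m * a \<in> gr r I (m * d + k * d)" by metis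
next
 assume "\<exists>m. h ^ m * a \<in> gr r I (m * d + k * d)"
 then obtain m where m: "h ^ m * a \<in> gr r I ((m + k) * d)" by (auto simp: distrib_right)
 have "frac a (h ^ k) = frac (h ^ m * a) (h ^ (m + k))" using h(2) by (simp add: eq_fract power_add)
 thus "frac a (h ^ k) \<in> sections r I h" using sections_iff[OF h] m by blast
qed

definition fscale :: "complex \<Rightarrow> ratfun \<Rightarrow> ratfun" where "fscale z x = frac (const z) 1 * x"

lemma fscale_vector_space: "vector_space fscale"
 unfolding fscale_def
 by unfold_locales (simp_all add: distrib_left distrib_right[symmetric] const_add const_mult const_1 One_fract_def[symmetric] mult.assoc[symmetric])

interpretation FV: vector_space fscale by (rule fscale_vector_space)

lemma frac_add_same: "b \<noteq> 0 \<Longrightarrow> frac x b + frac y b = frac (x + y) b"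
 by (simp add: eq_fract algebra_simps)

lemma sections_subspace:
 assumes I: "S.gideal r (gr r I)" and h: "h \<in> forms r d" "h \<noteq> 0"
 shows "FV.subspace (sections r I h)"
proof (rule FV.subspaceI)
 show "0 \<in> sections r I h"
  unfolding sections_iff[OF h] using S.gideal_0[OF I] by (intro exI[of _ 0] exI[of _ 0]) (simp add: Zero_fract_def)
next
 fix x y assume "x \<in> sections r I h" "y \<in> sections r I h"
 then obtain a k b l where *: "a \<in> gr r I (k * d)" "x = frac a (h ^ k)" "b \<in> gr r I (l * d)" "y = frac b (h ^ l)"
  unfolding sections_iff[OF h] by blast
 obtain a' b' where "a' \<in> gr r I (max k l * d)" "x = frac a' (h ^ max k l)" "b' \<in> gr r I (max k l * d)" "y = frac b' (h ^ max k l)"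
  using sections_raise[OF I h *(1), of "max k l"] sections_raise[OF I h *(3), of "max k l"] * by auto
 thus "x + y \<in> sections r I h" unfolding sections_iff[OF h]
  using S.gideal_add[OF I] frac_add_same h(2) by (metis power_not_zero)
next
 fix z x assume "x \<in> sections r I h"
 then obtain a k where *: "a \<in> gr r I (k * d)" "x = frac a (h ^ k)" unfolding sections_iff[OF h] by blast
 thus "fscale z x \<in> sections r I h" unfolding sections_iff[OF h]
  using S.gideal_scale[OF I *(1), of z] by (intro exI[of _ "const z * a"] exI[of _ k]) (simp add: fscale_def)
qed

lemma polys_gideal: "S.gideal r (gr r (polys r))" unfolding gr_polys by (rule S.G_gideal)

lemma sections_mult:
 assumes I: "S.gideal r (gr r I)" and h: "h \<in> forms r d" "h \<noteq> 0"
  and x: "x \<in> sections r (polys r) h" and y: "y \<in> sections r I h"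
 shows "x * y \<in> sections r I h"
proof -
 obtain a k b l where *: "a \<in> forms r (k * d)" "x = frac a (h ^ k)" "b \<in> gr r I (l * d)" "y = frac b (h ^ l)"
  using x y unfolding sections_iff[OF h] gr_polys by blast
 have "a * b \<in> gr r I (k * d + l * d)" by (rule S.gideal_mult[OF I *(1,3)])
 hence "a * b \<in> gr r I ((k + l) * d)" by (simp add: distrib_right)
 moreover have "x * y = frac (a * b) (h ^ (k + l))" using * by (simp add: power_add)
 ultimately show ?thesis unfolding sections_iff[OF h] by blast
qed

lemma sections_mono:
 assumes I: "S.gideal r (gr r I)" and h: "h \<in> forms r d" "h \<noteq> 0" and g: "g \<in> forms r e" "g \<noteq> 0"
 shows "sections r I h \<subseteq> sections r I (h * g)"
proof
 fix x assume "x \<in> sections r I h"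
 then obtain a k where *: "a \<in> gr r I (k * d)" "x = frac a (h ^ k)" unfolding sections_iff[OF h] by blast
 have hg: "h * g \<in> forms r (d + e)" "h * g \<noteq> 0" using forms_mult[OF h(1) g(1)] h g by auto
 have "a * g ^ k \<in> gr r I (k * d + k * e)" by (rule S.gideal_mult'[OF I *(1) S.G_power[OF g(1)]])
 hence "a * g ^ k \<in> gr r I (k * (d + e))" by (simp add: distrib_left)
 moreover have "x = frac (a * g ^ k) ((h * g) ^ k)" using * h g by (simp add: eq_fract power_mult_distrib)
 ultimately show "x \<in> sections r I (h * g)" unfolding sections_iff[OF hg] by blast
qed

lemma sections_subset: "S.gideal r (gr r I) \<Longrightarrow> h \<in> forms r d \<Longrightarrow> h \<noteq> 0 \<Longrightarrow> sections r I h \<subseteq> sections r (polys r) h"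
 using S.gideal_subset[of r "gr r I"] by (auto simp: sections_iff gr_polys) blast

lemma sections_one: assumes "h \<in> forms r d" "h \<noteq> 0" shows "1 \<in> sections r (polys r) h"
 unfolding sections_iff[OF assms] gr_polys
 using one_forms[of r] by (intro exI[of _ 1] exI[of _ 0]) (simp add: One_fract_def)

subsection \<open>Adding an open set to a cover\<close>

definition csign :: "nat \<Rightarrow> nat set \<Rightarrow> ratfun" where "csign j J = (- 1) ^ card {i \<in> J. i < j}"

lemma csign_sq: "csign j J * csign j J = 1"
 unfolding csign_def by (simp add: power_add[symmetric] mult_2[symmetric])

lemma csign_insert_self: "csign j (insert j J) = csign j J"
 unfolding csign_def by (rule arg_cong[of _ _ "\<lambda>A. (- 1) ^ card A"]) auto

lemma csign_remove_self: "csign j (J - {j}) = csign j J"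
 unfolding csign_def by (rule arg_cong[of _ _ "\<lambda>A. (- 1) ^ card A"]) auto

lemma csign_insert: assumes "finite J" "a \<notin> J" shows "csign i (insert a J) = (if a < i then - csign i J else csign i J)"
proof (cases "a < i")
 case True
 hence "{k \<in> insert a J. k < i} = insert a {k \<in> J. k < i}" by auto
 thus ?thesis using assms True unfolding csign_def by simp
next
 case False
 hence "{k \<in> insert a J. k < i} = {k \<in> J. k < i}" by auto
 thus ?thesis using False unfolding csign_def by simp
qed

lemma csign_swap:
 assumes "finite J" "i \<in> J" "a \<notin> J"
 shows "csign i (insert a J) * csign a J = - (csign i J * csign a (J - {i}))"
proof -
 have "csign a J = csign a (insert i (J - {i}))" using assms by (simp add: insert_absorb)
 also have "\<dots> = (if i < a then - csign a (J - {i}) else csign a (J - {i}))" using assms by (intro csign_insert) auto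
 finally have 1: "csign a J = \<dots>" .
 have "a \<noteq> i" using assms by blast
 thus ?thesis unfolding csign_insert[OF assms(1,3)] 1 by auto
qed

lemma cech_differential_csign: "cech_differential c J = (\<Sum>j\<in>J. csign j J * c (J - {j}))"
 unfolding cech_differential_def csign_def ..

lemma cech_differential_insert:
 assumes "finite J" "a \<notin> J"
 shows "cech_differential c (insert a J) = csign a J * c J + (\<Sum>i\<in>J. csign i (insert a J) * c (insert a (J - {i})))"
proof -
 have "insert a J - {i} = insert a (J - {i})" if "i \<in> J" for i using assms that by auto
 thus ?thesis using assms
  by (simp add: cech_differential_csign csign_insert_self sum.insert)
qed

text \<open>A coefficient system of subspaces \<open>N J \<subseteq> M J\<close> of the function field. The condition \<open>partition\<close> for an
 index \<open>a\<close> and a set \<open>A\<close> expresses that the open sets with indices in \<open>A\<close> cover the one with index \<open>a\<close>.\<close>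

locale cech_system =
 fixes M N :: "nat set \<Rightarrow> ratfun set" and U :: "nat set"
 assumes U: "finite U"
  and M_sub: "J \<subseteq> U \<Longrightarrow> J \<noteq> {} \<Longrightarrow> FV.subspace (M J)"
  and N_sub: "J \<subseteq> U \<Longrightarrow> J \<noteq> {} \<Longrightarrow> FV.subspace (N J)"
  and NM: "J \<subseteq> U \<Longrightarrow> J \<noteq> {} \<Longrightarrow> N J \<subseteq> M J"
  and M_mono: "J \<subseteq> J' \<Longrightarrow> J' \<subseteq> U \<Longrightarrow> J \<noteq> {} \<Longrightarrow> M J \<subseteq> M J'"
  and N_mono: "J \<subseteq> J' \<Longrightarrow> J' \<subseteq> U \<Longrightarrow> J \<noteq> {} \<Longrightarrow> N J \<subseteq> N J'"
  and MN: "J \<subseteq> U \<Longrightarrow> J \<noteq> {} \<Longrightarrow> x \<in> M J \<Longrightarrow> y \<in> N J \<Longrightarrow> x * y \<in> N J"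
begin

text \<open>A partition of unity subordinate to the sets in A, modulo functions vanishing on the
  scheme. It is chosen after a finite set F of sections, since the powers needed to clear poles
  depend on them.\<close>

definition partition :: "nat \<Rightarrow> nat set \<Rightarrow> bool" where
 "partition a A \<longleftrightarrow> (\<forall>F. finite F \<longrightarrow> (\<exists>\<rho>. (\<Sum>j\<in>A. \<rho> j) - 1 \<in> N {a} \<and>
   (\<forall>x\<in>F. \<forall>j\<in>A. \<forall>J. a \<in> J \<longrightarrow> J \<subseteq> insert a A \<longrightarrow>
    (x \<in> M (insert j J) \<longrightarrow> \<rho> j * x \<in> M J) \<and> (x \<in> N (insert j J) \<longrightarrow> \<rho> j * x \<in> N J))))"

definition cochains :: "nat set \<Rightarrow> nat \<Rightarrow> (nat set \<Rightarrow> ratfun) set" where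
 "cochains A p = {c. \<forall>J. if J \<subseteq> A \<and> card J = p + 1 then c J \<in> M J else c J = 0}"

definition cocycles :: "nat set \<Rightarrow> nat \<Rightarrow> (nat set \<Rightarrow> ratfun) set" where
 "cocycles A p = {c \<in> cochains A p. \<forall>J. J \<subseteq> A \<and> card J = p + 2 \<longrightarrow> cech_differential c J \<in> N J}"

definition coboundaries :: "nat set \<Rightarrow> nat \<Rightarrow> (nat set \<Rightarrow> ratfun) set" where
 "coboundaries A p = {c \<in> cochains A p. \<exists>b \<in> (if p = 0 then {0} else cochains A (p - 1)).
   \<forall>J. J \<subseteq> A \<and> card J = p + 1 \<longrightarrow> c J - cech_differential b J \<in> N J}"

lemma csign_mem: "FV.subspace V \<Longrightarrow> x \<in> V \<Longrightarrow> csign j J * x \<in> V"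
 using FV.subspace_neg[of V x] unfolding csign_def by (cases "even (card {i \<in> J. i < j})") auto

text \<open>The augmented complex of the open set a, covered by its intersections with the sets in
  A, is exact. A set J stands for \<open>insert a J\<close>, with J = {} allowed, so p is a
  cardinality. The partition of unity provides the contracting homotopy.\<close>

lemma acyclic:
 assumes aA: "insert a A \<subseteq> U" "a \<notin> A" and part: "partition a A"
  and c: "\<And>J. J \<subseteq> A \<Longrightarrow> card J = p \<Longrightarrow> c J \<in> M (insert a J)"
  and dc: "\<And>J. J \<subseteq> A \<Longrightarrow> card J = Suc p \<Longrightarrow> cech_differential c J \<in> N (insert a J)"
 shows "\<exists>b. (\<forall>J. J \<subseteq> A \<longrightarrow> Suc (card J) = p \<longrightarrow> b J \<in> M (insert a J)) \<and>
  (\<forall>J. J \<subseteq> A \<longrightarrow> card J = p \<longrightarrow> c J - cech_differential b J \<in> N (insert a J))"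
proof -
 have fA: "finite A" by (rule finite_subset[OF _ U]) (use aA(1) in blast)
 define F where "F = c ` Pow A \<union> cech_differential c ` Pow A"
 have fF: "finite F" unfolding F_def using fA by simp
 obtain \<rho> where \<rho>1: "(\<Sum>j\<in>A. \<rho> j) - 1 \<in> N {a}"
  and \<rho>2: "\<forall>x\<in>F. \<forall>j\<in>A. \<forall>J. a \<in> J \<longrightarrow> J \<subseteq> insert a A \<longrightarrow>
    (x \<in> M (insert j J) \<longrightarrow> \<rho> j * x \<in> M J) \<and> (x \<in> N (insert j J) \<longrightarrow> \<rho> j * x \<in> N J)"
  using part[unfolded partition_def, THEN spec, THEN mp, OF fF] by (elim exE conjE) (rule that)
 have \<rho>M: "\<rho> j * c K \<in> M (insert a J)" if "j \<in> A" "J \<subseteq> A" "K \<subseteq> A" "c K \<in> M (insert j (insert a J))" for j J K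
  using \<rho>2[rule_format, of "c K" j "insert a J"] that unfolding F_def by blast
 have \<rho>N: "\<rho> j * cech_differential c K \<in> N (insert a J)"
  if "j \<in> A" "J \<subseteq> A" "K \<subseteq> A" "cech_differential c K \<in> N (insert j (insert a J))" for j J K
  using \<rho>2[rule_format, of "cech_differential c K" j "insert a J"] that unfolding F_def by blast
 \<comment> \<open>The homotopy: a weighted sum over all ways to enlarge J by an index j, where
   \<rho> j removes the poles along the chart j.\<close>
 define b where "b J = (\<Sum>j\<in>A - J. \<rho> j * (csign j J * c (insert j J)))" for J
 have bM: "b J \<in> M (insert a J)" if J: "J \<subseteq> A" "Suc (card J) = p" for J
 proof -
  have sub: "FV.subspace (M (insert a J))" using J aA by (intro M_sub) auto
  show ?thesis unfolding b_def
  proof (rule FV.subspace_sum[OF sub])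
   fix j assume j: "j \<in> A - J"
   have "finite J" by (rule finite_subset[OF J(1) fA])
   hence "c (insert j J) \<in> M (insert a (insert j J))" using c[of "insert j J"] j J by auto
   hence "\<rho> j * c (insert j J) \<in> M (insert a J)" using \<rho>M[of j J "insert j J"] j J by (simp add: insert_commute)
   thus "\<rho> j * (csign j J * c (insert j J)) \<in> M (insert a J)"
    unfolding mult.left_commute[of "\<rho> j"] by (rule csign_mem[OF sub])
  qed
 qed
 have "c J - cech_differential b J \<in> N (insert a J)" if J: "J \<subseteq> A" "card J = p" for J
 proof -
  have fJ: "finite J" by (rule finite_subset[OF J(1) fA])
  have iU: "insert a J \<subseteq> U" using J aA by auto
  have subN: "FV.subspace (N (insert a J))" using iU by (intro N_sub) auto
  have b': "b (J - {i}) = \<rho> i * (csign i J * c J) + (\<Sum>j\<in>A - J. \<rho> j * (csign j (J - {i}) * c (insert j (J - {i}))))"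
   if i: "i \<in> J" for i
  proof -
   have "A - (J - {i}) = insert i (A - J)" using i J by auto
   moreover have "insert i (J - {i}) = J" using i by auto
   ultimately show ?thesis unfolding b_def using i fA by (simp add: csign_remove_self)
  qed
  have "cech_differential b J = (\<Sum>i\<in>J. csign i J * (\<rho> i * (csign i J * c J))) +
    (\<Sum>i\<in>J. \<Sum>j\<in>A - J. csign i J * (\<rho> j * (csign j (J - {i}) * c (insert j (J - {i})))))"
   unfolding cech_differential_csign by (simp add: b' distrib_left sum.distrib sum_distrib_left)
  moreover have "(\<Sum>i\<in>J. csign i J * (\<rho> i * (csign i J * c J))) = (\<Sum>i\<in>J. \<rho> i) * c J"
  proof -
   have "csign i J * (\<rho> i * (csign i J * c J)) = (csign i J * csign i J) * (\<rho> i * c J)" for i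
    by (simp only: mult_ac)
   hence "csign i J * (\<rho> i * (csign i J * c J)) = \<rho> i * c J" for i by (simp only: csign_sq mult_1)
   thus ?thesis by (simp only: sum_distrib_right)
  qed
  moreover have "(\<Sum>i\<in>J. \<Sum>j\<in>A - J. csign i J * (\<rho> j * (csign j (J - {i}) * c (insert j (J - {i}))))) =
    (\<Sum>j\<in>A - J. \<rho> j * (\<Sum>i\<in>J. csign i J * csign j (J - {i}) * c (insert j (J - {i}))))"
   by (subst sum.swap) (simp add: sum_distrib_left mult_ac)
  \<comment> \<open>In the differential of c on \<open>insert j J\<close>, the face omitting j is c
    J and the other faces are, by \<open>csign_swap\<close>, the inner sum up to sign.\<close>
  moreover have t: "\<rho> j * (\<Sum>i\<in>J. csign i J * csign j (J - {i}) * c (insert j (J - {i}))) =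
    \<rho> j * c J - csign j J * (\<rho> j * cech_differential c (insert j J))" if j: "j \<in> A - J" for j
  proof -
   have "csign j J * cech_differential c (insert j J) = c J +
     (\<Sum>i\<in>J. csign i (insert j J) * csign j J * c (insert j (J - {i})))"
    using csign_sq[of j J] j
    by (simp add: cech_differential_insert[OF fJ] distrib_left sum_distrib_left mult.assoc[symmetric] mult.commute[of "csign j J" "csign _ (insert j J)"])
   also have "\<dots> = c J - (\<Sum>i\<in>J. csign i J * csign j (J - {i}) * c (insert j (J - {i})))"
    using csign_swap[OF fJ _, of _ j] j by (simp add: sum_negf)
   finally have "(\<Sum>i\<in>J. csign i J * csign j (J - {i}) * c (insert j (J - {i}))) =
     c J - csign j J * cech_differential c (insert j J)" by simp
   thus ?thesis by (simp only: right_diff_distrib mult.left_commute[of "\<rho> j"])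
  qed
  moreover have "(\<Sum>j\<in>A - J. \<rho> j * (\<Sum>i\<in>J. csign i J * csign j (J - {i}) * c (insert j (J - {i})))) =
    (\<Sum>j\<in>A - J. \<rho> j * c J - csign j J * (\<rho> j * cech_differential c (insert j J)))"
   by (intro sum.cong refl t)
  ultimately have "cech_differential b J = (\<Sum>i\<in>J. \<rho> i) * c J + (\<Sum>j\<in>A - J. \<rho> j * c J - csign j J * (\<rho> j * cech_differential c (insert j J)))"
   by simp
  also have "\<dots> = (\<Sum>j\<in>A. \<rho> j) * c J - (\<Sum>j\<in>A - J. csign j J * (\<rho> j * cech_differential c (insert j J)))"
   using J fA by (subst sum.subset_diff[OF J(1) fA]) (simp add: sum_subtractf sum_distrib_right distrib_right)
  finally have e: "c J - cech_differential b J =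
    (\<Sum>j\<in>A - J. csign j J * (\<rho> j * cech_differential c (insert j J))) - ((\<Sum>j\<in>A. \<rho> j) - 1) * c J"
   by (simp add: algebra_simps)
  have "(\<Sum>j\<in>A - J. csign j J * (\<rho> j * cech_differential c (insert j J))) \<in> N (insert a J)"
  proof (rule FV.subspace_sum[OF subN])
   fix j assume j: "j \<in> A - J"
   have "cech_differential c (insert j J) \<in> N (insert a (insert j J))" using dc[of "insert j J"] j J fJ by auto
   hence "\<rho> j * cech_differential c (insert j J) \<in> N (insert a J)"
    using \<rho>N[of j J "insert j J"] j J by (simp add: insert_commute)
   thus "csign j J * (\<rho> j * cech_differential c (insert j J)) \<in> N (insert a J)" by (rule csign_mem[OF subN])
  qed
  moreover have "((\<Sum>j\<in>A. \<rho> j) - 1) * c J \<in> N (insert a J)"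
  proof -
   have "(\<Sum>j\<in>A. \<rho> j) - 1 \<in> N (insert a J)" using N_mono[of "{a}" "insert a J"] \<rho>1 iU by blast
   hence "c J * ((\<Sum>j\<in>A. \<rho> j) - 1) \<in> N (insert a J)" by (intro MN[OF iU _ c[OF J]]) simp_all
   thus ?thesis unfolding mult.commute[of "c J"] .
  qed
  ultimately show ?thesis unfolding e by (rule FV.subspace_diff[OF subN])
 qed
 thus ?thesis using bM by blast
qed

lemma cech_differential_cong: "(\<And>j. j \<in> J \<Longrightarrow> c (J - {j}) = c' (J - {j})) \<Longrightarrow> cech_differential c J = cech_differential c' J"
 unfolding cech_differential_csign by (intro sum.cong) auto

lemma cech_differential_add: "cech_differential (\<lambda>J. c J + c' J) J = cech_differential c J + cech_differential c' J"
 unfolding cech_differential_csign by (simp add: distrib_left sum.distrib)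

lemma cech_differential_scale: "cech_differential (\<lambda>J. fscale z (c J)) J = fscale z (cech_differential c J)"
 unfolding cech_differential_csign fscale_def by (simp add: sum_distrib_left mult.left_commute)

definition restr :: "nat set \<Rightarrow> (nat set \<Rightarrow> ratfun) \<Rightarrow> nat set \<Rightarrow> ratfun" where
 "restr A c J = (if J \<subseteq> A then c J else 0)"

lemma restr_cochains: "c \<in> cochains A' p \<Longrightarrow> A \<subseteq> A' \<Longrightarrow> restr A c \<in> cochains A p"
 unfolding cochains_def restr_def by (auto split: if_splits)

lemma restr_differential: "J \<subseteq> A \<Longrightarrow> cech_differential (restr A c) J = cech_differential c J"
 by (rule cech_differential_cong) (auto simp: restr_def)

lemma restr_cocycles:
 assumes c: "c \<in> cocycles A' p" and A: "A \<subseteq> A'"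
 shows "restr A c \<in> cocycles A p"
 unfolding cocycles_def
proof (intro CollectI conjI allI impI)
 show "restr A c \<in> cochains A p" using c A restr_cochains unfolding cocycles_def by blast
 fix J assume J: "J \<subseteq> A \<and> card J = p + 2"
 hence "cech_differential c J \<in> N J" using c A unfolding cocycles_def by auto
 thus "cech_differential (restr A c) J \<in> N J" using J restr_differential[of J A c] by simp
qed

lemma cochains_D: "c \<in> cochains A p \<Longrightarrow> J \<subseteq> A \<Longrightarrow> card J = p + 1 \<Longrightarrow> c J \<in> M J"
 unfolding cochains_def by (metis (mono_tags, lifting) mem_Collect_eq)

lemma cochains_0: "c \<in> cochains A p \<Longrightarrow> \<not> (J \<subseteq> A \<and> card J = p + 1) \<Longrightarrow> c J = 0"
 unfolding cochains_def by (metis (mono_tags, lifting) mem_Collect_eq)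

lemma cochains_I: "(\<And>J. J \<subseteq> A \<Longrightarrow> card J = p + 1 \<Longrightarrow> c J \<in> M J) \<Longrightarrow>
  (\<And>J. \<not> (J \<subseteq> A \<and> card J = p + 1) \<Longrightarrow> c J = 0) \<Longrightarrow> c \<in> cochains A p"
 unfolding cochains_def by auto

context
 fixes a A
 assumes aA: "insert a A \<subseteq> U" "a \<notin> A" and part: "partition a A"
begin

lemma fA: "finite A" by (rule finite_subset[OF _ U]) (use aA(1) in blast)

lemma subset_cases:
 assumes "J \<subseteq> insert a A"
 obtains "J \<subseteq> A" | K where "J = insert a K" "K \<subseteq> A" "a \<notin> K" "finite K"
proof (cases "a \<in> J")
 case True
 hence "J = insert a (J - {a})" "J - {a} \<subseteq> A" using assms by auto
 moreover have "finite (J - {a})" by (rule finite_subset[OF calculation(2) fA])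
 ultimately show ?thesis using that(2)[of "J - {a}"] by blast
qed (use assms that in blast)

text \<open>Up to signs, the complex of \<open>insert a A\<close> is the mapping cone of the
  restriction of the complex of A to the open set a; this is its component over a.\<close>

lemma differential_over_a:
 assumes K: "K \<subseteq> A"
 shows "cech_differential c (insert a K) = csign a K * (c K - cech_differential (\<lambda>J. csign a J * c (insert a J)) K)"
proof -
 have fK: "finite K" "a \<notin> K" using finite_subset[OF K fA] K aA(2) by blast+
 have e: "csign i (insert a K) * c (insert a (K - {i})) = - (csign a K * (csign i K * (csign a (K - {i}) * c (insert a (K - {i})))))"
  if i: "i \<in> K" for i
 proof -
  have "csign i (insert a K) = (csign a K * csign a K) * csign i (insert a K)" by (simp add: csign_sq)
  also have "\<dots> = csign a K * (csign i (insert a K) * csign a K)" by (simp only: mult_ac)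
  also have "\<dots> = - (csign a K * (csign i K * csign a (K - {i})))" using csign_swap[OF fK(1) i fK(2)] by simp
  finally show ?thesis by (simp add: mult.assoc)
 qed
 show ?thesis unfolding cech_differential_insert[OF fK] using e
  by (simp add: right_diff_distrib cech_differential_csign sum_distrib_left sum_negf)
qed

text \<open>Restricted to the open set a, the cocycle c is a coboundary by \<open>acyclic\<close>. A
  primitive y supplies the missing values on the index sets that contain a.\<close>

lemma cocycle_extend:
 assumes c: "c \<in> cocycles A p"
 shows "\<exists>c'\<in>cocycles (insert a A) p. restr A c' = c"
proof -
 have cc: "c \<in> cochains A p" and dc: "\<And>J. J \<subseteq> A \<Longrightarrow> card J = p + 2 \<Longrightarrow> cech_differential c J \<in> N J"
  using c unfolding cocycles_def by auto
 have M': "c J \<in> M (insert a J)" if J: "J \<subseteq> A" "card J = Suc p" for J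
 proof -
  have "J \<noteq> {}" using J by auto
  hence "M J \<subseteq> M (insert a J)" using J aA by (intro M_mono) auto
  thus ?thesis using cochains_D[OF cc] J by auto
 qed
 have N': "cech_differential c J \<in> N (insert a J)" if J: "J \<subseteq> A" "card J = Suc (Suc p)" for J
 proof -
  have "J \<noteq> {}" using J by auto
  hence "N J \<subseteq> N (insert a J)" using J aA by (intro N_mono) auto
  thus ?thesis using dc J by auto
 qed
 obtain y where y: "\<And>J. J \<subseteq> A \<Longrightarrow> Suc (card J) = Suc p \<Longrightarrow> y J \<in> M (insert a J)"
  "\<And>J. J \<subseteq> A \<Longrightarrow> card J = Suc p \<Longrightarrow> c J - cech_differential y J \<in> N (insert a J)"
  using acyclic[OF aA part M' N'] by blast
 define c' where "c' J = (if J \<subseteq> A then c J else if J \<subseteq> insert a A \<and> card J = p + 1 then csign a (J - {a}) * y (J - {a}) else 0)" for J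
 have c'a: "c' (insert a K) = csign a K * y K" if "K \<subseteq> A" "card K = p" for K
 proof -
  have "a \<notin> K" "finite K" using finite_subset[OF that(1) fA] that aA(2) by blast+
  thus ?thesis using that aA(2) unfolding c'_def by auto
 qed
 have "restr A c' = c"
 proof
  fix J show "restr A c' J = c J" using cochains_0[OF cc, of J] unfolding restr_def c'_def by auto
 qed
 moreover have "c' \<in> cocycles (insert a A) p"
  unfolding cocycles_def
 proof (intro CollectI conjI allI impI)
  show "c' \<in> cochains (insert a A) p"
  proof (rule cochains_I)
   fix J assume J: "J \<subseteq> insert a A" "card J = p + 1"
   show "c' J \<in> M J" using J(1)
   proof (cases rule: subset_cases)
    case 1 thus ?thesis using cochains_D[OF cc] J unfolding c'_def by auto
   next
    case (2 K)
    hence "card K = p" using J by simp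
    moreover have "FV.subspace (M (insert a K))" using 2 aA by (intro M_sub) auto
    ultimately show ?thesis using c'a[of K] y(1)[of K] 2 csign_mem by auto
   qed
  next
   fix J assume "\<not> (J \<subseteq> insert a A \<and> card J = p + 1)"
   thus "c' J = 0" using cochains_0[OF cc, of J] unfolding c'_def by auto
  qed
 next
  fix J assume J: "J \<subseteq> insert a A \<and> card J = p + 2"
  hence "J \<subseteq> insert a A" by blast
  thus "cech_differential c' J \<in> N J"
  proof (cases rule: subset_cases)
   case 1
   hence "cech_differential c' J = cech_differential c J"
    using 1 by (intro cech_differential_cong) (auto simp: c'_def)
   thus ?thesis using dc 1 J by simp
  next
   case (2 K)
   hence cK: "card K = Suc p" using J by simp
   have "cech_differential (\<lambda>J. csign a J * c' (insert a J)) K = cech_differential y K"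
   proof (rule cech_differential_cong)
    fix j assume j: "j \<in> K"
    hence "card (K - {j}) = p" using cK by simp
    hence "c' (insert a (K - {j})) = csign a (K - {j}) * y (K - {j})" using 2 by (intro c'a) auto
    thus "csign a (K - {j}) * c' (insert a (K - {j})) = y (K - {j})"
     using csign_sq[of a "K - {j}"] by (simp add: mult.assoc[symmetric])
   qed
   hence "cech_differential c' J = csign a K * (c K - cech_differential y K)"
    unfolding 2(1) differential_over_a[OF 2(2)] using 2 by (simp add: c'_def)
   moreover have "FV.subspace (N (insert a K))" using 2 aA by (intro N_sub) auto
   ultimately show ?thesis using csign_mem y(2)[OF 2(2) cK] 2(1) by simp
  qed
 qed
 ultimately show ?thesis by blast
qed

text \<open>A primitive b on A need not be compatible with the values of c over a. The difference q
  is a cocycle over the open set a, and a primitive z of it supplies the values of the new primitive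
  on the index sets containing a.\<close>

lemma coboundary_restr:
 assumes c: "c \<in> cocycles (insert a A) p"
 shows "restr A c \<in> coboundaries A p \<longleftrightarrow> c \<in> coboundaries (insert a A) p"
proof
 assume "c \<in> coboundaries (insert a A) p"
 then obtain b where cb: "c \<in> cochains (insert a A) p" "b \<in> (if p = 0 then {0} else cochains (insert a A) (p - 1))"
  "\<And>J. J \<subseteq> insert a A \<Longrightarrow> card J = p + 1 \<Longrightarrow> c J - cech_differential b J \<in> N J"
  unfolding coboundaries_def by blast
 have "restr A b \<in> (if p = 0 then {0} else cochains A (p - 1))"
  using cb(2) restr_cochains[of b "insert a A" "p - 1" A] by (cases "p = 0") (auto simp: restr_def fun_eq_iff)
 moreover have "restr A c J - cech_differential (restr A b) J \<in> N J" if "J \<subseteq> A" "card J = p + 1" for J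
  using cb(3)[of J] that restr_differential[OF that(1)] by (auto simp: restr_def)
 ultimately show "restr A c \<in> coboundaries A p"
  unfolding coboundaries_def using restr_cochains[OF cb(1), of A] by blast
next
 assume "restr A c \<in> coboundaries A p"
 then obtain b where b: "b \<in> (if p = 0 then {0} else cochains A (p - 1))"
  "\<And>J. J \<subseteq> A \<Longrightarrow> card J = p + 1 \<Longrightarrow> c J - cech_differential b J \<in> N J"
  unfolding coboundaries_def restr_def by auto
 have cc: "c \<in> cochains (insert a A) p"
  and dc: "\<And>J. J \<subseteq> insert a A \<Longrightarrow> card J = p + 2 \<Longrightarrow> cech_differential c J \<in> N J"
  using c unfolding cocycles_def by auto
 have bM: "b J \<in> M J" if "J \<subseteq> A" "card J = p" "J \<noteq> {}" for J
 proof (cases p)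
  case 0 thus ?thesis using that finite_subset[OF that(1) fA] by simp
 next
  case (Suc p') thus ?thesis using b(1) cochains_D[of b A p' J] that by simp
 qed
 \<comment> \<open>For p = 0 the only index set is empty and there is no primitive, hence the
   explicit 0.\<close>
 define q where "q J = (if p = 0 then 0 else b J) - csign a J * c (insert a J)" for J
 have q1: "q J \<in> M (insert a J)" if J: "J \<subseteq> A" "card J = p" for J
 proof -
  have sub: "FV.subspace (M (insert a J))" using J aA by (intro M_sub) auto
  have "a \<notin> J" "finite J" using finite_subset[OF J(1) fA] J(1) aA(2) by blast+
  hence "c (insert a J) \<in> M (insert a J)" using cochains_D[OF cc, of "insert a J"] J by auto
  hence 1: "csign a J * c (insert a J) \<in> M (insert a J)" by (rule csign_mem[OF sub])
  have "(if p = 0 then 0 else b J) \<in> M (insert a J)"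
  proof (cases "p = 0")
   case True thus ?thesis using FV.subspace_0[OF sub] by simp
  next
   case False
   hence "J \<noteq> {}" using J by auto
   moreover from this have "M J \<subseteq> M (insert a J)" using J aA by (intro M_mono) auto
   ultimately show ?thesis using bM[OF J] False by auto
  qed
  thus ?thesis unfolding q_def using 1 by (rule FV.subspace_diff[OF sub])
 qed
 have q2: "cech_differential q J \<in> N (insert a J)" if J: "J \<subseteq> A" "card J = Suc p" for J
 proof -
  have sub: "FV.subspace (N (insert a J))" using J aA by (intro N_sub) auto
  have fJ: "a \<notin> J" "finite J" "J \<noteq> {}" using finite_subset[OF J(1) fA] J aA(2) by auto
  have NN: "N J \<subseteq> N (insert a J)" using J aA fJ by (intro N_mono) auto
  have "cech_differential q J = cech_differential (\<lambda>J. if p = 0 then 0 else b J) J - cech_differential (\<lambda>J. csign a J * c (insert a J)) J"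
   unfolding q_def cech_differential_csign by (simp add: right_diff_distrib sum_subtractf)
  also have "cech_differential (\<lambda>J. if p = 0 then 0 else b J) J = cech_differential b J"
   using b(1) by (cases "p = 0") (auto simp: zero_fun_def)
  also have "cech_differential b J - cech_differential (\<lambda>J. csign a J * c (insert a J)) J =
    csign a J * cech_differential c (insert a J) - (c J - cech_differential b J)"
   unfolding differential_over_a[OF J(1)] using csign_sq[of a J] by (simp add: mult.assoc[symmetric])
  also have "\<dots> \<in> N (insert a J)"
  proof (rule FV.subspace_diff[OF sub])
   have "cech_differential c (insert a J) \<in> N (insert a J)" using dc[of "insert a J"] J fJ by auto
   thus "csign a J * cech_differential c (insert a J) \<in> N (insert a J)" by (rule csign_mem[OF sub])
   show "c J - cech_differential b J \<in> N (insert a J)" using b(2)[of J] J NN by auto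
  qed
  finally show ?thesis .
 qed
 obtain z where z: "\<And>J. J \<subseteq> A \<Longrightarrow> Suc (card J) = p \<Longrightarrow> z J \<in> M (insert a J)"
  "\<And>J. J \<subseteq> A \<Longrightarrow> card J = p \<Longrightarrow> q J - cech_differential z J \<in> N (insert a J)"
  using acyclic[OF aA part q1 q2] by blast
 define b' where "b' J = (if p = 0 then 0 else if J \<subseteq> A then b J else if J \<subseteq> insert a A \<and> card J = p then csign a (J - {a}) * z (J - {a}) else 0)" for J
 have b'mem: "b' \<in> (if p = 0 then {0} else cochains (insert a A) (p - 1))"
 proof (cases p)
  case 0 thus ?thesis by (simp add: b'_def fun_eq_iff)
 next
  case (Suc p')
  have "b' \<in> cochains (insert a A) p'"
  proof (rule cochains_I)
   fix J assume J: "J \<subseteq> insert a A" "card J = p' + 1"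
   show "b' J \<in> M J" using J(1)
   proof (cases rule: subset_cases)
    case 1
    moreover have "J \<noteq> {}" using J by auto
    ultimately show ?thesis using bM[of J] J Suc unfolding b'_def by auto
   next
    case (2 K)
    hence "card K = p'" using J by simp
    moreover have "FV.subspace (M (insert a K))" using 2 aA by (intro M_sub) auto
    moreover have "\<not> insert a K \<subseteq> A" using aA by blast
    ultimately show ?thesis using z(1)[of K] 2 Suc csign_mem J unfolding b'_def by auto
   qed
  next
   fix J assume J: "\<not> (J \<subseteq> insert a A \<and> card J = p' + 1)"
   thus "b' J = 0" using cochains_0[of b A p' J] b(1) Suc unfolding b'_def by auto
  qed
  thus ?thesis using Suc by simp
 qed
 have bres: "cech_differential b' J = cech_differential b J" if "J \<subseteq> A" for J
  using that b(1) by (intro cech_differential_cong) (auto simp: b'_def)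
 have "c J - cech_differential b' J \<in> N J" if J: "J \<subseteq> insert a A" "card J = p + 1" for J
  using J(1)
 proof (cases rule: subset_cases)
  case 1 thus ?thesis using b(2) bres J by simp
 next
  case (2 K)
  hence cK: "card K = p" using J by simp
  have sub: "FV.subspace (N (insert a K))" using 2 aA by (intro N_sub) auto
  have "cech_differential (\<lambda>J. csign a J * b' (insert a J)) K = cech_differential z K"
  proof (rule cech_differential_cong)
   fix j assume j: "j \<in> K"
   have p2: "Suc (card (K - {j})) = p" using card_Suc_Diff1[OF 2(4) j] cK by simp
   hence p: "p \<noteq> 0" "Suc (card (K - {j})) = p" by auto
   have "\<not> insert a (K - {j}) \<subseteq> A" "a \<notin> K - {j}" "finite (K - {j})" using aA 2 by auto
   hence "b' (insert a (K - {j})) = csign a (K - {j}) * z (K - {j})"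
   proof -
    have "K - {j} - {a} = K - {j}" using 2 by blast
    thus ?thesis using p 2 \<open>\<not> insert a (K - {j}) \<subseteq> A\<close> \<open>a \<notin> K - {j}\<close> \<open>finite (K - {j})\<close> unfolding b'_def by auto
   qed
   thus "csign a (K - {j}) * b' (insert a (K - {j})) = z (K - {j})"
    using csign_sq[of a "K - {j}"] by (simp add: mult.assoc[symmetric])
  qed
  moreover have "b' K = (if p = 0 then 0 else b K)" using 2 unfolding b'_def by simp
  ultimately have "c J - cech_differential b' J = - (csign a K * (q K - cech_differential z K))"
   unfolding 2(1) differential_over_a[OF 2(2)] q_def
   using csign_sq[of a K] by (simp add: right_diff_distrib mult.assoc[symmetric])
  thus ?thesis using FV.subspace_neg[OF sub csign_mem[OF sub z(2)[OF 2(2) cK]]] 2(1) by simp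
 qed
 thus "c \<in> coboundaries (insert a A) p"
  unfolding coboundaries_def using cc b'mem by blast
qed

end

end

subsection \<open>Covers by two open sets\<close>

context graded_alg begin

lemma nzd_power:
 assumes I: "saturated I" and f: "f \<in> G 1" "almost_nzd I f 1"
 shows "p \<in> G n \<Longrightarrow> f ^ k * p \<in> I (n + k) \<Longrightarrow> p \<in> I n"
proof (induction k)
 case (Suc k)
 have "f ^ k * p \<in> G (n + k)" using G_mult[OF G_power[OF f(1), of k] Suc.prems(1)] by (simp add: add.commute)
 moreover have "f * (f ^ k * p) \<in> I (n + k + 1)" using Suc.prems(2) by (simp add: mult.assoc)
 ultimately have "f ^ k * p \<in> I (n + k)" by (rule saturated_nzd[OF I f])
 thus ?case using Suc by blast
qed simp

text \<open>For the cover by \<open>V \<noteq> 0\<close> and \<open>W \<noteq> 0\<close>, \<open>kersp\<close> consists of the \<open>\<alpha>\<close> such that \<open>\<alpha> / V\<^sup>k\<close> extends to a global section, and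
 \<open>cokid\<close> in degree \<open>2 k\<close> of the \<open>p\<close> such that the cocycle \<open>p / (V W)\<^sup>k\<close> is a coboundary.\<close>

definition kersp :: "(nat \<Rightarrow> 'a set) \<Rightarrow> 'a \<Rightarrow> 'a \<Rightarrow> nat \<Rightarrow> 'a set" where
 "kersp I V W k = colon (adjoin I (V ^ k) k) (W ^ k) k k"

definition cokid :: "(nat \<Rightarrow> 'a set) \<Rightarrow> 'a \<Rightarrow> 'a \<Rightarrow> nat \<Rightarrow> nat \<Rightarrow> 'a set" where
 "cokid I V W k = adjoin (adjoin I (V ^ k) k) (W ^ k) k"

lemma cokid_iff:
 assumes I: "gideal I" and V: "V \<in> G 1"
 shows "p \<in> cokid I V W n (n + n) \<longleftrightarrow> (\<exists>i q q'. p = i + V ^ n * q + W ^ n * q' \<and> i \<in> I (n + n) \<and> q \<in> G n \<and> q' \<in> G n)"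
proof
 assume "p \<in> cokid I V W n (n + n)"
 then obtain j q' where 1: "p = j + W ^ n * q'" "j \<in> adjoin I (V ^ n) n (n + n)" "q' \<in> G n"
  unfolding cokid_def using adjoin_D by blast
 obtain i q where "j = i + V ^ n * q" "i \<in> I (n + n)" "q \<in> G n" using adjoin_D[OF 1(2)] by blast
 thus "\<exists>i q q'. p = i + V ^ n * q + W ^ n * q' \<and> i \<in> I (n + n) \<and> q \<in> G n \<and> q' \<in> G n" using 1 by blast
next
 assume "\<exists>i q q'. p = i + V ^ n * q + W ^ n * q' \<and> i \<in> I (n + n) \<and> q \<in> G n \<and> q' \<in> G n"
 then obtain i q q' where *: "p = i + V ^ n * q + W ^ n * q'" "i \<in> I (n + n)" "q \<in> G n" "q' \<in> G n" by blast
 have gA: "gideal (adjoin I (V ^ n) n)" by (rule adjoin_gideal[OF I G_power1[OF V]])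
 have "i \<in> adjoin I (V ^ n) n (n + n)" using *(2) adjoin_ge[of I "V ^ n" n] by (auto simp: le_fun_def)
 hence 1: "i + V ^ n * q \<in> adjoin I (V ^ n) n (n + n)"
  using gideal_add[OF gA _ adjoin_mult[OF I *(3)]] by blast
 thus "p \<in> cokid I V W n (n + n)" unfolding cokid_def adjoin_def[of "adjoin I (V ^ n) n"] *(1) using *(4) by auto
qed

lemma kersp_iff:
 assumes I: "gideal I" and V: "V \<in> G 1"
 shows "a \<in> kersp I V W n \<longleftrightarrow> a \<in> G n \<and> (\<exists>q\<in>G n. W ^ n * a - V ^ n * q \<in> I (n + n))"
proof
 assume "a \<in> kersp I V W n"
 hence a: "a \<in> G n" "W ^ n * a \<in> adjoin I (V ^ n) n (n + n)" unfolding kersp_def colon_def by auto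
 obtain i q where "W ^ n * a = i + V ^ n * q" "i \<in> I (n + n)" "q \<in> G n" using adjoin_D[OF a(2)] by blast
 thus "a \<in> G n \<and> (\<exists>q\<in>G n. W ^ n * a - V ^ n * q \<in> I (n + n))" using a(1) by force
next
 assume "a \<in> G n \<and> (\<exists>q\<in>G n. W ^ n * a - V ^ n * q \<in> I (n + n))"
 then obtain q where q: "a \<in> G n" "q \<in> G n" "W ^ n * a - V ^ n * q \<in> I (n + n)" by blast
 have gA: "gideal (adjoin I (V ^ n) n)" by (rule adjoin_gideal[OF I G_power1[OF V]])
 have "W ^ n * a - V ^ n * q \<in> adjoin I (V ^ n) n (n + n)" using q(3) adjoin_ge[of I "V ^ n" n] by (auto simp: le_fun_def)
 hence "(W ^ n * a - V ^ n * q) + V ^ n * q \<in> adjoin I (V ^ n) n (n + n)"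
  using gideal_add[OF gA _ adjoin_mult[OF I q(2)]] by blast
 thus "a \<in> kersp I V W n" unfolding kersp_def colon_def using q(1) by simp
qed

lemma kersp_subspace:
 assumes I: "gideal I" and V: "V \<in> G 1" and W: "W \<in> G 1"
 shows "subspace (kersp I V W n)"
 unfolding kersp_def by (intro gideal_sub colon_gideal adjoin_gideal I G_power1 V W)

text \<open>Modulo Y the products with V W vanish. Splitting g as i + V x + W y replaces V^(j+1) g
  by V^(j+2) x, so after d rounds the exponent has risen to N, where V^N vanishes as well. Thus
  multiples of V lie in Y in large degrees.\<close>

lemma power_descent:
 assumes Y: "gideal Y" "I \<le> Y" "V * W \<in> Y 2" "V ^ N \<in> Y N" and V: "V \<in> G 1"
  and split: "\<And>n g. n \<ge> n\<^sub>0 \<Longrightarrow> g \<in> G (Suc n) \<Longrightarrow> \<exists>i x y. g = i + V * x + W * y \<and> i \<in> I (Suc n) \<and> x \<in> G n \<and> y \<in> G n"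
 shows "Suc j + d = N \<Longrightarrow> g \<in> G k \<Longrightarrow> n\<^sub>0 + d \<le> k \<Longrightarrow> V ^ Suc j * g \<in> Y (Suc j + k)"
proof (induction d arbitrary: j g k)
 case 0
 thus ?case using gideal_mult'[OF Y(1,4)] by auto
next
 case (Suc d)
 then obtain k' where k': "k = Suc k'" "n\<^sub>0 + d \<le> k'" by (cases k) auto
 obtain i x y where g: "g = i + V * x + W * y" "i \<in> I k" "x \<in> G k'" "y \<in> G k'"
  using split[of k' g] Suc.prems k' by auto
 have "V ^ Suc (Suc j) * x \<in> Y (Suc (Suc j) + k')" by (rule Suc.IH) (use Suc.prems g k' in auto)
 moreover have "V ^ Suc j * i \<in> Y (Suc j + k)"
  using gideal_mult[OF Y(1) G_power1[OF V, of "Suc j"], of i k] g(2) Y(2) by (auto simp: le_fun_def)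
 moreover have "(V * W) * (V ^ j * y) \<in> Y (2 + (j + k'))"
  by (rule gideal_mult'[OF Y(1,3) G_mult[OF G_power1[OF V] g(4)]])
 moreover have "V ^ Suc j * g = V ^ Suc j * i + (V ^ Suc (Suc j) * x + (V * W) * (V ^ j * y))"
  by (simp add: g(1) algebra_simps)
 ultimately show ?case using gideal_add[OF Y(1)] k'(1) by simp
qed

text \<open>The kernels and cokernels at level k form direct systems whose limits are the two
  cohomology groups. The dimensions u are nondecreasing and the dimensions w are eventually
  nonincreasing, while u - w = 2 hf(k) - hf(2 k) is eventually \<chi>. Hence both become constant,
  and the transition maps are isomorphisms from a single level on.\<close>

lemma two_open_cover:
 assumes I: "saturated I" and V: "V \<in> G 1" "almost_nzd I V 1" and W: "W \<in> G 1" "almost_nzd I W 1"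
  and top: "\<forall>\<^sub>F n in sequentially. adjoin (adjoin I V 1) W 1 n = G n"
  and hf: "\<forall>\<^sub>F n in sequentially. int (hf I n) = e * int n + \<chi>"
 shows "\<exists>k u w. qdim scale (kersp I V W k) (I k) u \<and> qdim scale (G (k + k)) (cokid I V W k (k + k)) w \<and>
  int u - int w = \<chi> \<and>
  (\<forall>m. \<forall>\<alpha>\<in>kersp I V W (k + m). \<exists>\<beta>\<in>kersp I V W k. \<alpha> - V ^ m * \<beta> \<in> I (k + m)) \<and>
  (\<forall>m. \<forall>p\<in>G (k + k). (V * W) ^ m * p \<in> cokid I V W (k + m) ((k + m) + (k + m)) \<longrightarrow> p \<in> cokid I V W k (k + k)) \<and>
  (\<forall>m. \<forall>p\<in>G ((k + m) + (k + m)). \<exists>q\<in>G (k + k). p - (V * W) ^ m * q \<in> cokid I V W (k + m) ((k + m) + (k + m)))"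
proof -
 note gI = saturated_gideal[OF I]
 define A where "A k = adjoin I (V ^ k) k" for k
 define Q where "Q k = cokid I V W k" for k
 define T where "T k = kersp I V W k" for k
 have gA: "gideal (A k)" for k unfolding A_def by (rule adjoin_gideal[OF gI G_power1[OF V(1)]])
 have Qe: "Q k = adjoin (A k) (W ^ k) k" for k unfolding Q_def cokid_def A_def ..
 have Te: "T k = colon (A k) (W ^ k) k k" for k unfolding T_def kersp_def A_def ..
 have gQ: "gideal (Q k)" for k unfolding Qe by (rule adjoin_gideal[OF gA G_power1[OF W(1)]])
 have gC: "gideal (colon (A k) (W ^ k) k)" for k by (rule colon_gideal[OF gA G_power1[OF W(1)]])
 have IA: "I \<le> A k" for k unfolding A_def by (rule adjoin_ge)
 have AQ: "A k \<le> Q k" for k unfolding Qe by (rule adjoin_ge)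
 have IT: "I k \<subseteq> T k" for k
  using IA[of k] colon_ge[OF gA[of k] G_power1[OF W(1), of k]] unfolding Te by (auto simp: le_fun_def)
 have subT: "subspace (T k)" for k unfolding Te by (rule gideal_sub[OF gC])
 have TG: "T k \<subseteq> G k" for k unfolding Te by (rule gideal_subset[OF gC])
 define u where "u k = hf I k - hf (colon (A k) (W ^ k) k) k" for k
 define w where "w k = hf (Q k) (k + k)" for k
 have qu: "qdim scale (T k) (I k) (u k)" for k
  unfolding u_def Te using hf_between(2)[OF gI gC[of k], of k] IT[of k] Te[of k] by simp
 have qw: "qdim scale (G (k + k)) (Q k (k + k)) (w k)" for k
  unfolding w_def by (rule hf_qdim[OF gQ])
 \<comment> \<open>Two uses of \<open>hf_split\<close> in degree 2 k: V^k is a nonzerodivisor modulo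
   I, and the colon by W^k modulo I + V^k G is the kernel at level k.\<close>
 have uw: "int (u k) - int (w k) = 2 * int (hf I k) - int (hf I (k + k))" for k
 proof -
  have "colon I (V ^ k) k k = I k"
   using nzd_power[OF I V, of _ k k] colon_ge[OF gI G_power1[OF V(1)], of k] by (auto simp: colon_def le_fun_def)
  hence "hf (colon I (V ^ k) k) k = hf I k" using hf_cong[of "colon I (V ^ k) k" k I] by simp
  hence 1: "hf I (k + k) = hf (A k) (k + k) + hf I k"
   using hf_split[OF gI G_power1[OF V(1), of k], of k] unfolding A_def by simp
  have 2: "hf (A k) (k + k) = w k + hf (colon (A k) (W ^ k) k) k"
   using hf_split[OF gA[of k] G_power1[OF W(1), of k], of k] unfolding w_def Qe .
  have "hf (colon (A k) (W ^ k) k) k \<le> hf I k"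
   using hf_between(1)[OF gI gC[of k], of k] IT[of k] Te[of k] by simp
  thus ?thesis using 1 2 unfolding u_def by simp
 qed
 obtain n0 where n0: "\<And>n. n \<ge> n0 \<Longrightarrow> int (hf I n) = e * int n + \<chi>"
  using hf unfolding eventually_sequentially by blast
 have uw\<chi>: "int (u k) - int (w k) = \<chi>" if "k \<ge> n0" for k
  using uw[of k] n0[of k] n0[of "k + k"] that by (simp add: algebra_simps)
 have VWG: "(V * W) ^ m \<in> G (m + m)" for m
  using G_mult[OF G_power1[OF V(1)] G_power1[OF W(1)]] by (simp add: power_mult_distrib)
 have VT: "V ^ m * \<alpha> \<in> T (k + m)" if \<alpha>: "\<alpha> \<in> T k" for k m \<alpha>
 proof -
  obtain q where q: "\<alpha> \<in> G k" "q \<in> G k" "W ^ k * \<alpha> - V ^ k * q \<in> I (k + k)"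
   using \<alpha> unfolding T_def kersp_iff[OF gI V(1)] by blast
  have "(V * W) ^ m * (W ^ k * \<alpha> - V ^ k * q) \<in> I ((m + m) + (k + k))" by (rule gideal_mult[OF gI VWG q(3)])
  hence "W ^ (k + m) * (V ^ m * \<alpha>) - V ^ (k + m) * (W ^ m * q) \<in> I ((k + m) + (k + m))"
   by (simp add: power_mult_distrib power_add algebra_simps)
  thus ?thesis
   using G_mult[OF G_power1[OF V(1), of m] q(1)] G_mult[OF G_power1[OF W(1), of m] q(2)]
   unfolding T_def kersp_iff[OF gI V(1)] by (auto simp: add.commute)
 qed
 have umono: "u k \<le> u (k + m)" and ueq: "u k = u (k + m) \<Longrightarrow> \<forall>\<alpha>\<in>T (k + m). \<exists>\<beta>\<in>T k. \<alpha> - V ^ m * \<beta> \<in> I (k + m)" for k m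
 proof -
  \<comment> \<open>The image of level k in level k + m of the kernels. Multiplication by V^m is
    injective modulo I, so equal dimensions force the image to be everything.\<close>
  define Y where "Y = extend I (V ^ m) m (colon (A k) (W ^ k) k) (k + m)"
  have Y_iff: "y \<in> Y \<longleftrightarrow> (\<exists>\<alpha>\<in>T k. y - V ^ m * \<alpha> \<in> I (k + m))" for y
   unfolding Y_def Te by (rule extend_iff[OF gC])
  have sY: "subspace Y" unfolding Y_def by (rule gideal_sub[OF extend_gideal[OF gI G_power1[OF V(1)] gC]])
  have IY: "I (k + m) \<subseteq> Y" unfolding Y_def using extend_ge by (auto simp: le_fun_def)
  have YT: "Y \<subseteq> T (k + m)"
  proof
   fix y assume "y \<in> Y"
   then obtain \<alpha> where "\<alpha> \<in> T k" "y - V ^ m * \<alpha> \<in> I (k + m)" unfolding Y_iff by blast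
   hence "(y - V ^ m * \<alpha>) + V ^ m * \<alpha> \<in> T (k + m)" using IT VT by (intro subspace_add[OF subT]) auto
   thus "y \<in> T (k + m)" by simp
  qed
  interpret quotient_iso scale scale "T k" "I k" Y "I (k + m)" "(*) (V ^ m)"
  proof
   show "subspace (T k)" by (rule subT)
   show "subspace (I (k + m))" by (rule gideal_sub[OF gI])
   fix x y z c
   show "V ^ m * (x + y) = V ^ m * x + V ^ m * y" by (rule distrib_left)
   show "V ^ m * (c *s x) = c *s (V ^ m * x)" by (rule mult_scale)
   show "x \<in> T k \<Longrightarrow> V ^ m * x \<in> Y" unfolding Y_iff using gideal_0[OF gI] by (intro bexI[of _ x]) auto
   show "x \<in> T k \<Longrightarrow> V ^ m * x \<in> I (k + m) \<longleftrightarrow> x \<in> I k"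
    using nzd_power[OF I V, of x k m] TG gideal_mult[OF gI G_power1[OF V(1)], of x k m] by (auto simp: add.commute)
   show "z \<in> Y \<Longrightarrow> \<exists>x\<in>T k. z - V ^ m * x \<in> I (k + m)" unfolding Y_iff .
  qed
  obtain a b where ab: "qdim scale Y (I (k + m)) a" "qdim scale (T (k + m)) Y b" "u (k + m) = a + b"
   using qdim_between[OF gideal_sub[OF gI] sY subT IY YT qu] by blast
  have a: "a = u k" by (rule qdim_unique[OF gideal_sub[OF gI] ab(1) qdim_forward[OF qu]])
  thus "u k \<le> u (k + m)" using ab by simp
  assume "u k = u (k + m)"
  hence "T (k + m) = Y" using ab a qdim_0_iff[OF YT sY] by simp
  thus "\<forall>\<alpha>\<in>T (k + m). \<exists>\<beta>\<in>T k. \<alpha> - V ^ m * \<beta> \<in> I (k + m)" using Y_iff by blast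
 qed
 obtain e0 where e0: "\<And>n. n \<ge> e0 \<Longrightarrow> adjoin (adjoin I V 1) W 1 n = G n"
  using top unfolding eventually_sequentially by blast
 have split: "\<exists>i x y. g = i + V * x + W * y \<and> i \<in> I (Suc n) \<and> x \<in> G n \<and> y \<in> G n" if "n \<ge> e0" "g \<in> G (Suc n)" for n g
 proof -
  have "g \<in> adjoin (adjoin I V 1) W 1 (n + 1)" using e0[of "n + 1"] that by simp
  then obtain a y where *: "g = a + W * y" "a \<in> adjoin I V 1 (n + 1)" "y \<in> G n" using adjoin_D by blast
  obtain i x where "a = i + V * x" "i \<in> I (n + 1)" "x \<in> G n" using adjoin_D *(2) by blast
  thus ?thesis using * by auto
 qed
 have VWQ: "(V * W) ^ m * p \<in> Q (k + m) ((k + m) + (k + m))" if p: "p \<in> Q k (k + k)" for k m p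
 proof -
  obtain i q q' where *: "p = i + V ^ k * q + W ^ k * q'" "i \<in> I (k + k)" "q \<in> G k" "q' \<in> G k"
   using p unfolding Q_def cokid_iff[OF gI V(1)] by blast
  have "(V * W) ^ m * p = (V * W) ^ m * i + V ^ (k + m) * (W ^ m * q) + W ^ (k + m) * (V ^ m * q')"
   by (simp add: *(1) power_mult_distrib power_add algebra_simps)
  moreover have "(V * W) ^ m * i \<in> I ((m + m) + (k + k))" by (rule gideal_mult[OF gI VWG *(2)])
  hence "(V * W) ^ m * i \<in> I ((k + m) + (k + m))" by (simp add: ac_simps)
  moreover have "W ^ m * q \<in> G (k + m)" "V ^ m * q' \<in> G (k + m)"
   using G_mult[OF G_power1[OF W(1), of m] *(3)] G_mult[OF G_power1[OF V(1), of m] *(4)] by (simp_all add: add.commute)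
  ultimately show ?thesis unfolding Q_def cokid_iff[OF gI V(1)] by blast
 qed
 \<comment> \<open>Surjectivity of one transition map of the cokernels: modulo V W and the ideal
   \<open>Q\<close>, the multiples of V and of W vanish in this degree by
   \<open>power_descent\<close>.\<close>
 have D: "\<exists>q\<in>G (k + k). p - V * W * q \<in> Q (Suc k) (Suc k + Suc k)"
  if k: "Suc k \<ge> e0" and p: "p \<in> G (Suc k + Suc k)" for k p
 proof -
  have VW2: "V * W \<in> G 2" using VWG[of 1] by (simp add: numeral_2_eq_2)
  let ?Y = "adjoin (Q (Suc k)) (V * W) 2"
  have gY: "gideal ?Y" by (rule adjoin_gideal[OF gQ VW2])
  have QY: "Q (Suc k) \<le> ?Y" by (rule adjoin_ge)
  have IY: "I \<le> ?Y" by (rule order_trans[OF order_trans[OF IA AQ] QY])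
  have VW: "V * W \<in> ?Y 2" "W * V \<in> ?Y 2" using adjoin_mem[OF gQ[of "Suc k"], of "V * W" 2] by (simp_all add: mult.commute)
  have "V ^ Suc k \<in> A (Suc k) (Suc k)" unfolding A_def by (rule adjoin_mem[OF gI])
  hence VY: "V ^ Suc k \<in> ?Y (Suc k)" using order_trans[OF AQ QY] by (auto simp: le_fun_def simp del: power_Suc)
  have "W ^ Suc k \<in> Q (Suc k) (Suc k)" unfolding Qe by (rule adjoin_mem[OF gA])
  hence WY: "W ^ Suc k \<in> ?Y (Suc k)" using QY by (auto simp: le_fun_def simp del: power_Suc)
  obtain i x y where ixy: "p = i + V * x + W * y" "i \<in> I (Suc k + Suc k)" "x \<in> G (k + Suc k)" "y \<in> G (k + Suc k)"
   using split[of "k + Suc k" p] k p by auto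
  have "V ^ Suc 0 * x \<in> ?Y (Suc 0 + (k + Suc k))"
   by (rule power_descent[OF gY IY VW(1) VY V(1) split _ ixy(3)]) (use k in auto)
  moreover have "W ^ Suc 0 * y \<in> ?Y (Suc 0 + (k + Suc k))"
  proof (rule power_descent[OF gY IY VW(2) WY W(1) _ _ ixy(4)])
   show "\<exists>i x y. g = i + W * x + V * y \<and> i \<in> I (Suc n) \<and> x \<in> G n \<and> y \<in> G n" if "n \<ge> e0" "g \<in> G (Suc n)" for n g
    using split[OF that] by (metis add.assoc add.commute)
  qed (use k in auto)
  moreover have "i \<in> ?Y (Suc k + Suc k)" using IY ixy(2) by (auto simp: le_fun_def)
  ultimately have "p \<in> ?Y ((k + k) + 2)" using gideal_add[OF gY] ixy(1) by simp
  then obtain a q where "p = a + V * W * q" "a \<in> Q (Suc k) (k + k + 2)" "q \<in> G (k + k)" using adjoin_D by blast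
  thus ?thesis by (intro bexI[of _ q]) auto
 qed
 have kD: "\<forall>p\<in>G ((k + m) + (k + m)). \<exists>q\<in>G (k + k). p - (V * W) ^ m * q \<in> Q (k + m) ((k + m) + (k + m))" if k: "k \<ge> e0" for k m
 proof (induction m)
  case 0 thus ?case using gideal_0[OF gQ] by force
 next
  case (Suc m)
  show ?case
  proof
   fix p assume p: "p \<in> G (k + Suc m + (k + Suc m))"
   obtain p' where p': "p' \<in> G ((k + m) + (k + m))" "p - V * W * p' \<in> Q (Suc (k + m)) (Suc (k + m) + Suc (k + m))"
    using D[of "k + m" p] p k by auto
   obtain q where q: "q \<in> G (k + k)" "p' - (V * W) ^ m * q \<in> Q (k + m) ((k + m) + (k + m))" using Suc p'(1) by blast
   have "V * W * (p' - (V * W) ^ m * q) \<in> Q (Suc (k + m)) (Suc (k + m) + Suc (k + m))" using VWQ[OF q(2), of 1] by simp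
   hence "(p - V * W * p') + V * W * (p' - (V * W) ^ m * q) \<in> Q (Suc (k + m)) (Suc (k + m) + Suc (k + m))"
    by (rule gideal_add[OF gQ p'(2)])
   thus "\<exists>q\<in>G (k + k). p - (V * W) ^ Suc m * q \<in> Q (k + Suc m) (k + Suc m + (k + Suc m))"
    using q(1) by (intro bexI[of _ q]) (simp_all add: algebra_simps)
  qed
 qed
 have wle: "w (k + m) \<le> w k"
  and weq: "w k = w (k + m) \<Longrightarrow> \<forall>p\<in>G (k + k). (V * W) ^ m * p \<in> Q (k + m) ((k + m) + (k + m)) \<longrightarrow> p \<in> Q k (k + k)"
  if k: "k \<ge> e0" for k m
 proof -
  let ?f = "(V * W) ^ m"
  let ?C = "colon (Q (k + m)) ?f (m + m)" and ?B = "adjoin (Q (k + m)) ?f (m + m)"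
  have gC: "gideal ?C" by (rule colon_gideal[OF gQ VWG])
  have gB: "gideal ?B" by (rule adjoin_gideal[OF gQ VWG])
  have deg: "(k + k) + (m + m) = (k + m) + (k + m)" by simp
  have "p \<in> ?B ((k + m) + (k + m))" if pG: "p \<in> G ((k + m) + (k + m))" for p
  proof -
   obtain q where q: "q \<in> G (k + k)" "p - ?f * q \<in> Q (k + m) ((k + m) + (k + m))" using kD[OF k] pG by blast
   have "(p - ?f * q) + ?f * q \<in> ?B ((k + m) + (k + m))"
    using q(2) adjoin_ge[of "Q (k + m)" ?f "m + m"] adjoin_mult[OF gQ[of "k + m"] q(1), of ?f "m + m"] unfolding deg
    by (intro gideal_add[OF gB]) (auto simp: le_fun_def)
   thus ?thesis by simp
  qed
  hence "hf ?B ((k + m) + (k + m)) = 0" using hf_0_iff[OF gB] gideal_subset[OF gB] by blast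
  hence wC: "w (k + m) = hf ?C (k + k)" using hf_split[OF gQ[of "k + m"] VWG[of m], of "k + k"] unfolding w_def deg by simp
  have le: "Q k (k + k) \<subseteq> ?C (k + k)" using VWQ gideal_G[OF gQ] unfolding colon_def deg by auto
  show "w (k + m) \<le> w k" using hf_between(1)[OF gQ gC le] unfolding wC w_def[of k] .
  assume "w k = w (k + m)"
  hence "Q k (k + k) = ?C (k + k)" using hf_eq[OF gQ gC le] unfolding wC w_def[of k] by simp
  thus "\<forall>p\<in>G (k + k). ?f * p \<in> Q (k + m) ((k + m) + (k + m)) \<longrightarrow> p \<in> Q k (k + k)"
   unfolding colon_def deg by auto
 qed
 define k where "k = max e0 n0"
 have k: "k \<ge> e0" "int (u (k + m)) - int (w (k + m)) = \<chi>" for m using uw\<chi>[of "k + m"] unfolding k_def by auto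
 \<comment> \<open>The difference stays \<chi> while u cannot fall and w cannot rise.\<close>
 have "u k = u (k + m)" "w k = w (k + m)" for m using umono[of k m] wle[OF k(1), of m] k(2)[of 0] k(2)[of m] unfolding add_0_right by linarith+
 thus ?thesis using qu[of k] qw[of k] k(2)[of 0] ueq weq[OF k(1)] kD[OF k(1)] unfolding T_def Q_def
  by (intro exI[of _ k] exI[of _ "u k"] exI[of _ "w k"]) auto
qed

end

subsection \<open>Changing the cover\<close>

definition cochain_scale :: "complex \<Rightarrow> (nat set \<Rightarrow> ratfun) \<Rightarrow> nat set \<Rightarrow> ratfun" where
 "cochain_scale z c = (\<lambda>J. fscale z (c J))"

interpretation CF: vector_space cochain_scale
 by unfold_locales (auto simp: cochain_scale_def fun_eq_iff FV.scale_right_distrib FV.scale_left_distrib)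

context cech_system begin

lemma M_nonempty_card: "J \<subseteq> A \<Longrightarrow> A \<subseteq> U \<Longrightarrow> card J = Suc p \<Longrightarrow> FV.subspace (M J) \<and> FV.subspace (N J)"
 using M_sub[of J] N_sub[of J] by force

lemma cochains_subspace: "A \<subseteq> U \<Longrightarrow> CF.subspace (cochains A p)"
 by (rule CF.subspaceI; rule cochains_I)
  (auto simp: cochain_scale_def cochains_0 dest: M_nonempty_card intro!: FV.subspace_0 FV.subspace_add FV.subspace_scale intro: cochains_D[unfolded Suc_eq_plus1[symmetric]])

lemma differential_0: "cech_differential 0 J = 0"
 unfolding cech_differential_csign by simp

lemma differential_plus: "cech_differential (c + c') J = cech_differential c J + cech_differential c' J"
 using cech_differential_add[of c c' J] by (simp add: plus_fun_def)

lemma differential_cochain_scale: "cech_differential (cochain_scale z c) J = fscale z (cech_differential c J)"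
 unfolding cochain_scale_def by (rule cech_differential_scale)

lemma cocycles_subspace:
 assumes A: "A \<subseteq> U" shows "CF.subspace (cocycles A p)"
proof -
 note C = cochains_subspace[OF A, of p]
 have N: "FV.subspace (N J)" if "J \<subseteq> A \<and> card J = p + 2" for J
  using M_nonempty_card[of J A "Suc p"] that A by auto
 show ?thesis
  unfolding cocycles_def
  by (rule CF.subspaceI)
   (auto simp: CF.subspace_0[OF C] CF.subspace_add[OF C] CF.subspace_scale[OF C] differential_0 differential_plus
     differential_cochain_scale N FV.subspace_0 intro!: FV.subspace_add[OF N] FV.subspace_scale[OF N])
qed

lemma coboundaries_subspace:
 assumes A: "A \<subseteq> U" shows "CF.subspace (coboundaries A p)"
proof -
 note C = cochains_subspace[OF A, of p]
 define B where "B = (if p = 0 then {0} else cochains A (p - 1))"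
 have B: "CF.subspace B" unfolding B_def using cochains_subspace[OF A] CF.subspace_single_0 by simp
 have N: "FV.subspace (N J)" if "J \<subseteq> A \<and> card J = p + 1" for J
  using M_nonempty_card[of J A p] that A by auto
 show ?thesis
  unfolding coboundaries_def B_def[symmetric]
 proof (rule CF.subspaceI; (intro CollectI conjI))
  show "0 \<in> cochains A p" by (rule CF.subspace_0[OF C])
  show "\<exists>b\<in>B. \<forall>J. J \<subseteq> A \<and> card J = p + 1 \<longrightarrow> 0 J - cech_differential b J \<in> N J"
   using CF.subspace_0[OF B] N FV.subspace_0 by (intro bexI[of _ 0]) (auto simp: differential_0)
 next
  fix c c' assume c: "c \<in> {c \<in> cochains A p. \<exists>b\<in>B. \<forall>J. J \<subseteq> A \<and> card J = p + 1 \<longrightarrow> c J - cech_differential b J \<in> N J}"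
   "c' \<in> {c \<in> cochains A p. \<exists>b\<in>B. \<forall>J. J \<subseteq> A \<and> card J = p + 1 \<longrightarrow> c J - cech_differential b J \<in> N J}"
  show "c + c' \<in> cochains A p" using c CF.subspace_add[OF C] by blast
  obtain b b' where b: "b \<in> B" "b' \<in> B" "\<And>J. J \<subseteq> A \<and> card J = p + 1 \<Longrightarrow> c J - cech_differential b J \<in> N J"
   "\<And>J. J \<subseteq> A \<and> card J = p + 1 \<Longrightarrow> c' J - cech_differential b' J \<in> N J" using c by blast
  show "\<exists>b\<in>B. \<forall>J. J \<subseteq> A \<and> card J = p + 1 \<longrightarrow> (c + c') J - cech_differential b J \<in> N J"
  proof (intro bexI[of _ "b + b'"] allI impI CF.subspace_add[OF B] b(1,2))
   fix J assume J: "J \<subseteq> A \<and> card J = p + 1"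
   thus "(c + c') J - cech_differential (b + b') J \<in> N J"
    using FV.subspace_add[OF N[OF J] b(3)[OF J] b(4)[OF J]] by (simp add: differential_plus algebra_simps)
  qed
 next
  fix z c assume c: "c \<in> {c \<in> cochains A p. \<exists>b\<in>B. \<forall>J. J \<subseteq> A \<and> card J = p + 1 \<longrightarrow> c J - cech_differential b J \<in> N J}"
  show "cochain_scale z c \<in> cochains A p" using c CF.subspace_scale[OF C] by blast
  obtain b where b: "b \<in> B" "\<And>J. J \<subseteq> A \<and> card J = p + 1 \<Longrightarrow> c J - cech_differential b J \<in> N J" using c by blast
  show "\<exists>b\<in>B. \<forall>J. J \<subseteq> A \<and> card J = p + 1 \<longrightarrow> cochain_scale z c J - cech_differential b J \<in> N J"
  proof (intro bexI[of _ "cochain_scale z b"] allI impI CF.subspace_scale[OF B] b(1))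
   fix J assume J: "J \<subseteq> A \<and> card J = p + 1"
   show "cochain_scale z c J - cech_differential (cochain_scale z b) J \<in> N J"
    unfolding differential_cochain_scale
    using FV.subspace_scale[OF N[OF J] b(2)[OF J], of z] by (simp add: cochain_scale_def FV.scale_right_diff_distrib)
  qed
 qed
qed

lemma qdim_restr:
 assumes aA: "insert a A \<subseteq> U" "a \<notin> A" and part: "partition a A"
 shows "qdim cochain_scale (cocycles (insert a A) p) (coboundaries (insert a A) p) n \<longleftrightarrow>
  qdim cochain_scale (cocycles A p) (coboundaries A p) n"
proof -
 interpret Q: quotient_iso cochain_scale cochain_scale "cocycles (insert a A) p" "coboundaries (insert a A) p"
  "cocycles A p" "coboundaries A p" "restr A"
 proof unfold_locales
  show "CF.subspace (cocycles (insert a A) p)" by (rule cocycles_subspace[OF aA(1)])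
  show subc: "CF.subspace (coboundaries A p)" by (rule coboundaries_subspace) (use aA in blast)
  fix x y assume x: "x \<in> cocycles (insert a A) p"
  show "restr A (x + y) = restr A x + restr A y" by (auto simp: restr_def fun_eq_iff)
  show "restr A (cochain_scale z x) = cochain_scale z (restr A x)" for z by (auto simp: restr_def cochain_scale_def fun_eq_iff)
  show "restr A x \<in> cocycles A p" by (rule restr_cocycles[OF x]) blast
  show "restr A x \<in> coboundaries A p \<longleftrightarrow> x \<in> coboundaries (insert a A) p" by (rule coboundary_restr[OF aA part x])
 next
  fix z assume z: "z \<in> cocycles A p"
  then obtain c where "c \<in> cocycles (insert a A) p" "restr A c = z" using cocycle_extend[OF aA part z] by blast
  moreover have "CF.subspace (coboundaries A p)" by (rule coboundaries_subspace) (use aA in blast)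
  ultimately show "\<exists>x\<in>cocycles (insert a A) p. z - restr A x \<in> coboundaries A p"
   using CF.subspace_0 by (intro bexI[of _ c]) auto
 qed
 show ?thesis using Q.qdim_forward Q.qdim_backward by blast
qed

lemma qdim_no_cochains:
 assumes "\<And>J. J \<subseteq> A \<Longrightarrow> card J \<noteq> Suc p" and A: "A \<subseteq> U"
 shows "qdim cochain_scale (cocycles A p) (coboundaries A p) 0"
proof -
 have "cochains A p \<subseteq> {0}" using assms cochains_0[of _ A p] by (auto simp: fun_eq_iff)
 hence "cocycles A p \<subseteq> {0}" "coboundaries A p \<subseteq> {0}" unfolding cocycles_def coboundaries_def by blast+
 moreover have "0 \<in> cocycles A p" "0 \<in> coboundaries A p"
  using CF.subspace_0[OF cocycles_subspace[OF A]] CF.subspace_0[OF coboundaries_subspace[OF A]] by blast+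
 ultimately have "cocycles A p = {0}" "coboundaries A p = {0}" by blast+
 thus ?thesis using CF.qdim_0_iff[of "{0}" "{0}"] CF.subspace_single_0 by simp
qed

lemma sum_subspace:
 assumes "{v, w} \<subseteq> U"
 shows "FV.subspace {x. \<exists>y\<in>M {v}. \<exists>z\<in>M {w}. x - (z - y) \<in> N {v, w}}"
proof -
 let ?W = "{x. \<exists>y\<in>M {v}. \<exists>z\<in>M {w}. x - (z - y) \<in> N {v, w}}"
 have sub: "FV.subspace (M {v})" "FV.subspace (M {w})" "FV.subspace (N {v, w})"
  using M_sub N_sub assms by auto
 show ?thesis
 proof (rule FV.subspaceI)
  show "0 \<in> ?W" using FV.subspace_0[OF sub(1)] FV.subspace_0[OF sub(2)] FV.subspace_0[OF sub(3)] by force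
 next
  fix x x' assume "x \<in> ?W" "x' \<in> ?W"
  then obtain y z y' z' where *: "y \<in> M {v}" "z \<in> M {w}" "x - (z - y) \<in> N {v, w}" "y' \<in> M {v}" "z' \<in> M {w}" "x' - (z' - y') \<in> N {v, w}" by blast
  have "(x + x') - ((z + z') - (y + y')) \<in> N {v, w}"
   using FV.subspace_add[OF sub(3) *(3,6)] by (simp add: algebra_simps)
  thus "x + x' \<in> ?W" using FV.subspace_add[OF sub(1) *(1,4)] FV.subspace_add[OF sub(2) *(2,5)] by blast
 next
  fix c x assume "x \<in> ?W"
  then obtain y z where *: "y \<in> M {v}" "z \<in> M {w}" "x - (z - y) \<in> N {v, w}" by blast
  have "fscale c x - (fscale c z - fscale c y) \<in> N {v, w}"
   using FV.subspace_scale[OF sub(3) *(3), of c] by (simp add: FV.scale_right_diff_distrib)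
  thus "fscale c x \<in> ?W" using FV.subspace_scale[OF sub(1) *(1)] FV.subspace_scale[OF sub(2) *(2)] by blast
 qed
qed

context
 fixes v w assumes vw: "v < w" "{v, w} \<subseteq> U"
begin

lemma pair_cases: "J \<subseteq> {v, w} \<Longrightarrow> card J = Suc 0 \<Longrightarrow> J = {v} \<or> J = {w}"
 by (auto simp: card_Suc_eq)

lemma pair_top: "J \<subseteq> {v, w} \<Longrightarrow> card J = 2 \<Longrightarrow> J = {v, w}"
 using card_subset_eq[of "{v, w}" J] vw by simp

lemma pair_differential: "cech_differential b {v, w} = b {w} - b {v}"
proof -
 have "{i \<in> {v, w}. i < w} = {v}" "{i \<in> {v, w}. i < v} = {}" using vw by auto
 hence "csign w {v, w} = - 1" "csign v {v, w} = 1" unfolding csign_def by (simp_all only: card.empty) simp_all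
 moreover have "{v, w} - {v} = {w}" "{v, w} - {w} = {v}" using vw by auto
 ultimately show ?thesis unfolding cech_differential_csign using vw by simp
qed

lemma pair_cochain:
 assumes "y \<in> M {v}" "z \<in> M {w}"
 shows "(\<lambda>J. if J = {v} then y else if J = {w} then z else 0) \<in> cochains {v, w} 0"
proof (rule cochains_I)
 fix J assume "J \<subseteq> {v, w}" "card J = 0 + 1"
 hence "J = {v} \<or> J = {w}" using pair_cases by simp
 thus "(if J = {v} then y else if J = {w} then z else 0) \<in> M J" using assms vw by (elim disjE) simp_all
next
 fix J assume "\<not> (J \<subseteq> {v, w} \<and> card J = 0 + 1)"
 hence "J \<noteq> {v}" "J \<noteq> {w}" by auto
 thus "(if J = {v} then y else if J = {w} then z else 0) = 0" by simp
qed

lemma qdim_H1_pair: "qdim cochain_scale (cocycles {v, w} 1) (coboundaries {v, w} 1) n \<longleftrightarrow>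
  qdim fscale (M {v, w}) {x. \<exists>y\<in>M {v}. \<exists>z\<in>M {w}. x - (z - y) \<in> N {v, w}} n"
proof -
 let ?W = "{x. \<exists>y\<in>M {v}. \<exists>z\<in>M {w}. x - (z - y) \<in> N {v, w}}"
 have sub: "FV.subspace (M {v})" "FV.subspace (M {w})" "FV.subspace (M {v, w})" "FV.subspace (N {v, w})"
  using M_sub N_sub vw by auto
 have ne: "v \<noteq> w" "w \<noteq> v" using vw by auto
 have J3: "\<not> (J \<subseteq> {v, w} \<and> card J = Suc 2)" for J
  using card_mono[of "{v, w}" J] ne by auto
 have Wiff: "x \<in> ?W \<longleftrightarrow> (\<exists>y\<in>M {v}. \<exists>z\<in>M {w}. x - (z - y) \<in> N {v, w})" for x by (rule mem_Collect_eq)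
 interpret Q: quotient_iso cochain_scale fscale "cocycles {v, w} 1" "coboundaries {v, w} 1" "M {v, w}" ?W "\<lambda>c. c {v, w}"
 proof unfold_locales
  show "CF.subspace (cocycles {v, w} 1)" by (rule cocycles_subspace[OF vw(2)])
  show "FV.subspace ?W" by (rule sum_subspace[OF vw(2)])
  fix x y assume x: "x \<in> cocycles {v, w} 1"
  show "(x + y) {v, w} = x {v, w} + y {v, w}" by simp
  show "cochain_scale c x {v, w} = fscale c (x {v, w})" for c by (simp add: cochain_scale_def)
  have xc: "x \<in> cochains {v, w} 1" using x unfolding cocycles_def by blast
  show "x {v, w} \<in> M {v, w}" by (rule cochains_D[OF xc]) (use ne in auto)
  show "x {v, w} \<in> ?W \<longleftrightarrow> x \<in> coboundaries {v, w} 1"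
  proof
   assume "x {v, w} \<in> ?W"
   then obtain y z where *: "y \<in> M {v}" "z \<in> M {w}" "x {v, w} - (z - y) \<in> N {v, w}" unfolding Wiff by (elim bexE) (rule that)
   define b where "b = (\<lambda>J. if J = {v} then y else if J = {w} then z else 0)"
   have "b \<in> cochains {v, w} 0" unfolding b_def using *(1,2) by (rule pair_cochain)
   moreover have "x J - cech_differential b J \<in> N J" if "J \<subseteq> {v, w} \<and> card J = 1 + 1" for J
    using pair_top[of J] that * ne by (simp add: pair_differential b_def)
   ultimately show "x \<in> coboundaries {v, w} 1" unfolding coboundaries_def using xc by auto
  next
   assume "x \<in> coboundaries {v, w} 1"
   then obtain b where b: "b \<in> cochains {v, w} 0" "\<And>J. J \<subseteq> {v, w} \<Longrightarrow> card J = 2 \<Longrightarrow> x J - cech_differential b J \<in> N J"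
    unfolding coboundaries_def by (auto simp: numeral_2_eq_2)
   have "b {v} \<in> M {v}" "b {w} \<in> M {w}" by (auto intro!: cochains_D[OF b(1)])
   thus "x {v, w} \<in> ?W" using b(2)[of "{v, w}"] ne by (auto simp: pair_differential)
  qed
 next
  fix z assume z: "z \<in> M {v, w}"
  define c where "c = (\<lambda>J. if J = {v, w} then z else 0)"
  have "c \<in> cochains {v, w} 1"
  proof (rule cochains_I)
   fix J assume "J \<subseteq> {v, w}" "card J = 1 + 1"
   hence "J = {v, w}" using pair_top by simp
   thus "c J \<in> M J" using z unfolding c_def by simp
  next
   fix J assume "\<not> (J \<subseteq> {v, w} \<and> card J = 1 + 1)"
   hence "J \<noteq> {v, w}" using ne by auto
   thus "c J = 0" unfolding c_def by simp
  qed
  hence "c \<in> cocycles {v, w} 1" unfolding cocycles_def using J3 by (auto simp: numeral_eq_Suc)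
  moreover have "z - c {v, w} \<in> ?W"
   using FV.subspace_0[OF sub(1)] FV.subspace_0[OF sub(2)] FV.subspace_0[OF sub(4)] by (force simp: c_def)
  ultimately show "\<exists>x\<in>cocycles {v, w} 1. z - x {v, w} \<in> ?W" by blast
 qed
 show ?thesis using Q.qdim_forward Q.qdim_backward by blast
qed

text \<open>By \<open>inj\<close> a function on the open set w that vanishes on the overlap vanishes
  on the scheme, so a global section is determined by its component at v.\<close>

lemma qdim_H0_pair:
 assumes inj: "N {v, w} \<inter> M {w} \<subseteq> N {w}"
 shows "qdim cochain_scale (cocycles {v, w} 0) (coboundaries {v, w} 0) n \<longleftrightarrow>
  qdim fscale {x \<in> M {v}. \<exists>y\<in>M {w}. y - x \<in> N {v, w}} (N {v}) n"
proof -
 let ?V = "{x \<in> M {v}. \<exists>y\<in>M {w}. y - x \<in> N {v, w}}"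
 have sub: "FV.subspace (N {v})" "FV.subspace (N {w})" "FV.subspace (N {v, w})"
  using N_sub vw by auto
 have ne: "v \<noteq> w" "w \<noteq> v" using vw by auto
 interpret Q: quotient_iso cochain_scale fscale "cocycles {v, w} 0" "coboundaries {v, w} 0" ?V "N {v}" "\<lambda>c. c {v}"
 proof unfold_locales
  show "CF.subspace (cocycles {v, w} 0)" by (rule cocycles_subspace[OF vw(2)])
  show "FV.subspace (N {v})" by (rule sub)
  fix x y assume x: "x \<in> cocycles {v, w} 0"
  show "(x + y) {v} = x {v} + y {v}" by simp
  show "cochain_scale c x {v} = fscale c (x {v})" for c by (simp add: cochain_scale_def)
  have xc: "x \<in> cochains {v, w} 0" and dx: "x {w} - x {v} \<in> N {v, w}"
   using x ne unfolding cocycles_def by (auto simp: pair_differential[symmetric])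
  have xM: "x {v} \<in> M {v}" "x {w} \<in> M {w}" by (auto intro!: cochains_D[OF xc])
  show "x {v} \<in> ?V" using xM dx by blast
  show "x {v} \<in> N {v} \<longleftrightarrow> x \<in> coboundaries {v, w} 0"
  proof
   assume xv: "x {v} \<in> N {v}"
   hence "x {v} \<in> N {v, w}" using N_mono[of "{v}" "{v, w}"] vw by blast
   hence "x {w} \<in> N {v, w}" using FV.subspace_add[OF sub(3) dx] by force
   hence "x {w} \<in> N {w}" using inj xM by blast
   hence "\<forall>J. J \<subseteq> {v, w} \<and> card J = 0 + 1 \<longrightarrow> x J - cech_differential 0 J \<in> N J"
    using xv pair_cases by (auto simp: differential_0)
   thus "x \<in> coboundaries {v, w} 0" unfolding coboundaries_def using xc by auto
  next
   assume "x \<in> coboundaries {v, w} 0"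
   hence "\<forall>J. J \<subseteq> {v, w} \<and> card J = 1 \<longrightarrow> x J - cech_differential 0 J \<in> N J"
    unfolding coboundaries_def by auto
   hence "x {v} - cech_differential 0 {v} \<in> N {v}" by simp
   thus "x {v} \<in> N {v}" by (simp add: differential_0)
  qed
 next
  fix z assume "z \<in> ?V"
  then obtain y where z: "z \<in> M {v}" "y \<in> M {w}" "y - z \<in> N {v, w}" by blast
  define c where "c = (\<lambda>J. if J = {v} then z else if J = {w} then y else 0)"
  have "c \<in> cochains {v, w} 0" unfolding c_def using z(1,2) by (rule pair_cochain)
  moreover have "cech_differential c J \<in> N J" if "J \<subseteq> {v, w} \<and> card J = 0 + 2" for J
   using pair_top[of J] that z ne by (auto simp: pair_differential c_def)
  ultimately have "c \<in> cocycles {v, w} 0" unfolding cocycles_def by blast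
  moreover have "z - c {v} \<in> N {v}" using FV.subspace_0[OF sub(1)] by (simp add: c_def)
  ultimately show "\<exists>x\<in>cocycles {v, w} 0. z - x {v} \<in> N {v}" by blast
 qed
 show ?thesis using Q.qdim_forward Q.qdim_backward by blast
qed

end

end

section \<open>Decompositions subordinate to a cover\<close>

context graded_alg begin

text \<open>Q is I plus the ideal of the powers \<open>f j ^ N\<close>, built one generator at a
  time so that its elements come with an explicit decomposition.\<close>

lemma cover_power:
 assumes I: "gideal I" and A: "finite A" and f: "\<And>j. j \<in> A \<Longrightarrow> f j \<in> G 1"
 shows "\<exists>Q. gideal Q \<and> I \<le> Q \<and> (\<forall>j\<in>A. f j ^ N \<in> Q N) \<and>
  (\<forall>n\<ge>N. \<forall>x\<in>Q n. \<exists>g. (\<forall>j\<in>A. g j \<in> G (n - N)) \<and> x - (\<Sum>j\<in>A. f j ^ N * g j) \<in> I n)"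
 using A f
proof (induction A rule: finite_induct)
 case empty
 thus ?case using I by (intro exI[of _ I]) auto
next
 case (insert a A)
 then obtain Q where Q: "gideal Q" "I \<le> Q" "\<And>j. j \<in> A \<Longrightarrow> f j ^ N \<in> Q N"
  "\<And>n x. n \<ge> N \<Longrightarrow> x \<in> Q n \<Longrightarrow> \<exists>g. (\<forall>j\<in>A. g j \<in> G (n - N)) \<and> x - (\<Sum>j\<in>A. f j ^ N * g j) \<in> I n"
  by (smt (verit) insertCI)
 have fa: "f a ^ N \<in> G N" by (rule G_power1) (use insert.prems in simp)
 note ge = adjoin_ge[of Q "f a ^ N" N]
 show ?case
 proof (intro exI[of _ "adjoin Q (f a ^ N) N"] conjI ballI allI impI)
  show "gideal (adjoin Q (f a ^ N) N)" by (rule adjoin_gideal[OF Q(1) fa])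
  show "I \<le> adjoin Q (f a ^ N) N" by (rule order_trans[OF Q(2) ge])
  fix j assume "j \<in> insert a A"
  thus "f j ^ N \<in> adjoin Q (f a ^ N) N N" using adjoin_mem[OF Q(1), of "f a ^ N" N] Q(3) ge by (auto simp: le_fun_def)
 next
  fix n x assume n: "N \<le> n" and x: "x \<in> adjoin Q (f a ^ N) N n"
  have nN: "n - N + N = n" using n by simp
  obtain p q where pq: "x = p + f a ^ N * q" "p \<in> Q n" "q \<in> G (n - N)"
   using adjoin_D[of x Q "f a ^ N" N "n - N"] x unfolding nN by blast
  obtain g where g: "\<forall>j\<in>A. g j \<in> G (n - N)" "p - (\<Sum>j\<in>A. f j ^ N * g j) \<in> I n" using Q(4)[OF n pq(2)] by blast
  have "(\<Sum>j\<in>A. f j ^ N * (g(a := q)) j) = (\<Sum>j\<in>A. f j ^ N * g j)" using insert.hyps by (intro sum.cong) auto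
  hence "x - (\<Sum>j\<in>insert a A. f j ^ N * (g(a := q)) j) = p - (\<Sum>j\<in>A. f j ^ N * g j)"
   using insert.hyps by (simp add: pq(1))
  thus "\<exists>g. (\<forall>j\<in>insert a A. g j \<in> G (n - N)) \<and> x - (\<Sum>j\<in>insert a A. f j ^ N * g j) \<in> I n"
   using g pq insert.hyps by (intro exI[of _ "g(a := q)"]) auto
 qed
qed

text \<open>Forms without a common zero on the scheme have powers without one, so by the
  Nullstellensatz these powers generate everything modulo I in large degrees.\<close>

lemma cover_decomposition:
 fixes N :: nat and f :: "nat \<Rightarrow> 'a"
 assumes I: "gideal I" and A: "finite A" and f: "\<And>j. j \<in> A \<Longrightarrow> f j \<in> G 1"
  and cover: "\<And>P. relevant P \<Longrightarrow> I \<le> P \<Longrightarrow> \<exists>j\<in>A. f j \<notin> P 1"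
 shows "\<exists>n\<ge>N. \<forall>x\<in>G n. \<exists>g. (\<forall>j\<in>A. g j \<in> G (n - N)) \<and> x - (\<Sum>j\<in>A. f j ^ N * g j) \<in> I n"
proof -
 obtain Q where Q: "gideal Q" "I \<le> Q" "\<And>j. j \<in> A \<Longrightarrow> f j ^ N \<in> Q N"
  "\<And>n x. n \<ge> N \<Longrightarrow> x \<in> Q n \<Longrightarrow> \<exists>g. (\<forall>j\<in>A. g j \<in> G (n - N)) \<and> x - (\<Sum>j\<in>A. f j ^ N * g j) \<in> I n"
  using cover_power[OF I A, of f N] f by blast
 have no: "\<not> (relevant P \<and> Q \<le> P)" for P
 proof
  assume P: "relevant P \<and> Q \<le> P"
  then obtain j where j: "j \<in> A" "f j \<notin> P 1" using cover[of P] Q(2) by (meson order_trans)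
  have "f j ^ N \<in> P N" using Q(3)[OF j(1)] P by (auto simp: le_fun_def)
  moreover have "gprime P" using P unfolding relevant_def by blast
  ultimately show False using gprime_power[of P "f j" N] f[OF j(1)] j(2) by blast
 qed
 hence "\<forall>\<^sub>F n in sequentially. Q n = G n" using no_relevant_prime[OF Q(1)] no by blast
 then obtain n0 where "\<And>n. n \<ge> n0 \<Longrightarrow> Q n = G n" unfolding eventually_sequentially by blast
 thus ?thesis using Q(4)[of "max n0 N"] by (intro exI[of _ "max n0 N"]) auto
qed

lemma relevant_not_eventually_top:
 assumes P: "relevant P" and t: "\<forall>\<^sub>F n in sequentially. P n = G n"
 shows False
proof -
 obtain n0 where n0: "\<And>n. n \<ge> n0 \<Longrightarrow> P n = G n" using t unfolding eventually_sequentially by blast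
 obtain x where x: "x \<in> G 1" "x \<notin> P 1" using P unfolding relevant_def by blast
 have "x ^ n0 \<in> P n0" using G_power1[OF x(1), of n0] n0 by simp
 thus False using gprime_power[of P x n0] P x unfolding relevant_def by blast
qed

end

subsection \<open>The standard cover and two hyperplane complements\<close>

text \<open>The pole order k of x along f i is finite, so every N >= k clears it; the denominator f
  a ^ K is harmless because a belongs to J. The same N serves for all larger K.\<close>

lemma sections_clear:
 assumes I: "S.gideal r (gr r I)" and f: "\<And>j. j \<in> insert i J \<Longrightarrow> f j \<in> forms r 1 \<and> f j \<noteq> 0"
  and J: "finite J" "a \<in> J" and x: "x \<in> sections r I (\<Prod>j\<in>insert i J. f j)"
 shows "\<forall>\<^sub>F N in sequentially. \<forall>K\<ge>N. \<forall>g\<in>forms r (K - N). frac (f i ^ N * g) (f a ^ K) * x \<in> sections r I (\<Prod>j\<in>J. f j)"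
proof -
 have fa: "f a \<in> forms r 1" "f a \<noteq> 0" and fi: "f i \<in> forms r 1" "f i \<noteq> 0" using f J by auto
 have P: "(\<Prod>j\<in>B. f j) \<in> forms r (card B) \<and> (\<Prod>j\<in>B. f j) \<noteq> 0" if "B \<subseteq> insert i J" for B
 proof -
  have "finite B" using that J(1) finite_subset by blast
  thus ?thesis using that
  proof (induction B rule: finite_induct)
   case (insert b B)
   thus ?case using forms_mult[of "f b" r 1 "\<Prod>j\<in>B. f j" "card B"] f[of b] by auto
  qed (simp add: one_forms)
 qed
 have split: "(\<Prod>j\<in>J. f j) = f a * (\<Prod>j\<in>J - {a}. f j)" by (rule prod.remove[OF J])
 have PJ: "(\<Prod>j\<in>J. f j) \<in> forms r (card J)" "(\<Prod>j\<in>J. f j) \<noteq> 0" using P by blast+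
 have PJa: "(\<Prod>j\<in>J - {a}. f j) \<in> forms r (card J - 1)" "(\<Prod>j\<in>J - {a}. f j) \<noteq> 0" using P[of "J - {a}"] J by auto
 show ?thesis
 proof (cases "i \<in> J")
  case True
  hence x': "x \<in> sections r I (\<Prod>j\<in>J. f j)" using x by (simp add: insert_absorb)
  have "frac (f i ^ N * g) (f a ^ K) * x \<in> sections r I (\<Prod>j\<in>J. f j)" if K: "K \<ge> N" and g: "g \<in> forms r (K - N)" for N K g
  proof (rule sections_mult[OF I PJ _ x'])
   have "f i ^ N * g \<in> forms r K" using forms_mult[OF S.G_power1[OF fi(1), of N] g] K by simp
   hence "frac (f i ^ N * g) (f a ^ K) \<in> sections r (polys r) (f a)"
    unfolding sections_iff[OF fa] gr_polys by (intro exI[of _ "f i ^ N * g"] exI[of _ K]) simp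
   thus "frac (f i ^ N * g) (f a ^ K) \<in> sections r (polys r) (\<Prod>j\<in>J. f j)"
    unfolding split using sections_mono[OF polys_gideal fa PJa] by blast
  qed
  thus ?thesis by simp
 next
  case False
  have PiJ: "(\<Prod>j\<in>insert i J. f j) \<in> forms r (Suc (card J))" "(\<Prod>j\<in>insert i J. f j) \<noteq> 0"
   using P[of "insert i J"] J False by auto
  obtain \<alpha> k where \<alpha>: "\<alpha> \<in> gr r I (k * Suc (card J))" "x = frac \<alpha> ((\<Prod>j\<in>insert i J. f j) ^ k)"
   using x unfolding sections_iff[OF PiJ] by blast
  have "frac (f i ^ N * g) (f a ^ K) * x \<in> sections r I (\<Prod>j\<in>J. f j)"
   if N: "N \<ge> k" and K: "K \<ge> N" and g: "g \<in> forms r (K - N)" for N K g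
  proof -
   define q where "q = f i ^ (N - k) * g * (\<Prod>j\<in>J - {a}. f j) ^ K"
   have "f i ^ (N - k) * g \<in> forms r ((N - k) + (K - N))" by (rule forms_mult[OF S.G_power1[OF fi(1)] g])
   hence "q \<in> forms r ((N - k) + (K - N) + K * (card J - 1))"
    unfolding q_def by (rule forms_mult[OF _ S.G_power[OF PJa(1)]])
   hence "q * \<alpha> \<in> gr r I ((N - k) + (K - N) + K * (card J - 1) + k * Suc (card J))"
    by (rule S.gideal_mult[OF I _ \<alpha>(1)])
   moreover have "(N - k) + (K - N) + K * (card J - 1) + k * Suc (card J) = (K + k) * card J"
   proof -
    obtain c where c: "card J = Suc c" using J by (metis card_Suc_Diff1)
    show ?thesis using N K unfolding c by (simp add: algebra_simps)
   qed
   moreover have "frac (f i ^ N * g) (f a ^ K) * x = frac (q * \<alpha>) ((\<Prod>j\<in>J. f j) ^ (K + k))"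
   proof -
    obtain n where n: "N = n + k" using N by (metis le_add_diff_inverse2)
    show ?thesis
     using fa fi PJ PJa J False unfolding \<alpha>(2) q_def n
     by (simp add: eq_fract) (simp add: split power_add power_mult_distrib)
   qed
   ultimately show ?thesis unfolding sections_iff[OF PJ] by metis
  qed
  thus ?thesis unfolding eventually_sequentially by blast
 qed
qed

locale two_hyperplanes =
 fixes r :: nat and I :: "mpoly set" and V W :: mpoly
 assumes sat: "S.saturated r (gr r I)"
  and V: "V \<in> forms r 1" "V \<noteq> 0" "S.almost_nzd r (gr r I) V 1"
  and W: "W \<in> forms r 1" "W \<noteq> 0" "S.almost_nzd r (gr r I) W 1"
  and top: "\<forall>\<^sub>F n in sequentially. S.adjoin r (S.adjoin r (gr r I) V 1) W 1 n = forms r n"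
begin

text \<open>One family of charts containing both covers: the indices up to r are the standard one,
  and r + 1 and r + 2 are the complements of V = 0 and W = 0.\<close>

definition chart :: "nat \<Rightarrow> mpoly" where
 "chart j = (if j \<le> r then var j else if j = Suc r then V else W)"

definition prod_chart :: "nat set \<Rightarrow> mpoly" where
 "prod_chart J = (\<Prod>j\<in>J. chart j)"

lemma gI: "S.gideal r (gr r I)" by (rule S.saturated_gideal[OF sat])

lemma var_nonzero: "var j \<noteq> 0"
 unfolding var_def by (metis lookup_single_eq lookup_zero zero_neq_one)

lemma chart: "chart j \<in> forms r 1" "chart j \<noteq> 0"
 using V W var_forms var_nonzero unfolding chart_def by auto

lemma prod_chart: "prod_chart J \<in> forms r (card J)" "prod_chart J \<noteq> 0"
proof -
 have "prod_chart J \<in> forms r (card J) \<and> prod_chart J \<noteq> 0"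
 proof (cases "finite J")
  case True
  thus ?thesis unfolding prod_chart_def
  proof (induction J rule: finite_induct)
   case (insert b B)
   thus ?case using forms_mult[of "chart b" r 1 "\<Prod>j\<in>B. chart j" "card B"] chart[of b] by auto
  qed (simp add: one_forms)
 qed (simp add: one_forms prod_chart_def)
 thus "prod_chart J \<in> forms r (card J)" "prod_chart J \<noteq> 0" by blast+
qed

sublocale cech_system "\<lambda>J. sections r (polys r) (prod_chart J)" "\<lambda>J. sections r I (prod_chart J)" "{..r + 2}"
proof
 have mono: "sections r I' (prod_chart J) \<subseteq> sections r I' (prod_chart J')"
  if "J \<subseteq> J'" "J' \<subseteq> {..r + 2}" "S.gideal r (gr r I')" for I' J J'
 proof -
  have "finite J'" using that(2) finite_subset by blast
  hence "prod_chart J' = prod_chart J * prod_chart (J' - J)"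
   unfolding prod_chart_def using prod.subset_diff[OF that(1)] by (simp add: mult.commute)
  thus ?thesis using sections_mono[OF that(3) prod_chart prod_chart] by simp
 qed
 show "finite {..r + 2}" by simp
 fix J :: "nat set"
 show "FV.subspace (sections r (polys r) (prod_chart J))" by (rule sections_subspace[OF polys_gideal prod_chart])
 show "FV.subspace (sections r I (prod_chart J))" by (rule sections_subspace[OF gI prod_chart])
 show "sections r I (prod_chart J) \<subseteq> sections r (polys r) (prod_chart J)" by (rule sections_subset[OF gI prod_chart])
 show "x * y \<in> sections r I (prod_chart J)" if "x \<in> sections r (polys r) (prod_chart J)" "y \<in> sections r I (prod_chart J)" for x y
  by (rule sections_mult[OF gI prod_chart that])
 fix J' assume "J \<subseteq> J'" "J' \<subseteq> {..r + 2}"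
 thus "sections r (polys r) (prod_chart J) \<subseteq> sections r (polys r) (prod_chart J')"
  "sections r I (prod_chart J) \<subseteq> sections r I (prod_chart J')" using mono gI polys_gideal by blast+
qed

text \<open>Decompose f a ^ K as the sum of f j ^ N g j modulo I and divide by f a ^ K. The exponent
  N is chosen large enough for the finitely many given sections, and K afterwards.\<close>

lemma cover_partition:
 assumes aA: "insert a A \<subseteq> {..r + 2}" "a \<notin> A"
  and cover: "\<And>P. S.relevant r P \<Longrightarrow> gr r I \<le> P \<Longrightarrow> \<exists>j\<in>A. chart j \<notin> P 1"
 shows "partition a A"
 unfolding partition_def
proof (intro allI impI)
 fix F :: "ratfun set" assume F: "finite F"
 have fA: "finite A" by (rule finite_subset[of _ "{..r + 2}"]) (use aA in auto)
 define good where "good N x j J I' \<longleftrightarrow> (a \<in> J \<longrightarrow> x \<in> sections r I' (prod_chart (insert j J)) \<longrightarrow>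
  (\<forall>K\<ge>N. \<forall>g\<in>forms r (K - N). frac (chart j ^ N * g) (chart a ^ K) * x \<in> sections r I' (prod_chart J)))" for N x j J I'
 have ev: "\<forall>\<^sub>F N in sequentially. good N x j J I'" if J: "J \<subseteq> insert a A" and I': "S.gideal r (gr r I')" for x j J I'
 proof (cases "a \<in> J \<and> x \<in> sections r I' (prod_chart (insert j J))")
  case True
  have "finite J" by (rule finite_subset[OF J]) (use fA in simp)
  thus ?thesis
   using sections_clear[OF I', of j J chart a x] chart True unfolding good_def prod_chart_def by simp
 next
  case False
  thus ?thesis unfolding good_def by (auto intro: always_eventually)
 qed
 have "\<forall>\<^sub>F N in sequentially. \<forall>x\<in>F. \<forall>j\<in>A. \<forall>J\<in>Pow (insert a A). good N x j J I \<and> good N x j J (polys r)"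
  by (intro eventually_ball_finite F fA finite_Pow_iff[THEN iffD2] finite.insertI ballI eventually_conj ev gI polys_gideal) auto
 then obtain N where N: "\<And>x j J. x \<in> F \<Longrightarrow> j \<in> A \<Longrightarrow> J \<subseteq> insert a A \<Longrightarrow> good N x j J I \<and> good N x j J (polys r)"
  unfolding eventually_sequentially by blast
 obtain K where K: "K \<ge> N" "\<And>x. x \<in> forms r K \<Longrightarrow>
   \<exists>g. (\<forall>j\<in>A. g j \<in> forms r (K - N)) \<and> x - (\<Sum>j\<in>A. chart j ^ N * g j) \<in> gr r I K"
  using S.cover_decomposition[OF gI fA, of chart N] chart cover by blast
 obtain g where g: "\<And>j. j \<in> A \<Longrightarrow> g j \<in> forms r (K - N)" "chart a ^ K - (\<Sum>j\<in>A. chart j ^ N * g j) \<in> gr r I K"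
  using K(2)[OF S.G_power1[OF chart(1), of a K]] by blast
 define \<rho> where "\<rho> j = frac (chart j ^ N * g j) (chart a ^ K)" for j
 have "(\<Sum>j\<in>A. \<rho> j) - 1 = frac ((\<Sum>j\<in>A. chart j ^ N * g j) - chart a ^ K) (chart a ^ K)"
  unfolding \<rho>_def using sum_Fract[OF fA, of "chart a ^ K"] chart(2)[of a] by (simp add: One_fract_def eq_fract algebra_simps)
 moreover have "(\<Sum>j\<in>A. chart j ^ N * g j) - chart a ^ K \<in> gr r I K"
  using FV.subspace_neg S.subspace_neg[OF S.gideal_sub[OF gI] g(2)] by simp
 ultimately have "(\<Sum>j\<in>A. \<rho> j) - 1 \<in> sections r I (prod_chart {a})"
  unfolding prod_chart_def using sections_iff[OF chart, of _ I a] by auto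
 moreover have "\<rho> j * x \<in> sections r I' (prod_chart J)"
  if "x \<in> F" "j \<in> A" "a \<in> J" "J \<subseteq> insert a A" "x \<in> sections r I' (prod_chart (insert j J))" "I' \<in> {I, polys r}" for x j J I'
  using N[OF that(1,2,4)] that K(1) g(1)[OF that(2)] unfolding good_def \<rho>_def by blast
 ultimately show "\<exists>\<rho>. (\<Sum>j\<in>A. \<rho> j) - 1 \<in> sections r I (prod_chart {a}) \<and>
   (\<forall>x\<in>F. \<forall>j\<in>A. \<forall>J. a \<in> J \<longrightarrow> J \<subseteq> insert a A \<longrightarrow>
    (x \<in> sections r (polys r) (prod_chart (insert j J)) \<longrightarrow> \<rho> j * x \<in> sections r (polys r) (prod_chart J)) \<and>
    (x \<in> sections r I (prod_chart (insert j J)) \<longrightarrow> \<rho> j * x \<in> sections r I (prod_chart J)))"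
  by (intro exI[of _ \<rho>]) blast
qed

lemma VW_cover:
 assumes P: "S.relevant r P" "gr r I \<le> P" "V \<in> P 1" "W \<in> P 1"
 shows False
proof (rule S.relevant_not_eventually_top[OF P(1)])
 have gP: "S.gideal r P" using P(1) S.relevant_gideal by blast
 have le: "S.adjoin r (S.adjoin r (gr r I) V 1) W 1 \<le> P"
  by (intro S.adjoin_least gP P)
 show "\<forall>\<^sub>F n in sequentially. P n = forms r n"
  by (rule eventually_mono[OF top]) (metis le_funD[OF le] S.gideal_subset[OF gP] subset_antisym)
qed

definition coh :: "nat set \<Rightarrow> nat \<Rightarrow> nat \<Rightarrow> bool" where
 "coh A p n \<longleftrightarrow> qdim cochain_scale (cocycles A p) (coboundaries A p) n"

lemma coh_standard: "coh {..r} p n \<longleftrightarrow> coh {Suc r, r + 2} p n"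
proof -
 have c1: "\<exists>j\<in>{..r}. chart j \<notin> P 1" if "S.relevant r P" for P
  using S.relevant_X[OF that] unfolding chart_def by auto
 have "coh {..r} p n \<longleftrightarrow> coh (insert (Suc r) {..r}) p n"
  unfolding coh_def by (rule qdim_restr[symmetric], simp, simp, rule cover_partition) (use c1 in auto)
 also have "\<dots> \<longleftrightarrow> coh (insert (r + 2) (insert (Suc r) {..r})) p n"
  unfolding coh_def by (rule qdim_restr[symmetric], simp, simp, rule cover_partition) (use c1 in auto)
 also have "insert (r + 2) (insert (Suc r) {..r}) = {0..r + 2}" by auto
 \<comment> \<open>Deleting the coordinate charts one by one is harmless because V and W, which stay
   in the cover, have no common zero on the scheme.\<close>
 also have "coh {0..r + 2} p n \<longleftrightarrow> coh {k..r + 2} p n" if "k \<le> Suc r" for k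
  using that
 proof (induction k)
  case (Suc k)
  have "{k..r + 2} = insert k {Suc k..r + 2}" using Suc.prems by auto
  moreover have "coh (insert k {Suc k..r + 2}) p n \<longleftrightarrow> coh {Suc k..r + 2} p n"
   unfolding coh_def
  proof (rule qdim_restr)
   show "partition k {Suc k..r + 2}"
   proof (rule cover_partition)
    fix P assume P: "S.relevant r P" "gr r I \<le> P"
    have "chart (Suc r) = V" "chart (r + 2) = W" unfolding chart_def by auto
    moreover have "Suc r \<in> {Suc k..r + 2}" "r + 2 \<in> {Suc k..r + 2}" using Suc.prems by auto
    ultimately show "\<exists>j\<in>{Suc k..r + 2}. chart j \<notin> P 1" using VW_cover[OF P] by metis
   qed (use Suc.prems in auto)
  qed (use Suc.prems in auto)
  ultimately show ?case using Suc by simp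
 qed simp
 hence "coh {0..r + 2} p n \<longleftrightarrow> coh {Suc r..r + 2} p n" by simp
 also have "{Suc r..r + 2} = {Suc r, r + 2}" by auto
 finally show ?thesis .
qed

end

section \<open>Cohomology of the cover by two hyperplane complements\<close>

context two_hyperplanes begin

lemma prod_chart_pair: "prod_chart {Suc r} = V" "prod_chart {r + 2} = W" "prod_chart {Suc r, r + 2} = V * W"
 unfolding prod_chart_def chart_def by auto

lemma VW: "V * W \<in> forms r 2" "V * W \<noteq> 0"
 using forms_mult[OF V(1) W(1)] V(2) W(2) by (auto simp: numeral_2_eq_2)

lemma nzd_V: "a \<in> forms r n \<Longrightarrow> V ^ m * a \<in> gr r I (m + n) \<Longrightarrow> a \<in> gr r I n"
 using S.nzd_power[OF sat V(1,3), of a n m] by (simp add: add.commute)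

lemma nzd_W: "a \<in> forms r n \<Longrightarrow> W ^ m * a \<in> gr r I (m + n) \<Longrightarrow> a \<in> gr r I n"
 using S.nzd_power[OF sat W(1,3), of a n m] by (simp add: add.commute)

lemma nzd_VW:
 assumes a: "a \<in> forms r n" "(V * W) ^ m * a \<in> gr r I (m * 2 + n)"
 shows "a \<in> gr r I n"
proof -
 have "W ^ m * a \<in> forms r (m + n)" by (rule forms_mult[OF S.G_power1[OF W(1)] a(1)])
 moreover have "V ^ m * (W ^ m * a) \<in> gr r I (m + (m + n))"
  using a(2) by (simp add: power_mult_distrib mult.assoc mult_2_right add.assoc)
 ultimately have "W ^ m * a \<in> gr r I (m + n)" by (rule nzd_V)
 thus ?thesis by (rule nzd_W[OF a(1)])
qed

lemma frac_V: assumes "a \<in> forms r n" shows "frac a (V ^ n) \<in> sections r I V \<longleftrightarrow> a \<in> gr r I n"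
proof -
 have "frac a (V ^ n) \<in> sections r I V \<longleftrightarrow> (\<exists>m. V ^ m * a \<in> gr r I (m + n))"
  using sections_frac_iff[OF gI V(1,2), of a n] assms by simp
 thus ?thesis using nzd_V[OF assms] by (metis power_0 mult_1 add_0)
qed

lemma frac_W: assumes "a \<in> forms r n" shows "frac a (W ^ n) \<in> sections r I W \<longleftrightarrow> a \<in> gr r I n"
proof -
 have "frac a (W ^ n) \<in> sections r I W \<longleftrightarrow> (\<exists>m. W ^ m * a \<in> gr r I (m + n))"
  using sections_frac_iff[OF gI W(1,2), of a n] assms by simp
 thus ?thesis using nzd_W[OF assms] by (metis power_0 mult_1 add_0)
qed

lemma frac_VW: assumes "a \<in> forms r (n + n)" shows "frac a ((V * W) ^ n) \<in> sections r I (V * W) \<longleftrightarrow> a \<in> gr r I (n + n)"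
proof -
 have "a \<in> forms r (n * 2)" using assms by (simp add: mult_2_right)
 hence "frac a ((V * W) ^ n) \<in> sections r I (V * W) \<longleftrightarrow> (\<exists>m. (V * W) ^ m * a \<in> gr r I (m * 2 + n * 2))"
  by (rule sections_frac_iff[OF gI VW])
 hence "frac a ((V * W) ^ n) \<in> sections r I (V * W) \<longleftrightarrow> (\<exists>m. (V * W) ^ m * a \<in> gr r I (m * 2 + (n + n)))"
  by (simp only: mult_2_right)
 thus ?thesis using nzd_VW[OF assms] by (metis power_0 mult_1 add_0 mult_zero_left)
qed

lemma sections_V: "x \<in> sections r (polys r) V \<longleftrightarrow> (\<exists>a n. a \<in> forms r n \<and> x = frac a (V ^ n))"
 unfolding sections_iff[OF V(1,2)] gr_polys by simp

lemma sections_W: "x \<in> sections r (polys r) W \<longleftrightarrow> (\<exists>a n. a \<in> forms r n \<and> x = frac a (W ^ n))"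
 unfolding sections_iff[OF W(1,2)] gr_polys by simp

lemma sections_VW: "x \<in> sections r (polys r) (V * W) \<longleftrightarrow> (\<exists>a n. a \<in> forms r (n + n) \<and> x = frac a ((V * W) ^ n))"
 unfolding sections_iff[OF VW] gr_polys by (simp add: mult_2_right)

lemma raise_frac:
 assumes "h \<in> forms r 1" "h \<noteq> 0" "a \<in> forms r n" "n \<le> m"
 shows "\<exists>b\<in>forms r m. frac a (h ^ n) = frac b (h ^ m)"
 using sections_raise[OF polys_gideal assms(1,2), of a n m] assms(3,4) unfolding gr_polys by auto

lemma diff_VW: "frac b (W ^ n) - frac a (V ^ n) = frac (V ^ n * b - W ^ n * a) ((V * W) ^ n)"
 using V(2) W(2) by (simp add: eq_fract power_mult_distrib algebra_simps)

lemma diff_forms: "a \<in> forms r n \<Longrightarrow> b \<in> forms r n \<Longrightarrow> V ^ n * b - W ^ n * a \<in> forms r (n + n)"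
 by (intro S.subspace_diff[OF S.G_sub] forms_mult S.G_power1 V W)

definition H0 :: "ratfun set" where
 "H0 = {x \<in> sections r (polys r) V. \<exists>y\<in>sections r (polys r) W. y - x \<in> sections r I (V * W)}"

definition B1 :: "ratfun set" where
 "B1 = {x. \<exists>y\<in>sections r (polys r) V. \<exists>z\<in>sections r (polys r) W. x - (z - y) \<in> sections r I (V * W)}"

lemma H0_mem: "x \<in> H0 \<longleftrightarrow> (\<exists>a j b l. a \<in> forms r j \<and> x = frac a (V ^ j) \<and> b \<in> forms r l \<and>
  frac b (W ^ l) - x \<in> sections r I (V * W))"
 unfolding H0_def Bex_def mem_Collect_eq sections_V sections_W by blast

lemma B1_mem: "x \<in> B1 \<longleftrightarrow> (\<exists>a j b l. a \<in> forms r j \<and> b \<in> forms r l \<and>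
  x - (frac b (W ^ l) - frac a (V ^ j)) \<in> sections r I (V * W))"
 unfolding B1_def Bex_def mem_Collect_eq sections_V sections_W by blast

text \<open>Global sections are the union of the levels of \<open>kersp\<close>; since numerators
  can be raised by powers of V, any lower bound k on the level may be imposed.\<close>

lemma H0_iff:
 "x \<in> H0 \<longleftrightarrow> (\<exists>n\<ge>k. \<exists>a\<in>S.kersp r (gr r I) V W n. x = frac a (V ^ n))"
proof
 assume "x \<in> H0"
 then obtain a j b l where *: "a \<in> forms r j" "x = frac a (V ^ j)" "b \<in> forms r l"
  "frac b (W ^ l) - x \<in> sections r I (V * W)" unfolding H0_mem by blast
 define n where "n = k + max j l"
 have jn: "j \<le> n" "l \<le> n" unfolding n_def by auto
 obtain a' where a': "a' \<in> forms r n" "x = frac a' (V ^ n)"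
  using raise_frac[OF V(1,2) *(1) jn(1)] *(2) by auto
 obtain b' where b': "b' \<in> forms r n" "frac b (W ^ l) = frac b' (W ^ n)"
  using raise_frac[OF W(1,2) *(3) jn(2)] by auto
 have "V ^ n * b' - W ^ n * a' \<in> gr r I (n + n)"
  using *(4) frac_VW[OF diff_forms[OF a'(1) b'(1)]] unfolding a'(2) b'(2) diff_VW by blast
 hence "W ^ n * a' - V ^ n * b' \<in> gr r I (n + n)" using S.subspace_neg[OF S.gideal_sub[OF gI]] by force
 hence "a' \<in> S.kersp r (gr r I) V W n" unfolding S.kersp_iff[OF gI V(1)] using a' b' by blast
 thus "\<exists>n\<ge>k. \<exists>a\<in>S.kersp r (gr r I) V W n. x = frac a (V ^ n)"
  using a'(2) by (intro exI[of _ n]) (auto simp: n_def)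
next
 assume "\<exists>n\<ge>k. \<exists>a\<in>S.kersp r (gr r I) V W n. x = frac a (V ^ n)"
 then obtain n a where a: "a \<in> S.kersp r (gr r I) V W n" "x = frac a (V ^ n)" by blast
 then obtain q where q: "a \<in> forms r n" "q \<in> forms r n" "W ^ n * a - V ^ n * q \<in> gr r I (n + n)"
  unfolding S.kersp_iff[OF gI V(1)] by blast
 have "V ^ n * q - W ^ n * a \<in> gr r I (n + n)" using S.subspace_neg[OF S.gideal_sub[OF gI] q(3)] by simp
 hence "frac q (W ^ n) - x \<in> sections r I (V * W)"
  unfolding a(2) diff_VW frac_VW[OF diff_forms[OF q(1,2)]] .
 thus "x \<in> H0" unfolding H0_mem using q(1,2) a(2) by blast
qed

lemma B1_cokid:
 assumes p: "p \<in> S.cokid r (gr r I) V W n (n + n)"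
 shows "frac p ((V * W) ^ n) \<in> B1"
proof -
 obtain i q q' where *: "p = i + V ^ n * q + W ^ n * q'" "i \<in> gr r I (n + n)" "q \<in> forms r n" "q' \<in> forms r n"
  using p unfolding S.cokid_iff[OF gI V(1)] by blast
 have q'': "- q' \<in> forms r n" using *(4) S.subspace_neg[OF S.G_sub] by blast
 have "frac p ((V * W) ^ n) - (frac q (W ^ n) - frac (- q') (V ^ n)) = frac i ((V * W) ^ n)"
  unfolding diff_VW using V(2) W(2) by (simp add: *(1) eq_fract algebra_simps)
 also have "\<dots> \<in> sections r I (V * W)"
  using frac_VW *(2) S.gideal_subset[OF gI] by blast
 finally show ?thesis unfolding B1_mem using *(3) q'' by blast
qed

text \<open>Bringing p and the two bounding sections to the common denominator (V W)^(k + m)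
  exhibits the coboundary as membership in \<open>cokid\<close> at a higher level.\<close>

lemma B1_frac:
 assumes p: "p \<in> forms r (k + k)" "frac p ((V * W) ^ k) \<in> B1"
 shows "\<exists>m. (V * W) ^ m * p \<in> S.cokid r (gr r I) V W (k + m) ((k + m) + (k + m))"
proof -
 obtain a j b l where *: "a \<in> forms r j" "b \<in> forms r l"
  "frac p ((V * W) ^ k) - (frac b (W ^ l) - frac a (V ^ j)) \<in> sections r I (V * W)"
  using p(2) unfolding B1_mem by blast
 define m n where "m = max j l" and "n = k + m"
 have jn: "j \<le> n" "l \<le> n" unfolding n_def m_def by auto
 obtain a' where a': "a' \<in> forms r n" "frac a (V ^ j) = frac a' (V ^ n)"
  using raise_frac[OF V(1,2) *(1) jn(1)] by blast
 obtain b' where b': "b' \<in> forms r n" "frac b (W ^ l) = frac b' (W ^ n)"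
  using raise_frac[OF W(1,2) *(2) jn(2)] by blast
 have "(V * W) ^ m * p \<in> forms r (m * 2 + (k + k))" by (rule forms_mult[OF S.G_power[OF VW(1)] p(1)])
 moreover have "m * 2 + (k + k) = n + n" by (simp add: n_def)
 ultimately have pn: "(V * W) ^ m * p \<in> forms r (n + n)" by simp
 have "frac p ((V * W) ^ k) = frac ((V * W) ^ m * p) ((V * W) ^ n)"
  using V(2) W(2) by (simp add: n_def eq_fract power_add)
 hence "frac p ((V * W) ^ k) - (frac b (W ^ l) - frac a (V ^ j)) =
   frac ((V * W) ^ m * p - (V ^ n * b' - W ^ n * a')) ((V * W) ^ n)"
  unfolding a' b' diff_VW using VW(2) by (simp add: eq_fract algebra_simps)
 moreover have "(V * W) ^ m * p - (V ^ n * b' - W ^ n * a') \<in> forms r (n + n)"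
  by (rule S.subspace_diff[OF S.G_sub pn diff_forms[OF a'(1) b'(1)]])
 ultimately have i: "(V * W) ^ m * p - (V ^ n * b' - W ^ n * a') \<in> gr r I (n + n)" using *(3) frac_VW by simp
 have "- a' \<in> forms r n" using a'(1) S.subspace_neg[OF S.G_sub] by blast
 hence "\<exists>i q q'. (V * W) ^ m * p = i + V ^ n * q + W ^ n * q' \<and> i \<in> gr r I (n + n) \<and> q \<in> forms r n \<and> q' \<in> forms r n"
  using i b'(1) by (intro exI[of _ "(V * W) ^ m * p - (V ^ n * b' - W ^ n * a')"] exI[of _ b'] exI[of _ "- a'"]) simp
 thus ?thesis using S.cokid_iff[OF gI V(1), of _ W n] unfolding n_def by blast
qed

text \<open>The stable level k of \<open>two_open_cover\<close> represents both direct limits: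
  numerators over V^k give all global sections, and numerators over (V W)^k all classes of the
  overlap.\<close>

lemma coh_pair:
 assumes hf: "\<forall>\<^sub>F n in sequentially. int (S.hf r (gr r I) n) = e * int n + \<chi>"
 shows "\<exists>u w. coh {Suc r, r + 2} 0 u \<and> coh {Suc r, r + 2} 1 w \<and> int u - int w = \<chi>"
proof -
 obtain k u w where kuw: "qdim cscale (S.kersp r (gr r I) V W k) (gr r I k) u"
  "qdim cscale (forms r (k + k)) (S.cokid r (gr r I) V W k (k + k)) w" "int u - int w = \<chi>"
  and ker: "\<And>m \<alpha>. \<alpha> \<in> S.kersp r (gr r I) V W (k + m) \<Longrightarrow> \<exists>\<beta>\<in>S.kersp r (gr r I) V W k. \<alpha> - V ^ m * \<beta> \<in> gr r I (k + m)"
  and cok1: "\<And>m p. p \<in> forms r (k + k) \<Longrightarrow> (V * W) ^ m * p \<in> S.cokid r (gr r I) V W (k + m) ((k + m) + (k + m)) \<Longrightarrow>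
    p \<in> S.cokid r (gr r I) V W k (k + k)"
  and cok2: "\<And>m p. p \<in> forms r ((k + m) + (k + m)) \<Longrightarrow>
    \<exists>q\<in>forms r (k + k). p - (V * W) ^ m * q \<in> S.cokid r (gr r I) V W (k + m) ((k + m) + (k + m))"
  using S.two_open_cover[OF sat V(1,3) W(1,3) top hf] by blast
 have U: "{Suc r, r + 2} \<subseteq> {..r + 2}" "Suc r < r + 2" by auto
 have fr: "fscale c (frac a b) = frac (const c * a) b" for c a b by (simp add: fscale_def)
 interpret H: quotient_iso cscale fscale "S.kersp r (gr r I) V W k" "gr r I k" H0 "sections r I V" "\<lambda>a. frac a (V ^ k)"
 proof unfold_locales
  show "S.subspace (S.kersp r (gr r I) V W k)" by (rule S.kersp_subspace[OF gI V(1) W(1)])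
  show "FV.subspace (sections r I V)" by (rule sections_subspace[OF gI V(1,2)])
  fix x y assume x: "x \<in> S.kersp r (gr r I) V W k"
  have xk: "x \<in> forms r k" using x unfolding S.kersp_iff[OF gI V(1)] by blast
  show "frac (x + y) (V ^ k) = frac x (V ^ k) + frac y (V ^ k)" using frac_add_same V(2) by simp
  show "frac (cscale c x) (V ^ k) = fscale c (frac x (V ^ k))" for c by (simp add: fr)
  show "frac x (V ^ k) \<in> H0" unfolding H0_iff[of _ k] using x by blast
  show "frac x (V ^ k) \<in> sections r I V \<longleftrightarrow> x \<in> gr r I k" by (rule frac_V[OF xk])
 next
  fix z assume "z \<in> H0"
  then obtain n a where n: "n \<ge> k" "a \<in> S.kersp r (gr r I) V W n" "z = frac a (V ^ n)" unfolding H0_iff[of _ k] by blast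
  obtain m where m: "n = k + m" using n(1) le_Suc_ex by blast
  obtain \<beta> where \<beta>: "\<beta> \<in> S.kersp r (gr r I) V W k" "a - V ^ m * \<beta> \<in> gr r I n" using ker n m by blast
  have "z - frac \<beta> (V ^ k) = frac (a - V ^ m * \<beta>) (V ^ n)" using V(2) by (simp add: n(3) m eq_fract power_add algebra_simps)
  hence "z - frac \<beta> (V ^ k) \<in> sections r I V" using frac_V[of _ n] \<beta>(2) S.gideal_subset[OF gI] by auto
  thus "\<exists>x\<in>S.kersp r (gr r I) V W k. z - frac x (V ^ k) \<in> sections r I V" using \<beta>(1) by blast
 qed
 have inj: "sections r I (prod_chart {Suc r, r + 2}) \<inter> sections r (polys r) (prod_chart {r + 2}) \<subseteq> sections r I (prod_chart {r + 2})"
  unfolding prod_chart_pair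
 proof
  fix y assume y: "y \<in> sections r I (V * W) \<inter> sections r (polys r) W"
  hence "y \<in> sections r (polys r) W" by blast
  then obtain b n where b: "b \<in> forms r n" "y = frac b (W ^ n)" unfolding sections_W by blast
  have "frac b (W ^ n) = frac (V ^ n * b) ((V * W) ^ n)" using V(2) W(2) by (simp add: eq_fract power_mult_distrib)
  moreover have "V ^ n * b \<in> forms r (n + n)" by (rule forms_mult[OF S.G_power1[OF V(1)] b(1)])
  ultimately have "V ^ n * b \<in> gr r I (n + n)" using y frac_VW b(2) by auto
  thus "y \<in> sections r I W" unfolding b(2) frac_W[OF b(1)] by (rule nzd_V[OF b(1)])
 qed
 have "coh {Suc r, r + 2} 0 u"
  unfolding coh_def qdim_H0_pair[OF U(2,1) inj] prod_chart_pair H0_def[symmetric] by (rule H.qdim_forward[OF kuw(1)])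
 interpret K: quotient_iso cscale fscale "forms r (k + k)" "S.cokid r (gr r I) V W k (k + k)"
  "sections r (polys r) (V * W)" B1 "\<lambda>p. frac p ((V * W) ^ k)"
 proof unfold_locales
  show "S.subspace (forms r (k + k))" by (rule S.G_sub)
  show "FV.subspace B1" unfolding B1_def using sum_subspace[OF U(1)] by (simp only: prod_chart_pair)
  fix x y assume x: "x \<in> forms r (k + k)"
  show "frac (x + y) ((V * W) ^ k) = frac x ((V * W) ^ k) + frac y ((V * W) ^ k)" using frac_add_same VW(2) by simp
  show "frac (cscale c x) ((V * W) ^ k) = fscale c (frac x ((V * W) ^ k))" for c by (simp add: fr)
  show "frac x ((V * W) ^ k) \<in> sections r (polys r) (V * W)" unfolding sections_VW using x by blast
  show "frac x ((V * W) ^ k) \<in> B1 \<longleftrightarrow> x \<in> S.cokid r (gr r I) V W k (k + k)"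
   using B1_cokid[of x k] B1_frac[OF x] cok1[OF x] by blast
 next
  fix z assume "z \<in> sections r (polys r) (V * W)"
  then obtain a n where a: "a \<in> forms r (n + n)" "z = frac a ((V * W) ^ n)" unfolding sections_VW by blast
  have "a * (V * W) ^ k \<in> forms r ((n + n) + k * 2)" by (rule forms_mult[OF a(1) S.G_power[OF VW(1)]])
  moreover have "(n + n) + k * 2 = (k + n) + (k + n)" by simp
  ultimately have a': "a * (V * W) ^ k \<in> forms r ((k + n) + (k + n))" by simp
  then obtain q where q: "q \<in> forms r (k + k)"
   "a * (V * W) ^ k - (V * W) ^ n * q \<in> S.cokid r (gr r I) V W (k + n) ((k + n) + (k + n))" using cok2 by blast
  have "z - frac q ((V * W) ^ k) = frac (a * (V * W) ^ k - (V * W) ^ n * q) ((V * W) ^ (k + n))"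
   using VW(2) by (simp add: a(2) eq_fract power_add algebra_simps)
  thus "\<exists>x\<in>forms r (k + k). z - frac x ((V * W) ^ k) \<in> B1" using B1_cokid[OF q(2)] by (intro bexI[OF _ q(1)]) simp
 qed
 have "coh {Suc r, r + 2} 1 w"
  unfolding coh_def qdim_H1_pair[OF U(2,1)] prod_chart_pair B1_def[symmetric] by (rule K.qdim_forward[OF kuw(2)])
 thus ?thesis using \<open>coh {Suc r, r + 2} 0 u\<close> kuw(3) by blast
qed

lemma coh_unique: "A \<subseteq> {..r + 2} \<Longrightarrow> coh A p n \<Longrightarrow> coh A p m \<Longrightarrow> n = m"
 unfolding coh_def using CF.qdim_unique[OF coboundaries_subspace] by blast

lemma cohomology_dim_coh: assumes c: "coh {..r} p n" shows "cohomology_dim r I p = n"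
proof -
 have pc: "coord_prod J = prod_chart J" if "J \<subseteq> {..r}" for J
  unfolding coord_prod_def prod_chart_def chart_def using that by (intro prod.cong) auto
 have C: "cech_cochains r q = cochains {..r} q" for q
  unfolding cech_cochains_def cochains_def using pc by metis
 have "cech_cocycles r I p = cocycles {..r} p"
  unfolding cech_cocycles_def cocycles_def C using pc by auto
 moreover have "cech_coboundaries r I p = coboundaries {..r} p"
  unfolding cech_coboundaries_def coboundaries_def C using pc by auto
 moreover have "(\<lambda>z c J. frac (const z) 1 * c J) = cochain_scale" by (simp add: cochain_scale_def fscale_def fun_eq_iff)
 ultimately have e: "cohomology_dim r I p = quotient_dim cochain_scale (cocycles {..r} p) (coboundaries {..r} p)"
  unfolding cohomology_dim_def by simp
 have sub: "{..r} \<subseteq> {..r + 2}" by auto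
 show ?thesis
  unfolding e quotient_dim_def
  by (rule CF.quotient_dim_conv[OF coboundaries_subspace[OF sub] cocycles_subspace[OF sub] c[unfolded coh_def]])
qed

lemma euler_char_coh:
 assumes hf: "\<forall>\<^sub>F n in sequentially. int (S.hf r (gr r I) n) = e * int n + \<chi>"
 shows "euler_char r I = \<chi>"
proof -
 obtain u w where uw: "coh {Suc r, r + 2} 0 u" "coh {Suc r, r + 2} 1 w" "int u - int w = \<chi>" using coh_pair[OF hf] by blast
 define h where "h p = (if p = 0 then u else if p = 1 then w else 0)" for p :: nat
 have h: "coh {..r} p (h p)" for p
 proof -
  consider "p = 0" | "p = 1" | "p \<ge> 2" by linarith
  thus ?thesis
  proof cases
   case 3
   have "card J \<noteq> Suc p" if "J \<subseteq> {Suc r, r + 2}" for J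
    using card_mono[OF _ that] 3 by simp
   hence "coh {Suc r, r + 2} p 0" unfolding coh_def by (intro qdim_no_cochains) auto
   thus ?thesis unfolding coh_standard h_def using 3 by simp
  qed (use uw in \<open>simp_all add: coh_standard h_def\<close>)
 qed
 \<comment> \<open>Needed for r = 0, where the Euler characteristic sums over p = 0 only. The range
   can then be extended to p = r + 1, which always includes 0 and 1.\<close>
 have last: "h (Suc r) = 0"
 proof -
  have "card J \<noteq> Suc (Suc r)" if "J \<subseteq> {..r}" for J using card_mono[OF _ that] by simp
  hence "coh {..r} (Suc r) 0" unfolding coh_def by (intro qdim_no_cochains) auto
  thus ?thesis using coh_unique[OF _ h[of "Suc r"]] by auto
 qed
 have "euler_char r I = (\<Sum>p\<le>r. (- 1) ^ p * int (h p))"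
  unfolding euler_char_def using cohomology_dim_coh[OF h] by simp
 also have "\<dots> = (\<Sum>p\<le>Suc r. (- 1) ^ p * int (h p))" using last by simp
 also have "\<dots> = (\<Sum>p\<in>{0, 1}. (- 1) ^ p * int (h p))"
  by (rule sum.mono_neutral_right) (auto simp: h_def)
 also have "\<dots> = \<chi>" using uw(3) by (simp add: h_def)
 finally show ?thesis .
qed

end

text \<open>Cutting with V makes the linear Hilbert polynomial constant, and cutting with W makes it
  zero. So V and W have no common point on the scheme, and the cover by two hyperplane complements
  is available.\<close>

lemma arith_genus_hf:
 assumes sat: "S.saturated r (gr r I)"
  and hf: "\<forall>\<^sub>F n in sequentially. int (S.hf r (gr r I) n) = e * int n + \<chi>"
 shows "arith_genus r I = 1 - \<chi>"
proof -
 \<comment> \<open>The zero ideal joins the ideals to be respected so that V and W are nonzero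
   polynomials; for a scheme that is empty, I alone would permit V = 0.\<close>
 define Z :: "nat \<Rightarrow> mpoly set" where "Z = (\<lambda>n. {0})"
 have gI: "S.gideal r (gr r I)" by (rule S.saturated_gideal[OF sat])
 have gZ: "S.gideal r Z"
  unfolding Z_def by (rule S.gidealI) (auto simp: S.subspace_single_0 S.subspace_0[OF S.G_sub])
 have nz: "L \<noteq> 0" if L: "S.almost_nzd r Z L 1" for L
 proof
  assume "L = 0"
  obtain N where N: "\<And>n p. n \<ge> N \<Longrightarrow> p \<in> forms r n \<Longrightarrow> L * p \<in> Z (n + 1) \<Longrightarrow> p \<in> Z n"
   using L unfolding S.almost_nzd_def by blast
  have "var 0 ^ N \<in> forms r N" by (rule S.G_power1[OF var_forms]) simp
  hence "var 0 ^ N \<in> Z N" using N[of N "var 0 ^ N"] \<open>L = 0\<close> unfolding Z_def by simp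
  moreover have "var 0 \<noteq> 0" unfolding var_def by (metis lookup_single_eq lookup_zero zero_neq_one)
  ultimately show False unfolding Z_def by simp
 qed
 obtain V where V: "V \<in> forms r 1" "S.almost_nzd r (gr r I) V 1" "S.almost_nzd r Z V 1"
  using S.linear_nzd_exists[of "{gr r I, Z}" r] gI gZ by blast
 let ?A = "S.adjoin r (gr r I) V 1"
 have gA: "S.gideal r ?A" by (rule S.adjoin_gideal[OF gI V(1)])
 obtain W where W: "W \<in> forms r 1" "S.almost_nzd r (gr r I) W 1" "S.almost_nzd r Z W 1" "S.almost_nzd r ?A W 1"
  using S.linear_nzd_exists[of "{gr r I, Z, ?A}" r] gI gZ gA by blast
 have gB: "S.gideal r (S.adjoin r ?A W 1)" by (rule S.adjoin_gideal[OF gA W(1)])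
 have e: "\<forall>\<^sub>F n in sequentially. int (S.hf r ?A n) = e"
 proof (rule eventually_unshift[of _ 1])
  have hf1: "\<forall>\<^sub>F n in sequentially. int (S.hf r (gr r I) (n + 1)) = e * int (n + 1) + \<chi>"
   by (rule eventually_shift[OF hf])
  show "\<forall>\<^sub>F n in sequentially. int (S.hf r ?A (n + 1)) = e"
   using S.hf_nzd[OF gI V(1,2)] hf hf1 by eventually_elim (simp add: algebra_simps)
 qed
 have "\<forall>\<^sub>F n in sequentially. S.adjoin r ?A W 1 n = forms r n"
 proof (rule eventually_unshift[of _ 1])
  have e1: "\<forall>\<^sub>F n in sequentially. int (S.hf r ?A (n + 1)) = e" by (rule eventually_shift[OF e])
  show "\<forall>\<^sub>F n in sequentially. S.adjoin r ?A W 1 (n + 1) = forms r (n + 1)"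
   using S.hf_nzd[OF gA W(1,4)] e e1 by eventually_elim (use S.hf_0_iff[OF gB] in simp)
 qed
 then interpret two_hyperplanes r I V W
  using sat V W nz by unfold_locales
 show ?thesis unfolding arith_genus_def using euler_char_coh[OF hf] by simp
qed

section \<open>General hyperplane sections\<close>

text \<open>Uniqueness of the digits in base b.\<close>

lemma base_expansion_inj:
 fixes f g :: "nat \<Rightarrow> nat"
 assumes "\<And>i. i < n \<Longrightarrow> f i < b \<and> g i < b" "(\<Sum>i<n. f i * b ^ i) = (\<Sum>i<n. g i * b ^ i)" "i < n"
 shows "f i = g i"
 using assms
proof (induction n arbitrary: f g i)
 case (Suc n)
 have e: "(\<Sum>i<Suc n. h i * b ^ i) = h 0 + b * (\<Sum>i<n. h (Suc i) * b ^ i)" for h :: "nat \<Rightarrow> nat"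
  by (subst sum.lessThan_Suc_shift) (simp add: sum_distrib_left mult_ac)
 have eq: "f 0 + b * (\<Sum>i<n. f (Suc i) * b ^ i) = g 0 + b * (\<Sum>i<n. g (Suc i) * b ^ i)"
  using Suc.prems(2) unfolding e .
 have lt: "f 0 < b" "g 0 < b" using Suc.prems(1)[of 0] by auto
 hence 0: "f 0 = g 0" using arg_cong[OF eq, of "\<lambda>x. x mod b"] by simp
 hence "(\<Sum>i<n. f (Suc i) * b ^ i) = (\<Sum>i<n. g (Suc i) * b ^ i)" using eq lt by simp
 hence "f (Suc j) = g (Suc j)" if "j < n" for j
  using Suc.IH[of "\<lambda>i. f (Suc i)" "\<lambda>i. g (Suc i)" j] Suc.prems(1) that by simp
 thus ?case using 0 Suc.prems(3) by (cases i) auto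
qed simp

text \<open>Kronecker substitution: the variables are replaced by powers of a single variable in such a way that the
 monomials of \<open>F\<close> remain distinct.\<close>

lemma kronecker_substitution:
 assumes F: "F \<in> polys r" "F \<noteq> 0" and b: "\<And>t i. t \<in> keys F \<Longrightarrow> lookup t i < b"
 shows "\<exists>Q. Q \<noteq> 0 \<and> (\<forall>z. eval_mpoly (\<lambda>i. z ^ (b ^ i)) F = poly Q z)"
proof -
 define ex where "ex t = (\<Sum>i<Suc r. lookup t i * b ^ i)" for t :: "nat \<Rightarrow>\<^sub>0 nat"
 have k: "keys t \<subseteq> {..<Suc r}" if "t \<in> keys F" for t
  using that F(1) unfolding polys_def by (auto simp: lessThan_Suc_atMost)
 have inj: "s = t" if st: "s \<in> keys F" "t \<in> keys F" "ex s = ex t" for s t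
 proof (rule poly_mapping_eqI)
  fix i show "lookup s i = lookup t i"
  proof (cases "i < Suc r")
   case True
   thus ?thesis
    using base_expansion_inj[of "Suc r" "lookup s" b "lookup t" i] b st unfolding ex_def by blast
  next
   case False
   hence "i \<notin> keys s" "i \<notin> keys t" using k st by blast+
   thus ?thesis by (simp add: in_keys_iff)
  qed
 qed
 define Q where "Q = (\<Sum>t\<in>keys F. monom (lookup F t) (ex t))"
 obtain t where t: "t \<in> keys F" using F(2) by (metis ex_in_conv keys_eq_empty)
 have "coeff Q (ex t) = (\<Sum>s\<in>keys F. if s = t then lookup F s else 0)"
  unfolding Q_def coeff_sum coeff_monom using inj t by (intro sum.cong) auto
 also have "\<dots> \<noteq> 0" using t by (simp add: in_keys_iff)
 finally have "Q \<noteq> 0" by auto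
 moreover have "eval_mpoly (\<lambda>i. z ^ (b ^ i)) F = poly Q z" for z
  unfolding eval_mpoly_def Q_def poly_sum poly_monom
 proof (rule sum.cong)
  fix t assume t: "t \<in> keys F"
  have "(\<Prod>i\<in>keys t. (z ^ (b ^ i)) ^ lookup t i) = (\<Prod>i<Suc r. (z ^ (b ^ i)) ^ lookup t i)"
   by (rule prod.mono_neutral_left) (use k[OF t] in \<open>auto simp: in_keys_iff\<close>)
  also have "\<dots> = z ^ ex t" unfolding ex_def power_sum
   by (intro prod.cong) (simp_all add: power_mult[symmetric] mult.commute)
  finally show "lookup F t * (\<Prod>i\<in>keys t. (z ^ (b ^ i)) ^ lookup t i) = lookup F t * z ^ ex t" by simp
 qed simp
 ultimately show ?thesis by blast
qed

text \<open>Two nonempty open sets of hyperplanes meet: with a common base b, Kronecker substitution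
  turns F and G into nonzero polynomials in one variable, whose product has a nonzero value.\<close>

lemma common_nonzero:
 assumes F: "F \<in> polys r" "F \<noteq> 0" and G: "G \<in> polys r" "G \<noteq> 0"
 shows "\<exists>a. eval_mpoly a F \<noteq> 0 \<and> eval_mpoly a G \<noteq> 0"
proof -
 define A where "A = (\<Union>t\<in>keys F \<union> keys G. lookup t ` keys t)"
 have "finite A" unfolding A_def by simp
 then obtain b where b: "\<And>x. x \<in> A \<Longrightarrow> x < Suc b" using finite_nat_set_iff_bounded_le[of A] by (auto simp: less_Suc_eq_le)
 have bb: "lookup t i < Suc b" if "t \<in> keys F \<union> keys G" for t i
 proof (cases "i \<in> keys t")
  case True thus ?thesis using b that unfolding A_def by blast
 qed (simp add: in_keys_iff)
 obtain Q where Q: "Q \<noteq> 0" "\<And>z. eval_mpoly (\<lambda>i. z ^ (Suc b ^ i)) F = poly Q z"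
  using kronecker_substitution[OF F, of "Suc b"] bb by blast
 obtain R where R: "R \<noteq> 0" "\<And>z. eval_mpoly (\<lambda>i. z ^ (Suc b ^ i)) G = poly R z"
  using kronecker_substitution[OF G, of "Suc b"] bb by blast
 have "Q * R \<noteq> 0" using Q(1) R(1) by simp
 then obtain z where "poly (Q * R) z \<noteq> 0" using poly_all_0_iff_0 by blast
 thus ?thesis using Q(2) R(2) by (intro exI[of _ "\<lambda>i. z ^ (Suc b ^ i)"]) simp
qed

lemma linear_form_lookup:
 "lookup (linear_form r c) t = (\<Sum>i\<le>r. if t = Poly_Mapping.single i 1 then c i else 0)"
proof -
 have "const (c i) * var i = Poly_Mapping.single (Poly_Mapping.single i 1) (c i)" for i
  unfolding const_def var_def by (simp add: mult_single)
 thus ?thesis unfolding linear_form_def lookup_sum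
  by (intro sum.cong) (auto simp: lookup_single when_def)
qed

lemma linear_form_coeff: assumes "i \<le> r" shows "lookup (linear_form r c) (Poly_Mapping.single i 1) = c i"
proof -
 have "Poly_Mapping.single i (1::nat) = Poly_Mapping.single j 1 \<longleftrightarrow> i = j" for j
  by (metis lookup_single_eq lookup_single_not_eq zero_neq_one)
 thus ?thesis unfolding linear_form_lookup using assms by (simp add: sum.delta)
qed

lemma linear_form_forms: "linear_form r c \<in> forms r 1"
 unfolding linear_form_def using var_forms forms_scale by (intro S.subspace_sum[OF S.G_sub]) auto

lemma eval_linear_form: "eval_mpoly a (linear_form r c) = (\<Sum>i\<le>r. c i * a i)"
proof -
 let ?e = "\<lambda>i. Poly_Mapping.single i (1::nat)"
 have inj: "inj_on ?e {..r}" by (rule inj_onI) (metis lookup_single_eq lookup_single_not_eq zero_neq_one)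
 have sub: "keys (linear_form r c) \<subseteq> ?e ` {..r}"
 proof
  fix t assume "t \<in> keys (linear_form r c)"
  hence "(\<Sum>i\<le>r. if t = ?e i then c i else 0) \<noteq> 0" by (simp only: in_keys_iff linear_form_lookup) simp
  then obtain i where "i \<in> {..r}" "(if t = ?e i then c i else 0) \<noteq> 0" using sum.not_neutral_contains_not_neutral by blast
  thus "t \<in> ?e ` {..r}" by (metis imageI)
 qed
 have "eval_mpoly a (linear_form r c) = (\<Sum>t\<in>?e ` {..r}. lookup (linear_form r c) t *
   (\<Prod>i\<in>keys t. a i ^ lookup t i))"
  unfolding eval_mpoly_def by (rule sum.mono_neutral_left) (use sub in \<open>auto simp: in_keys_iff\<close>)
 also have "\<dots> = (\<Sum>i\<le>r. c i * a i)"
  unfolding sum.reindex[OF inj] using linear_form_coeff[of _ r c] by (intro sum.cong) auto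
 finally show ?thesis .
qed

text \<open>The hyperplanes through a given linear subspace lie in a hyperplane of the dual space: take a nonzero coordinate
 with respect to a basis of the linear forms modulo those in \<open>P\<close>.\<close>

lemma general_hyperplane_avoids:
 assumes P: "S.relevant r P"
 shows "\<exists>F\<in>polys r. F \<noteq> 0 \<and> (\<forall>a. eval_mpoly a F \<noteq> 0 \<longrightarrow> linear_form r a \<notin> P 1)"
proof -
 have gP: "S.gideal r P" using P S.relevant_gideal by blast
 note sub = S.gideal_sub[OF gP, of 1]
 obtain B where B: "qbasis cscale (forms r 1) (P 1) B"
  using S.hf_qdim[OF gP, of 1] unfolding qdim_def by blast
 have fB: "finite B" and ex: "\<And>v. v \<in> forms r 1 \<Longrightarrow> \<exists>c. v - (\<Sum>b\<in>B. cscale (c b) b) \<in> P 1"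
  and ind: "\<And>c b. (\<Sum>b\<in>B. cscale (c b) b) \<in> P 1 \<Longrightarrow> b \<in> B \<Longrightarrow> c b = 0"
  using B unfolding qbasis_def by blast+
 have "\<forall>i\<in>{..r}. \<exists>c. var i - (\<Sum>b\<in>B. cscale (c b) b) \<in> P 1" using var_forms by (intro ballI ex) simp
 from bchoice[OF this] obtain c where "\<forall>i\<in>{..r}. var i - (\<Sum>b\<in>B. cscale (c i b) b) \<in> P 1" ..
 hence c: "var i - (\<Sum>b\<in>B. cscale (c i b) b) \<in> P 1" if "i \<le> r" for i using that by simp
 obtain j where j: "j \<le> r" "var j \<notin> P 1" using S.relevant_X[OF P] by blast
 have "\<exists>b\<in>B. c j b \<noteq> 0"
 proof (rule ccontr)
  assume "\<not> (\<exists>b\<in>B. c j b \<noteq> 0)"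
  hence "(\<Sum>b\<in>B. cscale (c j b) b) = 0" by (intro sum.neutral) (simp add: const_0)
  thus False using c[OF j(1)] j(2) by simp
 qed
 then obtain b where b: "b \<in> B" "c j b \<noteq> 0" by blast
 define F where "F = linear_form r (\<lambda>i. c i b)"
 have "F \<noteq> 0"
 proof
  assume "F = 0"
  thus False using linear_form_coeff[OF j(1), of "\<lambda>i. c i b"] b(2) unfolding F_def by simp
 qed
 moreover have "F \<in> polys r" unfolding F_def using linear_form_forms forms_polys by blast
 moreover have "linear_form r a \<notin> P 1" if "eval_mpoly a F \<noteq> 0" for a
 proof
  assume aP: "linear_form r a \<in> P 1"
  have "(\<Sum>i\<le>r. cscale (a i) (var i - (\<Sum>b\<in>B. cscale (c i b) b))) \<in> P 1"
   using c by (intro S.subspace_sum[OF sub] S.subspace_scale[OF sub]) auto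
  moreover have "(\<Sum>i\<le>r. cscale (a i) (var i - (\<Sum>b\<in>B. cscale (c i b) b))) =
    linear_form r a - (\<Sum>b\<in>B. cscale (\<Sum>i\<le>r. a i * c i b) b)"
  proof -
   have "(\<Sum>i\<le>r. cscale (a i) (\<Sum>b\<in>B. cscale (c i b) b)) = (\<Sum>i\<le>r. \<Sum>b\<in>B. cscale (a i * c i b) b)"
    by (intro sum.cong refl) (simp only: S.scale_sum_right S.scale_scale)
   also have "\<dots> = (\<Sum>b\<in>B. cscale (\<Sum>i\<le>r. a i * c i b) b)"
    unfolding S.scale_sum_left by (rule sum.swap)
   finally show ?thesis unfolding linear_form_def S.scale_right_diff_distrib sum_subtractf by simp
  qed
  ultimately have "(\<Sum>b\<in>B. cscale (\<Sum>i\<le>r. a i * c i b) b) \<in> P 1"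
   using S.subspace_diff[OF sub aP] by force
  hence "(\<Sum>i\<le>r. a i * c i b) = 0"
   using ind[of "\<lambda>b. \<Sum>i\<le>r. a i * c i b" b, OF _ b(1)] by simp
  thus False using that unfolding F_def eval_linear_form by (simp add: mult.commute)
 qed
 ultimately show ?thesis by blast
qed

lemma hom_component_mult_form:
 assumes q: "q \<in> polys r" and L: "L \<in> forms r d"
 shows "hom_component n (q * L) = (if d \<le> n then hom_component (n - d) q * L else 0)"
proof -
 have Lp: "L \<in> polys r" using L forms_polys by blast
 have "hom_component n (L * q) = (\<Sum>i\<in>mdeg ` keys L. if i \<le> n then hom_component i L * hom_component (n - i) q else 0)"
  by (rule hom_component_mult[OF Lp q])
 also have "\<dots> = (\<Sum>i\<in>mdeg ` keys L. if i = d then (if d \<le> n then hom_component (n - d) q * L else 0) else 0)"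
  unfolding hom_component_of_form[OF L] by (intro sum.cong) auto
 also have "\<dots> = (if d \<le> n then hom_component (n - d) q * L else 0)"
 proof (cases "L = 0")
  case False
  then obtain t where "t \<in> keys L" by (metis ex_in_conv keys_eq_empty)
  hence "d \<in> mdeg ` keys L" using L unfolding forms_def by force
  thus ?thesis by (simp add: sum.delta)
 qed simp
 finally show ?thesis by (simp add: mult.commute)
qed

lemma gr_add_principal:
 assumes I: "homogeneous_ideal r I" and L: "L \<in> forms r d"
 shows "gr r {p + q * L | p q. p \<in> I \<and> q \<in> polys r} = S.adjoin r (gr r I) L d"
proof
 fix n
 have Ip: "I \<subseteq> polys r" using I unfolding homogeneous_ideal_def by blast
 show "gr r {p + q * L | p q. p \<in> I \<and> q \<in> polys r} n = S.adjoin r (gr r I) L d n"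
 proof (intro equalityI subsetI)
  fix x assume "x \<in> gr r {p + q * L | p q. p \<in> I \<and> q \<in> polys r} n"
  then obtain p q where pq: "x = p + q * L" "p \<in> I" "q \<in> polys r" "x \<in> forms r n" unfolding gr_def by blast
  have "hom_component n (q * L) = (if d \<le> n then L * hom_component (n - d) q else 0)"
   using hom_component_mult_form[OF pq(3) L] by (simp add: mult.commute)
  moreover have "x = hom_component n p + hom_component n (q * L)"
   using hom_component_of_form[OF pq(4), of n] unfolding pq(1) hom_component_add by simp
  moreover have "hom_component n p \<in> gr r I n"
   using I pq(2) hom_component_forms Ip unfolding homogeneous_ideal_def gr_def by blast
  ultimately show "x \<in> S.adjoin r (gr r I) L d n"
   unfolding S.adjoin_def using hom_component_forms[OF pq(3), of "n - d"] by force
 next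
  fix x assume "x \<in> S.adjoin r (gr r I) L d n"
  then obtain p q where pq: "x = p + L * q" "p \<in> gr r I n" "d \<le> n \<and> q \<in> forms r (n - d) \<or> q = 0"
   unfolding S.adjoin_def by blast
  have "q \<in> polys r" using pq(3) forms_polys[of r] S.subspace_0[OF S.G_sub[of r 0]] by blast
  moreover have "x \<in> forms r n"
   using S.gideal_G[OF S.adjoin_gideal[OF gr_gideal[OF I] L]] \<open>x \<in> S.adjoin r (gr r I) L d n\<close> by blast
  moreover have "x = p + q * L" by (simp add: pq(1) mult.commute)
  ultimately show "x \<in> gr r {p + q * L | p q. p \<in> I \<and> q \<in> polys r} n" using pq(2) unfolding gr_def by blast
 qed
qed

lemma gr_hyperplane_section:
 "homogeneous_ideal r I \<Longrightarrow> L \<in> forms r 1 \<Longrightarrow> gr r (hyperplane_section r I L) = S.sat r (S.adjoin r (gr r I) L 1)"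
 unfolding hyperplane_section_def by (simp add: fun_eq_iff gr_saturation gr_add_principal del: One_nat_def)

text \<open>For every hyperplane not containing D the section has the Hilbert polynomial
  \<open>pdiff Q 1\<close> = s n + c, hence genus 1 - c. The value is unique since any two general
  conditions hold simultaneously for some hyperplane.\<close>

lemma sectional_genus_eq:
 assumes D: "homogeneous_ideal r D" "S.relevant r (gr r D)" and Q: "S.hpoly r (gr r D) Q"
  and dQ: "pdiff Q 1 = [:of_int c, of_int s:]"
 shows "sectional_genus r D = 1 - c"
proof -
 have gD: "S.gideal r (gr r D)" "S.gprime r (gr r D)" using D(2) unfolding S.relevant_def S.gprime_def by auto
 have g: "arith_genus r (hyperplane_section r D (linear_form r a)) = 1 - c" if a: "linear_form r a \<notin> gr r D 1" for a
 proof (rule arith_genus_hf)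
  let ?L = "linear_form r a"
  note L = linear_form_forms[of r a]
  let ?A = "S.adjoin r (gr r D) ?L 1"
  have gA: "S.gideal r ?A" by (rule S.adjoin_gideal[OF gD(1) L])
  show "S.saturated r (gr r (hyperplane_section r D ?L))"
   unfolding gr_hyperplane_section[OF D(1) L] by (rule S.sat_sat[OF gA])
  have "S.hpoly r ?A (pdiff Q (real 1))" by (rule S.hpoly_nzd[OF gD(1) L S.gprime_nzd[OF gD(2) L a] Q])
  hence "S.hpoly r (S.sat r ?A) [:of_int c, of_int s:]" using S.hpoly_sat[OF gA] dQ by simp
  hence "\<forall>\<^sub>F n in sequentially. real (S.hf r (S.sat r ?A) n) = poly [:of_int c, of_int s:] (real n)"
   unfolding S.hpoly_def .
  thus "\<forall>\<^sub>F n in sequentially. int (S.hf r (gr r (hyperplane_section r D ?L)) n) = s * int n + c"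
   unfolding gr_hyperplane_section[OF D(1) L]
  proof eventually_elim
   case (elim n)
   hence "real_of_int (int (S.hf r (S.sat r ?A) n)) = real_of_int (s * int n + c)" by (simp add: mult.commute)
   thus ?case by (simp only: of_int_eq_iff)
  qed
 qed
 obtain F where F: "F \<in> polys r" "F \<noteq> 0" "\<And>a. eval_mpoly a F \<noteq> 0 \<Longrightarrow> linear_form r a \<notin> gr r D 1"
  using general_hyperplane_avoids[OF D(2)] by blast
 show ?thesis
  unfolding sectional_genus_def
 proof (rule the_equality)
  show "for_general_hyperplane r (\<lambda>L. arith_genus r (hyperplane_section r D L) = 1 - c)"
   unfolding for_general_hyperplane_def using F g by blast
  fix g' assume "for_general_hyperplane r (\<lambda>L. arith_genus r (hyperplane_section r D L) = g')"
  then obtain F' where F': "F' \<in> polys r" "F' \<noteq> 0"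
   "\<And>a. eval_mpoly a F' \<noteq> 0 \<Longrightarrow> arith_genus r (hyperplane_section r D (linear_form r a)) = g'"
   unfolding for_general_hyperplane_def by blast
  obtain a where "eval_mpoly a F \<noteq> 0" "eval_mpoly a F' \<noteq> 0" using common_nonzero[OF F(1,2) F'(1,2)] by blast
  thus "g' = 1 - c" using F(3) F'(3) g by metis
 qed
qed

section \<open>Linkage by divisors\<close>

context graded_alg begin

abbreviation isum :: "(nat \<Rightarrow> 'a set) \<Rightarrow> (nat \<Rightarrow> 'a set) \<Rightarrow> nat \<Rightarrow> 'a set" where
 "isum I D \<equiv> extend I 1 0 D"

lemma isum_iff: "gideal D \<Longrightarrow> x \<in> isum I D n \<longleftrightarrow> (\<exists>q\<in>D n. x - q \<in> I n)"
 using extend_iff[of D x I 1 0 n] by simp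

lemma isum_gideal: "gideal I \<Longrightarrow> gideal D \<Longrightarrow> gideal (isum I D)"
 using extend_gideal[OF _ G_one] by blast

lemma isum_ge: "gideal I \<Longrightarrow> gideal D \<Longrightarrow> D \<le> isum I D"
 unfolding le_fun_def subset_iff isum_iff using gideal_0[of I] by (metis diff_self)

lemma isum_mono: "gideal D \<Longrightarrow> I \<le> J \<Longrightarrow> isum I D \<le> isum J D"
 unfolding le_fun_def subset_iff isum_iff by blast

lemma isum_absorb: "gideal I \<Longrightarrow> gideal D \<Longrightarrow> I \<le> D \<Longrightarrow> isum I D = D"
proof (rule antisym[OF le_funI isum_ge])
 fix n assume I: "gideal I" and D: "gideal D" "I \<le> D"
 show "isum I D n \<subseteq> D n"
 proof
  fix x assume "x \<in> isum I D n"
  then obtain q where "q \<in> D n" "x - q \<in> D n" using D(2) unfolding isum_iff[OF D(1)] le_fun_def by blast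
  thus "x \<in> D n" using gideal_add[OF D(1), of "x - q" n q] by simp
 qed
qed

text \<open>The ideal quotient C : D, which defines the residual scheme.\<close>

definition icolon :: "(nat \<Rightarrow> 'a set) \<Rightarrow> (nat \<Rightarrow> 'a set) \<Rightarrow> nat \<Rightarrow> 'a set" where
 "icolon C D n = {q \<in> G n. \<forall>k. \<forall>p\<in>D k. p * q \<in> C (k + n)}"

lemma icolon_ge: "gideal C \<Longrightarrow> gideal D \<Longrightarrow> C \<le> icolon C D"
 using gideal_mult[of C] gideal_G by (auto simp: le_fun_def icolon_def)

lemma icolon_gideal:
 assumes C: "gideal C" shows "gideal (icolon C D)"
proof (rule gidealI)
 show "subspace (icolon C D n)" for n
  by (rule subspaceI)
   (auto simp: icolon_def subspace_0[OF G_sub] subspace_add[OF G_sub] subspace_scale[OF G_sub] distrib_left mult_scale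
     gideal_0[OF C] intro: gideal_add[OF C] gideal_scale[OF C])
 show "p \<in> G n" if "p \<in> icolon C D n" for n p using that unfolding icolon_def by blast
 show "X i * p \<in> icolon C D (Suc n)" if p: "p \<in> icolon C D n" and i: "i \<le> r" for n p i
 proof -
  have "d * (X i * p) \<in> C (k + Suc n)" if "d \<in> D k" for d k
   using gideal_mult[OF C X_in[OF i], of "d * p" "k + n"] p that unfolding icolon_def by (simp add: mult.left_commute)
  moreover have "X i * p \<in> G (Suc n)" using G_mult[OF X_in[OF i], of p n] p unfolding icolon_def by simp
  ultimately show ?thesis unfolding icolon_def by blast
 qed
qed

lemma icolon_saturated:
 assumes C: "saturated C" and D: "gideal D" shows "saturated (icolon C D)"
proof -
 have gC: "gideal C" by (rule saturated_gideal[OF C])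
 have "sat (icolon C D) n \<subseteq> icolon C D n" for n
 proof
  fix p assume "p \<in> sat (icolon C D) n"
  then obtain k where k: "p \<in> G n" "\<And>g. g \<in> G k \<Longrightarrow> g * p \<in> icolon C D (k + n)" unfolding sat_def by blast
  have "d * p \<in> C (j + n)" if d: "d \<in> D j" for d j
  proof (rule saturatedD[OF C, of _ _ k])
   show "d * p \<in> G (j + n)" by (rule G_mult[OF gideal_G[OF D d] k(1)])
   fix g assume "g \<in> G k"
   hence "d * (g * p) \<in> C (j + (k + n))" using k(2) d unfolding icolon_def by blast
   thus "g * (d * p) \<in> C (k + (j + n))" unfolding mult.left_commute[of g] add.left_commute[of k] .
  qed
  thus "p \<in> icolon C D n" unfolding icolon_def using k(1) by blast
 qed
 thus ?thesis unfolding saturated_def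
  using icolon_gideal[OF gC, of D] sat_ge[OF icolon_gideal[OF gC, of D]] by (auto simp: fun_eq_iff le_fun_def)
qed

text \<open>On \<open>Y\<close>, the ideal of \<open>D\<close> is isomorphic to the ideal generated by \<open>F / b\<close>, at least in large degrees; thus \<open>D\<close> is
 linearly equivalent to \<open>m\<close> hyperplane sections.\<close>

definition linked :: "(nat \<Rightarrow> 'a set) \<Rightarrow> (nat \<Rightarrow> 'a set) \<Rightarrow> nat \<Rightarrow> bool" where
 "linked Y D m \<longleftrightarrow> gideal D \<and> Y \<le> D \<and> (\<exists>e b F N. b \<in> G e \<and> b \<notin> Y e \<and> F \<in> G (m + e) \<and>
   (\<forall>n\<ge>N. \<forall>p\<in>D (n + m). \<exists>q\<in>G n. b * p - F * q \<in> Y (n + m + e)) \<and>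
   (\<forall>n\<ge>N. \<forall>q\<in>G n. \<exists>p\<in>D (n + m). b * p - F * q \<in> Y (n + m + e)))"

text \<open>The relation b p = F q modulo Y identifies D / Y with G / Y shifted by m in large
  degrees, and (C \<inter> D) / Y with (C : D) / Y. Therefore G / (C : D) in degree n is D / (C
  \<inter> D), that is (C + D) / C, in degree n + m.\<close>

lemma linked_residual:
 assumes Y: "gprime Y" and L: "linked Y D m" and C: "saturated C" "Y \<le> C"
 shows "\<forall>\<^sub>F n in sequentially. hf C (n + m) = hf (isum C D) (n + m) + hf (icolon C D) n"
proof -
 obtain e b F N where D: "gideal D" "Y \<le> D" and b: "b \<in> G e" "b \<notin> Y e" and F: "F \<in> G (m + e)"
  and ev1: "\<And>n p. n \<ge> N \<Longrightarrow> p \<in> D (n + m) \<Longrightarrow> \<exists>q\<in>G n. b * p - F * q \<in> Y (n + m + e)"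
  and ev2: "\<And>n q. n \<ge> N \<Longrightarrow> q \<in> G n \<Longrightarrow> \<exists>p\<in>D (n + m). b * p - F * q \<in> Y (n + m + e)"
  using L unfolding linked_def by blast
 have gX: "gideal Y" and gC: "gideal C" using Y C saturated_gideal unfolding gprime_def by auto
 define CD where "CD n = C n \<inter> D n" for n
 have gCD: "gideal CD"
  unfolding CD_def
  by (rule gidealI)
   (use gideal_sub[OF gC] gideal_sub[OF D(1)] gideal_G[OF gC] gideal_mult[OF gC X_in] gideal_mult[OF D(1) X_in] in
    \<open>auto intro: subspace_inter\<close>)
 define B' where "B' = extend Y b e D"
 define W' where "W' = extend Y b e CD"
 have gB: "gideal B'" "gideal W'" unfolding B'_def W'_def by (rule extend_gideal[OF gX b(1)], rule D gCD)+
 have B'_iff: "x \<in> B' (n + e) \<longleftrightarrow> (\<exists>q\<in>D n. x - b * q \<in> Y (n + e))" for x n unfolding B'_def by (rule extend_iff[OF D(1)])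
 have W'_iff: "x \<in> W' (n + e) \<longleftrightarrow> (\<exists>q\<in>CD n. x - b * q \<in> Y (n + e))" for x n unfolding W'_def by (rule extend_iff[OF gCD])
 have cancel: "p \<in> Y n" if "p \<in> G n" "b * p \<in> Y (n + e)" for p n
  using gprimeD[OF Y b(1) that(1)] that(2) b(2) by (simp add: add.commute)
 have XC: "p \<in> Y n \<Longrightarrow> p \<in> C n" for p n using C(2) by (auto simp: le_fun_def)
 text \<open>The pairs \<open>(p, q)\<close> with \<open>b p \<equiv> F q\<close> form the graph of a module homomorphism.\<close>
 have cross: "p * v - p' * q \<in> Y (n + m + k)"
  if "b * p - F * q \<in> Y (n + m + e)" "b * p' - F * v \<in> Y (k + m + e)" "p \<in> D (n + m)" "q \<in> G n" "p' \<in> D (k + m)" "v \<in> G k"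
  for p q p' v n k
 proof (rule cancel)
  have "p * v \<in> G (n + m + k)" "q * p' \<in> G (n + (k + m))" using that G_mult gideal_G[OF D(1)] by blast+
  thus "p * v - p' * q \<in> G (n + m + k)"
   using subspace_diff[OF G_sub, of "p * v" "n + m + k" "q * p'"] by (simp add: ac_simps)
  have "v * (b * p - F * q) \<in> Y (k + (n + m + e))" "q * (b * p' - F * v) \<in> Y (n + (k + m + e))"
   using gideal_mult[OF gX] that by blast+
  hence "v * (b * p - F * q) \<in> Y (n + m + k + e)" "q * (b * p' - F * v) \<in> Y (n + m + k + e)" by (simp_all add: ac_simps)
  hence "v * (b * p - F * q) - q * (b * p' - F * v) \<in> Y (n + m + k + e)" by (rule gideal_diff[OF gX])
  thus "b * (p * v - p' * q) \<in> Y (n + m + k + e)" by (simp add: algebra_simps)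
 qed
 have "hf C (n + m) = hf (isum C D) (n + m) + hf (icolon C D) n" if n: "n \<ge> N" for n
 proof -
  \<comment> \<open>Multiplication by F identifies G / (C : D) with the quotient of Y + b D by Y + b
    (C \<inter> D).\<close>
  interpret A: quotient_iso scale scale "G n" "icolon C D n" "B' (n + m + e)" "W' (n + m + e)" "\<lambda>q. F * q"
  proof unfold_locales
   show "subspace (G n)" "subspace (W' (n + m + e))" by (rule G_sub, rule gideal_sub[OF gB(2)])
   fix q q' assume q: "q \<in> G n"
   show "F * (q + q') = F * q + F * q'" by (rule distrib_left)
   show "F * (c *s q) = c *s (F * q)" for c by (rule mult_scale)
   obtain p where p: "p \<in> D (n + m)" "b * p - F * q \<in> Y (n + m + e)" using ev2[OF n q] by blast
   have p2: "F * q - b * p \<in> Y (n + m + e)" using subspace_neg[OF gideal_sub[OF gX] p(2)] by simp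
   thus "F * q \<in> B' (n + m + e)" unfolding B'_iff using p(1) by blast
   show "F * q \<in> W' (n + m + e) \<longleftrightarrow> q \<in> icolon C D n"
   proof
    assume "F * q \<in> W' (n + m + e)"
    then obtain p where p: "p \<in> C (n + m)" "p \<in> D (n + m)" "F * q - b * p \<in> Y (n + m + e)" unfolding W'_iff CD_def by blast
    have p': "b * p - F * q \<in> Y (n + m + e)" using subspace_neg[OF gideal_sub[OF gX] p(3)] by simp
    have "d * q \<in> C (k + n)" if d: "d \<in> D k" for d k
    \<comment> \<open>Degree N + m is large enough to raise d into the range where the relation has
      a partner v; \<open>cross\<close> then expresses u d q through p v, which lies in C.\<close>
    proof (rule saturatedD[OF C(1), of _ _ "N + m"])
     show "d * q \<in> G (k + n)" by (rule G_mult[OF gideal_G[OF D(1) d] q])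
     fix u assume u: "u \<in> G (N + m)"
     have "u * d \<in> D ((N + m) + k)" by (rule gideal_mult[OF D(1) u d])
     hence ud: "u * d \<in> D ((N + k) + m)" by (simp add: ac_simps)
     obtain v where v: "v \<in> G (N + k)" "b * (u * d) - F * v \<in> Y ((N + k) + m + e)" using ev1[OF _ ud] by auto
     have "p * v - (u * d) * q \<in> Y (n + m + (N + k))" by (rule cross[OF p' v(2) p(2) q ud v(1)])
     hence "p * v - (u * d) * q \<in> C (n + m + (N + k))" by (rule XC)
     moreover have "p * v \<in> C (n + m + (N + k))" by (rule gideal_mult'[OF gC p(1) v(1)])
     ultimately have "p * v - (p * v - (u * d) * q) \<in> C (n + m + (N + k))" using gideal_diff[OF gC] by blast
     thus "u * (d * q) \<in> C (N + m + (k + n))" by (simp add: ac_simps)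
    qed
    thus "q \<in> icolon C D n" unfolding icolon_def using q by blast
   next
    assume qi: "q \<in> icolon C D n"
    have "p \<in> C (n + m)"
    proof (rule saturatedD[OF C(1), of _ _ N])
     show "p \<in> G (n + m)" using p(1) gideal_G[OF D(1)] by blast
     fix u assume u: "u \<in> G N"
     obtain p' where p': "p' \<in> D (N + m)" "b * p' - F * u \<in> Y (N + m + e)" using ev2[OF order_refl u] by blast
     have "p * u - p' * q \<in> Y (n + m + N)" by (rule cross[OF p(2) p'(2) p(1) q p'(1) u])
     hence "p * u - p' * q \<in> C (n + m + N)" by (rule XC)
     moreover have "p' * q \<in> C ((N + m) + n)" using qi p'(1) unfolding icolon_def by blast
     hence "p' * q \<in> C (n + m + N)" by (simp add: ac_simps)
     ultimately have "(p * u - p' * q) + p' * q \<in> C (n + m + N)" by (rule gideal_add[OF gC])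
     thus "u * p \<in> C (N + (n + m))" by (simp add: ac_simps)
    qed
    thus "F * q \<in> W' (n + m + e)" unfolding W'_iff CD_def using p(1) p2 by blast
   qed
  next
   fix z assume "z \<in> B' (n + m + e)"
   then obtain p where p: "p \<in> D (n + m)" "z - b * p \<in> Y (n + m + e)" unfolding B'_iff by blast
   obtain q where q: "q \<in> G n" "b * p - F * q \<in> Y (n + m + e)" using ev1[OF n p(1)] by blast
   have "(z - b * p) + (b * p - F * q) \<in> Y (n + m + e)" by (rule gideal_add[OF gX p(2) q(2)])
   hence "z - F * q \<in> W' (n + m + e)" using extend_ge[of Y b e CD] unfolding W'_def by (auto simp: le_fun_def)
   thus "\<exists>x\<in>G n. z - F * x \<in> W' (n + m + e)" using q(1) by blast
  qed
  \<comment> \<open>Multiplication by b identifies D / (C \<inter> D) with the same quotient, as b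
    is cancelled modulo the prime Y.\<close>
  interpret B: quotient_iso scale scale "D (n + m)" "C (n + m)" "B' (n + m + e)" "W' (n + m + e)" "\<lambda>p. b * p"
  proof unfold_locales
   show "subspace (D (n + m))" "subspace (W' (n + m + e))" by (rule gideal_sub[OF D(1)], rule gideal_sub[OF gB(2)])
   fix p p' assume p: "p \<in> D (n + m)"
   show "b * (p + p') = b * p + b * p'" by (rule distrib_left)
   show "b * (c *s p) = c *s (b * p)" for c by (rule mult_scale)
   show "b * p \<in> B' (n + m + e)" unfolding B'_iff using p gideal_0[OF gX] by (intro bexI[of _ p]) auto
   show "b * p \<in> W' (n + m + e) \<longleftrightarrow> p \<in> C (n + m)"
   proof
    assume "b * p \<in> W' (n + m + e)"
    then obtain q where q: "q \<in> C (n + m)" "q \<in> D (n + m)" "b * p - b * q \<in> Y (n + m + e)" unfolding W'_iff CD_def by blast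
    have "p - q \<in> G (n + m)" by (rule subspace_diff[OF G_sub gideal_G[OF D(1) p] gideal_G[OF D(1) q(2)]])
    moreover have "b * (p - q) \<in> Y (n + m + e)" using q(3) by (simp only: right_diff_distrib)
    ultimately have "p - q \<in> Y (n + m)" by (rule cancel)
    thus "p \<in> C (n + m)" using gideal_add[OF gC XC q(1), of "p - q"] by simp
   next
    assume "p \<in> C (n + m)"
    thus "b * p \<in> W' (n + m + e)" unfolding W'_iff CD_def using p gideal_0[OF gX] by (intro bexI[of _ p]) auto
   qed
  next
   fix z assume "z \<in> B' (n + m + e)"
   then obtain p where p: "p \<in> D (n + m)" "z - b * p \<in> Y (n + m + e)" unfolding B'_iff by blast
   hence "z - b * p \<in> W' (n + m + e)" using extend_ge[of Y b e CD] unfolding W'_def by (auto simp: le_fun_def)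
   thus "\<exists>x\<in>D (n + m). z - b * x \<in> W' (n + m + e)" using p(1) by blast
  qed
  \<comment> \<open>The isomorphism D / (C \<inter> D) = (C + D) / C.\<close>
  interpret E: quotient_iso scale scale "D (n + m)" "C (n + m)" "isum C D (n + m)" "C (n + m)" "\<lambda>p. p"
  proof unfold_locales
   show "subspace (D (n + m))" "subspace (C (n + m))" by (rule gideal_sub[OF D(1)], rule gideal_sub[OF gC])
   show "x \<in> isum C D (n + m)" if "x \<in> D (n + m)" for x
    using isum_ge[OF gC D(1)] that by (auto simp: le_fun_def)
   show "\<exists>x\<in>D (n + m). z - x \<in> C (n + m)" if "z \<in> isum C D (n + m)" for z
    using that unfolding isum_iff[OF D(1)] .
  qed auto
  note gE = isum_gideal[OF gC D(1)]
  have "qdim scale (isum C D (n + m)) (C (n + m)) (hf (icolon C D) n)"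
   by (rule E.qdim_forward[OF B.qdim_backward[OF A.qdim_forward[OF hf_qdim[OF icolon_gideal[OF gC]]]]])
  hence "hf (icolon C D) n = hf C (n + m) - hf (isum C D) (n + m)"
   using qdim_unique[OF gideal_sub[OF gC]] hf_between(2)[OF gC gE] extend_ge[of C 1 0 D] by (auto simp: le_fun_def)
  moreover have "hf (isum C D) (n + m) \<le> hf C (n + m)" by (rule hf_mono[OF gC gE extend_ge])
  ultimately show ?thesis by simp
 qed
 thus ?thesis unfolding eventually_sequentially by blast
qed

text \<open>The residual formula for C = Y: here Y : D = Y because Y is prime and D is strictly
  larger.\<close>

lemma linked_hpoly:
 assumes Y: "relevant Y" "hpoly Y P" and L: "linked Y D m" and ne: "D \<noteq> Y"
 shows "hpoly D (pdiff P (real m))"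
proof -
 have gX: "gideal Y" "gprime Y" using Y unfolding relevant_def gprime_def by auto
 have D: "gideal D" "Y \<le> D" using L unfolding linked_def by auto
 have "icolon Y D n \<subseteq> Y n" for n
 proof
  fix q assume q: "q \<in> icolon Y D n"
  obtain k d where d: "d \<in> D k" "d \<notin> Y k" using ne D(2) by (metis le_fun_def order_antisym subsetI)
  have "d * q \<in> Y (k + n)" "q \<in> G n" using q d(1) unfolding icolon_def by auto
  thus "q \<in> Y n" using gprimeD[OF gX(2) gideal_G[OF D(1) d(1)]] d(2) by blast
 qed
 hence ic: "icolon Y D = Y" using icolon_ge[OF gX(1) D(1)] by (auto simp: fun_eq_iff le_fun_def)
 have "\<forall>\<^sub>F n in sequentially. real (hf D (n + m)) = poly (pdiff P (real m)) (real (n + m))"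
  using linked_residual[OF gX(2) L relevant_saturated[OF Y(1)] order_refl]
   eventually_shift[OF Y(2)[unfolded hpoly_def], of m] Y(2)[unfolded hpoly_def]
  by eventually_elim (simp add: ic isum_absorb[OF gX(1) D] poly_pdiff)
 thus ?thesis unfolding hpoly_def
  using eventually_unshift[of "\<lambda>n. real (hf D n) = poly (pdiff P (real m)) (real n)" m] by blast
qed

subsection \<open>Schemes of dimension at most one\<close>

definition linear_hf :: "(nat \<Rightarrow> 'a set) \<Rightarrow> nat \<Rightarrow> int \<Rightarrow> bool" where
 "linear_hf C d \<chi> \<longleftrightarrow> (\<forall>\<^sub>F n in sequentially. int (hf C n) = int d * int n + \<chi>)"

lemma linear_le:
 fixes a b c d :: int
 assumes "\<forall>\<^sub>F n in sequentially. a * int n + b \<le> c * int n + d"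
 shows "a \<le> c"
proof (rule ccontr)
 assume "\<not> a \<le> c"
 obtain N where N: "\<And>n. n \<ge> N \<Longrightarrow> a * int n + b \<le> c * int n + d" using assms unfolding eventually_sequentially by blast
 define n where "n = max N (nat (d - b + 1))"
 have "(a - c) * int n \<le> d - b" using N[of n] by (simp add: n_def left_diff_distrib)
 moreover have "1 * int n \<le> (a - c) * int n" using \<open>\<not> a \<le> c\<close> by (intro mult_right_mono) auto
 ultimately show False unfolding n_def by linarith
qed

lemma linear_eq:
 fixes a b c d :: int
 assumes "\<forall>\<^sub>F n in sequentially. a * int n + b = c * int n + d"
 shows "a = c \<and> b = d"
proof -
 have "a = c"
  using linear_le[of a b c d] linear_le[of c d a b] eventually_mono[OF assms] by (metis (no_types, lifting) order_antisym order_refl)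
 moreover obtain n where "a * int n + b = c * int n + d" using assms unfolding eventually_sequentially by blast
 ultimately show ?thesis by simp
qed

lemma linear_hf_unique:
 assumes "linear_hf C d \<chi>" "linear_hf C d' \<chi>'" shows "d = d' \<and> \<chi> = \<chi>'"
proof -
 have "\<forall>\<^sub>F n in sequentially. int d * int n + \<chi> = int d' * int n + \<chi>'"
  using assms[unfolded linear_hf_def] by eventually_elim simp
 from linear_eq[OF this] show ?thesis by simp
qed

lemma linear_hf_above:
 assumes C: "gideal C" "linear_hf C d \<chi>" and E: "gideal E" "C \<le> E"
 shows "\<exists>e \<psi>. linear_hf E e \<psi> \<and> e \<le> d"
proof -
 obtain R where R: "hpoly E R" using hpoly_exists[OF E(1)] by blast
 have "hpoly C [:of_int \<chi>, real d:]"
  unfolding hpoly_def using C(2)[unfolded linear_hf_def]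
 proof eventually_elim
  case (elim n)
  hence "real_of_int (int (hf C n)) = of_int (int d * int n + \<chi>)" by simp
  thus ?case by (simp add: mult.commute)
 qed
 hence "degree R \<le> 1" using hpoly_mono(1)[OF C(1) E(1,2) _ R] by (metis degree_pCons_le degree_pCons_0 One_nat_def order_trans)
 then obtain e c :: int where e: "R = [:of_int c, of_int e:]" using int_valued_linear[OF hpoly_int_valued[OF R]] by blast
 have h: "\<forall>\<^sub>F n in sequentially. int (hf E n) = e * int n + c"
  using R[unfolded hpoly_def]
 proof eventually_elim
  case (elim n)
  hence "real_of_int (int (hf E n)) = of_int (e * int n + c)" by (simp add: e mult.commute)
  thus ?case by (simp only: of_int_eq_iff)
 qed
 have "\<forall>\<^sub>F n in sequentially. 0 * int n + 0 \<le> e * int n + c" using h by eventually_elim (metis mult_zero_left add_0 of_nat_0_le_iff)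
 hence "0 \<le> e" by (rule linear_le)
 have "\<forall>\<^sub>F n in sequentially. e * int n + c \<le> int d * int n + \<chi>"
  using h C(2)[unfolded linear_hf_def] by eventually_elim (use hf_mono[OF C(1) E] in \<open>metis of_nat_le_iff\<close>)
 hence "e \<le> int d" by (rule linear_le)
 thus ?thesis using h \<open>0 \<le> e\<close> unfolding linear_hf_def by (intro exI[of _ "nat e"] exI[of _ c]) auto
qed

lemma linear_hf_sat: "gideal C \<Longrightarrow> linear_hf C d \<chi> \<Longrightarrow> linear_hf (sat C) d \<chi>"
 unfolding linear_hf_def using hf_sat[of C] by (auto elim: eventually_elim2)

text \<open>The residual enters the formula with its degree shifted by m; comparing constant terms
  produces the correction - m d'.\<close>

lemma linear_residual:
 assumes Y: "gprime Y" and L: "linked Y D m" and C: "saturated C" "Y \<le> C" "linear_hf C d \<chi>"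
 shows "\<exists>e \<chi>\<^sub>1 d' \<chi>\<^sub>2. linear_hf (isum C D) e \<chi>\<^sub>1 \<and> linear_hf (icolon C D) d' \<chi>\<^sub>2 \<and> d = e + d' \<and> \<chi> = \<chi>\<^sub>1 + \<chi>\<^sub>2 - int m * int d'"
proof -
 have gD: "gideal D" using L unfolding linked_def by blast
 note gC = saturated_gideal[OF C(1)]
 obtain e \<chi>\<^sub>1 where E: "linear_hf (isum C D) e \<chi>\<^sub>1" using linear_hf_above[OF gC C(3) isum_gideal[OF gC gD] extend_ge] by blast
 obtain d' \<chi>\<^sub>2 where R: "linear_hf (icolon C D) d' \<chi>\<^sub>2" using linear_hf_above[OF gC C(3) icolon_gideal[OF gC] icolon_ge[OF gC gD]] by blast
 have "\<forall>\<^sub>F n in sequentially. int d * int n + (int d * int m + \<chi>) = (int e + int d') * int n + (int e * int m + \<chi>\<^sub>1 + \<chi>\<^sub>2)"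
  using linked_residual[OF Y L C(1,2)] eventually_shift[OF C(3)[unfolded linear_hf_def], of m]
   eventually_shift[OF E[unfolded linear_hf_def], of m] R[unfolded linear_hf_def]
 proof eventually_elim
  case (elim n)
  have "int (hf C (n + m)) = int (hf (isum C D) (n + m)) + int (hf (icolon C D) n)" using elim(1) by simp
  hence "int d * int (n + m) + \<chi> = int e * int (n + m) + \<chi>\<^sub>1 + (int d' * int n + \<chi>\<^sub>2)" unfolding elim(2-4) .
  thus ?case by (simp add: algebra_simps)
 qed
 from linear_eq[OF this] have "int d = int e + int d'" "int d * int m + \<chi> = int e * int m + \<chi>\<^sub>1 + \<chi>\<^sub>2" by auto
 hence "d = e + d'" "\<chi> = \<chi>\<^sub>1 + \<chi>\<^sub>2 - int m * int d'" by (auto simp: algebra_simps)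
 thus ?thesis using E R by blast
qed

text \<open>If the product of all the ideals lies in C, then the product without the factor of a
  lies in the residual C : D a. This keeps the annihilation hypothesis alive during peeling.\<close>

lemma product_icolon:
 assumes Q: "finite Q" "a \<notin> Q" and D: "\<And>x. x \<in> Q \<Longrightarrow> gideal (D x)" and p: "\<forall>x\<in>Q. p x \<in> D x (k x)"
  and prod: "\<And>p k. (\<forall>x\<in>insert a Q. p x \<in> D x (k x)) \<Longrightarrow> (\<Prod>x\<in>insert a Q. p x) \<in> C (\<Sum>x\<in>insert a Q. k x)"
 shows "(\<Prod>x\<in>Q. p x) \<in> icolon C (D a) (\<Sum>x\<in>Q. k x)"
proof -
 have "(\<Prod>x\<in>Q. p x) \<in> G (\<Sum>x\<in>Q. k x)"
  using Q(1) p D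
 proof (induction Q rule: finite_induct)
  case (insert x Q)
  have "p x \<in> G (k x)" using insert.prems gideal_G by blast
  thus ?case using G_mult[of "p x" "k x" "\<Prod>x\<in>Q. p x" "\<Sum>x\<in>Q. k x"] insert by simp
 qed (simp add: G_one)
 moreover have "d * (\<Prod>x\<in>Q. p x) \<in> C (j + (\<Sum>x\<in>Q. k x))" if d: "d \<in> D a j" for d j
 proof -
  have "(\<Prod>x\<in>insert a Q. (p(a := d)) x) \<in> C (\<Sum>x\<in>insert a Q. (k(a := j)) x)"
   using p d Q(2) by (intro prod) auto
  moreover have "(\<Prod>x\<in>Q. (p(a := d)) x) = (\<Prod>x\<in>Q. p x)" "(\<Sum>x\<in>Q. (k(a := j)) x) = (\<Sum>x\<in>Q. k x)"
   using Q(2) by (auto intro!: prod.cong sum.cong)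
  ultimately show ?thesis using Q by simp
 qed
 ultimately show ?thesis unfolding icolon_def by blast
qed

text \<open>A curve annihilated by the product of the ideals of finitely many divisors is covered by its intersections with them.\<close>

lemma degree_le_sections:
 assumes Y: "gprime Y" and "finite Q" "\<And>x. x \<in> Q \<Longrightarrow> linked Y (D x) (m x)"
  and "saturated C" "Y \<le> C" "linear_hf C d \<chi>" "\<And>x. x \<in> Q \<Longrightarrow> linear_hf (isum C (D x)) (e x) (\<psi> x)"
  and "\<And>p k. (\<forall>x\<in>Q. p x \<in> D x (k x)) \<Longrightarrow> (\<Prod>x\<in>Q. p x) \<in> C (\<Sum>x\<in>Q. k x)"
 shows "d \<le> (\<Sum>x\<in>Q. e x)"
 using assms(2-)
proof (induction Q arbitrary: C d \<chi> e \<psi> rule: finite_induct)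
 case empty
 have "1 \<in> C 0" using empty.prems(6) by simp
 hence "C = G" using gideal_top[OF saturated_gideal[OF empty.prems(2)]] by blast
 hence "\<forall>\<^sub>F n in sequentially. int d * int n + \<chi> = 0 * int n + 0"
  using empty.prems(4) unfolding linear_hf_def by (auto simp: hf_G elim: eventually_mono)
 from linear_eq[OF this] show ?case by simp
next
 case (insert a Q)
 note C = insert.prems(2,3,4) and gC = saturated_gideal[OF insert.prems(2)]
 have L: "linked Y (D a) (m a)" using insert.prems(1) by blast
 have gD: "gideal (D x)" if "x \<in> insert a Q" for x using insert.prems(1)[OF that] unfolding linked_def by blast
 let ?R = "icolon C (D a)"
 obtain e' \<chi>\<^sub>1 d' \<chi>\<^sub>2 where r: "linear_hf (isum C (D a)) e' \<chi>\<^sub>1" "linear_hf ?R d' \<chi>\<^sub>2" "d = e' + d'"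
  using linear_residual[OF Y L C] by blast
 have "e' = e a" using linear_hf_unique[OF r(1) insert.prems(5)[of a]] by simp
 have gR: "gideal ?R" by (rule icolon_gideal[OF gC])
 have CR: "C \<le> ?R" by (rule icolon_ge[OF gC gD]) simp
 have "\<forall>x\<in>Q. \<exists>e' \<psi>'. linear_hf (isum ?R (D x)) e' \<psi>' \<and> e' \<le> e x"
 proof
  fix x assume x: "x \<in> Q"
  hence "isum C (D x) \<le> isum ?R (D x)" using isum_mono[OF gD CR] by blast
  thus "\<exists>e' \<psi>'. linear_hf (isum ?R (D x)) e' \<psi>' \<and> e' \<le> e x"
   using linear_hf_above[OF isum_gideal[OF gC gD] insert.prems(5) isum_gideal[OF gR gD]] x by blast
 qed
 then obtain e2 \<psi>2 where e2: "\<And>x. x \<in> Q \<Longrightarrow> linear_hf (isum ?R (D x)) (e2 x) (\<psi>2 x) \<and> e2 x \<le> e x" by metis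
 have "d' \<le> (\<Sum>x\<in>Q. e2 x)"
 proof (rule insert.IH[of ?R d' \<chi>\<^sub>2 e2 \<psi>2])
  show "saturated ?R" by (rule icolon_saturated[OF C(1) gD]) simp
  show "Y \<le> ?R" by (rule order_trans[OF C(2) CR])
  show "(\<Prod>x\<in>Q. p x) \<in> ?R (\<Sum>x\<in>Q. k x)" if p: "\<forall>x\<in>Q. p x \<in> D x (k x)" for p k
   by (rule product_icolon[of Q a D p k C, OF insert.hyps _ p insert.prems(6)]) (use gD in auto)
 qed (use insert.prems e2 r in auto)
 also have "\<dots> \<le> (\<Sum>x\<in>Q. e x)" using e2 by (intro sum_mono) blast
 finally show ?case using r(3) \<open>e' = e a\<close> insert.hyps by simp
qed

end

section \<open>Effective Cartier divisors\<close>

lemma homogeneous_ideal_ops: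
 assumes "homogeneous_ideal r X"
 shows "x \<in> X \<Longrightarrow> y \<in> X \<Longrightarrow> x + y \<in> X" "x \<in> X \<Longrightarrow> s \<in> polys r \<Longrightarrow> s * x \<in> X" "x \<in> X \<Longrightarrow> x \<in> polys r" "0 \<in> X"
  "x \<in> X \<Longrightarrow> - x \<in> X"
proof -
 show "x \<in> X \<Longrightarrow> y \<in> X \<Longrightarrow> x + y \<in> X" "x \<in> X \<Longrightarrow> s \<in> polys r \<Longrightarrow> s * x \<in> X" "x \<in> X \<Longrightarrow> x \<in> polys r" "0 \<in> X"
  using assms unfolding homogeneous_ideal_def by blast+
 have "const (- 1) \<in> polys r" by (rule const_polys)
 hence "const (- 1) * x \<in> X" if "x \<in> X" using assms that unfolding homogeneous_ideal_def by blast
 moreover have "const (- 1) * x = - x" using S.scale_minus_left[of 1 x] by simp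
 ultimately show "x \<in> X \<Longrightarrow> - x \<in> X" by simp
qed

lemma homogeneous_ideal_comb:
 assumes "homogeneous_ideal r X" "x \<in> X" "y \<in> X" "s \<in> polys r" "t \<in> polys r"
 shows "s * x + t * y \<in> X"
 using assms homogeneous_ideal_ops(1,2)[OF assms(1)] by blast

lemma point_mult:
 assumes "P \<in> points r X" "c \<in> polys r - P" "c' \<in> polys r - P" shows "c * c' \<in> polys r - P"
 using assms polys_mult unfolding points_def homogeneous_prime_def by blast

lemma point_one: "P \<in> points r X \<Longrightarrow> 1 \<in> polys r - P"
 using homogeneous_ideal_top[of r P] one_forms forms_polys[of r 0] unfolding points_def homogeneous_prime_def by blast

lemma point_power: "P \<in> points r X \<Longrightarrow> c \<in> polys r - P \<Longrightarrow> c ^ k \<in> polys r - P"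
 by (induction k) (use point_mult point_one in auto)

lemma point_var:
 assumes "homogeneous_ideal r X" "P \<in> points r X" shows "\<exists>i\<le>r. var i \<in> polys r - P"
proof -
 obtain i where "i \<le> r" "var i \<notin> gr r P 1" using S.relevant_X relevant_points(1)[OF assms] by blast
 thus ?thesis using var_forms[of i r] forms_polys[of r 1] unfolding gr_def by blast
qed

text \<open>\<open>loc r X P y z\<close>: near the point \<open>P\<close> of \<open>X\<close>, \<open>y\<close> lies in the ideal generated by \<open>z\<close>.\<close>

definition loc :: "nat \<Rightarrow> mpoly set \<Rightarrow> mpoly set \<Rightarrow> mpoly \<Rightarrow> mpoly \<Rightarrow> bool" where
 "loc r X P y z \<longleftrightarrow> (\<exists>c\<in>polys r - P. \<exists>s\<in>polys r. c * y - z * s \<in> X)"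

context
 fixes r X P
 assumes hX: "homogeneous_ideal r X" and P: "P \<in> points r X"
begin

lemma loc_trans: assumes "loc r X P y z" "loc r X P z w" shows "loc r X P y w"
proof -
 obtain c s where 1: "c \<in> polys r - P" "s \<in> polys r" "c * y - z * s \<in> X" using assms(1) unfolding loc_def by blast
 obtain c' s' where 2: "c' \<in> polys r - P" "s' \<in> polys r" "c' * z - w * s' \<in> X" using assms(2) unfolding loc_def by blast
 have "c' * (c * y - z * s) + s * (c' * z - w * s') \<in> X"
  using 1 2 by (intro homogeneous_ideal_comb[OF hX]) auto
 moreover have "c' * (c * y - z * s) + s * (c' * z - w * s') = (c' * c) * y - w * (s' * s)" by (simp add: algebra_simps)
 ultimately have "(c' * c) * y - w * (s' * s) \<in> X" by simp
 thus ?thesis unfolding loc_def using point_mult[OF P 2(1) 1(1)] polys_mult[OF 2(2) 1(2)] by blast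
qed

lemma loc_eq: "c \<in> polys r - P \<Longrightarrow> s \<in> polys r \<Longrightarrow> c * y - z * s \<in> X \<Longrightarrow> loc r X P y z"
 unfolding loc_def by blast

lemma loc_mult:
 assumes "loc r X P y z" "loc r X P y' z'" and "y \<in> polys r" "z' \<in> polys r"
 shows "loc r X P (y * y') (z * z')"
proof -
 obtain c s where 1: "c \<in> polys r - P" "s \<in> polys r" "c * y - z * s \<in> X" using assms(1) unfolding loc_def by blast
 obtain c' s' where 2: "c' \<in> polys r - P" "s' \<in> polys r" "c' * y' - z' * s' \<in> X" using assms(2) unfolding loc_def by blast
 have "(c * y) * (c' * y' - z' * s') + (z' * s') * (c * y - z * s) \<in> X"
  using 1 2 assms by (intro homogeneous_ideal_comb[OF hX] polys_mult) auto
 moreover have "(c * y) * (c' * y' - z' * s') + (z' * s') * (c * y - z * s) = (c * c') * (y * y') - (z * z') * (s * s')"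
  by (simp add: algebra_simps)
 ultimately have "(c * c') * (y * y') - (z * z') * (s * s') \<in> X" by simp
 thus ?thesis unfolding loc_def using point_mult[OF P 1(1) 2(1)] polys_mult[OF 1(2) 2(2)] by blast
qed

lemma loc_refl: "loc r X P y y"
 by (rule loc_eq[of 1 1]) (use point_one[OF P] homogeneous_ideal_ops(4)[OF hX] in auto)

lemma loc_prod:
 assumes "finite A" "\<And>i. i \<in> A \<Longrightarrow> loc r X P (y i) (z i) \<and> y i \<in> polys r \<and> z i \<in> polys r"
 shows "loc r X P (\<Prod>i\<in>A. y i) (\<Prod>i\<in>A. z i) \<and> (\<Prod>i\<in>A. z i) \<in> polys r"
 using assms
proof (induction A rule: finite_induct)
 case empty thus ?case using loc_refl[of 1] point_one[OF P] by simp
next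
 case (insert a A)
 thus ?case using loc_mult[of "y a" "z a" "\<Prod>i\<in>A. y i" "\<Prod>i\<in>A. z i"] polys_mult[of "z a" r] by auto
qed

lemma loc_power: "loc r X P y z \<Longrightarrow> y \<in> polys r \<Longrightarrow> z \<in> polys r \<Longrightarrow> loc r X P (y ^ k) (z ^ k)"
 using loc_prod[of "{..<k}" "\<lambda>_. y" "\<lambda>_. z"] by simp

text \<open>A form of D that generates D near P modulo X. Working with numerators only, units at P
  included, avoids rational functions and degree bookkeeping.\<close>

definition local_equation :: "mpoly set \<Rightarrow> mpoly \<Rightarrow> bool" where
 "local_equation D \<phi> \<longleftrightarrow> (\<exists>\<delta>. \<phi> \<in> gr r D \<delta>) \<and> (\<forall>n. \<forall>p\<in>gr r D n. loc r X P p \<phi>)"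

lemma basic_nbhd_power: "basic_nbhd r P h \<Longrightarrow> h \<noteq> 0" "basic_nbhd r P h \<Longrightarrow> h ^ k \<in> polys r - P"
 using homogeneous_ideal_ops(4)[OF hX] P point_power[OF P, of h k] forms_polys unfolding points_def basic_nbhd_def by blast+

lemma local_generator_equation:
 assumes D: "S.gideal r (gr r D)" and nb: "basic_nbhd r P h" and f: "local_generator r X D h f"
 shows "\<exists>\<phi> k. local_equation D \<phi> \<and> f = frac \<phi> (h ^ k)"
proof -
 obtain d where h: "h \<in> forms r d" "d > 0" using nb unfolding basic_nbhd_def by blast
 note h0 = basic_nbhd_power(1)[OF nb] and hp = basic_nbhd_power(2)[OF nb]
 have eq: "sections r D h = {f * g + u | g u. g \<in> sections r (polys r) h \<and> u \<in> sections r X h}"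
  using f unfolding local_generator_def by blast
 have "f * 1 + 0 \<in> sections r D h"
  unfolding eq using sections_one[OF h(1) h0] FV.subspace_0[OF sections_subspace[OF gr_gideal[OF hX] h(1) h0]] by blast
 then obtain \<phi> k where \<phi>: "\<phi> \<in> gr r D (k * d)" "f = frac \<phi> (h ^ k)" using sections_iff[OF h(1) h0, of f D] by auto
 obtain i where i: "i \<le> r" "var i \<in> polys r - P" using point_var[OF hX P] by blast
 have "loc r X P p \<phi>" if p: "p \<in> gr r D n" for p n
 proof -
  \<comment> \<open>A section over the complement of h = 0 needs a numerator whose degree is a
    multiple of d. A power of a variable that is a unit at P lifts the degree from n to n d.\<close>
  have "var i ^ (n * d - n) * p \<in> gr r D ((n * d - n) + n)"
   by (rule S.gideal_mult[OF D S.G_power1[OF var_forms[OF i(1)]] p])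
  hence "var i ^ (n * d - n) * p \<in> gr r D (n * d)" using h(2) by (cases d) (auto simp: add.commute)
  hence "frac (var i ^ (n * d - n) * p) (h ^ n) \<in> sections r D h" unfolding sections_iff[OF h(1) h0] by blast
  then obtain g u where gu: "frac (var i ^ (n * d - n) * p) (h ^ n) = f * g + u" "g \<in> sections r (polys r) h" "u \<in> sections r X h"
   unfolding eq by blast
  obtain \<sigma> l where \<sigma>: "\<sigma> \<in> forms r (l * d)" "g = frac \<sigma> (h ^ l)" using gu(2) unfolding sections_iff[OF h(1) h0] gr_polys by blast
  obtain \<tau> q where \<tau>: "\<tau> \<in> gr r X (q * d)" "u = frac \<tau> (h ^ q)" using gu(3) unfolding sections_iff[OF h(1) h0] by blast
  have "frac (var i ^ (n * d - n) * p) (h ^ n) = frac (\<phi> * \<sigma> * h ^ q + \<tau> * h ^ (k + l)) (h ^ (k + l + q))"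
   unfolding gu(1) \<phi>(2) \<sigma>(2) \<tau>(2) using h0 by (simp add: power_add mult_ac)
  hence "(var i ^ (n * d - n) * p) * h ^ (k + l + q) = (\<phi> * \<sigma> * h ^ q + \<tau> * h ^ (k + l)) * h ^ n"
   using h0 by (simp add: eq_fract)
  hence "(var i ^ (n * d - n) * h ^ (k + l + q)) * p - \<phi> * (\<sigma> * h ^ (q + n)) = h ^ (k + l + n) * \<tau>"
   by (simp add: power_add algebra_simps)
  moreover have "h ^ (k + l + n) * \<tau> \<in> X"
   using \<tau>(1) hp homogeneous_ideal_ops(2)[OF hX] unfolding gr_def by blast
  ultimately have "(var i ^ (n * d - n) * h ^ (k + l + q)) * p - \<phi> * (\<sigma> * h ^ (q + n)) \<in> X" by (simp only:)
  moreover have "var i ^ (n * d - n) * h ^ (k + l + q) \<in> polys r - P"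
   by (rule point_mult[OF P point_power[OF P i(2)] hp])
  moreover have "\<sigma> * h ^ (q + n) \<in> polys r"
   using polys_mult \<sigma>(1) forms_polys[of r "l * d"] hp by blast
  ultimately show ?thesis by (intro loc_eq)
 qed
 thus ?thesis unfolding local_equation_def using \<phi> by blast
qed

text \<open>The ideal of the section is a saturation, but near P saturation changes nothing because
  some variable is a unit there. Hence L itself is a local equation.\<close>

lemma hyperplane_equation:
 assumes L: "L \<in> forms r 1" and \<zeta>: "local_equation (hyperplane_section r X L) \<zeta>"
 shows "loc r X P L \<zeta>" "loc r X P \<zeta> L"
proof -
 let ?A = "S.adjoin r (gr r X) L 1"
 have gA: "S.gideal r ?A" by (rule S.adjoin_gideal[OF gr_gideal[OF hX] L])
 have gr: "gr r (hyperplane_section r X L) = S.sat r ?A" by (rule gr_hyperplane_section[OF hX L])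
 have "L \<in> S.sat r ?A 1" using S.sat_ge[OF gA] S.adjoin_mem[OF gr_gideal[OF hX], of L 1] by (auto simp: le_fun_def)
 thus "loc r X P L \<zeta>" using \<zeta> unfolding local_equation_def gr by blast
 obtain \<delta> where "\<zeta> \<in> S.sat r ?A \<delta>" using \<zeta> unfolding local_equation_def gr by blast
 then obtain k where k: "\<And>g. g \<in> forms r k \<Longrightarrow> g * \<zeta> \<in> ?A (k + \<delta>)" unfolding S.sat_def by blast
 obtain i where i: "i \<le> r" "var i \<in> polys r - P" using point_var[OF hX P] by blast
 have "var i ^ k * \<zeta> \<in> ?A (k + \<delta>)" by (rule k[OF S.G_power1[OF var_forms[OF i(1)]]])
 then obtain x q where xq: "var i ^ k * \<zeta> = x + L * q" "x \<in> gr r X (k + \<delta>)" "1 \<le> k + \<delta> \<and> q \<in> forms r (k + \<delta> - 1) \<or> q = 0"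
  unfolding S.adjoin_def by blast
 have "q \<in> polys r" using xq(3) forms_polys homogeneous_ideal_ops(3,4)[OF hX] by blast
 moreover have "var i ^ k * \<zeta> - L * q \<in> X" using xq(1,2) unfolding gr_def by simp
 ultimately show "loc r X P \<zeta> L" using loc_eq point_power[OF P i(2)] by blast
qed

lemma local_equation_polys: "local_equation D \<phi> \<Longrightarrow> \<phi> \<in> polys r"
 unfolding local_equation_def gr_def using forms_polys by blast

end

text \<open>The forms c with c y in A constitute the ideal A : y. The local relations put an element
  outside P into it for every point P of X, so it lies in no relevant prime and contains all forms
  of some degree.\<close>

lemma local_to_global:
 assumes X: "homogeneous_ideal r X" and A: "S.gideal r A" "gr r X \<le> A" and y: "y \<in> forms r n"
  and loc: "\<And>P. P \<in> points r X \<Longrightarrow> \<exists>z\<in>ungr r A. loc r X P y z"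
 shows "y \<in> S.sat r A n"
proof -
 let ?K = "S.colon r A y n"
 have gK: "S.gideal r ?K" by (rule S.colon_gideal[OF A(1) y])
 have hA: "homogeneous_ideal r (ungr r A)" by (rule ungr_homogeneous[OF A(1)])
 have XA: "X \<subseteq> ungr r A" using gr_mono_iff[OF X hA] A(2) gr_ungr[OF A(1)] by simp
 have False if J: "S.relevant r J" "?K \<le> J" for J
 proof -
  have "gr r X \<le> J" using A(2) S.colon_ge[OF A(1) y] J(2) by (meson order_trans)
  hence P: "ungr r J \<in> points r X" by (rule relevant_points(2)[OF X J(1)])
  obtain z c s where zc: "z \<in> ungr r A" "c \<in> polys r - ungr r J" "s \<in> polys r" "c * y - z * s \<in> X"
   using loc[OF P] unfolding loc_def by blast
  have "s * z \<in> ungr r A" by (rule homogeneous_ideal_ops(2)[OF hA zc(1,3)])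
  hence "(c * y - z * s) + s * z \<in> ungr r A" using zc(4) XA homogeneous_ideal_ops(1)[OF hA] by blast
  hence cy: "c * y \<in> ungr r A" by (simp add: mult.commute)
  obtain k where k: "hom_component k c \<notin> J k" using zc(2) unfolding ungr_def by blast
  have c: "c \<in> polys r" using zc(2) by blast
  have "hom_component (k + n) (c * y) \<in> A (k + n)" using cy unfolding ungr_def by blast
  hence "y * hom_component k c \<in> A (k + n)" by (simp add: hom_component_mult_form[OF c y] mult.commute)
  hence "hom_component k c \<in> ?K k" unfolding S.colon_def using hom_component_forms[OF c] by blast
  thus False using J(2) k by (auto simp: le_fun_def)
 qed
 hence "\<forall>\<^sub>F k in sequentially. ?K k = forms r k" by (rule S.no_relevant_prime[OF gK])
 then obtain k where "?K k = forms r k" unfolding eventually_sequentially by blast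
 hence "\<forall>g\<in>forms r k. g * y \<in> A (k + n)" unfolding S.colon_def by (auto simp: mult.commute)
 thus ?thesis unfolding S.sat_def using y by blast
qed

text \<open>For a hyperplane section H cut out by a linear form L, the divisor E = m H has the local
  equation L^m, and D differs from E by the divisor of a / b. So near every point b D and the form F
  = a L^m generate the same ideal modulo X, and by \<open>local_to_global\<close> they do so in
  large degrees.\<close>

lemma linked_divisor:
 assumes X: "homogeneous_ideal r X" and D: "homogeneous_ideal r D" "X \<subseteq> D"
  and eq: "equivalent_to_multiple_of_hyperplane_section r X D"
 shows "\<exists>m. S.linked r (gr r X) (gr r D) m"
proof -
 obtain m F\<^sub>0 where F0: "F\<^sub>0 \<in> polys r" "F\<^sub>0 \<noteq> 0" "\<And>a. eval_mpoly a F\<^sub>0 \<noteq> 0 \<Longrightarrow> \<exists>E.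
   is_divisor_sum r X {0} (\<lambda>_. hyperplane_section r X (linear_form r a)) (\<lambda>_. m) E \<and> linearly_equivalent r X D E"
  using eq unfolding equivalent_to_multiple_of_hyperplane_section_def for_general_hyperplane_def by blast
 obtain a\<^sub>0 where "eval_mpoly a\<^sub>0 F\<^sub>0 \<noteq> 0" using common_nonzero[OF F0(1,2) F0(1,2)] by blast
 define L where "L = linear_form r a\<^sub>0"
 have L: "L \<in> forms r 1" unfolding L_def by (rule linear_form_forms)
 obtain E where E: "is_divisor_sum r X {0} (\<lambda>_. hyperplane_section r X L) (\<lambda>_. m) E" "linearly_equivalent r X D E"
  using F0(3)[OF \<open>eval_mpoly a\<^sub>0 F\<^sub>0 \<noteq> 0\<close>] unfolding L_def by blast
 have gE: "S.gideal r (gr r E)" using E(1) closed_homogeneous gr_gideal unfolding is_divisor_sum_def by blast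
 have gH: "S.gideal r (gr r (hyperplane_section r X L))"
  unfolding gr_hyperplane_section[OF X L] by (rule S.sat_gideal[OF S.adjoin_gideal[OF gr_gideal[OF X] L]])
 have gX: "S.gideal r (gr r X)" and gD: "S.gideal r (gr r D)" using gr_gideal X D by blast+
 obtain e a b where ab: "a \<in> forms r e" "b \<in> forms r e" "b \<notin> X"
  and le: "\<And>P. P \<in> points r X \<Longrightarrow> \<exists>h f g. basic_nbhd r P h \<and> local_generator r X D h f \<and> local_generator r X E h g \<and>
      frac b 1 * f - frac a 1 * g \<in> {frac c (h ^ k) | c k. c \<in> X}"
  using E(2) unfolding linearly_equivalent_def by blast
 define F where "F = a * L ^ m"
 have F: "F \<in> forms r (m + e)" unfolding F_def using forms_mult[OF ab(1) S.G_power1[OF L, of m]] by (simp add: add.commute)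
 have pol: "a \<in> polys r" "b \<in> polys r" "L \<in> polys r" using ab L forms_polys by blast+
 have local: "\<exists>\<phi>. \<phi> \<in> D \<and> (\<exists>\<delta>. \<phi> \<in> gr r D \<delta>) \<and> (\<forall>n. \<forall>p\<in>gr r D n. loc r X P (b * p) F) \<and> loc r X P F (b * \<phi>)"
  if P: "P \<in> points r X" for P
 proof -
  note lm = loc_mult[OF X P] and lt = loc_trans[OF X P]
  obtain h f g where h: "basic_nbhd r P h" and f: "local_generator r X D h f" and g: "local_generator r X E h g"
   and fg: "frac b 1 * f - frac a 1 * g \<in> {frac c (h ^ k) | c k. c \<in> X}" using le[OF P] by blast
  note h0 = basic_nbhd_power(1)[OF X P h] and hP = basic_nbhd_power(2)[OF X P h]
  obtain \<phi> k where \<phi>: "local_equation r X P D \<phi>" "f = frac \<phi> (h ^ k)"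
   using local_generator_equation[OF X P gD h f] by blast
  obtain \<gamma> l where \<gamma>: "local_equation r X P E \<gamma>" "g = frac \<gamma> (h ^ l)"
   using local_generator_equation[OF X P gE h g] by blast
  obtain c j where c: "c \<in> X" "frac b 1 * f - frac a 1 * g = frac c (h ^ j)" using fg by blast
  have "frac b 1 * f - frac a 1 * g = frac (b * \<phi> * h ^ l - a * \<gamma> * h ^ k) (h ^ (k + l))"
   unfolding \<phi>(2) \<gamma>(2) using h0 by (simp add: eq_fract power_add algebra_simps)
  hence "(b * \<phi> * h ^ l - a * \<gamma> * h ^ k) * h ^ j = h ^ (k + l) * c"
   using c(2) h0 by (simp add: eq_fract mult.commute)
  moreover have "h ^ (k + l) * c \<in> X" using homogeneous_ideal_ops(2)[OF X c(1)] hP by blast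
  ultimately have rel: "(b * \<phi> * h ^ l - a * \<gamma> * h ^ k) * h ^ j \<in> X" by simp
  have pp: "\<phi> \<in> polys r" "\<gamma> \<in> polys r" using local_equation_polys[OF X P] \<phi> \<gamma> by blast+
  have 1: "loc r X P (b * \<phi>) (a * \<gamma>)"
  proof (rule loc_eq[OF X P])
   show "h ^ (l + j) \<in> polys r - P" by (rule hP)
   show "h ^ (k + j) \<in> polys r" using hP by blast
   show "h ^ (l + j) * (b * \<phi>) - a * \<gamma> * h ^ (k + j) \<in> X" using rel by (simp add: power_add algebra_simps)
  qed
  have 2: "loc r X P (a * \<gamma>) (b * \<phi>)"
  proof (rule loc_eq[OF X P])
   show "h ^ (k + j) \<in> polys r - P" by (rule hP)
   show "h ^ (l + j) \<in> polys r" using hP by blast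
   show "h ^ (k + j) * (a * \<gamma>) - b * \<phi> * h ^ (l + j) \<in> X"
    using homogeneous_ideal_ops(5)[OF X rel] by (simp add: power_add algebra_simps)
  qed
  obtain h1 f1 where h1: "basic_nbhd r P h1" and f1: "local_generator r X (hyperplane_section r X L) h1 f1"
   and g1: "local_generator r X E h1 (f1 ^ m)"
   using E(1) P unfolding is_divisor_sum_def by auto
  note h10 = basic_nbhd_power(1)[OF X P h1] and h1P = basic_nbhd_power(2)[OF X P h1]
  obtain \<zeta> k1 where \<zeta>: "local_equation r X P (hyperplane_section r X L) \<zeta>" "f1 = frac \<zeta> (h1 ^ k1)"
   using local_generator_equation[OF X P gH h1 f1] by blast
  obtain \<eta> l1 where \<eta>: "local_equation r X P E \<eta>" "f1 ^ m = frac \<eta> (h1 ^ l1)"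
   using local_generator_equation[OF X P gE h1 g1] by blast
  have "\<zeta> ^ m * h1 ^ l1 = \<eta> * h1 ^ (k1 * m)"
   using \<zeta>(2) \<eta>(2) h10 by (simp add: Fract_power eq_fract power_mult)
  hence "h1 ^ l1 * \<zeta> ^ m - \<eta> * h1 ^ (k1 * m) \<in> X" "h1 ^ (k1 * m) * \<eta> - \<zeta> ^ m * h1 ^ l1 \<in> X"
   using homogeneous_ideal_ops(4)[OF X] by (simp_all add: mult.commute)
  hence 3: "loc r X P (\<zeta> ^ m) \<eta>" "loc r X P \<eta> (\<zeta> ^ m)" using loc_eq[OF X P] h1P by blast+
  \<comment> \<open>\<gamma> and \<eta> come from two different neighbourhoods of P, but both are
    local equations of E and hence divide each other near P.\<close>
  have 4: "loc r X P \<eta> \<gamma>" "loc r X P \<gamma> \<eta>" using \<gamma>(1) \<eta>(1) unfolding local_equation_def[OF X P] by blast+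
  have \<zeta>p: "\<zeta> \<in> polys r" using local_equation_polys[OF X P \<zeta>(1)] .
  have 5: "loc r X P (L ^ m) (\<zeta> ^ m)" "loc r X P (\<zeta> ^ m) (L ^ m)"
   using hyperplane_equation[OF X P L \<zeta>(1)] loc_power[OF X P] pol \<zeta>p by blast+
  have pw: "L ^ m \<in> polys r" using S.G_power1[OF L] forms_polys by blast
  have "loc r X P (a * \<gamma>) F" unfolding F_def
   by (rule lm[OF loc_refl[OF X P] lt[OF lt[OF 4(2) 3(2)] 5(2)] pol(1) pw])
  moreover have "loc r X P F (a * \<gamma>)" unfolding F_def
   by (rule lm[OF loc_refl[OF X P] lt[OF lt[OF 5(1) 3(1)] 4(1)] pol(1) pp(2)])
  moreover have "loc r X P (b * p) (b * \<phi>)" if "p \<in> gr r D n" for p n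
   using lm[OF loc_refl[OF X P] _ pol(2) pp(1)] \<phi>(1) that unfolding local_equation_def[OF X P] by blast
  ultimately show ?thesis using lt 1 2 \<phi>(1) unfolding local_equation_def[OF X P] gr_def by blast
 qed
 define A where "A = S.adjoin r (gr r X) F (m + e)"
 define J where "J = S.extend (gr r X) b e (gr r D)"
 have gA: "S.gideal r A" "gr r X \<le> A" unfolding A_def using S.adjoin_gideal[OF gX F] S.adjoin_ge by blast+
 have gJ: "S.gideal r J" "gr r X \<le> J" unfolding J_def using S.extend_gideal[OF gX ab(2) gD] S.extend_ge by blast+
 have mem: "x \<in> ungr r B" if "S.gideal r B" "x \<in> B k" for x B k
  using fun_cong[OF gr_ungr[OF that(1)], of k] that(2) unfolding gr_def by blast
 have inA: "b * p \<in> S.sat r A (e + n)" if p: "p \<in> gr r D n" for p n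
 proof (rule local_to_global[OF X gA])
  show "b * p \<in> forms r (e + n)" using forms_mult[OF ab(2)] p unfolding gr_def by blast
  have "F \<in> A (m + e)" unfolding A_def by (rule S.adjoin_mem[OF gX])
  thus "\<exists>z\<in>ungr r A. loc r X P (b * p) z" if "P \<in> points r X" for P
   using local[OF that] p mem[OF gA(1)] by blast
 qed
 have inJ: "F \<in> S.sat r J (m + e)"
 proof (rule local_to_global[OF X gJ F])
  fix P assume "P \<in> points r X"
  then obtain \<phi> \<delta> where \<phi>: "\<phi> \<in> gr r D \<delta>" "loc r X P F (b * \<phi>)" using local by blast
  have "b * \<phi> \<in> J (\<delta> + e)" unfolding J_def S.extend_iff[OF gD]
   using \<phi>(1) S.gideal_0[OF gX] by (intro bexI[of _ \<phi>]) auto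
  thus "\<exists>z\<in>ungr r J. loc r X P F z" using \<phi>(2) mem[OF gJ(1)] by blast
 qed
 obtain N1 where N1: "\<And>n. n \<ge> N1 \<Longrightarrow> S.sat r A n = A n" using S.sat_eventually[OF gA(1)] by blast
 obtain N2 where N2: "\<And>n. n \<ge> N2 \<Longrightarrow> S.sat r J n = J n" using S.sat_eventually[OF gJ(1)] by blast
 have "\<exists>q\<in>forms r n. b * p - F * q \<in> gr r X (n + m + e)" if n: "n \<ge> max N1 N2" and p: "p \<in> gr r D (n + m)" for n p
 proof -
  have "b * p \<in> S.sat r A (n + (m + e))" using inA[OF p] by (simp only: ac_simps)
  hence "b * p \<in> A (n + (m + e))" using N1[of "n + (m + e)"] n by simp
  then obtain x q where "b * p = x + F * q" "x \<in> gr r X (n + (m + e))" "q \<in> forms r n" unfolding A_def using S.adjoin_D by blast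
  thus ?thesis by (intro bexI[of _ q]) (auto simp: add.assoc)
 qed
 moreover have "\<exists>p\<in>gr r D (n + m). b * p - F * q \<in> gr r X (n + m + e)" if n: "n \<ge> max N1 N2" and q: "q \<in> forms r n" for n q
 proof -
  have "q * F \<in> S.sat r J (n + (m + e))" by (rule S.gideal_mult[OF S.sat_gideal[OF gJ(1)] q inJ])
  hence "F * q \<in> J (n + m + e)" using N2[of "n + m + e"] n by (simp add: add.assoc mult.commute)
  then obtain p where p: "p \<in> gr r D (n + m)" "F * q - b * p \<in> gr r X (n + m + e)" unfolding J_def S.extend_iff[OF gD] by blast
  thus ?thesis using S.subspace_neg[OF S.gideal_sub[OF gX] p(2)] by (intro bexI[OF _ p(1)]) simp
 qed
 moreover have "b \<notin> gr r X e" using ab(3) unfolding gr_def by blast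
 moreover have "gr r X \<le> gr r D" using D(2) by (auto simp: gr_def le_fun_def)
 ultimately show ?thesis unfolding S.linked_def using gD ab(2) F
  by (intro exI[of _ m] conjI exI[of _ e] exI[of _ b] exI[of _ F] exI[of _ "max N1 N2"] allI impI ballI) auto
qed

text \<open>The index set lists each divisor with its multiplicity. Near a point every factor is a
  multiple of the local equation of its divisor, so the product is a multiple of the local equation
  of S.\<close>

lemma product_in_divisor_sum:
 assumes X: "homogeneous_ideal r X" and I: "finite I" and D: "\<And>i. i \<in> I \<Longrightarrow> homogeneous_ideal r (D i)"
  and S: "is_divisor_sum r X I D m S"
  and p: "\<forall>x\<in>Sigma I (\<lambda>i. {..<m i}). p x \<in> gr r (D (fst x)) (k x)"
 shows "(\<Prod>x\<in>Sigma I (\<lambda>i. {..<m i}). p x) \<in> gr r S (\<Sum>x\<in>Sigma I (\<lambda>i. {..<m i}). k x)"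
proof -
 let ?Q = "Sigma I (\<lambda>i. {..<m i})"
 have cS: "closed_subscheme r S" and XS: "X \<subseteq> S"
  using S unfolding is_divisor_sum_def subscheme_of_def by auto
 note hS = closed_homogeneous[OF cS]
 have gS: "S.gideal r (gr r S)" by (rule gr_gideal[OF hS])
 have fQ: "finite ?Q" using I by simp
 have pf: "(\<Prod>x\<in>A. p x) \<in> forms r (\<Sum>x\<in>A. k x)" if "finite A" "A \<subseteq> ?Q" for A
  using that
 proof (induction A rule: finite_induct)
  case (insert x A)
  hence "p x \<in> forms r (k x)" using p unfolding gr_def by blast
  thus ?case using insert forms_mult[of "p x" r "k x" "\<Prod>x\<in>A. p x" "\<Sum>x\<in>A. k x"] by simp
 qed (simp add: one_forms)
 have "(\<Prod>x\<in>?Q. p x) \<in> S.sat r (gr r S) (\<Sum>x\<in>?Q. k x)"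
 proof (rule local_to_global[OF X gS])
  show "gr r X \<le> gr r S" using XS by (auto simp: gr_def le_fun_def)
  show "(\<Prod>x\<in>?Q. p x) \<in> forms r (\<Sum>x\<in>?Q. k x)" by (rule pf[OF fQ order_refl])
  fix P assume P: "P \<in> points r X"
  obtain h f where h: "basic_nbhd r P h" and f: "\<And>i. i \<in> I \<Longrightarrow> local_generator r X (D i) h (f i)"
   and g: "local_generator r X S h (\<Prod>i\<in>I. f i ^ m i)" using S P unfolding is_divisor_sum_def by blast
  note h0 = basic_nbhd_power(1)[OF X P h] and hP = basic_nbhd_power(2)[OF X P h]
  have "\<forall>i\<in>I. \<exists>\<phi> k. local_equation r X P (D i) \<phi> \<and> f i = frac \<phi> (h ^ k)"
   using local_generator_equation[OF X P gr_gideal[OF D] h f] by blast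
  then obtain \<phi> j where \<phi>: "\<And>i. i \<in> I \<Longrightarrow> local_equation r X P (D i) (\<phi> i) \<and> f i = frac (\<phi> i) (h ^ j i)" by metis
  obtain \<psi> l where \<psi>: "local_equation r X P S \<psi>" "(\<Prod>i\<in>I. f i ^ m i) = frac \<psi> (h ^ l)"
   using local_generator_equation[OF X P gS h g] by blast
  have "(\<Prod>i\<in>A. f i ^ m i) = frac (\<Prod>i\<in>A. \<phi> i ^ m i) (h ^ (\<Sum>i\<in>A. j i * m i))" if "finite A" "A \<subseteq> I" for A
   using that
  proof (induction A rule: finite_induct)
   case (insert i A)
   hence "f i ^ m i = frac (\<phi> i ^ m i) (h ^ (j i * m i))" using \<phi> by (simp add: Fract_power power_mult)
   thus ?case using insert by (simp add: power_add)
  qed (simp add: One_fract_def)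
  hence "frac (\<Prod>i\<in>I. \<phi> i ^ m i) (h ^ (\<Sum>i\<in>I. j i * m i)) = frac \<psi> (h ^ l)" using \<psi>(2) I by simp
  hence "h ^ l * (\<Prod>i\<in>I. \<phi> i ^ m i) - \<psi> * h ^ (\<Sum>i\<in>I. j i * m i) \<in> X"
   using h0 homogeneous_ideal_ops(4)[OF X] by (simp add: eq_fract mult.commute)
  hence 1: "loc r X P (\<Prod>i\<in>I. \<phi> i ^ m i) \<psi>" using loc_eq[OF X P hP] hP by blast
  have "(\<Prod>x\<in>?Q. \<phi> (fst x)) = (\<Prod>i\<in>I. \<phi> i ^ m i)"
   using prod.Sigma[OF I, of "\<lambda>i. {..<m i}" "\<lambda>i _. \<phi> i"] by (simp add: case_prod_unfold)
  moreover have "loc r X P (\<Prod>x\<in>?Q. p x) (\<Prod>x\<in>?Q. \<phi> (fst x))"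
  proof (rule loc_prod[OF X P fQ, THEN conjunct1], intro conjI)
   fix x assume x: "x \<in> ?Q"
   hence xi: "fst x \<in> I" by auto
   show "loc r X P (p x) (\<phi> (fst x))" using \<phi>[OF xi] p x unfolding local_equation_def[OF X P] by blast
   show "p x \<in> polys r" using p x forms_polys unfolding gr_def by blast
   show "\<phi> (fst x) \<in> polys r" using \<phi>[OF xi] local_equation_polys[OF X P] by blast
  qed
  ultimately have "loc r X P (\<Prod>x\<in>?Q. p x) \<psi>" using loc_trans[OF X P _ 1] by simp
  moreover have "\<psi> \<in> ungr r (gr r S)" unfolding ungr_gr[OF hS] using \<psi>(1) unfolding local_equation_def[OF X P] gr_def by blast
  ultimately show "\<exists>z\<in>ungr r (gr r S). loc r X P (\<Prod>x\<in>?Q. p x) z" by blast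
 qed
 thus ?thesis using gr_saturated[OF cS] unfolding S.saturated_def by simp
qed

section \<open>The genus bound\<close>

text \<open>Here e is the degree of the intersection with a surface of degree t, d the residual
  degree and m d the loss. The right side is the bound for the total degree e + d with the reference
  data s, c, plus a constant.\<close>

lemma residual_step_estimate:
 fixes s t e d c k m M :: real
 assumes s: "s \<ge> 1" "s \<le> t" "t = s \<Longrightarrow> k = c" "t \<noteq> s \<Longrightarrow> s + 1 \<le> t"
  and c: "c \<le> s" "0 \<le> t * (t - 3) + 2 * k" and m: "m \<ge> 0" "M \<ge> 0" and ed: "e \<ge> 0" "d \<ge> 0" "d \<le> M * e"
 shows "(e\<^sup>2 / (2 * t) - e / 2 - k * e / t + 3 / 2 * t ^ 4) + (d\<^sup>2 / (2 * s) - d / 2 - c * d / s) + m * d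
  \<le> (e + d)\<^sup>2 / (2 * s) - (e + d) / 2 - c * (e + d) / s + (2 * t ^ 4 + M * m\<^sup>2 * s)"
proof -
 have 1: "e\<^sup>2 / (2 * t) - e\<^sup>2 / (2 * s) + (c / s - k / t) * e \<le> t ^ 4 / 2"
 proof (cases "t = s")
  case False
  have t: "t \<ge> 1" "t > 0" "s > 0" using s by auto
  have "c / s \<le> 1" using c(1) t by simp
  moreover have "- (k / t) \<le> (t - 3) / 2" using c(2) t by (simp add: field_simps)
  ultimately have "c / s - k / t \<le> t" using t by argo
  hence ck: "(c / s - k / t) * e \<le> t * e" using ed(1) by (rule mult_right_mono)
  \<comment> \<open>Degrees being integers, t >= s + 1, so 1 / (2 s) - 1 / (2 t) is at least 1 / (2
    t^2).\<close>
  have "s * 1 \<le> t * (t - s)" using s(4)[OF False] s t by (intro mult_mono) auto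
  hence "1 / (2 * t\<^sup>2) \<le> 1 / (2 * s) - 1 / (2 * t)" using t by (simp add: field_simps power2_eq_square)
  from mult_right_mono[OF this zero_le_power2[of e]]
  have "e\<^sup>2 / (2 * t) - e\<^sup>2 / (2 * s) \<le> - (e\<^sup>2 / (2 * t\<^sup>2))" by (simp add: left_diff_distrib)
  \<comment> \<open>Completing the square: the maximum is attained at e = t^3.\<close>
  moreover have "t * e - e\<^sup>2 / (2 * t\<^sup>2) \<le> t ^ 4 / 2"
  proof -
   have "0 \<le> (e / t - t\<^sup>2)\<^sup>2" by simp
   also have "\<dots> = e\<^sup>2 / t\<^sup>2 - 2 * (t * e) + t ^ 4" using t by (simp add: field_simps power2_eq_square power4_eq_xxxx)
   finally show ?thesis by simp
  qed
  ultimately show ?thesis using ck by linarith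
 qed (use s(3) in simp)
 \<comment> \<open>If e >= m s, the cross term e d / s of the square pays for the loss; otherwise d
   <= M e < M m s bounds the loss by a constant when m and M are positive, and it vanishes when
   either is zero.\<close>
 have 2: "m * d - e * d / s \<le> M * m\<^sup>2 * s"
 proof -
  show ?thesis
  proof (cases "m * s \<le> e")
   case True
   hence "m * d \<le> (e / s) * d" using s ed by (intro mult_right_mono) (simp_all add: field_simps)
   moreover have "0 \<le> M * m\<^sup>2 * s" using m s by simp
   ultimately show ?thesis by simp
  next
   case False
   have "m * d \<le> m * (M * e)" using ed m by (intro mult_left_mono) auto
   also have "\<dots> \<le> m * (M * (m * s))" using False m by (intro mult_left_mono) auto
   finally have "m * d \<le> M * m\<^sup>2 * s" by (simp add: power2_eq_square mult_ac)
   moreover have "0 \<le> e * d / s" using ed s by simp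
   ultimately show ?thesis by simp
  qed
 qed
 have "(e + d)\<^sup>2 / (2 * s) = e\<^sup>2 / (2 * s) + e * d / s + d\<^sup>2 / (2 * s)" using s by (simp add: field_simps power2_eq_square)
 moreover have "c * (e + d) / s = c * e / s + c * d / s" by (simp add: distrib_left add_divide_distrib)
 moreover have "e\<^sup>2 / (2 * t) - e\<^sup>2 / (2 * s) + (c * e / s - k * e / t) \<le> t ^ 4 / 2"
  using 1 by (simp only: left_diff_distrib times_divide_eq_left)
 moreover have "u - e / 2 - v + 3 / 2 * w + (x - d / 2 - y) + z \<le> u' - (e + d) / 2 - v' + (2 * w + y')"
  if "u' = x' + a + x" "v' = b + y" "u - x' + (b - v) \<le> w / 2" "z - a \<le> y'" for u v w x y z u' v' x' y' a b :: real
  using that by (simp add: field_simps)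
 ultimately show ?thesis using 2 by blast
qed

text \<open>Induction on the number of divisors counted with multiplicity. M bounds the initial
  number and stays fixed, as do the reference data of the surface of least degree. With no divisor
  left, the empty product 1 lies in C, so the scheme is empty.\<close>

lemma curve_on_divisors:
 fixes r :: nat and D :: "'i \<Rightarrow> nat \<Rightarrow> mpoly set"
 assumes Y: "S.gprime r Y"
  and s0: "s\<^sub>0 \<ge> 1" "c\<^sub>0 \<le> int s\<^sub>0"
  and "finite Q" "card Q \<le> M"
  and D: "\<And>x. x \<in> Q \<Longrightarrow> S.relevant r (D x) \<and> S.linked r Y (D x) (m x) \<and> s\<^sub>0 \<le> s x \<and> (s x = s\<^sub>0 \<longrightarrow> c x = c\<^sub>0) \<and>
   (\<forall>\<^sub>F n in sequentially. int (S.hf r (D x) (Suc n)) - int (S.hf r (D x) n) = int (s x) * int (Suc n) + c x)"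
  and "S.saturated r C" "Y \<le> C" "S.linear_hf r C d \<chi>"
  and "\<And>p k. (\<forall>x\<in>Q. p x \<in> D x (k x)) \<Longrightarrow> (\<Prod>x\<in>Q. p x) \<in> C (\<Sum>x\<in>Q. k x)"
 shows "- real_of_int \<chi> \<le> (real d)\<^sup>2 / (2 * real s\<^sub>0) - real d / 2 - real_of_int c\<^sub>0 * real d / real s\<^sub>0 + (\<Sum>x\<in>Q. 2 * real (s x) ^ 4 + real M * (real (m x))\<^sup>2 * real s\<^sub>0)"
 using assms(4-)
proof (induction "card Q" arbitrary: Q C d \<chi>)
 case 0
 hence "Q = {}" by simp
 hence "1 \<in> C 0" using "0.prems"(7) by simp
 hence "C = forms r" using S.gideal_top[OF S.saturated_gideal[OF "0.prems"(4)]] by blast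
 hence "S.linear_hf r C 0 0" unfolding S.linear_hf_def by (simp add: S.hf_G)
 hence "d = 0" "\<chi> = 0" using S.linear_hf_unique "0.prems"(6) by blast+
 thus ?case using \<open>Q = {}\<close> by simp
next
 case (Suc n)
 note fQ = Suc.prems(1) and D = Suc.prems(3) and C = Suc.prems(4,5,6) and prod = Suc.prems(7)
 note gC = S.saturated_gideal[OF C(1)]
 have L: "S.linked r Y (D x) (m x)" if "x \<in> Q" for x using D[OF that] by blast
 have gD: "S.gideal r (D x)" if "x \<in> Q" for x using L[OF that] unfolding S.linked_def by blast
 have "\<forall>x\<in>Q. \<exists>e \<psi>. S.linear_hf r (S.isum C (D x)) e \<psi>"
  using S.linear_hf_above[OF gC C(3) S.isum_gideal[OF gC gD] S.extend_ge] by blast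
 from bchoice[OF this] obtain e where "\<forall>x\<in>Q. \<exists>\<psi>. S.linear_hf r (S.isum C (D x)) (e x) \<psi>" ..
 from bchoice[OF this] obtain \<psi> where "\<forall>x\<in>Q. S.linear_hf r (S.isum C (D x)) (e x) (\<psi> x)" ..
 hence e: "\<And>x. x \<in> Q \<Longrightarrow> S.linear_hf r (S.isum C (D x)) (e x) (\<psi> x)" by blast
 have "Q \<noteq> {}" using Suc.hyps(2) by auto
 hence "Max (e ` Q) \<in> e ` Q" using fQ by simp
 \<comment> \<open>The divisor of largest intersection degree. At most M intersections cover C, so
   d, and with it the residual degree d', is at most M times that degree.\<close>
 then obtain a where a: "a \<in> Q" "Max (e ` Q) = e a" by blast
 have max: "e x \<le> e a" if "x \<in> Q" for x using Max_ge[of "e ` Q" "e x"] fQ that a(2) by simp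
 have ins: "insert a (Q - {a}) = Q" using a(1) by blast
 let ?R = "S.icolon r C (D a)"
 obtain e' \<chi>\<^sub>1 d' \<chi>\<^sub>2 where r: "S.linear_hf r (S.isum C (D a)) e' \<chi>\<^sub>1" "S.linear_hf r ?R d' \<chi>\<^sub>2" "d = e' + d'"
  "\<chi> = \<chi>\<^sub>1 + \<chi>\<^sub>2 - int (m a) * int d'"
  using S.linear_residual[OF Y L[OF a(1)] C] by blast
 have ea: "e' = e a" using S.linear_hf_unique[OF r(1) e[OF a(1)]] by blast
 have "d \<le> (\<Sum>x\<in>Q. e x)" by (rule S.degree_le_sections[OF Y fQ L C e prod])
 also have "\<dots> \<le> (\<Sum>x\<in>Q. e a)" by (intro sum_mono max)
 also have "\<dots> = card Q * e a" by simp
 also have "\<dots> \<le> M * e a" using Suc.prems(2) by (intro mult_le_mono1)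
 finally have "d' \<le> M * e'" using r(3) ea by simp
 hence d'M: "real d' \<le> real M * real e'" by (metis of_nat_le_iff of_nat_mult)
 have gR: "S.gideal r ?R" by (rule S.icolon_gideal[OF gC])
 have IH: "- real_of_int \<chi>\<^sub>2 \<le> (real d')\<^sup>2 / (2 * real s\<^sub>0) - real d' / 2 - real_of_int c\<^sub>0 * real d' / real s\<^sub>0 +
   (\<Sum>x\<in>Q - {a}. 2 * real (s x) ^ 4 + real M * (real (m x))\<^sup>2 * real s\<^sub>0)"
 proof (rule Suc.hyps(1)[of "Q - {a}" ?R d' \<chi>\<^sub>2])
  show "n = card (Q - {a})" using Suc.hyps(2) fQ a(1) by simp
  show "card (Q - {a}) \<le> M" using Suc.prems(2) fQ a(1) by simp
  show "S.saturated r ?R" by (rule S.icolon_saturated[OF C(1) gD[OF a(1)]])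
  show "Y \<le> ?R" by (rule order_trans[OF C(2) S.icolon_ge[OF gC gD[OF a(1)]]])
  show "(\<Prod>x\<in>Q - {a}. p x) \<in> ?R (\<Sum>x\<in>Q - {a}. k x)" if p: "\<forall>x\<in>Q - {a}. p x \<in> D x (k x)" for p k
   by (rule S.product_icolon[of "Q - {a}" a r D p k C, OF _ _ _ p])
    (use fQ gD prod in \<open>simp_all only: ins finite_Diff, auto\<close>)
 qed (use fQ D r(2) in auto)
 note Da = D[OF a(1)]
 have sa: "s a \<ge> 1" using Da s0(1) by linarith
 have hDa: "\<forall>\<^sub>F n in sequentially. int (S.hf r (D a) (Suc n)) - int (S.hf r (D a) n) = int (s a) * int (Suc n) + c a"
  and rel: "S.relevant r (D a)" using Da by blast+
 have gE: "S.gideal r (S.isum C (D a))" by (rule S.isum_gideal[OF gC gD[OF a(1)]])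
 \<comment> \<open>Saturating C + D a keeps the Hilbert polynomial and makes the bound on a single
   surface applicable.\<close>
 have "S.linear_hf r (S.sat r (S.isum C (D a))) e' \<chi>\<^sub>1" by (rule S.linear_hf_sat[OF gE r(1)])
 moreover have "D a \<le> S.sat r (S.isum C (D a))"
  by (rule order_trans[OF S.isum_ge[OF gC gD[OF a(1)]] S.sat_ge[OF gE]])
 ultimately have E: "real_of_int \<chi>\<^sub>1 \<ge> 1 - ((real e')\<^sup>2 / (2 * real (s a)) - real e' / 2 - real_of_int (c a) * real e' / real (s a) + 3 / 2 * real (s a) ^ 4)"
  using curve_on_surface[OF rel sa hDa S.sat_sat[OF gE], of e' \<chi>\<^sub>1] unfolding S.linear_hf_def by simp
 have sec: "0 \<le> int (s a) * (int (s a) - 3) + 2 * c a" using surface_section_bounds(2)[OF rel sa hDa] .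
 have est: "((real e')\<^sup>2 / (2 * real (s a)) - real e' / 2 - real_of_int (c a) * real e' / real (s a) + 3 / 2 * real (s a) ^ 4) +
   ((real d')\<^sup>2 / (2 * real s\<^sub>0) - real d' / 2 - real_of_int c\<^sub>0 * real d' / real s\<^sub>0) + real (m a) * real d'
  \<le> (real e' + real d')\<^sup>2 / (2 * real s\<^sub>0) - (real e' + real d') / 2 - real_of_int c\<^sub>0 * (real e' + real d') / real s\<^sub>0 + (2 * real (s a) ^ 4 + real M * (real (m a))\<^sup>2 * real s\<^sub>0)"
 proof (rule residual_step_estimate)
  show "real (s a) = real s\<^sub>0 \<Longrightarrow> real_of_int (c a) = real_of_int c\<^sub>0" using Da by simp
  show "real (s a) \<noteq> real s\<^sub>0 \<Longrightarrow> real s\<^sub>0 + 1 \<le> real (s a)" using Da by simp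
  show "real_of_int c\<^sub>0 \<le> real s\<^sub>0" using s0(2) by linarith
  have "real_of_int 0 \<le> real_of_int (int (s a) * (int (s a) - 3) + 2 * c a)" using sec by (simp only: of_int_le_iff)
  thus "0 \<le> real (s a) * (real (s a) - 3) + 2 * real_of_int (c a)" by simp
 qed (use Da s0 d'M in auto)
 have "- real_of_int \<chi> = - real_of_int \<chi>\<^sub>1 - real_of_int \<chi>\<^sub>2 + real (m a) * real d'" by (simp add: r(4))
 moreover have "(\<Sum>x\<in>Q. 2 * real (s x) ^ 4 + real M * (real (m x))\<^sup>2 * real s\<^sub>0) = (2 * real (s a) ^ 4 + real M * (real (m a))\<^sup>2 * real s\<^sub>0) +
   (\<Sum>x\<in>Q - {a}. 2 * real (s x) ^ 4 + real M * (real (m x))\<^sup>2 * real s\<^sub>0)"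
  using sum.remove[OF fQ a(1)] by simp
 moreover have "real d = real e' + real d'" using r(3) by simp
 moreover have "- x - y + w \<le> u + (v + z)" if "1 - a \<le> x" "- y \<le> b + z" "a + b + w \<le> u + v" for x y z u v w a b :: real
  using that by linarith
 ultimately show ?case using E IH est by simp
qed

lemma integral_relevant:
 assumes "integral_subscheme r I" shows "S.relevant r (gr r I)"
proof -
 have I: "closed_subscheme r I" "homogeneous_prime r I" using assms unfolding integral_subscheme_def by auto
 have g: "S.gprime r (gr r I)" by (rule gr_gprime[OF I(2)])
 have "\<not> forms r 1 \<subseteq> gr r I 1"
 proof
  assume sub: "forms r 1 \<subseteq> gr r I 1"
  have "1 \<in> gr r I 0"
   by (rule S.saturatedD[OF gr_saturated[OF I(1)] one_forms, of 1]) (use sub in auto)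
  hence "gr r I = forms r" using S.gideal_top g unfolding S.gprime_def by blast
  thus False using g unfolding S.gprime_def by blast
 qed
 thus ?thesis unfolding S.relevant_def using g by blast
qed

text \<open>As M s0 <= \<sigma> and m x <= s x <= \<sigma>, each summand is at most s x (2
  \<sigma>^3 + \<sigma>^2). The total 1 + 2 \<sigma>^4 + \<sigma>^3 is then at most 4 \<sigma>^6
  because \<sigma> >= 1.\<close>

lemma constant_estimate:
 fixes s m :: "'i \<Rightarrow> nat" and M s\<^sub>0 :: nat
 assumes Q: "finite Q" "Q \<noteq> {}" "M = card Q" and s: "s\<^sub>0 \<ge> 1" "\<And>x. x \<in> Q \<Longrightarrow> s\<^sub>0 \<le> s x" "\<And>x. x \<in> Q \<Longrightarrow> m x \<le> s x"
 defines "\<sigma> \<equiv> \<Sum>x\<in>Q. real (s x)"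
 shows "1 + (\<Sum>x\<in>Q. 2 * real (s x) ^ 4 + real M * (real (m x))\<^sup>2 * real s\<^sub>0) \<le> 4 * \<sigma> ^ 6"
proof -
 have le: "real (s x) \<le> \<sigma>" if "x \<in> Q" for x unfolding \<sigma>_def by (rule member_le_sum[OF that _ Q(1)]) simp
 obtain x\<^sub>0 where x0: "x\<^sub>0 \<in> Q" using Q(2) by blast
 have "1 \<le> real (s x\<^sub>0)" using s(1) s(2)[OF x0] by linarith
 hence \<sigma>: "1 \<le> \<sigma>" using le[OF x0] by linarith
 have "real M * real s\<^sub>0 = (\<Sum>x\<in>Q. real s\<^sub>0)" using Q(3) by simp
 also have "\<dots> \<le> \<sigma>" unfolding \<sigma>_def using s(2) by (intro sum_mono) simp
 finally have M: "real M * real s\<^sub>0 \<le> \<sigma>" .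
 have "2 * real (s x) ^ 4 + real M * (real (m x))\<^sup>2 * real s\<^sub>0 \<le> real (s x) * (2 * \<sigma> ^ 3 + \<sigma>\<^sup>2)" if x: "x \<in> Q" for x
 proof -
  have "real (s x) ^ 3 \<le> \<sigma> ^ 3" using le[OF x] by (intro power_mono) auto
  hence "real (s x) * real (s x) ^ 3 \<le> real (s x) * \<sigma> ^ 3" by (intro mult_left_mono) auto
  moreover have "(real M * real s\<^sub>0) * (real (m x))\<^sup>2 \<le> \<sigma> * (real (s x) * \<sigma>)"
  proof (intro mult_mono M)
   have "real (m x) * real (m x) \<le> real (s x) * \<sigma>" using s(3)[OF x] le[OF x] by (intro mult_mono) auto
   thus "(real (m x))\<^sup>2 \<le> real (s x) * \<sigma>" by (simp add: power2_eq_square)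
  qed (use \<sigma> in auto)
  ultimately show ?thesis by (simp add: power2_eq_square eval_nat_numeral algebra_simps)
 qed
 hence "(\<Sum>x\<in>Q. 2 * real (s x) ^ 4 + real M * (real (m x))\<^sup>2 * real s\<^sub>0) \<le> (\<Sum>x\<in>Q. real (s x) * (2 * \<sigma> ^ 3 + \<sigma>\<^sup>2))" by (rule sum_mono)
 also have "\<dots> = \<sigma> * (2 * \<sigma> ^ 3 + \<sigma>\<^sup>2)" unfolding \<sigma>_def sum_distrib_right ..
 also have "\<dots> = 2 * \<sigma> ^ 4 + \<sigma> ^ 3" by (simp add: eval_nat_numeral algebra_simps)
 finally have "1 + (\<Sum>x\<in>Q. 2 * real (s x) ^ 4 + real M * (real (m x))\<^sup>2 * real s\<^sub>0) \<le> 1 + 2 * \<sigma> ^ 4 + \<sigma> ^ 3" by simp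
 moreover have "1 \<le> \<sigma> ^ 6" "\<sigma> ^ 4 \<le> \<sigma> ^ 6" "\<sigma> ^ 3 \<le> \<sigma> ^ 6" using \<sigma> by (auto intro: power_increasing one_le_power)
 ultimately show ?thesis by linarith
qed

theorem proposition2p9:
 fixes r l :: nat
  and X S C :: "mpoly set"
  and D :: "nat \<Rightarrow> mpoly set"
  and m :: "nat \<Rightarrow> nat"
  and d s degS :: real
  and \<pi>\<^sub>1 :: int
 assumes "integral_subscheme r X" and "scheme_dim r X = 3"
  and "l \<ge> 1"
  and "inj_on D {1..l}"
  and "\<And>i. i \<in> {1..l} \<Longrightarrow> effective_cartier r X (D i)"
  and "\<And>i. i \<in> {1..l} \<Longrightarrow> integral_subscheme r (D i)"
  and "\<And>i. i \<in> {1..l} \<Longrightarrow> scheme_dim r (D i) = 2"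
  and "\<And>i. i \<in> {1..l} \<Longrightarrow> equivalent_to_multiple_of_hyperplane_section r X (D i)"
  and "mono_on {1..l} (\<lambda>i. scheme_degree r (D i))"
  and "\<And>i. i \<in> {1..l} \<Longrightarrow> m i > 0"
  and "is_divisor_sum r X {1..l} D m S"
  and "s = scheme_degree r (D 1)"
  and "\<pi>\<^sub>1 = sectional_genus r (D 1)"
  and "degS = (\<Sum>i=1..l. real (m i) * scheme_degree r (D i))"
  and "closed_subscheme r C" and "scheme_dim r C = 1"
  and "subscheme_of C S"
  and "d = scheme_degree r C" and "d > 0"
 shows "real_of_int (arith_genus r C)
      \<le> d\<^sup>2 / (2 * s) + d / (2 * s) * (2 * real_of_int \<pi>\<^sub>1 - 2 - s) + 4 * degS ^ 6"
proof -
 have hX: "homogeneous_ideal r X" using assms(1) closed_homogeneous unfolding integral_subscheme_def by blast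
 have relX: "S.relevant r (gr r X)" by (rule integral_relevant[OF assms(1)])
 have pX: "S.gprime r (gr r X)" using relX unfolding S.relevant_def by blast
 obtain P where P: "S.hpoly r (gr r X) P" using S.hpoly_exists[OF gr_gideal[OF hX]] by blast
 have degP: "degree P = 3" using scheme_dim_eq[OF hX P] assms(2) by simp
 \<comment> \<open>The number 6 a is the degree of X. The degrees and sectional genera of the
   divisors are read off from differences of P.\<close>
 define a where "a = coeff P 3"
 have d3: "degree (pdiff P b) \<le> 2 \<and> coeff (pdiff P b) 2 = 3 * b * a" for b
  using pdiff_degree[of P 2 b] degP by (simp add: a_def)
 have d2: "degree (pdiff (pdiff P b) 1) \<le> 1 \<and> coeff (pdiff (pdiff P b) 1) 1 = 2 * (3 * b * a)" for b
  using pdiff_degree[of "pdiff P b" 1 1] d3[of b] by (simp add: numeral_2_eq_2)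
 have int: "int_valued (pdiff (pdiff P (real k)) 1)" for k
  using int_valued_pdiff[OF int_valued_pdiff[OF S.hpoly_int_valued[OF P], of k], of 1] by simp
 \<comment> \<open>6 a is the slope of an integer-valued linear polynomial, the second difference of
   P with step 1.\<close>
 obtain \<xi>' where "6 * a = of_int \<xi>'"
 proof -
  obtain e c :: int where "pdiff (pdiff P (real 1)) 1 = [:of_int c, of_int e:]"
   using int_valued_linear[OF int, of 1] d2[of "real 1"] by auto
  thus thesis using that[of e] d2[of "real 1"] by simp
 qed
 moreover have "P \<noteq> 0" using degP by auto
 hence "a > 0" using lead_coeff_pos[OF S.hpoly_nonneg[OF P]] degP unfolding a_def by simp
 ultimately obtain \<xi> :: nat where \<xi>: "6 * a = real \<xi>" "\<xi> \<ge> 1"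
  using that[of "nat \<xi>'"] by simp
 have hD: "homogeneous_ideal r (D i)" and relD: "S.relevant r (gr r (D i))" and XD: "X \<subseteq> D i" if "i \<in> {1..l}" for i
  using assms(5,6)[OF that] closed_homogeneous integral_relevant
  unfolding integral_subscheme_def effective_cartier_def subscheme_of_def by blast+
 have "\<forall>i\<in>{1..l}. \<exists>\<mu>. S.linked r (gr r X) (gr r (D i)) \<mu>"
  using linked_divisor[OF hX hD XD assms(8)] by blast
 from bchoice[OF this] obtain \<mu> where \<mu>: "\<And>i. i \<in> {1..l} \<Longrightarrow> S.linked r (gr r X) (gr r (D i)) (\<mu> i)" by blast
 have pD: "S.hpoly r (gr r (D i)) (pdiff P (real (\<mu> i)))" if i: "i \<in> {1..l}" for i
 proof (rule S.linked_hpoly[OF relX P \<mu>[OF i]])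
  show "gr r (D i) \<noteq> gr r X" using gr_inj[OF hD[OF i] hX] assms(2) assms(7)[OF i] by auto
 qed
 \<comment> \<open>The degree of a divisor equivalent to \<mu> hyperplane sections is \<mu> times
   the degree \<xi> of X.\<close>
 define t where "t i = \<mu> i * \<xi>" for i
 have deg: "scheme_degree r (D i) = real (t i)" if i: "i \<in> {1..l}" for i
 proof -
  have "degree (pdiff P (real (\<mu> i))) = 2" using scheme_dim_eq[OF hD[OF i] pD[OF i]] assms(7)[OF i] by simp
  hence "scheme_degree r (D i) = 2 * coeff (pdiff P (real (\<mu> i))) 2"
   using scheme_degree_eq[OF hD[OF i] pD[OF i]] by (simp add: fact_2)
  also have "\<dots> = real (\<mu> i) * (6 * a)" using d3[of "real (\<mu> i)"] by simp
  finally show ?thesis unfolding \<xi>(1) t_def by simp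
 qed
 \<comment> \<open>The constant term depends on k alone. Divisors of equal degree have equal \<mu>,
   hence the same constant, as \<open>curve_on_divisors\<close> requires when the least degree is
   attained several times.\<close>
 have "\<exists>c::int. pdiff (pdiff P (real k)) 1 = [:of_int c, real (k * \<xi>):]" for k
 proof -
  obtain e c :: int where "pdiff (pdiff P (real k)) 1 = [:of_int c, of_int e:]"
   using int_valued_linear[OF int] d2[of "real k"] by blast
  thus ?thesis using d2[of "real k"] \<xi>(1) by (intro exI[of _ c]) (simp add: algebra_simps)
 qed
 then obtain \<kappa> :: "nat \<Rightarrow> int" where \<kappa>: "\<And>k. pdiff (pdiff P (real k)) 1 = [:of_int (\<kappa> k), real (k * \<xi>):]" by metis
 have hf: "\<forall>\<^sub>F n in sequentially. int (S.hf r (gr r (D i)) (Suc n)) - int (S.hf r (gr r (D i)) n) = int (t i) * int (Suc n) + \<kappa> (\<mu> i)"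
  if i: "i \<in> {1..l}" for i
  using eventually_shift[OF pD[OF i, unfolded S.hpoly_def], of 1] pD[OF i, unfolded S.hpoly_def]
 proof eventually_elim
  case (elim n)
  have "real (S.hf r (gr r (D i)) (Suc n)) - real (S.hf r (gr r (D i)) n) = poly (pdiff (pdiff P (real (\<mu> i))) 1) (real (Suc n))"
   using elim by (simp add: poly_pdiff[of "pdiff P (real (\<mu> i))"])
  also have "\<dots> = of_int (int (t i) * int (Suc n) + \<kappa> (\<mu> i))" unfolding \<kappa> t_def by (simp add: algebra_simps)
  finally have "real_of_int (int (S.hf r (gr r (D i)) (Suc n)) - int (S.hf r (gr r (D i)) n)) = of_int (int (t i) * int (Suc n) + \<kappa> (\<mu> i))" by simp
  thus ?case by (simp only: of_int_eq_iff)
 qed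
 have one: "1 \<in> {1..l}" using assms(3) by simp
 have le: "t 1 \<le> t i" if i: "i \<in> {1..l}" for i
  using mono_onD[OF assms(9) one i] i deg[OF i] deg[OF one] by simp
 \<comment> \<open>With \<mu> = 0 the Hilbert polynomial of D 1 would vanish, contradicting
   dimension 2.\<close>
 have "t 1 \<noteq> 0"
 proof
  assume "t 1 = 0"
  hence "\<mu> 1 = 0" using \<xi>(2) unfolding t_def by simp
  hence "pdiff P (real (\<mu> 1)) = 0" by (simp add: pdiff_def)
  thus False using scheme_dim_eq[OF hD[OF one] pD[OF one]] assms(7)[OF one] by simp
 qed
 hence t1: "t 1 \<ge> 1" by simp
 have \<pi>: "\<pi>\<^sub>1 = 1 - \<kappa> (\<mu> 1)"
  using sectional_genus_eq[OF hD[OF one] relD[OF one] pD[OF one], of "\<kappa> (\<mu> 1)" "int (t 1)"] \<kappa> assms(13) by (simp add: t_def)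
 have hC: "homogeneous_ideal r C" by (rule closed_homogeneous[OF assms(15)])
 obtain R where R: "S.hpoly r (gr r C) R" using S.hpoly_exists[OF gr_gideal[OF hC]] by blast
 have degR: "degree R = 1" using scheme_dim_eq[OF hC R] assms(16) by simp
 obtain e \<chi> :: int where e: "R = [:of_int \<chi>, of_int e:]" using int_valued_linear[OF S.hpoly_int_valued[OF R]] degR by auto
 have de: "d = of_int e" using scheme_degree_eq[OF hC R] assms(18) degR e by simp
 hence e0: "e = int (nat e)" using assms(19) by simp
 have lin: "S.linear_hf r (gr r C) (nat e) \<chi>"
  unfolding S.linear_hf_def using R[unfolded S.hpoly_def]
 proof eventually_elim
  case (elim n)
  hence "real_of_int (int (S.hf r (gr r C) n)) = of_int (e * int n + \<chi>)" by (simp add: e mult.commute[of "real n"])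
  thus ?case using e0 by (simp only: of_int_eq_iff)
 qed
 have pa: "arith_genus r C = 1 - \<chi>"
  by (rule arith_genus_hf[OF gr_saturated[OF assms(15)] lin[unfolded S.linear_hf_def]])
 \<comment> \<open>One index for each copy of a divisor in S; summing degrees over Q gives the
   degree of S.\<close>
 define Q where "Q = Sigma {1..l} (\<lambda>i. {..<m i})"
 have fQ: "finite Q" and Qi: "\<And>x. x \<in> Q \<Longrightarrow> fst x \<in> {1..l}" unfolding Q_def by auto
 have XS: "X \<subseteq> S" and SC: "S \<subseteq> C" using assms(11,17) unfolding is_divisor_sum_def subscheme_of_def by auto
 have main: "- real_of_int \<chi> \<le> (real (nat e))\<^sup>2 / (2 * real (t 1)) - real (nat e) / 2 - real_of_int (\<kappa> (\<mu> 1)) * real (nat e) / real (t 1) +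
   (\<Sum>x\<in>Q. 2 * real (t (fst x)) ^ 4 + real (card Q) * (real (\<mu> (fst x)))\<^sup>2 * real (t 1))"
 proof (rule curve_on_divisors[where D = "\<lambda>x. gr r (D (fst x))" and c = "\<lambda>x. \<kappa> (\<mu> (fst x))", OF pX t1 _ fQ order_refl _ gr_saturated[OF assms(15)] _ lin])
  show "\<kappa> (\<mu> 1) \<le> int (t 1)" by (rule surface_section_bounds(1)[OF relD[OF one] t1 hf[OF one]])
  show "gr r X \<le> gr r C" using XS SC by (auto simp: gr_def le_fun_def)
  fix x assume "x \<in> Q"
  hence i: "fst x \<in> {1..l}" by (rule Qi)
  have "\<kappa> (\<mu> (fst x)) = \<kappa> (\<mu> 1)" if "t (fst x) = t 1" using that \<xi>(2) unfolding t_def by simp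
  thus "S.relevant r (gr r (D (fst x))) \<and> S.linked r (gr r X) (gr r (D (fst x))) (\<mu> (fst x)) \<and> t 1 \<le> t (fst x) \<and>
   (t (fst x) = t 1 \<longrightarrow> \<kappa> (\<mu> (fst x)) = \<kappa> (\<mu> 1)) \<and>
   (\<forall>\<^sub>F n in sequentially. int (S.hf r (gr r (D (fst x))) (Suc n)) - int (S.hf r (gr r (D (fst x))) n) =
    int (t (fst x)) * int (Suc n) + \<kappa> (\<mu> (fst x)))"
   using relD[OF i] \<mu>[OF i] le[OF i] hf[OF i] by blast
 next
  fix p k assume "\<forall>x\<in>Q. p x \<in> gr r (D (fst x)) (k x)"
  hence "(\<Prod>x\<in>Q. p x) \<in> gr r S (\<Sum>x\<in>Q. k x)"
   unfolding Q_def by (intro product_in_divisor_sum[OF hX _ hD assms(11)]) auto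
  thus "(\<Prod>x\<in>Q. p x) \<in> gr r C (\<Sum>x\<in>Q. k x)" using SC unfolding gr_def by blast
 qed
 have "1 + (\<Sum>x\<in>Q. 2 * real (t (fst x)) ^ 4 + real (card Q) * (real (\<mu> (fst x)))\<^sup>2 * real (t 1)) \<le> 4 * (\<Sum>x\<in>Q. real (t (fst x))) ^ 6"
 proof (rule constant_estimate[OF fQ _ refl t1])
  show "Q \<noteq> {}" using one assms(10)[OF one] unfolding Q_def by force
  show "\<And>x. x \<in> Q \<Longrightarrow> \<mu> (fst x) \<le> t (fst x)" using \<xi>(2) unfolding t_def by simp
 qed (use le Qi in blast)
 moreover have "(\<Sum>x\<in>Q. real (t (fst x))) = degS"
 proof -
  have "(\<Sum>x\<in>Q. real (t (fst x))) = (\<Sum>i=1..l. \<Sum>j<m i. real (t i))"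
   unfolding Q_def by (subst sum.Sigma) (auto simp: case_prod_unfold)
  also have "\<dots> = degS" unfolding assms(14) using deg by (intro sum.cong) auto
  finally show ?thesis .
 qed
 moreover have s: "s = real (t 1)" using assms(12) deg[OF one] by simp
 moreover have "d = real (nat e)" using de e0 by (metis of_int_of_nat_eq)
 \<comment> \<open>The linear term in the genus becomes the one of \<open>curve_on_divisors\<close>
   through 2 \<pi> - 2 = - 2 \<kappa>.\<close>
 moreover have "d / (2 * s) * (2 * real_of_int \<pi>\<^sub>1 - 2 - s) = - d / 2 - real_of_int (\<kappa> (\<mu> 1)) * d / s"
  using s t1 by (simp add: \<pi> field_simps)
 ultimately show ?thesis using main by (simp add: pa)
qed

end
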